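(* Let $q$ be a power of $2$ and let $H=\mathbb{F}_{q^2}(x,y)$ be the Hermitian function field over $\mathbb{F}_{q^2}$, defined by $y^q+y=x^{q+1}$. Let $a\in\mathbb{F}_{q^2}$ be a primitive $(q^2-1)$-th root of unity, let $\delta=a^{q+1}$ and $c=\delta+a^{q+1}\delta^{-1}=a^{q+1}+1$ (so $c^q+c=0$). Let $\sigma$ be the $\mathbb{F}_{q^2}$-automorphism of $H$ given by $\sigma(x)=\frac{ax}{a^{q+1}y+c}$, $\sigma(y)=\frac{1}{a^{q+1}y+c}$ (it has order $q^2-1$). Let $m$ be a positive divisor of $q^2-1$, let $\mathcal G=\langle\sigma^{\frac{q^2-1}{m}}\rangle$ and $d=\gcd(m,q+1)$. Then $$g(H^{\mathcal G})=\frac{(q-1)(q+1-d)}{2m}.$$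
   Context: $H^{\mathcal G}$ denotes the subfield of $H$ fixed by every element of $\mathcal G$, regarded as a function field over $\mathbb{F}_{q^2}$. Note $\sigma=\tau\omega$ with $\tau(x)=ax$, $\tau(y)=a^{q+1}y+c$ and $\omega(x)=x/y$, $\omega(y)=1/y$.
   Formalization: That σ has order q²−1 is taken as a hypothesis; this is automatic for q ≥ 4 but false for q = 2 (there σ has order 6), so q = 2 is excluded; for q = 2, m = 1 the stated formula gives 1 while the genus is 0. *)

theory Defs
  imports "HOL-Algebra.Algebra" Complex_Main
begin

text \<open>
  Terminology of Stichtenoth, \<^emph>\<open>Algebraic Function Fields and Codes\<close>. A function field
  \<open>F/K\<close> is given by a ring record \<open>F\<close> and a subset \<open>K\<close> of its carrier.
\<close>

definition valuation_ring :: "('a, 'b) ring_scheme \<Rightarrow> 'a set \<Rightarrow> 'a set \<Rightarrow> bool" where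
  "valuation_ring F K \<O> \<longleftrightarrow>
     subring \<O> F \<and> K \<subset> \<O> \<and> \<O> \<subset> carrier F \<and>
     (\<forall>z \<in> carrier F - {\<zero>\<^bsub>F\<^esub>}. z \<in> \<O> \<or> inv\<^bsub>F\<^esub> z \<in> \<O>)"

definition places :: "('a, 'b) ring_scheme \<Rightarrow> 'a set \<Rightarrow> 'a set set" where
  "places F K = {P. \<exists>\<O>. valuation_ring F K \<O> \<and> maximalideal P (F\<lparr>carrier := \<O>\<rparr>)}"

text \<open>A place determines its valuation ring: \<open>O\<^sub>P\<close> consists of \<open>0\<close> and the \<open>z \<noteq> 0\<close> with
  \<open>z\<^sup>-\<^sup>1 \<notin> P\<close>.\<close>

definition place_ring :: "('a, 'b) ring_scheme \<Rightarrow> 'a set \<Rightarrow> 'a set \<Rightarrow> ('a, 'b) ring_scheme" where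
  "place_ring F K P =
     F\<lparr>carrier := (THE \<O>. valuation_ring F K \<O> \<and> maximalideal P (F\<lparr>carrier := \<O>\<rparr>))\<rparr>"

text \<open>\<open>v\<^sub>P(z)\<close> is the \<open>n\<close> with \<open>z = t\<^sup>n u\<close>, where \<open>t\<close> is a prime element for \<open>P\<close> and \<open>u\<close> is a unit of
  \<open>O\<^sub>P\<close>. It is meant for \<open>z \<noteq> 0\<close> only; the convention \<open>v\<^sub>P(0) = \<infinity>\<close> is built into
  \<open>riemann_roch_space\<close> below.\<close>

definition valuation :: "('a, 'b) ring_scheme \<Rightarrow> 'a set \<Rightarrow> 'a set \<Rightarrow> 'a \<Rightarrow> int" where
  "valuation F K P z =
     (THE n. \<exists>t u. t \<in> P \<and> P = PIdl\<^bsub>place_ring F K P\<^esub> t \<and> u \<in> Units (place_ring F K P) \<and>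
        z = t [^]\<^bsub>F\<^esub> n \<otimes>\<^bsub>F\<^esub> u)"

text \<open>The residue class field \<open>O\<^sub>P/P\<close> contains \<open>K\<close> through the residue class map.\<close>

definition place_degree :: "('a, 'b) ring_scheme \<Rightarrow> 'a set \<Rightarrow> 'a set \<Rightarrow> nat" where
  "place_degree F K P =
     (let R = place_ring F K P
      in ring.dim (R Quot P) ((\<lambda>k. P +>\<^bsub>R\<^esub> k) ` K) (carrier (R Quot P)))"

definition divisors :: "('a, 'b) ring_scheme \<Rightarrow> 'a set \<Rightarrow> ('a set \<Rightarrow> int) set" where
  "divisors F K = {A. finite {P. A P \<noteq> 0} \<and> {P. A P \<noteq> 0} \<subseteq> places F K}"

definition divisor_degree :: "('a, 'b) ring_scheme \<Rightarrow> 'a set \<Rightarrow> ('a set \<Rightarrow> int) \<Rightarrow> int" where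
  "divisor_degree F K A = (\<Sum>P | A P \<noteq> 0. A P * int (place_degree F K P))"

definition riemann_roch_space ::
    "('a, 'b) ring_scheme \<Rightarrow> 'a set \<Rightarrow> ('a set \<Rightarrow> int) \<Rightarrow> 'a set" where
  "riemann_roch_space F K A =
     {z \<in> carrier F. z \<noteq> \<zero>\<^bsub>F\<^esub> \<longrightarrow> (\<forall>P \<in> places F K. valuation F K P z \<ge> - A P)}"

text \<open>The genus is the maximum of \<open>deg A - \<ell>(A) + 1\<close> over all divisors \<open>A\<close> of \<open>F/K\<close>.\<close>

definition genus :: "('a, 'b) ring_scheme \<Rightarrow> 'a set \<Rightarrow> int" where
  "genus F K =
     (GREATEST g. \<exists>A \<in> divisors F K.
        g = divisor_degree F K A - int (ring.dim F K (riemann_roch_space F K A)) + 1)"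

text \<open>\<open>H = K(x, y)\<close> over the field \<open>K\<close> with \<open>q\<^sup>2\<close> elements, defined by \<open>y\<^sup>q + y = x\<^sup>q\<^sup>+\<^sup>1\<close>. The polynomial
  \<open>T\<^sup>q + T - x\<^sup>q\<^sup>+\<^sup>1\<close> is irreducible over the rational function field \<open>K(x)\<close>, so these conditions
  determine \<open>H\<close> together with \<open>x\<close> and \<open>y\<close> up to isomorphism.\<close>

locale hermitian_function_field = field H + subfield K H
  for q :: nat and H :: "('a, 'b) ring_scheme" (structure) and K :: "'a set" and x y :: 'a +
  assumes card_constants: "card K = q\<^sup>2"
    and x_closed: "x \<in> carrier H"
    and y_closed: "y \<in> carrier H"
    and x_transcendental: "transcendental K x"
    and hermitian_equation: "y [^] q \<oplus> y = x [^] (q + 1)"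
    and generated: "carrier H = generate_field H (K \<union> {x, y})"

text \<open>The automorphisms are taken extensional on the carrier, as in \<open>BijGroup\<close>.\<close>

definition field_aut_group :: "('a, 'b) ring_scheme \<Rightarrow> 'a set \<Rightarrow> ('a \<Rightarrow> 'a) monoid" where
  "field_aut_group H K =
     (BijGroup (carrier H))
       \<lparr>carrier := {f \<in> ring_iso H H \<inter> extensional (carrier H). \<forall>k \<in> K. f k = k}\<rparr>"

definition fixed_field :: "('a, 'b) ring_scheme \<Rightarrow> ('a \<Rightarrow> 'a) set \<Rightarrow> ('a, 'b) ring_scheme" where
  "fixed_field H G = H\<lparr>carrier := {z \<in> carrier H. \<forall>\<tau> \<in> G. \<tau> z = z}\<rparr>"

end

theory Submission
  imports Defs
begin

text \<open>
  For \<open>q > 2\<close> there are \<open>X\<close> and \<open>Y\<close> generating \<open>H\<close> with \<open>\<sigma>(X) = a X\<close>, \<open>\<sigma>(Y) = \<delta> Y\<close> and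
  \<open>Y\<^sup>q + Y = \<epsilon> X\<^sup>q\<^sup>+\<^sup>1\<close>, where \<open>\<epsilon> \<in> K\<close>. With \<open>V = Y\<^sup>q\<^sup>-\<^sup>1\<close> one gets \<open>X\<^bsup>(q - 1)(q + 1)\<^esup> = \<kappa> V (V + 1)\<^sup>q\<^sup>-\<^sup>1\<close>, so \<open>H = K(V, X)\<close>
  is a Kummer extension of \<open>K(V)\<close>, and the subfield fixed by \<open>\<sigma>\<^sup>s\<close>, where \<open>s m = q\<^sup>2 - 1\<close>, is \<open>K(V, U)\<close>
  with \<open>U = X\<^sup>m\<close> and \<open>U\<^sup>s = \<kappa> V (V + 1)\<^sup>q\<^sup>-\<^sup>1\<close>. As \<open>s\<close> is prime to \<open>q\<close>, the pole of \<open>V\<close> is totally ramified.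
  Splitting the functions regular at all other places into eigenvectors of \<open>U \<mapsto> \<eta> U\<close> yields a
  \<open>K[V]\<close>-basis of powers of \<open>U\<close> divided by powers of \<open>V + 1\<close>, and thus the exact dimension of
  \<open>\<L>(k P)\<close> for the infinite place \<open>P\<close> and large \<open>k\<close>; the genus is the number of gaps at \<open>P\<close>. That no
  other divisor does better follows from the fundamental inequality \<open>\<Sum> e f \<le> n\<close>, which bounds the
  number of zeros. Since \<open>K\<close> is finite, dimensions can be compared by counting elements throughout.
\<close>

section \<open>Polynomial expressions and Chevalley's extension theorem\<close>

text \<open>The genus is a maximum over all divisors, so knowing L(kP) at a single place gives only
  one of the two inequalities; an arbitrary divisor must also be bounded, and the bound on zeros
  enters there. The exponents of the Kummer equation decide the answer. The pole order of U at
  infinity is q, which is prime to s because s divides q^2 - 1: this forces total ramification and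
  degree one. The exponent q - 1 of V + 1, in contrast, may share a factor with s, and this common
  factor is the source of gcd(m, q + 1). The number of gaps is a difference of two sums of integer
  parts, of i q / s and of i (q - 1) / s over i < s, each with a closed form involving a gcd. The
  automorphism that separates eigenvectors is \<sigma> itself: it preserves the field fixed by its
  power \<sigma>^s and multiplies U by a^m, which has order s, so the eigenvalues on the powers U^i
  with i < s are distinct. Places and prime elements have to be produced as well: the former by
  Chevalley's theorem, the latter from the finiteness of the residue rings S/zS, which is again a
  counting statement.\<close>

context ring
begin

text \<open>The index counts coefficients: these are the values at \<open>w\<close> of polynomials
  of degree below \<open>n\<close>, so \<open>Suc n\<close> stands for degree at most
  \<open>n\<close>. \<open>B\<close> may be any subset because it is instantiated by the constant
  field, by ideals, by truncated polynomial rings and by sets of residue representatives.\<close>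

primrec polys :: "'a set \<Rightarrow> 'a \<Rightarrow> nat \<Rightarrow> 'a set" where
  "polys B w 0 = {\<zero>}"
| "polys B w (Suc n) = {a \<oplus> w \<otimes> p | a p. a \<in> B \<and> p \<in> polys B w n}"

definition adjoin :: "'a set \<Rightarrow> 'a \<Rightarrow> 'a set" where
  "adjoin B w = (\<Union>n. polys B w n)"

lemma polys_carrier: "B \<subseteq> carrier R \<Longrightarrow> w \<in> carrier R \<Longrightarrow> polys B w n \<subseteq> carrier R"
  by (induction n) auto

lemma polys_SucI: "a \<in> B \<Longrightarrow> p \<in> polys B w n \<Longrightarrow> a \<oplus> w \<otimes> p \<in> polys B w (Suc n)"
  by auto

lemma polys_zero: "\<zero> \<in> B \<Longrightarrow> w \<in> carrier R \<Longrightarrow> \<zero> \<in> polys B w n"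
proof (induction n)
  case (Suc n)
  then have "\<zero> = \<zero> \<oplus> w \<otimes> \<zero>" by simp
  then show ?case using Suc polys_SucI by metis
qed simp

lemma additive_subgroup_minus:
  "additive_subgroup B R \<Longrightarrow> a \<in> B \<Longrightarrow> b \<in> B \<Longrightarrow> a \<ominus> b \<in> B"
  by (simp add: a_minus_def additive_subgroup.a_closed additive_subgroup.a_inv_closed)

lemma additive_subgroupI:
  assumes "B \<subseteq> carrier R" "\<zero> \<in> B" "\<And>a b. a \<in> B \<Longrightarrow> b \<in> B \<Longrightarrow> a \<ominus> b \<in> B"
  shows "additive_subgroup B R"
proof -
  have neg: "\<ominus> a \<in> B" if "a \<in> B" for a
    using assms(3)[OF assms(2) that] assms(1) that by (auto simp: a_minus_def)
  have add: "a \<oplus> b \<in> B" if "a \<in> B" "b \<in> B" for a b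
    using assms(3)[OF that(1) neg[OF that(2)]] assms(1) that by (auto simp: a_minus_def)
  show ?thesis
    unfolding additive_subgroup_def
    by (rule group.subgroupI[OF a_group]) (use assms neg add in \<open>auto simp flip: a_inv_def\<close>)
qed

lemma polys_subgroup:
  assumes B: "additive_subgroup B R" and w: "w \<in> carrier R"
  shows "additive_subgroup (polys B w n) R"
proof -
  have Bc: "B \<subseteq> carrier R" using B by (simp add: additive_subgroup.a_subset)
  note Pc = polys_carrier[OF Bc w]
  have z: "\<zero> \<in> polys B w n" for n
    using polys_zero[OF _ w] B by (simp add: additive_subgroup.zero_closed)
  have "p \<in> polys B w n \<Longrightarrow> r \<in> polys B w n \<Longrightarrow> p \<ominus> r \<in> polys B w n" for p r
  proof (induction n arbitrary: p r)
    case (Suc n)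
    obtain a p' where p: "p = a \<oplus> w \<otimes> p'" "a \<in> B" "p' \<in> polys B w n" using Suc.prems by auto
    obtain c r' where r: "r = c \<oplus> w \<otimes> r'" "c \<in> B" "r' \<in> polys B w n" using Suc.prems by auto
    have "p \<ominus> r = (a \<ominus> c) \<oplus> w \<otimes> (p' \<ominus> r')"
      using p r Bc Pc w unfolding a_minus_def
      by (smt (verit) a_ac(1) a_ac(2) a_closed add.inv_closed minus_add r_distr r_minus subsetD m_closed a_comm)
    moreover have "a \<ominus> c \<in> B" by (rule additive_subgroup_minus[OF B p(2) r(2)])
    ultimately show ?case using Suc.IH[OF p(3) r(3)] by auto
  qed simp
  then show ?thesis using Pc z by (intro additive_subgroupI) auto
qed

lemma polys_const:
  assumes "B \<subseteq> carrier R" "\<zero> \<in> B" "w \<in> carrier R" "a \<in> B" shows "a \<in> polys B w (Suc n)"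
proof -
  have "a = a \<oplus> w \<otimes> \<zero>" using assms by auto
  then show ?thesis using polys_zero[OF assms(2,3)] assms polys_SucI by metis
qed

lemma polys_shift:
  assumes "B \<subseteq> carrier R" "\<zero> \<in> B" "w \<in> carrier R" "p \<in> polys B w n" shows "w \<otimes> p \<in> polys B w (Suc n)"
proof -
  have "p \<in> carrier R" using assms polys_carrier[OF assms(1,3)] by blast
  then have "w \<otimes> p = \<zero> \<oplus> w \<otimes> p" using assms by simp
  then show ?thesis using assms polys_SucI by metis
qed

lemma polys_mono:
  assumes "B \<subseteq> carrier R" "\<zero> \<in> B" "w \<in> carrier R" "n \<le> m" shows "polys B w n \<subseteq> polys B w m"
proof -
  have "polys B w n \<subseteq> polys B w (Suc n)" for n
  proof (induction n)
    case 0
    show ?case using polys_zero[OF assms(2,3), of "Suc 0"] by simp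
  next
    case (Suc n)
    then show ?case by auto
  qed
  then show ?thesis using assms(4) by (rule lift_Suc_mono_le)
qed

lemma polys_mono_coeff: "B \<subseteq> B' \<Longrightarrow> polys B w n \<subseteq> polys B' w n"
  by (induction n) auto

lemma polys_card:
  assumes "finite B" shows "finite (polys B w n) \<and> card (polys B w n) \<le> card B ^ n"
proof (induction n)
  case (Suc n)
  have eq: "polys B w (Suc n) = (\<lambda>(a, p). a \<oplus> w \<otimes> p) ` (B \<times> polys B w n)" by auto
  have "card (polys B w (Suc n)) \<le> card (B \<times> polys B w n)"
    unfolding eq by (rule card_image_le) (use assms Suc in auto)
  also have "\<dots> \<le> card B * card B ^ n" using Suc by (simp add: card_cartesian_product)
  finally show ?case using assms Suc unfolding eq by auto
qed simp

end

context cring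
begin

lemma polys_scale:
  assumes "B \<subseteq> carrier R" "w \<in> carrier R" "a \<in> carrier R"
    and "\<And>c. c \<in> B \<Longrightarrow> a \<otimes> c \<in> B'" and "p \<in> polys B w n"
  shows "a \<otimes> p \<in> polys B' w n"
  using assms(5)
proof (induction n arbitrary: p)
  case 0
  then show ?case using assms by simp
next
  case (Suc n)
  obtain c p' where p: "p = c \<oplus> w \<otimes> p'" "c \<in> B" "p' \<in> polys B w n" using Suc.prems by auto
  have "a \<otimes> p = a \<otimes> c \<oplus> w \<otimes> (a \<otimes> p')"
    using p assms polys_carrier[OF assms(1,2)]
    by (simp add: p(1) r_distr m_lcomm subset_iff)
  then show ?case using Suc.IH[OF p(3)] assms(4)[OF p(2)] by auto
qed

text \<open>Degrees add: degree at most \<open>n\<close> times degree below \<open>m\<close> gives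
  degree below \<open>n + m\<close>.\<close>

lemma polys_mult:
  assumes B: "additive_subgroup B R" "\<And>a c. a \<in> B \<Longrightarrow> c \<in> B \<Longrightarrow> a \<otimes> c \<in> B"
    and w: "w \<in> carrier R" and p: "p \<in> polys B w (Suc n)" and r: "r \<in> polys B w m"
  shows "p \<otimes> r \<in> polys B w (n + m)"
  using p
proof (induction n arbitrary: p)
  have Bc: "B \<subseteq> carrier R" and B0: "\<zero> \<in> B"
    using B by (simp_all add: additive_subgroup.a_subset additive_subgroup.zero_closed)
  note Pc = polys_carrier[OF Bc w]
  {
    case 0
    then obtain a where a: "a \<in> B" "p = a" using w Bc by auto
    then show ?case using polys_scale[OF Bc w _ _ r, of a B] B Bc by auto
  next
    case (Suc n)
    obtain c p' where p: "p = c \<oplus> w \<otimes> p'" "c \<in> B" "p' \<in> polys B w (Suc n)"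
      using Suc.prems unfolding polys.simps(2)[of B w "Suc n"] by blast
    have cs: "c \<in> carrier R" "p' \<in> carrier R" "r \<in> carrier R"
      using p r Bc Pc by blast+
    have "p \<otimes> r = c \<otimes> r \<oplus> w \<otimes> (p' \<otimes> r)"
      using cs w by (simp add: p(1) l_distr m_assoc)
    moreover have "c \<otimes> r \<in> polys B w (Suc (n + m))"
      using polys_scale[OF Bc w cs(1) _ r, of B] B(2) p(2) polys_mono[OF Bc B0 w, of m "Suc (n+m)"] by auto
    moreover have "w \<otimes> (p' \<otimes> r) \<in> polys B w (Suc (n + m))"
      using polys_shift[OF Bc B0 w Suc.IH[OF p(3)]] .
    ultimately show ?case
      using additive_subgroup.a_closed[OF polys_subgroup[OF B(1) w]] by (metis add_Suc)
  }
qed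

text \<open>The recursion of \<open>polys\<close> splits off the constant coefficient;
  degree-lowering arguments need the leading one.\<close>

lemma polys_snoc:
  assumes B: "B \<subseteq> carrier R" and B0: "\<zero> \<in> B" and w: "w \<in> carrier R"
  shows "polys B w (Suc n) = {p \<oplus> a \<otimes> w [^] n | p a. a \<in> B \<and> p \<in> polys B w n}"
proof (induction n)
  case 0
  have "a \<oplus> w \<otimes> \<zero> = \<zero> \<oplus> a \<otimes> w [^] (0::nat)" if "a \<in> B" for a using that B w by auto
  then show ?case by force
next
  case (Suc n)
  note Pc = polys_carrier[OF B w]
  have *: "c \<oplus> w \<otimes> (p \<oplus> a \<otimes> w [^] n) = (c \<oplus> w \<otimes> p) \<oplus> a \<otimes> w [^] Suc n"
    if "a \<in> B" "c \<in> B" "p \<in> polys B w n" for a c p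
  proof -
    have "a \<in> carrier R" "c \<in> carrier R" "p \<in> carrier R" using that B Pc by auto
    then show ?thesis using w by (simp add: r_distr a_assoc m_assoc m_comm m_lcomm)
  qed
  have "polys B w (Suc (Suc n)) = {c \<oplus> w \<otimes> (p \<oplus> a \<otimes> w [^] n) | c p a. a \<in> B \<and> c \<in> B \<and> p \<in> polys B w n}"
    unfolding polys.simps(2)[of B w "Suc n"] Suc by blast
  also have "\<dots> = {(c \<oplus> w \<otimes> p) \<oplus> a \<otimes> w [^] Suc n | c p a. a \<in> B \<and> c \<in> B \<and> p \<in> polys B w n}"
    using * by (metis (no_types, lifting))
  also have "\<dots> = {p \<oplus> a \<otimes> w [^] Suc n | p a. a \<in> B \<and> p \<in> polys B w (Suc n)}"
    unfolding polys.simps(2)[of B w n] by blast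
  finally show ?case .
qed

lemma polys_finsum:
  assumes B: "B \<subseteq> carrier R" and B0: "\<zero> \<in> B" and w: "w \<in> carrier R"
  shows "polys B w n = {(\<Oplus>i\<in>{..<n}. g i \<otimes> w [^] i) | g. g \<in> {..<n} \<rightarrow> B}"
proof (induction n)
  case 0
  show ?case by auto
next
  case (Suc n)
  have eq: "(\<Oplus>i\<in>{..<Suc n}. g i \<otimes> w [^] i) = (\<Oplus>i\<in>{..<n}. g i \<otimes> w [^] i) \<oplus> g n \<otimes> w [^] n"
    if "g \<in> {..<Suc n} \<rightarrow> B" for g
  proof -
    have "g i \<in> carrier R" if "i < Suc n" for i using \<open>g \<in> _\<close> that B by auto
    then show ?thesis unfolding lessThan_Suc
      using w by (subst finsum_insert) (auto simp: a_comm)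
  qed
  show ?case
  proof (intro equalityI subsetI)
    fix z assume "z \<in> polys B w (Suc n)"
    then obtain p a where z: "z = p \<oplus> a \<otimes> w [^] n" "a \<in> B" "p \<in> polys B w n"
      unfolding polys_snoc[OF assms] by blast
    then obtain g where g: "g \<in> {..<n} \<rightarrow> B" "p = (\<Oplus>i\<in>{..<n}. g i \<otimes> w [^] i)"
      using Suc by blast
    have "(\<Oplus>i\<in>{..<n}. (g(n := a)) i \<otimes> w [^] i) = p" unfolding g(2)
      by (rule finsum_cong') (use g B w in auto)
    moreover have gn: "g(n := a) \<in> {..<Suc n} \<rightarrow> B" using g(1) z(2) by (auto simp: Pi_iff less_Suc_eq)
    ultimately have "z = (\<Oplus>i\<in>{..<Suc n}. (g(n := a)) i \<otimes> w [^] i)" using eq[OF gn] z by simp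
    then show "z \<in> {(\<Oplus>i\<in>{..<Suc n}. g i \<otimes> w [^] i) | g. g \<in> {..<Suc n} \<rightarrow> B}" using gn by blast
  next
    fix z assume "z \<in> {(\<Oplus>i\<in>{..<Suc n}. g i \<otimes> w [^] i) | g. g \<in> {..<Suc n} \<rightarrow> B}"
    then obtain g where g: "g \<in> {..<Suc n} \<rightarrow> B" "z = (\<Oplus>i\<in>{..<Suc n}. g i \<otimes> w [^] i)" by blast
    have "g \<in> {..<n} \<rightarrow> B" using g(1) by auto
    then have "(\<Oplus>i\<in>{..<n}. g i \<otimes> w [^] i) \<in> polys B w n" unfolding Suc by blast
    moreover have "g n \<in> B" using g(1) by auto
    ultimately show "z \<in> polys B w (Suc n)" unfolding polys_snoc[OF assms] eq[OF g(1), folded g(2)] by blast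
  qed
qed

lemma subring_additive: "subring S R \<Longrightarrow> additive_subgroup S R"
  by (simp add: additive_subgroup_def subring.axioms(1))

lemma adjoin_subring:
  assumes S: "subring S R" and w: "w \<in> carrier R"
  shows "subring (adjoin S w) R"
proof -
  note B = subring_additive[OF S]
  have Sc: "S \<subseteq> carrier R" and S0: "\<zero> \<in> S" and S1: "\<one> \<in> S" using subringE[OF S] by auto
  have m: "\<And>a c. a \<in> S \<Longrightarrow> c \<in> S \<Longrightarrow> a \<otimes> c \<in> S" using subringE[OF S] by auto
  note Pc = polys_carrier[OF Sc w]
  note M = polys_mono[OF Sc S0 w]
  have common: "\<exists>n. p \<in> polys S w (Suc n) \<and> r \<in> polys S w (Suc n)" if pr: "p \<in> adjoin S w" "r \<in> adjoin S w" for p r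
  proof -
    obtain i j where ij: "p \<in> polys S w i" "r \<in> polys S w j" using pr by (auto simp: adjoin_def)
    then have "p \<in> polys S w (Suc (i+j))" "r \<in> polys S w (Suc (i+j))"
      using M[of i "Suc (i+j)"] M[of j "Suc (i+j)"] by auto
    then show ?thesis by blast
  qed
  have in_adjoin: "polys S w n \<subseteq> adjoin S w" for n by (auto simp: adjoin_def)
  show ?thesis
  proof (rule subringI)
    show "adjoin S w \<subseteq> carrier R" using Pc by (auto simp: adjoin_def)
    show "\<one> \<in> adjoin S w" using polys_const[OF Sc S0 w S1] in_adjoin by blast
    fix p r assume pr: "p \<in> adjoin S w" "r \<in> adjoin S w"
    then obtain n where n: "p \<in> polys S w (Suc n)" "r \<in> polys S w (Suc n)" using common by blast
    show "\<ominus> p \<in> adjoin S w" using additive_subgroup.a_inv_closed[OF polys_subgroup[OF B w] n(1)] in_adjoin by blast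
    show "p \<oplus> r \<in> adjoin S w" using additive_subgroup.a_closed[OF polys_subgroup[OF B w] n] in_adjoin by blast
    show "p \<otimes> r \<in> adjoin S w" using polys_mult[OF B m w n] in_adjoin by blast
  qed
qed

lemma adjoin_base: "subring S R \<Longrightarrow> w \<in> carrier R \<Longrightarrow> S \<subseteq> adjoin S w"
  unfolding adjoin_def using polys_const[of S w] subringE[of S R] by (meson UN_I UNIV_I subsetI)

lemma adjoin_gen: assumes S: "subring S R" and w: "w \<in> carrier R" shows "w \<in> adjoin S w"
proof -
  have Sc: "S \<subseteq> carrier R" "\<zero> \<in> S" "\<one> \<in> S" using subringE[OF S] by auto
  have "w = w \<otimes> \<one>" using w by simp
  moreover have "w \<otimes> \<one> \<in> polys S w (Suc (Suc 0))"
    by (rule polys_shift[OF Sc(1,2) w]) (rule polys_const[OF Sc(1,2) w Sc(3)])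
  ultimately show ?thesis unfolding adjoin_def by (metis UN_I UNIV_I)
qed

lemma polys_least:
  assumes "subring M R" "B \<subseteq> M" "w \<in> M" shows "polys B w n \<subseteq> M"
proof (induction n)
  case 0
  show ?case using subringE(2)[OF assms(1)] by simp
next
  case (Suc n)
  show ?case
  proof
    fix z assume "z \<in> polys B w (Suc n)"
    then obtain a p where "z = a \<oplus> w \<otimes> p" "a \<in> B" "p \<in> polys B w n" by auto
    then show "z \<in> M" using Suc assms subringE(6,7)[OF assms(1)] by blast
  qed
qed

lemma adjoin_least:
  assumes "subring M R" "B \<subseteq> M" "w \<in> M" shows "adjoin B w \<subseteq> M"
  unfolding adjoin_def using polys_least[OF assms] by blast

text \<open>Multiplying a polynomial in 1/w of degree at most \<open>k\<close> by w^k reverses its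
  coefficients.\<close>

lemma polys_reverse:
  assumes B: "additive_subgroup B R" and w: "w \<in> carrier R" "w' \<in> carrier R" "w \<otimes> w' = \<one>"
    and c: "c \<in> polys B w' m" "m \<le> Suc k"
  shows "w [^] k \<otimes> c \<in> polys B w (Suc k)"
  using c
proof (induction m arbitrary: c k)
  have Bc: "B \<subseteq> carrier R" and B0: "\<zero> \<in> B"
    using B by (simp_all add: additive_subgroup.a_subset additive_subgroup.zero_closed)
  {
    case 0
    then show ?case using polys_zero[OF B0 w(1), of "Suc k"] w by simp
  next
    case (Suc m)
    obtain b c' where c: "c = b \<oplus> w' \<otimes> c'" "b \<in> B" "c' \<in> polys B w' m" using Suc.prems by auto
    have cs: "b \<in> carrier R" "c' \<in> carrier R" using c Bc polys_carrier[OF Bc w(2)] by blast+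
    show ?case
    proof (cases k)
      case 0
      then have "c' = \<zero>" using Suc.prems c by simp
      then have "w [^] k \<otimes> c = b" using 0 c cs w by simp
      then show ?thesis using polys_const[OF Bc B0 w(1) c(2)] by simp
    next
      case (Suc j)
      have "w [^] Suc j \<otimes> (w' \<otimes> c') = w [^] j \<otimes> ((w \<otimes> w') \<otimes> c')"
        using w(1,2) cs by (simp add: m_assoc)
      then have "w [^] k \<otimes> c = (w [^] j \<otimes> c') \<oplus> b \<otimes> w [^] k"
        using Suc c cs w by (simp add: r_distr m_comm a_comm)
      moreover have "w [^] j \<otimes> c' \<in> polys B w k"
        using Suc.IH[OF c(3), of j] Suc.prems(2) Suc by simp
      ultimately show ?thesis using c(2) unfolding polys_snoc[OF Bc B0 w(1)] by blast
    qed
  }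
qed

end

section \<open>Arithmetic of inverses; valuation rings omitting a given element\<close>

context field
begin

lemma nz_inv:
  assumes "z \<in> carrier R" "z \<noteq> \<zero>"
  shows "inv z \<in> carrier R" "inv z \<noteq> \<zero>" "z \<otimes> inv z = \<one>" "inv z \<otimes> z = \<one>" "inv (inv z) = z"
proof -
  have u: "z \<in> Units R" using assms field_Units by auto
  show "inv z \<in> carrier R" "z \<otimes> inv z = \<one>" "inv z \<otimes> z = \<one>" "inv (inv z) = z" using u by auto
  then show "inv z \<noteq> \<zero>" using assms by auto
qed

lemma inv_mult':
  assumes "z \<in> carrier R" "z \<noteq> \<zero>" "w \<in> carrier R" "w \<noteq> \<zero>"
  shows "inv (z \<otimes> w) = inv z \<otimes> inv w"
proof (rule comm_inv_char)
  have "z \<otimes> w \<otimes> (inv z \<otimes> inv w) = (z \<otimes> inv z) \<otimes> (w \<otimes> inv w)"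
    using assms nz_inv(1)[OF assms(1,2)] nz_inv(1)[OF assms(3,4)] by (simp add: m_ac)
  then show "z \<otimes> w \<otimes> (inv z \<otimes> inv w) = \<one>" using nz_inv assms by simp
qed (use assms nz_inv in auto)

lemma nz_mult: "z \<in> carrier R \<Longrightarrow> w \<in> carrier R \<Longrightarrow> z \<noteq> \<zero> \<Longrightarrow> w \<noteq> \<zero> \<Longrightarrow> z \<otimes> w \<noteq> \<zero>"
  using integral by blast

lemma nz_pow: "z \<in> carrier R \<Longrightarrow> z \<noteq> \<zero> \<Longrightarrow> z [^] (n::nat) \<noteq> \<zero>"
  by (induction n) (auto simp: integral_iff)

lemma inv_pow': "z \<in> carrier R \<Longrightarrow> z \<noteq> \<zero> \<Longrightarrow> inv (z [^] (n::nat)) = inv z [^] n"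
  by (induction n) (auto simp: inv_mult' nz_pow nz_inv m_comm)

lemma div_eq_iff:
  assumes "z \<in> carrier R" "w \<in> carrier R" "w \<noteq> \<zero>" "y \<in> carrier R"
  shows "z \<otimes> inv w = y \<longleftrightarrow> z = y \<otimes> w"
proof -
  note i = nz_inv[OF assms(2,3)]
  have "z \<otimes> inv w \<otimes> w = z" "y \<otimes> w \<otimes> inv w = y" using i assms by (simp_all add: m_assoc)
  then show ?thesis by metis
qed

lemma cancel_left:
  assumes "z \<in> carrier R" "z \<noteq> \<zero>" "w \<in> carrier R"
  shows "z \<otimes> (inv z \<otimes> w) = w" "inv z \<otimes> (z \<otimes> w) = w"
  using nz_inv[OF assms(1,2)] assms by (simp_all flip: m_assoc)

lemma chain_Union_subring:
  assumes "C \<noteq> {}" "subset.chain A C" "\<And>S. S \<in> C \<Longrightarrow> subring S R"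
  shows "subring (\<Union>C) R"
proof -
  have ch: "S \<subseteq> T \<or> T \<subseteq> S" if "S \<in> C" "T \<in> C" for S T
    using assms(2) that unfolding subset_chain_def by blast
  have common: "\<exists>S\<in>C. a \<in> S \<and> b \<in> S" if ab: "a \<in> \<Union>C" "b \<in> \<Union>C" for a b
  proof -
    obtain S T where "S \<in> C" "T \<in> C" "a \<in> S" "b \<in> T" using ab by blast
    then show ?thesis using ch[of S T] by blast
  qed
  show ?thesis
  proof (rule subringI)
    show "\<Union>C \<subseteq> carrier R" using subringE(1)[OF assms(3)] by blast
    show "\<one> \<in> \<Union>C" using assms(1) subringE(3)[OF assms(3)] by blast
  next
    fix a assume "a \<in> \<Union>C"
    then obtain S where S: "S \<in> C" "a \<in> S" by blast
    then show "\<ominus> a \<in> \<Union>C" using subringE(5)[OF assms(3)[OF S(1)] S(2)] by blast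
  next
    fix a b assume "a \<in> \<Union>C" "b \<in> \<Union>C"
    then obtain S where S: "S \<in> C" "a \<in> S" "b \<in> S" using common by blast
    then show "a \<otimes> b \<in> \<Union>C" "a \<oplus> b \<in> \<Union>C"
      using subringE(6,7)[OF assms(3)[OF S(1)] S(2,3)] by blast+
  qed
qed

text \<open>The degree-lowering step in Chevalley's extension theorem: \<open>I\<close> is an ideal of \<open>S\<close> which
  generates the unit ideal both in \<open>S[w]\<close> and in \<open>S[w\<^sup>-\<^sup>1]\<close>.\<close>

lemma Chevalley_step:
  assumes S: "subring S R" and I: "additive_subgroup I R" "I \<subseteq> S"
      "\<And>a b. a \<in> S \<Longrightarrow> b \<in> I \<Longrightarrow> a \<otimes> b \<in> I"
    and w: "w \<in> carrier R" "w' \<in> carrier R" "w \<otimes> w' = \<one>"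
    and n: "\<one> \<in> polys I w (Suc n)" "\<one> \<in> polys I w' (Suc m)" "m \<le> n" "n \<ge> 1"
  shows "\<one> \<in> polys I w n"
proof -
  have Sc: "S \<subseteq> carrier R" using subringE[OF S] by auto
  have Ic: "I \<subseteq> carrier R" and I0: "\<zero> \<in> I"
    using I by (auto simp: additive_subgroup.zero_closed)
       (meson I(1) additive_subgroup.a_Hcarr)
  note AG = polys_subgroup[OF I(1) w(1), of n]
  note Pc = polys_carrier[OF Ic w(1)] polys_carrier[OF Ic w(2)]
  obtain p a where p: "\<one> = p \<oplus> a \<otimes> w [^] n" "a \<in> I" "p \<in> polys I w n"
    using n(1) unfolding polys_snoc[OF Ic I0 w(1)] by blast
  obtain b c where b: "\<one> = b \<oplus> w' \<otimes> c" "b \<in> I" "c \<in> polys I w' m" using n(2) by auto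
  obtain k where k: "n = Suc k" using n(4) by (cases n) auto
  have cs: "p \<in> carrier R" "a \<in> carrier R" "b \<in> carrier R" "c \<in> carrier R"
    using p b Pc Ic by blast+
  have r: "w [^] k \<otimes> c \<in> polys I w n" unfolding k
    by (rule polys_reverse[OF I(1) w b(3)]) (use n k in simp)
  \<comment> \<open>The relation 1 = b + w' c shows that 1 - b is divisible by w'. Multiplication by
    1 - b therefore turns w^n into w^k c with n = k + 1, which has degree at most \<open>k\<close>
    because m \<le> n.\<close>
  have "\<one> \<ominus> b = (b \<oplus> w' \<otimes> c) \<ominus> b" using b(1) by simp
  also have "\<dots> = w' \<otimes> c" using cs w by algebra
  finally have "\<one> \<ominus> b = w' \<otimes> c" .
  then have "(\<one> \<ominus> b) \<otimes> w [^] n = w [^] k \<otimes> ((w \<otimes> w') \<otimes> c)"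
    using cs w(1,2) by (simp add: k m_ac)
  then have br: "(\<one> \<ominus> b) \<otimes> w [^] n = w [^] k \<otimes> c" using w cs by simp
  have wn: "w [^] n \<in> carrier R" "\<one> \<ominus> b \<in> carrier R" using w cs by auto
  \<comment> \<open>The relation of degree \<open>n\<close>, multiplied by 1 - b: after substituting
    for the leading term, every summand has degree below \<open>n\<close>.\<close>
  have "\<one> = b \<oplus> (\<one> \<ominus> b) \<otimes> \<one>" using cs by algebra
  also have "\<dots> = b \<oplus> (\<one> \<ominus> b) \<otimes> (p \<oplus> a \<otimes> w [^] n)" using p(1) by simp
  also have "\<dots> = b \<oplus> ((\<one> \<ominus> b) \<otimes> p \<oplus> a \<otimes> ((\<one> \<ominus> b) \<otimes> w [^] n))"
    using cs wn by (simp add: r_distr m_lcomm)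
  finally have *: "\<one> = b \<oplus> ((\<one> \<ominus> b) \<otimes> p \<oplus> a \<otimes> (w [^] k \<otimes> c))" unfolding br .
  have bS: "\<one> \<ominus> b \<in> S" using additive_subgroup_minus[OF subring_additive[OF S]] subringE(3)[OF S] b I by blast
  have "b \<in> polys I w n" unfolding k by (rule polys_const[OF Ic I0 w(1) b(2)])
  moreover have "(\<one> \<ominus> b) \<otimes> p \<in> polys I w n"
    by (rule polys_scale[OF Ic w(1) wn(2) _ p(3)]) (use I(3) bS in blast)
  moreover have "a \<otimes> (w [^] k \<otimes> c) \<in> polys I w n"
    by (rule polys_scale[OF Ic w(1) cs(2) _ r]) (use I p in blast)
  ultimately show ?thesis using * additive_subgroup.a_closed[OF AG] by metis
qed

text \<open>Zorn's lemma gives a subring \<open>S\<close> maximal among those that contain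
  \<open>K\<close> and \<open>z\<close> but not 1/z. If \<open>w\<close> and 1/w were both outside
  \<open>S\<close>, then 1/z would lie in S[w] and in S[1/w], and lowering degrees below the least
  possible ones gives a contradiction. Applied to the inverse of an element, the theorem produces a
  place where that element has a pole.\<close>

theorem Chevalley:
  assumes K: "subfield K R" and z: "z \<in> carrier R" "z \<noteq> \<zero>" "inv z \<notin> adjoin K z"
  shows "\<exists>S. valuation_ring R K S \<and> z \<in> S \<and> inv z \<notin> S"
proof -
  define A where "A = {S. subring S R \<and> K \<subseteq> S \<and> z \<in> S \<and> inv z \<notin> S}"
  have Ks: "subring K R" using subfieldE(1)[OF K] .
  have "adjoin K z \<in> A" unfolding A_def
    using adjoin_subring[OF Ks z(1)] adjoin_base[OF Ks z(1)] adjoin_gen[OF Ks z(1)] z by auto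
  moreover have "\<Union>C \<in> A" if C: "C \<noteq> {}" "subset.chain A C" for C
  proof -
    have CA: "C \<subseteq> A" using C by (simp add: subset_chain_def)
    have "subring (\<Union>C) R" by (rule chain_Union_subring[OF C]) (use CA A_def in auto)
    moreover obtain S where "S \<in> C" using C by auto
    ultimately show ?thesis using CA unfolding A_def by auto
  qed
  ultimately have "\<exists>M\<in>A. \<forall>N\<in>A. M \<subseteq> N \<longrightarrow> N = M" by (intro subset_Zorn_nonempty) auto
  then obtain S where S: "S \<in> A" "\<forall>N\<in>A. S \<subseteq> N \<longrightarrow> N = S" by auto
  have SS: "subring S R" "K \<subseteq> S" "z \<in> S" "inv z \<notin> S" using S by (auto simp: A_def)
  have Sc: "S \<subseteq> carrier R" using subringE[OF SS(1)] by auto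
  \<comment> \<open>The ideal zS is proper because 1/z is not in \<open>S\<close>. Multiplication by
    \<open>z\<close> turns a polynomial expression for 1/z over \<open>S\<close> into one for 1 over
    \<open>I\<close>, which is what \<open>Chevalley_step\<close> works with.\<close>
  define I where "I = {z \<otimes> a | a. a \<in> S}"
  have I: "additive_subgroup I R"
  proof (rule additive_subgroupI)
    show "I \<subseteq> carrier R" using Sc z by (auto simp: I_def)
    show "\<zero> \<in> I" unfolding I_def using z subringE(2)[OF SS(1)] by force
    fix a b assume "a \<in> I" "b \<in> I"
    then obtain a' b' where ab: "a = z \<otimes> a'" "b = z \<otimes> b'" "a' \<in> S" "b' \<in> S" by (auto simp: I_def)
    then have "a \<ominus> b = z \<otimes> (a' \<ominus> b')" using z Sc
      by (simp add: subset_iff r_distr r_minus a_minus_def)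
    then show "a \<ominus> b \<in> I" unfolding I_def
      using additive_subgroup_minus[OF subring_additive[OF SS(1)] ab(3,4)] by blast
  qed
  have IS: "I \<subseteq> S" using SS subringE(6)[OF SS(1)] by (auto simp: I_def)
  have Im: "a \<otimes> b \<in> I" if ab: "a \<in> S" "b \<in> I" for a b
  proof -
    obtain b' where b': "b = z \<otimes> b'" "b' \<in> S" using ab by (auto simp: I_def)
    then have "a \<otimes> b = z \<otimes> (a \<otimes> b')" using ab z Sc by (simp add: m_lcomm subset_iff)
    then show ?thesis using subringE(6)[OF SS(1)] ab b' by (auto simp: I_def)
  qed
  have I1: "\<one> \<notin> I"
  proof
    assume "\<one> \<in> I"
    then obtain a where "\<one> = z \<otimes> a" "a \<in> S" by (auto simp: I_def)
    then have "inv z = a" using comm_inv_char[of z a] z Sc by auto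
    then show False using SS \<open>a \<in> S\<close> by simp
  qed
  have one: "\<exists>n. \<one> \<in> polys I w (Suc n)" if w: "w \<in> carrier R" "w \<notin> S" for w
  proof -
    have "adjoin S w \<notin> A" using S(2) adjoin_base[OF SS(1) w(1)] adjoin_gen[OF SS(1) w(1)] w by blast
    then have "inv z \<in> adjoin S w"
      using adjoin_subring[OF SS(1) w(1)] adjoin_base[OF SS(1) w(1)] SS unfolding A_def by blast
    then obtain n where n: "inv z \<in> polys S w n" by (auto simp: adjoin_def)
    have "z \<otimes> inv z \<in> polys I w n"
      by (rule polys_scale[OF Sc w(1) z(1) _ n]) (auto simp: I_def)
    then have "\<one> \<in> polys I w n" using nz_inv[OF z(1,2)] by simp
    then show ?thesis using polys_mono[of I w n "Suc n"] I w
      by (meson IS Sc additive_subgroup.zero_closed le_SucI order_refl subset_iff subset_trans)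
  qed
  have "w \<in> S \<or> inv w \<in> S" if w: "w \<in> carrier R" "w \<noteq> \<zero>" for w
  proof (rule ccontr)
    assume "\<not> ?thesis"
    then have nS: "w \<notin> S" "inv w \<notin> S" by auto
    note iw = nz_inv[OF w]
    \<comment> \<open>Least degrees of such expressions in \<open>w\<close> and in 1/w; the larger
      of the two could still be lowered.\<close>
    define n where "n = (LEAST n. \<one> \<in> polys I w (Suc n))"
    define m where "m = (LEAST n. \<one> \<in> polys I (inv w) (Suc n))"
    have n: "\<one> \<in> polys I w (Suc n)" unfolding n_def by (rule LeastI_ex[OF one[OF w(1) nS(1)]])
    have m: "\<one> \<in> polys I (inv w) (Suc m)" unfolding m_def by (rule LeastI_ex[OF one[OF iw(1) nS(2)]])
    have base: "\<one> \<notin> polys I v (Suc 0)" if v: "v \<in> carrier R" for v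
    proof
      assume "\<one> \<in> polys I v (Suc 0)"
      then obtain a where a: "\<one> = a \<oplus> v \<otimes> \<zero>" "a \<in> I" by auto
      then have "\<one> = a" using v IS Sc by auto
      then show False using a(2) I1 by simp
    qed
    have np: "n \<ge> 1" using n base[OF w(1)] by (cases n) simp_all
    have mp: "m \<ge> 1" using m base[OF iw(1)] by (cases m) simp_all
    have n': "\<one> \<notin> polys I w n" using not_less_Least[of "n - 1" "\<lambda>n. \<one> \<in> polys I w (Suc n)"] np n_def by auto
    have m': "\<one> \<notin> polys I (inv w) m" using not_less_Least[of "m - 1" "\<lambda>n. \<one> \<in> polys I (inv w) (Suc n)"] mp m_def by auto
    show False
    proof (cases "m \<le> n")
      case True
      show False using Chevalley_step[OF SS(1) I IS Im w(1) iw(1,3) n m True np] n' by blast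
    next
      case False
      then show False using Chevalley_step[OF SS(1) I IS Im iw(1) w(1) iw(4) m n _ mp] m' by simp
    qed
  qed
  moreover have "K \<noteq> S"
    using SS z subfield_m_inv(1)[OF K] by auto
  moreover have "S \<noteq> carrier R" using SS nz_inv(1)[OF z(1,2)] by auto
  ultimately show ?thesis using SS Sc unfolding valuation_ring_def by blast
qed

end

section \<open>Valuation rings and prime elements\<close>

definition (in ring) nonunits :: "'a set \<Rightarrow> 'a set" where
  "nonunits S = {z \<in> S. z = \<zero> \<or> inv z \<notin> S}"

definition (in ring) place_units :: "'a set \<Rightarrow> 'a set" where
  "place_units S = {u \<in> S. u \<noteq> \<zero> \<and> inv u \<in> S}"

text \<open>Discreteness in multiplicative form. The factorisation is asked for all nonzero field
  elements, not only those of \<open>S\<close>, so that it yields the value of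
  \<open>valuation\<close> directly.\<close>

definition (in ring) prime_element :: "'a set \<Rightarrow> 'a \<Rightarrow> bool" where
  "prime_element S t \<longleftrightarrow> t \<in> nonunits S \<and> t \<noteq> \<zero> \<and>
     (\<forall>z\<in>carrier R - {\<zero>}. \<exists>n::int. \<exists>u\<in>place_units S. z = t [^] n \<otimes> u)"

text \<open>A bound on the size of such sets says that S/zS is finite, without forming the quotient.
  It is used for valuation rings and also for intersections of finitely many of them.\<close>

definition (in ring) incongruent :: "'a set \<Rightarrow> 'a \<Rightarrow> 'a set \<Rightarrow> bool" where
  "incongruent S z T \<longleftrightarrow> finite T \<and> T \<subseteq> S \<and>
     (\<forall>a\<in>T. \<forall>b\<in>T. a \<noteq> b \<longrightarrow> a \<ominus> b \<notin> {z \<otimes> c | c. c \<in> S})"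

section \<open>Places as valuation rings: maximal ideals, units and valuations\<close>

context field
begin

lemma ipow_units_of:
  assumes "t \<in> carrier R" "t \<noteq> \<zero>" shows "t [^]\<^bsub>units_of R\<^esub> (n::int) = t [^] n"
proof -
  have "t [^] (k::nat) \<in> Units R" for k using assms nz_pow field_Units by simp
  then have "inv\<^bsub>units_of R\<^esub> (t [^] (k::nat)) = inv (t [^] k)" for k using units_of_inv by blast
  moreover have "t [^]\<^bsub>units_of R\<^esub> (k::nat) = t [^] k" for k
    by (rule units_of_pow) (use assms field_Units in simp)
  ultimately show ?thesis unfolding int_pow_def2 by presburger
qed

lemma ipow:
  assumes "t \<in> carrier R" "t \<noteq> \<zero>"
  shows "t [^] (n::int) \<in> carrier R" "t [^] n \<noteq> \<zero>"
    "t [^] (n + m) = t [^] n \<otimes> t [^] (m::int)" "t [^] (- n) = inv (t [^] n)"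
    "w \<in> carrier R \<Longrightarrow> w \<noteq> \<zero> \<Longrightarrow> (t \<otimes> w) [^] n = t [^] n \<otimes> w [^] n"
    "t [^] (1::int) = t"
proof -
  interpret G: comm_group "units_of R" by (rule units_comm_group)
  have U: "carrier (units_of R) = carrier R - {\<zero>}" by (simp add: units_of_carrier field_Units)
  have t: "t \<in> carrier (units_of R)" using assms U by simp
  show c: "t [^] n \<in> carrier R" "t [^] n \<noteq> \<zero>"
    using G.int_pow_closed[OF t, of n] ipow_units_of[OF assms] U by auto
  show "t [^] (n + m) = t [^] n \<otimes> t [^] m"
    using G.int_pow_mult[OF t, of n m] ipow_units_of[OF assms] by (simp add: units_of_mult)
  show "t [^] (- n) = inv (t [^] n)"
    using G.int_pow_neg[OF t, of n] ipow_units_of[OF assms] units_of_inv[of "t [^] n"] c field_Units by simp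
  show "t [^] (1::int) = t" using G.int_pow_1[OF t] ipow_units_of[OF assms] by simp
  assume w: "w \<in> carrier R" "w \<noteq> \<zero>"
  have "w \<in> carrier (units_of R)" using w U by simp
  then show "(t \<otimes> w) [^] n = t [^] n \<otimes> w [^] n"
    using G.int_pow_mult_distrib[OF _ t, of w n] ipow_units_of assms w m_comm[OF assms(1) w(1)]
    by (simp add: nz_mult units_of_mult)
qed

lemma valuation_ringD:
  assumes "valuation_ring R K S"
  shows "subring S R" "K \<subseteq> S" "S \<subseteq> carrier R" "S \<noteq> carrier R"
    "\<And>z. z \<in> carrier R \<Longrightarrow> z \<noteq> \<zero> \<Longrightarrow> z \<in> S \<or> inv z \<in> S"
  using assms unfolding valuation_ring_def by auto

lemma nonunits_ideal:
  assumes vr: "valuation_ring R K S"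
  shows "\<zero> \<in> nonunits S" "\<one> \<notin> nonunits S" "nonunits S \<subseteq> S"
    "\<And>a z. a \<in> S \<Longrightarrow> z \<in> nonunits S \<Longrightarrow> a \<otimes> z \<in> nonunits S"
    "\<And>a b. a \<in> nonunits S \<Longrightarrow> b \<in> nonunits S \<Longrightarrow> a \<oplus> b \<in> nonunits S"
    "\<And>a. a \<in> nonunits S \<Longrightarrow> \<ominus> a \<in> nonunits S"
proof -
  note D = valuation_ringD[OF vr]
  note E = subringE[OF D(1)]
  show "\<zero> \<in> nonunits S" using E unfolding nonunits_def by auto
  show "\<one> \<notin> nonunits S" using E unfolding nonunits_def by auto
  show "nonunits S \<subseteq> S" unfolding nonunits_def by auto
  show M: "a \<otimes> z \<in> nonunits S" if "a \<in> S" "z \<in> nonunits S" for a z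
  proof -
    have zc: "z \<in> S" "z \<in> carrier R" "a \<in> carrier R" using that D unfolding nonunits_def by auto
    have "inv z \<in> S" if nz: "a \<otimes> z \<noteq> \<zero>" "inv (a \<otimes> z) \<in> S"
    proof -
      have n: "a \<noteq> \<zero>" "z \<noteq> \<zero>" using nz zc by auto
      have "a \<otimes> inv (a \<otimes> z) = inv z"
        using inv_mult'[OF zc(3) n(1) zc(2) n(2)] cancel_left[OF zc(3) n(1)] nz_inv[OF zc(2) n(2)] by simp
      then show ?thesis using E(6)[OF \<open>a \<in> S\<close> nz(2)] by simp
    qed
    then show ?thesis using that zc E(6) unfolding nonunits_def by auto
  qed
  show N: "\<ominus> a \<in> nonunits S" if "a \<in> nonunits S" for a
  proof -
    have "a \<in> carrier R" using that D unfolding nonunits_def by auto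
    then have "\<ominus> a = (\<ominus> \<one>) \<otimes> a" by algebra
    then show ?thesis using M[of "\<ominus> \<one>" a] that E by auto
  qed
  show "a \<oplus> b \<in> nonunits S" if ab: "a \<in> nonunits S" "b \<in> nonunits S" for a b
  proof -
    \<comment> \<open>One of a/b and b/a lies in the valuation ring, so the sum is a ring multiple
      of \<open>b\<close> or of \<open>a\<close>.\<close>
    have *: "a \<oplus> b \<in> nonunits S" if ab: "a \<in> nonunits S" "b \<in> nonunits S" "b \<noteq> \<zero>" "a \<otimes> inv b \<in> S" for a b
    proof -
      have c: "a \<in> carrier R" "b \<in> carrier R" using ab D unfolding nonunits_def by auto
      have "a \<oplus> b = (a \<otimes> inv b \<oplus> \<one>) \<otimes> b"
        using c ab(3) nz_inv[OF c(2) ab(3)] by (simp add: l_distr m_assoc)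
      then show ?thesis using M[OF _ ab(2), of "a \<otimes> inv b \<oplus> \<one>"] E ab(4) by auto
    qed
    have c: "a \<in> carrier R" "b \<in> carrier R" using ab D unfolding nonunits_def by auto
    show ?thesis
    proof (cases "a = \<zero> \<or> b = \<zero>")
      case True
      then show ?thesis using ab c by auto
    next
      case False
      then have ib: "inv b \<in> carrier R" "inv b \<noteq> \<zero>" "inv (inv b) = b" using nz_inv c by auto
      have "a \<otimes> inv b \<in> S \<or> inv (a \<otimes> inv b) \<in> S" using D(5) ib c False nz_mult by simp
      moreover have "inv (a \<otimes> inv b) = b \<otimes> inv a"
        using inv_mult'[OF c(1) _ ib(1,2)] ib(3) False c nz_inv by (simp add: m_comm)
      ultimately show ?thesis using *[OF ab] *[OF ab(2,1)] False c by (auto simp: a_comm)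
    qed
  qed
qed

text \<open>A proper ideal contains no unit of \<open>S\<close>, so \<open>S\<close> is local. The
  maximal ideals in the definition of \<open>places\<close> thereby become explicit sets.\<close>

lemma maximalideal_nonunits:
  assumes vr: "valuation_ring R K S"
  shows "maximalideal P (R\<lparr>carrier := S\<rparr>) \<longleftrightarrow> P = nonunits S"
proof -
  note D = valuation_ringD[OF vr]
  note E = subringE[OF D(1)]
  note M = nonunits_ideal[OF vr]
  have rg: "ring (R\<lparr>carrier := S\<rparr>)" using subring_is_ring[OF D(1)] .
  have neg: "\<ominus>\<^bsub>R\<lparr>carrier := S\<rparr>\<^esub> a = \<ominus> a" if "a \<in> S" for a
    using group.m_inv_consistent[OF a_group additive_subgroup.a_subgroup[OF subring_additive[OF D(1)]] that]
    by (simp add: a_inv_def)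
  have idl: "ideal (nonunits S) (R\<lparr>carrier := S\<rparr>)"
  proof (rule idealI[OF rg])
    have "additive_subgroup (nonunits S) (R\<lparr>carrier := S\<rparr>)"
      using M neg by (intro ring.additive_subgroupI[OF rg]) (auto simp: a_minus_def subset_iff)
    then show "subgroup (nonunits S) (add_monoid (R\<lparr>carrier := S\<rparr>))"
      by (rule additive_subgroup.a_subgroup)
    fix a z assume "a \<in> nonunits S" "z \<in> carrier (R\<lparr>carrier := S\<rparr>)"
    then show "z \<otimes>\<^bsub>R\<lparr>carrier := S\<rparr>\<^esub> a \<in> nonunits S" "a \<otimes>\<^bsub>R\<lparr>carrier := S\<rparr>\<^esub> z \<in> nonunits S"
      using M(4)[of z a] m_comm[OF subsetD[OF D(3)] subsetD[OF D(3)], of a z] M(3) by auto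
  qed
  have sub: "J \<subseteq> nonunits S" if J: "ideal J (R\<lparr>carrier := S\<rparr>)" "J \<noteq> S" for J
  proof
    interpret J: ideal J "R\<lparr>carrier := S\<rparr>" by (rule J(1))
    have JS: "J \<subseteq> S" using J.a_subset by simp
    fix z assume z: "z \<in> J"
    have "J = S" if "z \<noteq> \<zero>" "inv z \<in> S"
    proof -
      have "inv z \<otimes> z \<in> J" using J.I_l_closed[OF z] that by simp
      moreover have "z \<in> carrier R" using z JS D(3) by blast
      ultimately have "\<one> \<in> J" using nz_inv(4)[OF _ that(1)] by simp
      then show ?thesis using J.one_imp_carrier by simp
    qed
    then show "z \<in> nonunits S" using J(2) z JS unfolding nonunits_def by auto
  qed
  have ne: "nonunits S \<noteq> S" using M E by auto
  have "maximalideal (nonunits S) (R\<lparr>carrier := S\<rparr>)"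
    by (rule maximalidealI[OF idl]) (use ne sub in auto)
  moreover have "P = nonunits S" if mi: "maximalideal P (R\<lparr>carrier := S\<rparr>)"
  proof -
    have "ideal P (R\<lparr>carrier := S\<rparr>)" "P \<noteq> S"
      using mi maximalideal.axioms(1) maximalideal.I_notcarr by fastforce+
    then have "P \<subseteq> nonunits S" using sub by blast
    then show ?thesis using maximalideal.I_maximal[OF mi idl] M(3) ne by auto
  qed
  ultimately show ?thesis by blast
qed

lemma nonunits_inject:
  assumes "valuation_ring R K S" "valuation_ring R K' S'" "nonunits S = nonunits S'"
  shows "S = S'"
proof -
  have "S = insert \<zero> {z \<in> carrier R - {\<zero>}. inv z \<notin> nonunits S}" if vr: "valuation_ring R K S" for K S
  proof -
    note D = valuation_ringD[OF vr]
    show ?thesis using D(3,5) nz_inv subringE(2)[OF D(1)] unfolding nonunits_def by auto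
  qed
  then show ?thesis using assms by metis
qed

lemma places_eq: "places R K = nonunits ` {S. valuation_ring R K S}"
  unfolding places_def using maximalideal_nonunits by auto

lemma place_ring_nonunits:
  assumes vr: "valuation_ring R K S" shows "place_ring R K (nonunits S) = R\<lparr>carrier := S\<rparr>"
proof -
  have "(THE S'. valuation_ring R K S' \<and> maximalideal (nonunits S) (R\<lparr>carrier := S'\<rparr>)) = S"
  proof (rule the_equality)
    show "valuation_ring R K S \<and> maximalideal (nonunits S) (R\<lparr>carrier := S\<rparr>)"
      using vr maximalideal_nonunits[OF vr] by simp
    fix S' assume "valuation_ring R K S' \<and> maximalideal (nonunits S) (R\<lparr>carrier := S'\<rparr>)"
    then have S': "valuation_ring R K S'" "nonunits S = nonunits S'" using maximalideal_nonunits[of K S'] by auto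
    then show "S' = S" using nonunits_inject[OF vr] by simp
  qed
  then show ?thesis unfolding place_ring_def by simp
qed

lemma place_units_closed:
  assumes vr: "valuation_ring R K S" and u: "u \<in> place_units S"
  shows "u \<in> carrier R" "u \<noteq> \<zero>" "inv u \<in> place_units S" "w \<in> place_units S \<Longrightarrow> u \<otimes> w \<in> place_units S"
    "u [^] (n::int) \<in> place_units S"
proof -
  note D = valuation_ringD[OF vr]
  note E = subringE[OF D(1)]
  show c: "u \<in> carrier R" "u \<noteq> \<zero>" using u D unfolding place_units_def by auto
  show i: "inv u \<in> place_units S" using u nz_inv[OF c] unfolding place_units_def by auto
  have M: "v \<otimes> w \<in> place_units S" if "v \<in> place_units S" "w \<in> place_units S" for v w
    using that E(6) nz_mult inv_mult' D(3) unfolding place_units_def by (auto simp: subset_iff)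
  then show "w \<in> place_units S \<Longrightarrow> u \<otimes> w \<in> place_units S" using u by blast
  have "\<one> \<in> place_units S" using E unfolding place_units_def by auto
  then have P: "w \<in> place_units S \<Longrightarrow> w [^] (n::nat) \<in> place_units S" for w n
    by (induction n) (auto simp: M)
  show "u [^] n \<in> place_units S"
  proof (cases n)
    case (nonneg k)
    then show ?thesis using P[OF u, of k] by (simp add: int_pow_int)
  next
    case (neg k)
    have "u [^] n = inv (u [^] Suc k)"
      using ipow(4)[OF c, of "int (Suc k)"] neg int_pow_int[of R u "Suc k"] by simp
    then show ?thesis using P[OF i, of "Suc k"] inv_pow'[OF c, of "Suc k"] by simp
  qed
qed

lemma place_units_iff:
  assumes vr: "valuation_ring R K S"
  shows "place_units S = Units (R\<lparr>carrier := S\<rparr>)" "place_units S = S - nonunits S"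
proof -
  note D = valuation_ringD[OF vr]
  show "place_units S = Units (R\<lparr>carrier := S\<rparr>)"
  proof (intro equalityI subsetI)
    fix u assume u: "u \<in> place_units S"
    then have "u \<in> S" "inv u \<in> S" "u \<otimes> inv u = \<one>" "inv u \<otimes> u = \<one>"
      using nz_inv(3,4)[of u] D(3) unfolding place_units_def by auto
    then show "u \<in> Units (R\<lparr>carrier := S\<rparr>)" unfolding Units_def by auto
  next
    fix u assume "u \<in> Units (R\<lparr>carrier := S\<rparr>)"
    then obtain w where w: "u \<in> S" "w \<in> S" "u \<otimes> w = \<one>" unfolding Units_def by auto
    then have c: "u \<in> carrier R" "w \<in> carrier R" using D(3) by auto
    have "u \<noteq> \<zero>" using w(3) c by auto
    moreover have "inv u = w" by (rule comm_inv_char[OF c w(3)])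
    ultimately show "u \<in> place_units S" unfolding place_units_def using w by simp
  qed
  show "place_units S = S - nonunits S" unfolding place_units_def nonunits_def by auto
qed

lemma prime_element_pow:
  assumes vr: "valuation_ring R K S" and t: "prime_element S t"
    and z: "z = t [^] (n::int) \<otimes> u" "u \<in> place_units S"
  shows "z \<in> carrier R" "z \<noteq> \<zero>" "z \<in> S \<longleftrightarrow> n \<ge> 0" "z \<in> nonunits S \<longleftrightarrow> n \<ge> 1"
proof -
  note D = valuation_ringD[OF vr]
  note E = subringE[OF D(1)]
  have tc: "t \<in> carrier R" "t \<noteq> \<zero>" "t \<in> S" "t \<in> nonunits S" using t D unfolding prime_element_def nonunits_def by auto
  note u = place_units_closed[OF vr z(2)]
  note tp = ipow[OF tc(1,2)]
  show zc: "z \<in> carrier R" "z \<noteq> \<zero>" using z u tp nz_mult by auto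
  have pos: "t [^] k \<in> nonunits S" if "k \<ge> 1" for k :: int
  proof -
    have "t [^] (Suc j) \<in> nonunits S" for j :: nat
    proof (induction j)
      case (Suc j)
      then have "t [^] (Suc j) \<in> S" using nonunits_ideal(3)[OF vr] by blast
      then show ?case using nonunits_ideal(4)[OF vr _ tc(4)] by simp
    qed (use tc in simp)
    moreover have "k = int (Suc (nat (k - 1)))" using that by auto
    ultimately show ?thesis using int_pow_int[of R t "Suc (nat (k - 1))"] by metis
  qed
  have S1: "z \<in> nonunits S" if "n \<ge> 1"
    using nonunits_ideal(4)[OF vr _ pos[OF that], of u] z place_units_def tp u by (auto simp: m_comm)
  have S0: "z \<in> place_units S" if "n = 0" using z that u by simp
  have S2: "inv z \<in> nonunits S" if "n < 0"
  proof -
    have "inv z = t [^] (- n) \<otimes> inv u" unfolding z(1)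
      using inv_mult'[OF tp(1,2) u(1,2)] tp(4) by simp
    moreover have "t [^] (- n) \<in> nonunits S" by (rule pos) (use that in simp)
    moreover have "inv u \<in> S" using u(3) unfolding place_units_def by simp
    ultimately show ?thesis
      using nonunits_ideal(4)[OF vr, of "inv u" "t [^] (- n)"] m_comm[of "inv u" "t [^] (- n)"]
        ipow(1)[OF tc(1,2), of "- n"] nz_inv(1)[OF u(1,2)] by simp
  qed
  show "z \<in> S \<longleftrightarrow> n \<ge> 0"
  proof -
    have "z \<notin> S" if "n < 0" using S2[OF that] zc nz_inv unfolding nonunits_def by auto
    moreover have "z \<in> S" if "n \<ge> 0" using S1 S0 that unfolding nonunits_def place_units_def by (cases "n = 0") auto
    ultimately show ?thesis by force
  qed
  show "z \<in> nonunits S \<longleftrightarrow> n \<ge> 1"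
  proof -
    have "z \<notin> nonunits S" if "n < 0" using S2[OF that] zc nz_inv unfolding nonunits_def by auto
    moreover have "z \<notin> nonunits S" if "n = 0" using S0[OF that] unfolding nonunits_def place_units_def by auto
    ultimately show ?thesis using S1 by force
  qed
qed

lemma prime_element_PIdl:
  assumes vr: "valuation_ring R K S" and t: "prime_element S t"
  shows "nonunits S = PIdl\<^bsub>R\<lparr>carrier := S\<rparr>\<^esub> t"
proof -
  note D = valuation_ringD[OF vr]
  have tc: "t \<in> carrier R" "t \<noteq> \<zero>" "t \<in> nonunits S" using t D unfolding prime_element_def nonunits_def by auto
  have "\<exists>a\<in>S. z = a \<otimes> t" if z: "z \<in> nonunits S" for z
  proof (cases "z = \<zero>")
    case True
    then show ?thesis using tc subringE(2)[OF D(1)] by force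
  next
    case False
    have zc: "z \<in> carrier R" using z D unfolding nonunits_def by auto
    obtain n :: int and u where u: "u \<in> place_units S" "z = t [^] n \<otimes> u"
      using t False zc unfolding prime_element_def by blast
    have n: "n \<ge> 1" using prime_element_pow(4)[OF vr t u(2,1)] z by simp
    have "z = (t [^] (n - 1) \<otimes> u) \<otimes> t"
      using ipow(3)[OF tc(1,2), of "n - 1" 1] ipow[OF tc(1,2)] place_units_closed[OF vr u(1)] u(2) tc
      by (simp add: m_ac)
    moreover have "t [^] (n - 1) \<otimes> u \<in> S" using prime_element_pow(3)[OF vr t refl u(1)] n by simp
    ultimately show ?thesis by blast
  qed
  then show ?thesis unfolding cgenideal_def using nonunits_ideal(4)[OF vr _ tc(3)] by auto
qed

text \<open>Two generators of the maximal ideal differ by a unit, whose powers are absorbed into the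
  unit factor, so the exponent does not depend on the generator. This settles the definite
  description in \<open>valuation\<close>.\<close>

lemma valuation_unique:
  assumes vr: "valuation_ring R K S" and t: "prime_element S t"
    and z: "z = t [^] (n::int) \<otimes> u" "u \<in> place_units S"
  shows "valuation R K (nonunits S) z = n"
proof -
  note D = valuation_ringD[OF vr]
  have tc: "t \<in> carrier R" "t \<noteq> \<zero>" "t \<in> nonunits S" using t D unfolding prime_element_def nonunits_def by auto
  have uq: "k = n" if s: "s \<in> nonunits S" "nonunits S = PIdl\<^bsub>R\<lparr>carrier := S\<rparr>\<^esub> s" "w \<in> place_units S" "z = s [^] k \<otimes> w" for s w k
  proof -
    have sc: "s \<in> carrier R" using s(1) D unfolding nonunits_def by auto
    obtain a where a: "a \<in> S" "t = a \<otimes> s" using tc(3) s(2) unfolding cgenideal_def by auto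
    obtain b where b: "b \<in> S" "s = b \<otimes> t" using s(1) prime_element_PIdl[OF vr t] unfolding cgenideal_def by auto
    have bc: "a \<in> carrier R" "b \<in> carrier R" "b \<noteq> \<zero>" using a b D(3) tc sc by auto
    have sn: "s \<noteq> \<zero>" using a tc bc by auto
    have "(a \<otimes> b) \<otimes> t = \<one> \<otimes> t" using a b bc tc by (simp add: m_assoc)
    then have "a \<otimes> b = \<one>" using m_rcancel[OF tc(2,1)] bc by simp
    then have "inv b = a" using comm_inv_char[of b a] bc m_comm by simp
    then have bu: "b \<in> place_units S" using a b bc unfolding place_units_def by auto
    note bu' = place_units_closed[OF vr bu] and wu = place_units_closed[OF vr s(3)] and uu = place_units_closed[OF vr z(2)]
    note tp = ipow[OF tc(1,2)]
    have bk: "b [^] k \<otimes> w \<in> place_units S" using place_units_closed(4)[OF vr bu'(5) s(3)] .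
    note bkc = place_units_closed[OF vr bk]
    have bkk: "b [^] k \<in> carrier R" using ipow(1)[OF bc(2,3)] .
    have "z = t [^] k \<otimes> (b [^] k \<otimes> w)"
      unfolding s(4) b(2) using ipow(5)[OF bc(2,3) tc(1,2)] tp(1) wu(1) bkk by (simp add: m_ac)
    then have eq: "t [^] n \<otimes> u = t [^] k \<otimes> (b [^] k \<otimes> w)" using z by simp
    define e where "e = u \<otimes> inv (b [^] k \<otimes> w)"
    have eu: "e \<in> place_units S" unfolding e_def using place_units_closed(4)[OF vr z(2) bkc(3)] .
    have ec: "e \<in> carrier R" using place_units_closed(1)[OF vr eu] .
    have ib: "inv (b [^] k \<otimes> w) \<in> carrier R" using nz_inv bkc by auto
    have "t [^] n \<otimes> e = (t [^] n \<otimes> u) \<otimes> inv (b [^] k \<otimes> w)" unfolding e_def using tp(1) uu ib by (simp add: m_assoc)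
    also have "\<dots> = t [^] k \<otimes> ((b [^] k \<otimes> w) \<otimes> inv (b [^] k \<otimes> w))" unfolding eq using tp(1) bkc(1) ib by (rule m_assoc)
    also have "\<dots> = t [^] k" using nz_inv(3)[OF bkc(1,2)] tp(1) by simp
    finally have e: "t [^] n \<otimes> e = t [^] k" .
    have "t [^] (n - k) \<otimes> e = t [^] (-k) \<otimes> (t [^] n \<otimes> e)"
      using tp(3)[of "-k" n] tp(1) ec by (simp add: m_assoc)
    also have "\<dots> = \<one>" unfolding e using tp(1,2,4) nz_inv(4) by simp
    finally have one: "\<one> = t [^] (n - k) \<otimes> e" by simp
    have "\<one> \<in> S" "\<one> \<notin> nonunits S" using subringE[OF D(1)] nonunits_ideal[OF vr] by auto
    then show ?thesis using prime_element_pow(3,4)[OF vr t one eu] by linarith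
  qed
  have ex: "\<exists>t u. t \<in> nonunits S \<and> nonunits S = PIdl\<^bsub>R\<lparr>carrier := S\<rparr>\<^esub> t \<and> u \<in> place_units S \<and> z = t [^] n \<otimes> u"
    using tc(3) prime_element_PIdl[OF vr t] z by blast
  show ?thesis
    unfolding valuation_def place_ring_nonunits[OF vr] place_units_iff(1)[OF vr, symmetric]
    by (rule the_equality) (use ex uq in blast)+
qed

lemma incongruent_mono:
  assumes "incongruent S z T" "w \<in> S" "\<exists>c\<in>S. w = z \<otimes> c" "z \<in> carrier R" "subring S R"
  shows "incongruent S w T"
proof -
  have Sc: "S \<subseteq> carrier R" using subringE(1)[OF assms(5)] .
  obtain c0 where c0: "c0 \<in> S" "w = z \<otimes> c0" using assms(3) by blast
  have "w \<otimes> c = z \<otimes> (c0 \<otimes> c) \<and> c0 \<otimes> c \<in> S" if "c \<in> S" for c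
    using c0 that Sc assms(4) subringE(6)[OF assms(5) c0(1) that] m_assoc[of z c0 c] by auto
  then have "{w \<otimes> c | c. c \<in> S} \<subseteq> {z \<otimes> c | c. c \<in> S}" by blast
  then show ?thesis using assms(1) unfolding incongruent_def by blast
qed

text \<open>If all quotients \<open>S/zS\<close> are finite, a \<open>t\<close> with \<open>S/tS\<close> of minimal size generates the
  maximal ideal.\<close>

lemma finite_quotients_imp_prime_element:
  assumes vr: "valuation_ring R K S"
    and fin: "\<And>z. z \<in> S \<Longrightarrow> z \<noteq> \<zero> \<Longrightarrow> \<exists>D. \<forall>T. incongruent S z T \<longrightarrow> card T \<le> D"
  shows "\<exists>t. prime_element S t"
proof -
  note D = valuation_ringD[OF vr]
  note E = subringE[OF D(1)]
  note M = nonunits_ideal[OF vr]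
  obtain w where w: "w \<in> carrier R" "w \<notin> S" using D by auto
  then have "w \<noteq> \<zero>" using E by auto
  then have iw: "inv w \<in> nonunits S" "inv w \<noteq> \<zero>" using w D(5) nz_inv unfolding nonunits_def by auto
  define Q where "Q D t \<longleftrightarrow> t \<in> nonunits S \<and> t \<noteq> \<zero> \<and> (\<forall>T. incongruent S t T \<longrightarrow> card T \<le> D)" for D t
  have "\<exists>D. \<exists>t. Q D t" unfolding Q_def using fin[of "inv w"] iw M(3) by blast
  define m where "m = (LEAST D. \<exists>t. Q D t)"
  obtain t where t: "Q m t" unfolding m_def using LeastI_ex[OF \<open>\<exists>D. \<exists>t. Q D t\<close>] by blast
  have tm: "t \<in> nonunits S" "t \<noteq> \<zero>" "t \<in> S" "t \<in> carrier R" "\<And>T. incongruent S t T \<Longrightarrow> card T \<le> m"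
    using t M(3) D(3) unfolding Q_def by auto
  have "incongruent S t {\<zero>}" unfolding incongruent_def using E by auto
  then have m1: "m \<ge> 1" using tm(5) by force
  \<comment> \<open>If \<open>s\<close> were not a multiple of \<open>t\<close>, then
    \<open>t\<close> would be a multiple of \<open>s\<close>, and every nonempty set incongruent
    modulo \<open>s\<close> could be enlarged by one element modulo \<open>t\<close>. The bound for
    \<open>s\<close> would then be m - 1, against the minimality of \<open>m\<close>.\<close>
  have gen: "\<exists>a\<in>S. s = t \<otimes> a" if s: "s \<in> nonunits S" for s
  proof (rule ccontr)
    assume no: "\<not> ?thesis"
    have sc: "s \<in> S" "s \<in> carrier R" using s M(3) D(3) by auto
    have s0: "s \<noteq> \<zero>" using no E(2) tm by auto
    have "t \<otimes> inv s \<in> S"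
    proof -
      have "inv (t \<otimes> inv s) = inv t \<otimes> s" "t \<otimes> (inv t \<otimes> s) = s"
        using inv_mult'[OF tm(4,2) nz_inv(1,2)[OF sc(2) s0]] nz_inv(5)[OF sc(2) s0] cancel_left tm sc by auto
      then show ?thesis using D(5)[of "t \<otimes> inv s"] nz_mult tm sc s0 nz_inv no by auto
    qed
    moreover have "t = s \<otimes> (t \<otimes> inv s)" using cancel_left(1)[OF sc(2) s0 tm(4)] tm sc s0 nz_inv by (simp add: m_comm)
    ultimately have ts: "\<exists>c\<in>S. t = s \<otimes> c" by blast
    have "card T \<le> m - 1" if T: "incongruent S s T" for T
    proof (cases "T = {}")
      case False
      then obtain a where a: "a \<in> T" by auto
      have TS: "T \<subseteq> S" "finite T" using T unfolding incongruent_def by auto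
      have ac: "a \<in> S" "a \<in> carrier R" using a TS D by auto
      have nin: "s \<notin> {t \<otimes> c | c. c \<in> S}" using no by auto
      have t': "incongruent S t T" using incongruent_mono[OF T tm(3) ts sc(2) D(1)] .
      \<comment> \<open>The element to be added is s + a. For x = a the difference is
        \<open>s\<close>, not a multiple of \<open>t\<close>; for any other \<open>x\<close>, a
        difference divisible by \<open>t\<close>, hence by \<open>s\<close>, would make
        \<open>x\<close> and \<open>a\<close> congruent modulo \<open>s\<close>.\<close>
      have key: "x \<ominus> (s \<oplus> a) \<notin> {t \<otimes> c |c. c \<in> S} \<and> (s \<oplus> a) \<ominus> x \<notin> {t \<otimes> c |c. c \<in> S}" if x: "x \<in> T" for x
      proof -
        have xc: "x \<in> carrier R" using x TS D by auto
        obtain c0 where c0: "c0 \<in> S" "t = s \<otimes> c0" using ts by blast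
        have tS: "t \<otimes> c \<in> {s \<otimes> c | c. c \<in> S}" if "c \<in> S" for c
          using that c0 E(6)[OF c0(1) that] sc D(3) m_assoc[of s c0 c] by (auto simp: subset_iff)
        have i1: "\<not> (\<exists>c\<in>S. (s \<oplus> a) \<ominus> x = t \<otimes> c)"
        proof
          assume "\<exists>c\<in>S. (s \<oplus> a) \<ominus> x = t \<otimes> c"
          then obtain c where c: "c \<in> S" "(s \<oplus> a) \<ominus> x = t \<otimes> c" by blast
          show False
          proof (cases "x = a")
            case True
            have "(s \<oplus> a) \<ominus> x = s" unfolding True using sc ac by algebra
            then show ?thesis using nin c by auto
          next
            case False
            obtain c' where c': "c' \<in> S" "t \<otimes> c = s \<otimes> c'" using tS[OF c(1)] by auto
            have cc: "c' \<in> carrier R" using c' D by auto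
            have "x \<ominus> a = s \<ominus> ((s \<oplus> a) \<ominus> x)" using sc ac xc by algebra
            also have "\<dots> = s \<otimes> (\<one> \<ominus> c')" unfolding c(2) c'(2) using sc cc by algebra
            finally have "x \<ominus> a \<in> {s \<otimes> c | c. c \<in> S}"
              using additive_subgroup_minus[OF subring_additive[OF D(1)] E(3) c'(1)] by blast
            then show ?thesis using T x a False unfolding incongruent_def by blast
          qed
        qed
        have i2: "\<not> (\<exists>c\<in>S. x \<ominus> (s \<oplus> a) = t \<otimes> c)"
        proof
          assume "\<exists>c\<in>S. x \<ominus> (s \<oplus> a) = t \<otimes> c"
          then obtain c where c: "c \<in> S" "x \<ominus> (s \<oplus> a) = t \<otimes> c" by blast
          have "(s \<oplus> a) \<ominus> x = \<ominus> (x \<ominus> (s \<oplus> a))" using sc ac xc by algebra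
          also have "\<dots> = t \<otimes> (\<ominus> c)" unfolding c(2) using tm c D(3) by (simp add: r_minus subset_iff)
          finally show False using i1 E(5)[OF c(1)] by blast
        qed
        show ?thesis using i1 i2 by blast
      qed
      have "\<zero> \<in> {t \<otimes> c | c. c \<in> S}" using E(2) tm by force
      then have new: "s \<oplus> a \<notin> T" using key[of "s \<oplus> a"] sc ac by (auto simp: a_minus_def r_neg)
      have "incongruent S t (insert (s \<oplus> a) T)"
        using t' key E(7)[OF sc(1) ac(1)] unfolding incongruent_def by auto
      then have "card (insert (s \<oplus> a) T) \<le> m" using tm(5) by blast
      then show ?thesis using new TS by simp
    qed simp
    then have "Q (m - 1) s" unfolding Q_def using s s0 by blast
    then have "m \<le> m - 1" unfolding m_def using Least_le by (metis (mono_tags, lifting))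
    then show False using m1 by simp
  qed
  note tn = nat_pow_closed[OF tm(4)] nz_pow[OF tm(4,2)]
  \<comment> \<open>If all powers of \<open>t\<close> divided \<open>z\<close>, then t^i - t^j with
    i < j, being a multiple of \<open>z\<close>, would be a multiple of t^(i+1), which makes 1 a
    non-unit. So the powers of \<open>t\<close> would be pairwise incongruent modulo
    \<open>z\<close>, against the finite bound for \<open>z\<close>.\<close>
  have arch: "\<exists>n. \<not> (\<exists>a\<in>S. z = t [^] (n::nat) \<otimes> a)" if z: "z \<in> S" "z \<noteq> \<zero>" for z
  proof (rule ccontr)
    assume "\<not> ?thesis"
    then have all: "\<And>n::nat. \<exists>a\<in>S. z = t [^] n \<otimes> a" by blast
    obtain B where B: "\<And>T. incongruent S z T \<Longrightarrow> card T \<le> B" using fin[OF z] by blast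
    have step: "t [^] i \<ominus> t [^] j \<notin> {z \<otimes> c | c. c \<in> S}" if ij: "i < j" for i j :: nat
    proof
      assume "t [^] i \<ominus> t [^] j \<in> {z \<otimes> c | c. c \<in> S}"
      then obtain c where c: "c \<in> S" "t [^] i \<ominus> t [^] j = z \<otimes> c" by blast
      obtain a where a: "a \<in> S" "z = t [^] Suc i \<otimes> a" using all by blast
      obtain k where k: "j = i + Suc k" using ij less_iff_Suc_add by auto
      have cc: "a \<in> carrier R" "c \<in> carrier R" using a c D by auto
      define e where "e = t [^] i"
      define g where "g = t [^] Suc k"
      have eg: "e \<in> carrier R" "e \<noteq> \<zero>" "g \<in> carrier R" using tn tm(4) unfolding e_def g_def by auto
      have tj: "t [^] j = e \<otimes> g" unfolding k e_def g_def by (simp only: nat_pow_mult[OF tm(4)])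
      have zc: "z \<otimes> c = e \<otimes> (t \<otimes> (a \<otimes> c))"
        unfolding a(2) e_def using cc tm(4) by (simp add: m_assoc)
      have eq: "e \<ominus> e \<otimes> g = e \<otimes> (t \<otimes> (a \<otimes> c))" using c(2) tj zc e_def by simp
      have h: "t \<otimes> (a \<otimes> c) \<in> carrier R" using tm(4) cc by simp
      have "e \<otimes> \<one> = (e \<ominus> e \<otimes> g) \<oplus> e \<otimes> g" using eg by algebra
      also have "\<dots> = e \<otimes> (g \<oplus> t \<otimes> (a \<otimes> c))" unfolding eq r_distr[OF eg(3) h eg(1)]
        by (rule a_comm) (use eg h in simp_all)
      finally have "\<one> = g \<oplus> t \<otimes> (a \<otimes> c)"
        using m_lcancel[OF eg(2,1) one_closed] eg h by simp
      also have "\<dots> = t [^] Suc k \<oplus> t \<otimes> (a \<otimes> c)" unfolding g_def ..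
      also have "\<dots> = (t [^] k \<oplus> a \<otimes> c) \<otimes> t" using cc tn(1)[of k] tm(4) by (simp add: l_distr r_distr m_comm)
      also have "\<dots> \<in> nonunits S"
      proof -
        have "t [^] k \<in> S" by (induction k) (use E tm in auto)
        then have "t [^] k \<oplus> a \<otimes> c \<in> S" using E(7)[OF _ E(6)[OF a(1) c(1)]] by simp
        then show ?thesis using M(4)[OF _ tm(1)] by simp
      qed
      finally show False using M by simp
    qed
    have i2: "t [^] i \<ominus> t [^] j \<notin> {z \<otimes> c | c. c \<in> S}" if ij: "i \<noteq> j" for i j :: nat
    proof (cases "i < j")
      case False
      then have ji: "j < i" using ij by simp
      show ?thesis
      proof
        assume "t [^] i \<ominus> t [^] j \<in> {z \<otimes> c | c. c \<in> S}"
        then obtain c where c: "c \<in> S" "t [^] i \<ominus> t [^] j = z \<otimes> c" by blast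
        have "t [^] j \<ominus> t [^] i = \<ominus> (t [^] i \<ominus> t [^] j)" using tn by algebra
        also have "\<dots> = z \<otimes> (\<ominus> c)" unfolding c(2) using z c D(3) by (simp add: r_minus subset_iff)
        finally show False using step[OF ji] E(5)[OF c(1)] by blast
      qed
    qed (rule step)
    have z0: "\<zero> \<in> {z \<otimes> c | c. c \<in> S}" using E(2) z D(3) by force
    have inj: "inj_on (\<lambda>i. t [^] i) {..B}"
    proof (rule inj_onI, rule ccontr)
      fix i j :: nat assume ij: "t [^] i = t [^] j" "i \<noteq> j"
      have "t [^] i \<ominus> t [^] j = \<zero>" unfolding ij(1) using tn by (simp add: a_minus_def r_neg)
      then have "t [^] i \<ominus> t [^] j \<in> {z \<otimes> c | c. c \<in> S}" using z0 by (simp only:)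
      then show False using i2[OF ij(2)] by contradiction
    qed
    have tS: "t [^] i \<in> S" for i :: nat by (induction i) (use E tm in auto)
    have "incongruent S z ((\<lambda>i. t [^] i) ` {..B})" unfolding incongruent_def
    proof (intro conjI ballI impI)
      fix a b assume "a \<in> (\<lambda>i. t [^] i) ` {..B}" "b \<in> (\<lambda>i. t [^] i) ` {..B}" "a \<noteq> b"
      then obtain i j :: nat where ij: "a = t [^] i" "b = t [^] j" "i \<noteq> j" by blast
      show "a \<ominus> b \<notin> {z \<otimes> c |c. c \<in> S}" unfolding ij(1,2) by (rule i2[OF ij(3)])
    qed (use tS in auto)
    then have "card ((\<lambda>i. t [^] i) ` {..B}) \<le> B" using B by blast
    then show False using inj by (simp add: card_image)
  qed
  have repS: "\<exists>n::int. \<exists>u\<in>place_units S. z = t [^] n \<otimes> u" if z: "z \<in> S" "z \<noteq> \<zero>" for z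
  proof -
    define n where "n = (LEAST n. \<not> (\<exists>a\<in>S. z = t [^] (n::nat) \<otimes> a))"
    have n: "\<not> (\<exists>a\<in>S. z = t [^] n \<otimes> a)" unfolding n_def by (rule LeastI_ex[OF arch[OF z]])
    have "z = t [^] (0::nat) \<otimes> z" using z D(3) by auto
    then have "n \<noteq> 0" using n z(1) by metis
    then obtain k where k: "n = Suc k" by (cases n) auto
    obtain a where a: "a \<in> S" "z = t [^] k \<otimes> a"
      using not_less_Least[of k "\<lambda>n. \<not> (\<exists>a\<in>S. z = t [^] (n::nat) \<otimes> a)"] k n_def by auto
    have ac: "a \<in> carrier R" using a D by auto
    have "a \<notin> nonunits S"
    proof
      assume "a \<in> nonunits S"
      then obtain b where b: "b \<in> S" "a = t \<otimes> b" using gen by blast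
      then have "z = t [^] n \<otimes> b" using a k tm tn D(3) by (simp add: m_assoc subset_iff)
      then show False using n b by blast
    qed
    then have "a \<in> place_units S" using place_units_iff(2)[OF vr] a by auto
    then show ?thesis using a by (metis int_pow_int)
  qed
  have "\<exists>n::int. \<exists>u\<in>place_units S. z = t [^] n \<otimes> u" if z: "z \<in> carrier R" "z \<noteq> \<zero>" for z
  proof (cases "z \<in> S")
    case False
    then have "inv z \<in> S" using D(5) z by blast
    then obtain n u where nu: "u \<in> place_units S" "inv z = t [^] (n::int) \<otimes> u" using repS nz_inv[OF z] by blast
    note uc = place_units_closed[OF vr nu(1)]
    have "z = inv (t [^] n \<otimes> u)" using nu nz_inv[OF z] by simp
    also have "\<dots> = t [^] (- n) \<otimes> inv u"
      using inv_mult'[OF ipow(1,2)[OF tm(4,2)] uc(1,2)] ipow(4)[OF tm(4,2)] by simp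
    finally show ?thesis using uc(3) by blast
  qed (use repS z in blast)
  then have "prime_element S t" unfolding prime_element_def using tm by blast
  then show ?thesis by blast
qed

end

text \<open>The constant \<open>C\<close> is outgrown: if \<open>t\<close> were at least a + 1,
  Bernoulli's inequality at the exponent a C would already beat it. This removes the contribution of
  fixed denominators from counting estimates.\<close>

lemma power_le_imp_le_nat:
  fixes a t C :: nat
  assumes "a > 0" "\<And>k. t ^ k \<le> C * a ^ k"
  shows "t \<le> a"
proof (rule ccontr)
  assume "\<not> t \<le> a"
  then have t: "a + 1 \<le> t" by simp
  have bern: "a ^ k * (a + k) \<le> (a + 1) ^ k * a" for k
  proof (induction k)
    case (Suc k)
    have "a ^ k * (a * (a + Suc k)) \<le> a ^ k * ((a + 1) * (a + k))"
      by (rule mult_le_mono2) (simp add: algebra_simps)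
    then have "a ^ Suc k * (a + Suc k) \<le> (a + 1) * (a ^ k * (a + k))"
      by (simp only: power_Suc mult_ac)
    also have "\<dots> \<le> (a + 1) * ((a + 1) ^ k * a)" by (rule mult_le_mono2[OF Suc])
    finally show ?case by (simp only: power_Suc mult_ac)
  qed simp
  have "a ^ (a * C) * (a + a * C) \<le> (a + 1) ^ (a * C) * a" by (rule bern)
  also have "\<dots> \<le> t ^ (a * C) * a" by (intro mult_le_mono power_mono) (use t in auto)
  also have "\<dots> \<le> C * a ^ (a * C) * a" by (intro mult_le_mono assms) auto
  finally have "a ^ (a * C) * a * (1 + C) \<le> a ^ (a * C) * a * C" by (simp add: algebra_simps)
  then show False using assms(1) by simp
qed

declare (in ring) polys.simps(2) [simp del]

text \<open>The finitely many coefficients lie in one member of the chain.\<close>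

lemma (in cring) polys_UN:
  assumes "\<And>i. additive_subgroup (B i) R" "\<And>i j. i \<le> j \<Longrightarrow> B i \<subseteq> B j" "w \<in> carrier R"
    and "p \<in> polys (\<Union>i::nat. B i) w n"
  shows "\<exists>i. p \<in> polys (B i) w n"
  using assms(4)
proof (induction n arbitrary: p)
  case (Suc n)
  obtain a r where p: "p = a \<oplus> w \<otimes> r" "a \<in> (\<Union>i. B i)" "r \<in> polys (\<Union>i. B i) w n" using Suc.prems by (auto simp: polys.simps(2))
  obtain i where i: "a \<in> B i" using p by auto
  obtain j where j: "r \<in> polys (B j) w n" using Suc.IH[OF p(3)] by auto
  have "a \<in> B (max i j)" using i assms(2)[of i "max i j"] by auto
  moreover have "r \<in> polys (B (max i j)) w n" using j polys_mono_coeff[OF assms(2)[of j "max i j"]] by auto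
  ultimately have "p \<in> polys (B (max i j)) w (Suc n)" unfolding p(1) by (rule polys_SucI)
  then show ?case by blast
qed simp

section \<open>Finite constant field: roots of unity and independence of powers\<close>

context field
begin

text \<open>Clearing denominators expresses a power of \<open>z\<close> over \<open>K\<close> by
  lower ones, so all powers lie in one finite set \<open>polys K z N\<close> and two of them
  coincide.\<close>

lemma adjoin_inv_imp_torsion:
  assumes K: "subfield K R" "finite K" and z: "z \<in> carrier R" "z \<noteq> \<zero>" "z \<in> adjoin K (inv z)"
  shows "\<exists>i::nat. i > 0 \<and> z [^] i = \<one>"
proof -
  have sK: "subring K R" using subfieldE(1)[OF K(1)] .
  have Kc: "K \<subseteq> carrier R" and K0: "\<zero> \<in> K" and K1: "\<one> \<in> K" using subringE[OF sK] by auto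
  note add = subring_additive[OF sK]
  obtain n where n: "z \<in> polys K (inv z) n" using z(3) by (auto simp: adjoin_def)
  note iz = nz_inv[OF z(1,2)]
  define N where "N = Suc n"
  have "z [^] n \<otimes> z \<in> polys K z N" unfolding N_def
    by (rule polys_reverse[OF add z(1) iz(1,3) n]) simp
  then have zN: "z [^] N \<in> polys K z N" by (simp add: N_def)
  have step: "z \<otimes> p \<in> polys K z N" if p: "p \<in> polys K z N" for p
  proof -
    have "z \<otimes> p \<in> polys K z (Suc N)" by (rule polys_shift[OF Kc K0 z(1) p])
    then obtain p' a where pa: "z \<otimes> p = p' \<oplus> a \<otimes> z [^] N" "a \<in> K" "p' \<in> polys K z N"
      unfolding polys_snoc[OF Kc K0 z(1)] by blast
    have "a \<otimes> z [^] N \<in> polys K z N"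
      by (rule polys_scale[OF Kc z(1) _ _ zN]) (use pa(2) Kc subringE(6)[OF sK] in auto)
    then show ?thesis unfolding pa(1) using additive_subgroup.a_closed[OF polys_subgroup[OF add z(1)] pa(3)] by blast
  qed
  have "z [^] j \<in> polys K z N" for j :: nat
  proof (induction j)
    case 0
    show ?case unfolding N_def using polys_const[OF Kc K0 z(1) K1] by simp
  next
    case (Suc j)
    then show ?case using step[OF Suc] z(1) by (simp add: m_comm)
  qed
  then have "range (\<lambda>j::nat. z [^] j) \<subseteq> polys K z N" by auto
  then have "finite (range (\<lambda>j::nat. z [^] j))" using polys_card[OF K(2)] finite_subset by blast
  then have "\<not> inj (\<lambda>j::nat. z [^] j)" using finite_imageD by blast
  then obtain i j :: nat where ij: "i < j" "z [^] i = z [^] j"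
    unfolding inj_def by (metis linorder_neqE_nat)
  have "z [^] j = z [^] i \<otimes> z [^] (j - i)" using nat_pow_mult[OF z(1), of i "j - i"] ij(1) by simp
  then have "z [^] i \<otimes> \<one> = z [^] i \<otimes> z [^] (j - i)" using ij(2) z(1) by simp
  then have "z [^] (j - i) = \<one>"
    using m_lcancel[OF nz_pow[OF z(1,2)] nat_pow_closed[OF z(1)] one_closed] z(1) by simp
  then show ?thesis using ij(1) by (intro exI[of _ "j - i"]) simp
qed

text \<open>A coincidence between two coefficient lists would make 1/z a polynomial in
  \<open>z\<close>; by \<open>adjoin_inv_imp_torsion\<close> for 1/z, the element \<open>z\<close>
  would be a root of unity.\<close>

lemma card_polys_nontorsion:
  assumes K: "subfield K R" "finite K" and z: "z \<in> carrier R" "z \<noteq> \<zero>" "\<And>i::nat. i > 0 \<Longrightarrow> z [^] i \<noteq> \<one>"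
  shows "card (polys K z n) = card K ^ n"
proof (induction n)
  case (Suc n)
  have sK: "subring K R" using subfieldE(1)[OF K(1)] .
  have Kc: "K \<subseteq> carrier R" using subringE[OF sK] by auto
  note add = subring_additive[OF sK]
  have eq: "polys K z (Suc n) = (\<lambda>(a, p). a \<oplus> z \<otimes> p) ` (K \<times> polys K z n)" by (auto simp: polys.simps(2))
  have "inj_on (\<lambda>(a, p). a \<oplus> z \<otimes> p) (K \<times> polys K z n)"
  proof (rule inj_onI, clarify)
    fix a p a' p' assume a: "a \<in> K" "p \<in> polys K z n" "a' \<in> K" "p' \<in> polys K z n"
      and e: "a \<oplus> z \<otimes> p = a' \<oplus> z \<otimes> p'"
    have c: "a \<in> carrier R" "a' \<in> carrier R" "p \<in> carrier R" "p' \<in> carrier R"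
      using a Kc polys_carrier[OF Kc z(1)] by blast+
    have "z \<otimes> (p' \<ominus> p) = (a' \<oplus> z \<otimes> p') \<ominus> z \<otimes> p \<ominus> a'" using c z(1) by algebra
    also have "\<dots> = a \<ominus> a'" unfolding e[symmetric] using c z(1) by algebra
    finally have e': "z \<otimes> (p' \<ominus> p) = a \<ominus> a'" .
    define d where "d = p' \<ominus> p"
    define k where "k = a \<ominus> a'"
    have d: "d \<in> polys K z n" "d \<in> carrier R" unfolding d_def
      using additive_subgroup_minus[OF polys_subgroup[OF add z(1)]] a c by auto
    have k: "k \<in> K" "k \<in> carrier R" unfolding k_def using additive_subgroup_minus[OF add] a c by auto
    have zd: "z \<otimes> d = k" using e' by (simp add: d_def k_def)
    have "d = \<zero>"
    proof (rule ccontr)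
      assume dn: "d \<noteq> \<zero>"
      then have kn: "k \<noteq> \<zero>" using nz_mult[OF z(1) d(2) z(2)] zd by simp
      note ik = nz_inv[OF k(2) kn] and iz = nz_inv[OF z(1,2)]
      have ikK: "inv k \<in> K" using subfield_m_inv(1)[OF K(1)] k kn by simp
      have "z \<otimes> (inv k \<otimes> d) = inv k \<otimes> (z \<otimes> d)" using z(1) d ik(1) by (simp add: m_lcomm)
      also have "\<dots> = \<one>" using zd ik by simp
      finally have "inv z = inv k \<otimes> d" using comm_inv_char[OF z(1) _] d ik(1) by simp
      also have "inv k \<otimes> d \<in> polys K z n"
        by (rule polys_scale[OF Kc z(1) ik(1) _ d(1)]) (use ikK subringE(6)[OF sK] in blast)
      finally have "inv z \<in> adjoin K (inv (inv z))" using iz(5) by (auto simp: adjoin_def)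
      then obtain i :: nat where i: "i > 0" "inv z [^] i = \<one>" using adjoin_inv_imp_torsion[OF K iz(1,2)] by blast
      have "z [^] i = inv (inv z [^] i)" using inv_pow'[OF iz(1,2), of i] iz(5) by simp
      then show False using z(3)[OF i(1)] i(2) by simp
    qed
    then have "p' = p" "a = a'" using c e zd k_def z(1) by (auto simp: d_def)
    then show "a = a' \<and> p = p'" by simp
  qed
  then have "card (polys K z (Suc n)) = card (K \<times> polys K z n)" unfolding eq by (rule card_image)
  then show ?case using Suc by (simp add: card_cartesian_product)
qed simp

end

section \<open>Kummer extensions\<close>

text \<open>A Kummer extension \<open>K(V, U)\<close> of the rational function field \<open>K(V)\<close>, where \<open>U\<^sup>s = \<kappa> V (V + 1)\<^sup>b\<close>
  and \<open>\<phi>\<close> is a \<open>K(V)\<close>-automorphism. As \<open>K\<close> is finite, \<open>V\<close> is transcendental iff it is not a root of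
  unity.\<close>

locale kummer_extension = field R for R (structure) +
  fixes K :: "'a set" and V U \<kappa> :: 'a and s b :: nat and \<phi> :: "'a \<Rightarrow> 'a" and \<eta> :: 'a
  assumes subfield_K: "subfield K R" and finite_K: "finite K"
    and V_closed: "V \<in> carrier R" and V_nz: "V \<noteq> \<zero>"
    and V_trans: "\<And>i::nat. i > 0 \<Longrightarrow> V [^] i \<noteq> \<one>"
    and U_closed: "U \<in> carrier R"
    and kappa: "\<kappa> \<in> K" "\<kappa> \<noteq> \<zero>"
    and U_power: "U [^] s = \<kappa> \<otimes> (V \<otimes> (V \<oplus> \<one>) [^] b)"
    and s_pos: "s \<ge> 1" and b_pos: "b \<ge> 1" and coprime_s: "coprime s (b + 1)"
    and spanning: "\<And>z. z \<in> carrier R \<Longrightarrow>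
      \<exists>h\<in>adjoin K V. h \<noteq> \<zero> \<and> h \<otimes> z \<in> polys (adjoin K V) U s"
    and phi_hom: "\<phi> \<in> ring_hom R R" and phi_K: "\<And>c. c \<in> K \<Longrightarrow> \<phi> c = c"
    and phi_V: "\<phi> V = V" and phi_U: "\<phi> U = \<eta> \<otimes> U"
    and eta: "\<eta> \<in> K" "\<And>i j. i < s \<Longrightarrow> j < s \<Longrightarrow> \<eta> [^] i = \<eta> [^] j \<Longrightarrow> i = j"
begin

abbreviation "T \<equiv> V \<oplus> \<one>"

lemma subring_K: "subring K R" using subfieldE(1)[OF subfield_K] .

lemma K_closed: "K \<subseteq> carrier R" using subringE(1)[OF subring_K] .

lemma K_inv: "c \<in> K \<Longrightarrow> c \<noteq> \<zero> \<Longrightarrow> inv c \<in> K"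
  using subfield_m_inv(1)[OF subfield_K] by auto

lemma card_K: "card K \<ge> 2"
proof -
  have "{\<zero>, \<one>} \<subseteq> K" using subringE[OF subring_K] by auto
  then have "card {\<zero>, \<one>} \<le> card K" by (rule card_mono[OF finite_K])
  then show ?thesis by simp
qed

lemma T_closed: "T \<in> carrier R" using V_closed by simp

lemma T_nz: "T \<noteq> \<zero>"
proof
  assume "T = \<zero>"
  then have "V = \<ominus> \<one>" using V_closed by (simp add: minus_equality)
  then have "V [^] (2::nat) = \<one>" using V_closed by (simp add: numeral_2_eq_2 l_minus r_minus)
  then show False using V_trans[of 2] by simp
qed

lemma kappa_closed: "\<kappa> \<in> carrier R" using kappa K_closed by auto

lemma U_nz: "U \<noteq> \<zero>"
proof
  assume "U = \<zero>"
  then have "\<zero> = \<kappa> \<otimes> (V \<otimes> T [^] b)" using U_power s_pos by (cases s) auto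
  moreover have "\<kappa> \<otimes> (V \<otimes> T [^] b) \<noteq> \<zero>"
    using kappa(2) kappa_closed V_nz V_closed T_closed nz_pow[OF T_closed T_nz] nz_mult by simp
  ultimately show False by simp
qed

abbreviation "KV \<equiv> adjoin K V"

lemma KV_subring: "subring KV R" by (rule adjoin_subring[OF subring_K V_closed])

lemma KV_closed: "KV \<subseteq> carrier R" using subringE(1)[OF KV_subring] .

lemma K_sub_KV: "K \<subseteq> KV" by (rule adjoin_base[OF subring_K V_closed])

lemma V_KV: "V \<in> KV" by (rule adjoin_gen[OF subring_K V_closed])

lemma T_KV: "T \<in> KV" using V_KV subringE(3,7)[OF KV_subring] by simp

text \<open>Finite boxes exhausting K[V][U]. Per unit of degree in \<open>V\<close> the bound on
  their size grows by the factor \<open>card K ^ s\<close>, and this \<open>s\<close> is the degree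
  that appears in all later bounds on residue rings and zeros.\<close>

definition E where "E B = polys (polys K V B) U s"

lemma K_additive: "additive_subgroup K R" by (rule subring_additive[OF subring_K])

lemma polysK_additive: "additive_subgroup (polys K V n) R" by (rule polys_subgroup[OF K_additive V_closed])

lemma polysK_mono: "n \<le> m \<Longrightarrow> polys K V n \<subseteq> polys K V m"
  by (rule polys_mono[OF K_closed _ V_closed]) (use subringE(2)[OF subring_K] in auto)

lemma polysK_closed: "polys K V n \<subseteq> carrier R" by (rule polys_carrier[OF K_closed V_closed])

lemma polysK_mult: "p \<in> polys K V (Suc n) \<Longrightarrow> r \<in> polys K V m \<Longrightarrow> p \<otimes> r \<in> polys K V (n + m)"
  by (rule polys_mult[OF K_additive subringE(6)[OF subring_K] V_closed])

lemma polysK_pow: "p \<in> polys K V (Suc n) \<Longrightarrow> p [^] k \<in> polys K V (Suc (k * n))"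
proof (induction k)
  case 0
  show ?case using polys_const[OF K_closed _ V_closed subringE(3)[OF subring_K]] subringE(2)[OF subring_K]
    by (simp del: polys.simps)
next
  case (Suc k)
  then have "p [^] k \<otimes> p \<in> polys K V (k * n + Suc n)" using polysK_mult by blast
  then show ?case by (simp add: add.commute)
qed

lemma E_additive: "additive_subgroup (E B) R"
  unfolding E_def by (rule polys_subgroup[OF polysK_additive U_closed])

lemma E_mono: "n \<le> m \<Longrightarrow> E n \<subseteq> E m"
  unfolding E_def by (rule polys_mono_coeff[OF polysK_mono])

lemma E_card: "finite (E B)" "card (E B) \<le> card K ^ (s * B)"
proof -
  have 1: "finite (polys K V B)" "card (polys K V B) \<le> card K ^ B" using polys_card[OF finite_K] by auto
  have 2: "finite (E B)" "card (E B) \<le> card (polys K V B) ^ s"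
    unfolding E_def using polys_card[OF 1(1)] by auto
  show "finite (E B)" by fact
  have "card (polys K V B) ^ s \<le> (card K ^ B) ^ s" by (rule power_mono[OF 1(2)]) simp
  then show "card (E B) \<le> card K ^ (s * B)" using 2(2) by (simp add: power_mult mult.commute)
qed

lemma E_mult: "f \<in> polys K V (Suc N) \<Longrightarrow> e \<in> E B \<Longrightarrow> f \<otimes> e \<in> E (N + B)"
  unfolding E_def
  by (rule polys_scale[OF polysK_closed U_closed, where B' = "polys K V (N + B)"]) (use polysK_closed polysK_mult in auto)

lemma spanning_E: assumes "z \<in> carrier R" shows "\<exists>h\<in>KV. h \<noteq> \<zero> \<and> (\<exists>B. h \<otimes> z \<in> E B)"
proof -
  obtain h where h: "h \<in> KV" "h \<noteq> \<zero>" "h \<otimes> z \<in> polys KV U s" using spanning[OF assms] by blast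
  have "\<exists>B. h \<otimes> z \<in> polys (polys K V B) U s"
    by (rule polys_UN[OF polysK_additive polysK_mono U_closed]) (use h(3) in \<open>auto simp: adjoin_def\<close>)
  then show ?thesis using h unfolding E_def by blast
qed

lemma common_denominator:
  assumes "finite Y" "Y \<subseteq> carrier R"
  shows "\<exists>h\<in>KV. h \<noteq> \<zero> \<and> (\<exists>B. \<forall>z\<in>Y. h \<otimes> z \<in> E B)"
  using assms
proof (induction Y)
  case empty
  have "\<one> \<in> KV" using subringE[OF KV_subring] by auto
  then show ?case by (intro bexI[of _ \<one>]) auto
next
  case (insert x F)
  obtain h B where h: "h \<in> KV" "h \<noteq> \<zero>" "\<And>z. z \<in> F \<Longrightarrow> h \<otimes> z \<in> E B" using insert by auto
  obtain g C where g: "g \<in> KV" "g \<noteq> \<zero>" "g \<otimes> x \<in> E C" using spanning_E insert.prems by blast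
  obtain i j where ij: "h \<in> polys K V (Suc i)" "g \<in> polys K V (Suc j)"
  proof -
    obtain i j where "h \<in> polys K V i" "g \<in> polys K V j" using h g by (auto simp: adjoin_def)
    then show ?thesis using that[of i j] polysK_mono[of i "Suc i"] polysK_mono[of j "Suc j"] by auto
  qed
  have hc: "h \<in> carrier R" "g \<in> carrier R" using h g KV_closed by auto
  define D where "D = i + C + (j + B)"
  have "(h \<otimes> g) \<otimes> z \<in> E D" if z: "z \<in> insert x F" for z
  proof (cases "z = x")
    case True
    have "h \<otimes> (g \<otimes> x) \<in> E (i + C)" using E_mult ij g by blast
    then show ?thesis using True hc insert.prems E_mono[of "i + C" D] by (auto simp: m_assoc D_def)
  next
    case False
    then have zF: "z \<in> F" "z \<in> carrier R" using z insert.prems by auto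
    have "g \<otimes> (h \<otimes> z) \<in> E (j + B)" using E_mult ij h(3)[OF zF(1)] by blast
    moreover have "(h \<otimes> g) \<otimes> z = g \<otimes> (h \<otimes> z)" using hc zF by (simp add: m_ac)
    ultimately show ?thesis using E_mono[of "j + B" D] by (auto simp: D_def)
  qed
  moreover have "h \<otimes> g \<in> KV" "h \<otimes> g \<noteq> \<zero>" using subringE(6)[OF KV_subring] h g hc nz_mult by auto
  ultimately show ?case by blast
qed

text \<open>The \<open>card Y ^ k\<close> sums \<open>x\<^sub>0 + f x\<^sub>1 + \<dots> + f\<^sup>k\<^sup>-\<^sup>1 x\<^sub>k\<^sub>-\<^sub>1\<close> are distinct and have a denominator whose
  degree is \<open>k N\<close> up to a constant; letting \<open>k\<close> tend to infinity bounds \<open>card Y\<close>.\<close>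

theorem incongruent_card:
  assumes g: "g1 \<in> polys K V (Suc N)" "g2 \<in> polys K V (Suc N)" "g1 \<noteq> \<zero>" "g2 \<noteq> \<zero>"
    and f: "f = g1 \<otimes> inv g2" and M: "subring M R" "f \<in> M" and Y: "incongruent M f Y"
  shows "card Y \<le> card K ^ (s * N)"
proof -
  have gc: "g1 \<in> carrier R" "g2 \<in> carrier R" using g polysK_closed by auto
  have fc: "f \<in> carrier R" "f \<noteq> \<zero>" "g2 \<otimes> f = g1"
    using f gc g nz_inv[OF gc(2) g(4)] nz_mult cancel_left[OF gc(2) g(4)] by (auto simp: m_lcomm)
  have Mc: "M \<subseteq> carrier R" using subringE[OF M(1)] by auto
  have XM: "finite Y" "Y \<subseteq> M" "Y \<subseteq> carrier R" using Y Mc unfolding incongruent_def by auto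
  obtain h B where h: "h \<in> KV" "h \<noteq> \<zero>" "\<And>z. z \<in> Y \<Longrightarrow> h \<otimes> z \<in> E B"
    using common_denominator[OF XM(1,3)] by auto
  have hc: "h \<in> carrier R" using h KV_closed by auto
  have PM: "polys Y f k \<subseteq> M" for k by (rule polys_least[OF M(1) XM(2) M(2)])
  \<comment> \<open>Uniqueness of digits to the base \<open>f\<close>: equal sums have first digits
    congruent modulo \<open>f\<close>, hence equal, and then \<open>f\<close> cancels.\<close>
  have card: "finite (polys Y f k) \<and> card (polys Y f k) = card Y ^ k" for k
  proof (induction k)
    case (Suc k)
    have eq: "polys Y f (Suc k) = (\<lambda>(a, p). a \<oplus> f \<otimes> p) ` (Y \<times> polys Y f k)"
      by (auto simp: polys.simps(2))
    have "inj_on (\<lambda>(a, p). a \<oplus> f \<otimes> p) (Y \<times> polys Y f k)"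
    proof (rule inj_onI, clarify)
      fix a p a' p' assume ap: "a \<in> Y" "p \<in> polys Y f k" "a' \<in> Y" "p' \<in> polys Y f k"
        and e: "a \<oplus> f \<otimes> p = a' \<oplus> f \<otimes> p'"
      have c: "a \<in> carrier R" "a' \<in> carrier R" "p \<in> carrier R" "p' \<in> carrier R" "p \<in> M" "p' \<in> M"
        using ap XM PM Mc by blast+
      have "a \<ominus> a' = (a \<oplus> f \<otimes> p) \<ominus> (a' \<oplus> f \<otimes> p)" using c fc by algebra
      also have "\<dots> = f \<otimes> (p' \<ominus> p)" unfolding e using c fc by algebra
      finally have "a \<ominus> a' \<in> {f \<otimes> c | c. c \<in> M}"
        using additive_subgroup_minus[OF subring_additive[OF M(1)] c(6,5)] by blast
      then have aa: "a = a'" using Y ap unfolding incongruent_def by blast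
      then have "f \<otimes> p = f \<otimes> p'" using e c fc by simp
      then have "p = p'" using m_lcancel[OF fc(2,1) c(3,4)] by simp
      then show "a = a' \<and> p = p'" using aa by simp
    qed
    then have "card (polys Y f (Suc k)) = card Y * card Y ^ k"
      unfolding eq using Suc by (simp add: card_image card_cartesian_product)
    then show ?case unfolding eq using Suc XM by auto
  qed simp
  \<comment> \<open>\<open>h\<close> clears the denominators of all digits at once; each further
    digit costs one factor \<open>g2\<close> and thus \<open>N\<close> in degree.\<close>
  have bound: "h \<otimes> (g2 [^] k \<otimes> e) \<in> E (B + k * N)" if "e \<in> polys Y f k" for k e
    using that
  proof (induction k arbitrary: e)
    case 0
    then show ?case using hc additive_subgroup.zero_closed[OF E_additive] by simp
  next
    case (Suc k)
    obtain a p where e: "e = a \<oplus> f \<otimes> p" "a \<in> Y" "p \<in> polys Y f k"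
      using Suc.prems by (auto simp: polys.simps(2))
    have c: "a \<in> carrier R" "p \<in> carrier R" using e XM PM Mc by blast+
    have gk: "g2 [^] k \<in> carrier R" "g2 [^] Suc k \<in> carrier R" using gc by auto
    have "g2 [^] Suc k \<otimes> (f \<otimes> p) = g1 \<otimes> (g2 [^] k \<otimes> p)"
      using gc c fc gk unfolding fc(3)[symmetric] by (simp add: m_ac)
    then have "h \<otimes> (g2 [^] Suc k \<otimes> e) = g2 [^] Suc k \<otimes> (h \<otimes> a) \<oplus> g1 \<otimes> (h \<otimes> (g2 [^] k \<otimes> p))"
      unfolding e(1) using gc gk c fc hc by (simp add: r_distr m_lcomm del: nat_pow_Suc)
    moreover have "g2 [^] Suc k \<otimes> (h \<otimes> a) \<in> E (B + Suc k * N)"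
      using E_mult[OF polysK_pow[OF g(2)] h(3)[OF e(2)]] by (simp only: add.commute)
    moreover have "g1 \<otimes> (h \<otimes> (g2 [^] k \<otimes> p)) \<in> E (B + Suc k * N)"
      using E_mult[OF g(1) Suc.IH[OF e(3)]] by (simp add: add.left_commute)
    ultimately show ?case using additive_subgroup.a_closed[OF E_additive] by simp
  qed
  have "card Y ^ k \<le> card K ^ (s * B) * (card K ^ (s * N)) ^ k" for k
  proof -
    have ne: "h \<otimes> g2 [^] k \<in> carrier R" "h \<otimes> g2 [^] k \<noteq> \<zero>"
      using hc h gc nz_pow[OF gc(2) g(4)] nz_mult by auto
    have eq: "h \<otimes> (g2 [^] k \<otimes> e) = (h \<otimes> g2 [^] k) \<otimes> e" if "e \<in> polys Y f k" for e
      using that PM Mc hc gc by (subst m_assoc) auto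
    have "inj_on (\<lambda>e. h \<otimes> (g2 [^] k \<otimes> e)) (polys Y f k)"
    proof (rule inj_onI)
      fix e e' assume "e \<in> polys Y f k" "e' \<in> polys Y f k" "h \<otimes> (g2 [^] k \<otimes> e) = h \<otimes> (g2 [^] k \<otimes> e')"
      then show "e = e'" using eq m_lcancel[OF ne(2,1)] PM Mc by (metis subsetD)
    qed
    then have "card (polys Y f k) \<le> card (E (B + k * N))"
      by (rule card_inj_on_le) (use bound E_card in auto)
    also have "\<dots> \<le> card K ^ (s * (B + k * N))" by (rule E_card)
    finally show ?thesis using card by (simp add: power_add power_mult distrib_left mult.left_commute mult.assoc[symmetric])
         (metis mult.commute mult.left_commute power_mult)
  qed
  then show ?thesis by (rule power_le_imp_le_nat[rotated]) (use card_K in simp)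
qed

end

section \<open>Dimension over a finite field by counting elements\<close>

context ring
begin

lemma dimension_card:
  assumes d: "dimension n K E" and K: "subfield K R" "finite K"
  shows "finite E \<and> card E = card K ^ n"
  using d K
proof (induction rule: dimension.induct)
  case (Suc_dim v E n K)
  have E: "finite E" "card E = card K ^ n" using Suc_dim by auto
  note sp = space_subgroup_props[OF Suc_dim.prems(1) Suc_dim.hyps(3)]
  have Kc: "K \<subseteq> carrier R" using subringE(1)[OF subfieldE(1)[OF Suc_dim.prems(1)]] .
  note Kg = subringE[OF subfieldE(1)[OF Suc_dim.prems(1)]]
  have eq: "line_extension K v E = (\<lambda>(k, e). k \<otimes> v \<oplus> e) ` (K \<times> E)"
    by (auto simp: line_extension_mem_iff, blast)
  have inj: "inj_on (\<lambda>(k, e). k \<otimes> v \<oplus> e) (K \<times> E)"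
  proof (rule inj_onI, clarify)
    fix k e k' e' assume a: "k \<in> K" "k' \<in> K" "e \<in> E" "e' \<in> E" and eq: "k \<otimes> v \<oplus> e = k' \<otimes> v \<oplus> e'"
    have c: "k \<in> carrier R" "k' \<in> carrier R" "e \<in> carrier R" "e' \<in> carrier R" using a Kc sp(1) by auto
    have v: "v \<in> carrier R" by fact
    have "(k \<ominus> k') \<otimes> v = (k \<otimes> v \<oplus> e) \<ominus> (k' \<otimes> v \<oplus> e)"
      using c v by (simp add: a_minus_def l_distr l_minus minus_add a_ac r_neg1 r_neg2 r_neg)
    also have "\<dots> = e' \<ominus> e"
      unfolding eq using c v by (simp add: a_minus_def l_distr l_minus minus_add a_ac r_neg1 r_neg2 r_neg)
    finally have kv: "(k \<ominus> k') \<otimes> v = e' \<ominus> e" .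
    have "e' \<ominus> e \<in> E" using sp(3,4) a by (simp add: a_minus_def)
    moreover have kk: "k \<ominus> k' \<in> K" using Kg(5,7) a by (simp add: a_minus_def)
    ultimately have "k \<ominus> k' = \<zero>" using sp(6)[of "k \<ominus> k'" v] Suc_dim.hyps(2) v kv by auto
    then have kk': "k = k'" using c r_right_minus_eq by simp
    then have "e = e'" using eq c v by simp
    then show "k = k' \<and> e = e'" using kk' by simp
  qed
  show ?case unfolding eq using E Suc_dim.prems(2) card_image[OF inj] by (simp add: card_cartesian_product)
qed auto

text \<open>A subspace of largest dimension inside \<open>E\<close> is all of \<open>E\<close>,
  because adjoining a missing vector stays inside \<open>E\<close>. Together with
  \<open>dimension_card\<close>, this turns statements about \<open>dim\<close> into counts.\<close>

lemma finite_subspace_card: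
  assumes K: "subfield K R" "finite K" and E: "finite E" "additive_subgroup E R"
    and smult: "\<And>k e. k \<in> K \<Longrightarrow> e \<in> E \<Longrightarrow> k \<otimes> e \<in> E"
  shows "card E = card K ^ dim K E"
proof -
  have Kc: "{\<zero>, \<one>} \<subseteq> K" "\<one> \<noteq> \<zero>"
    using subringE[OF subfieldE(1)[OF K(1)]] subfieldE(5)[OF K(1)] subfieldE[OF K(1)] by auto
  have "card {\<zero>, \<one>} \<le> card K" by (rule card_mono[OF K(2) Kc(1)])
  then have K2: "card K \<ge> 2" using Kc by simp
  have Ec: "E \<subseteq> carrier R" using additive_subgroup.a_subset[OF E(2)] .
  define P where "P n \<longleftrightarrow> (\<exists>E'. E' \<subseteq> E \<and> dimension n K E')" for n
  have "P 0" unfolding P_def using additive_subgroup.zero_closed[OF E(2)] by auto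
  moreover have "n \<le> card E" if "P n" for n
  proof -
    obtain E' where "E' \<subseteq> E" "dimension n K E'" using \<open>P n\<close> by (auto simp: P_def)
    then have "card K ^ n \<le> card E" using dimension_card[OF _ K] card_mono[OF E(1)] by metis
    moreover have "n < 2 ^ n" by simp
    moreover have "2 ^ n \<le> card K ^ n" using K2 by (simp add: power_mono)
    ultimately show ?thesis by linarith
  qed
  ultimately obtain n where n: "P n" "\<And>m. P m \<Longrightarrow> m \<le> n"
    using Greatest_le_nat[of P _ "card E"] GreatestI_nat[of P 0 "card E"] by blast
  obtain E' where E': "E' \<subseteq> E" "dimension n K E'" using n(1) by (auto simp: P_def)
  have "E \<subseteq> E'"
  proof
    fix v assume v: "v \<in> E"
    show "v \<in> E'"
    proof (rule ccontr)
      assume "v \<notin> E'"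
      then have "dimension (Suc n) K (line_extension K v E')" using E' v Ec by (intro Suc_dim) auto
      moreover have "line_extension K v E' \<subseteq> E"
      proof
        fix u assume "u \<in> line_extension K v E'"
        then obtain k e where "k \<in> K" "e \<in> E'" "u = k \<otimes> v \<oplus> e" by (auto simp: line_extension_mem_iff)
        then show "u \<in> E" using smult[OF _ v] E'(1) additive_subgroup.a_closed[OF E(2)] by auto
      qed
      ultimately have "P (Suc n)" unfolding P_def by blast
      then show False using n(2) by fastforce
    qed
  qed
  then have "dimension n K E" using E' by (simp add: subset_antisym)
  then show ?thesis using dimension_card[OF _ K] dimI[OF K(1)] by (simp add: over_def)
qed

end

section \<open>Residue class fields; valuation rings are closed under roots\<close>

context field
begin

text \<open>The bound \<open>D\<close> makes the residue class field finite, so its size is a power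
  of \<open>card K\<close> with the degree as exponent. Choosing one preimage per class moves
  everything back into the field, where congruence is expressed by \<open>nonunits\<close>.\<close>

lemma residue_representatives:
  assumes vr: "valuation_ring R K S" and K: "subfield K R" "finite K"
    and fin: "\<And>Y. finite Y \<Longrightarrow> Y \<subseteq> S \<Longrightarrow> (\<And>a b. a \<in> Y \<Longrightarrow> b \<in> Y \<Longrightarrow> a \<noteq> b \<Longrightarrow> a \<ominus> b \<notin> nonunits S) \<Longrightarrow> card Y \<le> D"
  shows "\<exists>Y. finite Y \<and> Y \<subseteq> S \<and> card Y = card K ^ place_degree R K (nonunits S) \<and>
    (\<forall>a\<in>Y. \<forall>b\<in>Y. a \<noteq> b \<longrightarrow> a \<ominus> b \<notin> nonunits S) \<and> (\<forall>z\<in>S. \<exists>a\<in>Y. z \<ominus> a \<in> nonunits S)"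
proof -
  note V = valuation_ringD[OF vr]
  define RS where "RS = R\<lparr>carrier := S\<rparr>"
  define P where "P = nonunits S"
  interpret RS: ring RS unfolding RS_def by (rule subring_is_ring[OF V(1)])
  have mx: "maximalideal P RS" unfolding P_def RS_def using maximalideal_nonunits[OF vr] by blast
  interpret P: maximalideal P RS by (rule mx)
  have carr: "carrier RS = S" by (simp add: RS_def)
  have "cring RS" using subring_is_domain[OF V(1)] unfolding RS_def domain_def by simp
  then interpret Q: field "RS Quot P" using P.quotient_is_field by blast
  define f where "f = (\<lambda>z. P +>\<^bsub>RS\<^esub> z)"
  interpret f: ring_hom_ring RS "RS Quot P" f unfolding f_def by (rule P.rcos_ring_hom_ring)
  have neg: "\<ominus>\<^bsub>RS\<^esub> a = \<ominus> a" if "a \<in> S" for a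
    using group.m_inv_consistent[OF a_group additive_subgroup.a_subgroup[OF subring_additive[OF V(1)]] that]
    by (simp add: a_inv_def RS_def)
  have feq: "f a = f b \<longleftrightarrow> a \<ominus> b \<in> P" if "a \<in> S" "b \<in> S" for a b
    using RS.quotient_eq_iff_same_a_r_cos[OF P.is_ideal, of a b] that neg[OF that(2)]
    by (simp add: f_def carr a_minus_def) (simp add: RS_def)
  have Qc: "carrier (RS Quot P) = f ` S"
    unfolding f_def FactRing_def A_RCOSETS_defs a_r_coset_def carr[symmetric] by auto
  have KRS: "subfield K RS"
  proof (rule RS.subfield_iff(1))
    show "field (RS\<lparr>carrier := K\<rparr>)" using subfield_iff(2)[OF K(1)] by (simp add: RS_def)
    show "K \<subseteq> carrier RS" using V(2) carr by simp
  qed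
  note im = f.img_is_subfield[OF KRS Q.one_not_zero]
  define rep where "rep C = (SOME z. z \<in> S \<and> f z = C)" for C
  have rep: "rep C \<in> S" "f (rep C) = C" if "C \<in> f ` S" for C
    using someI_ex[of "\<lambda>z. z \<in> S \<and> f z = C"] that unfolding rep_def by blast+
  have reps: "rep ` B \<subseteq> S \<and> inj_on rep B \<and> (\<forall>a\<in>rep ` B. \<forall>b\<in>rep ` B. a \<noteq> b \<longrightarrow> a \<ominus> b \<notin> P)"
    if B: "B \<subseteq> f ` S" for B
  proof (intro conjI ballI impI)
    show "rep ` B \<subseteq> S" using B rep by blast
    show "inj_on rep B" using B rep(2) by (metis inj_on_def subsetD)
    fix a b assume a: "a \<in> rep ` B" and b: "b \<in> rep ` B" and ab: "a \<noteq> b"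
    obtain C where C: "C \<in> f ` S" "a = rep C" using a B by blast
    obtain C' where C': "C' \<in> f ` S" "b = rep C'" using b B by blast
    have "f a \<noteq> f b" "a \<in> S" "b \<in> S" using C C' rep ab by auto
    then show "a \<ominus> b \<notin> P" using feq by blast
  qed
  have "finite (f ` S)"
  proof (rule ccontr)
    assume "infinite (f ` S)"
    then obtain B where B: "finite B" "card B = Suc D" "B \<subseteq> f ` S" using infinite_arbitrarily_large by blast
    have "card (rep ` B) = Suc D" using reps[OF B(3)] B by (simp add: card_image)
    moreover have "card (rep ` B) \<le> D" by (rule fin) (use reps[OF B(3)] B in \<open>auto simp: P_def\<close>)
    ultimately show False by simp
  qed
  moreover have "finite (f ` K)" using K(2) by simp
  moreover have "additive_subgroup (f ` S) (RS Quot P)"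
    using Q.subring_additive[OF Q.carrier_is_subring] Qc by simp
  moreover have "k \<otimes>\<^bsub>RS Quot P\<^esub> e \<in> f ` S" if ke: "k \<in> f ` K" "e \<in> f ` S" for k e
  proof -
    have "k \<in> carrier (RS Quot P)" "e \<in> carrier (RS Quot P)" using ke V(2) Qc by auto
    then show ?thesis using Qc Q.m_closed by blast
  qed
  ultimately have "card (f ` S) = card (f ` K) ^ Q.dim (f ` K) (f ` S)"
    by (intro Q.finite_subspace_card[OF im(2)])
  moreover have "card (f ` K) = card K" by (rule card_image[OF im(1)])
  moreover have "Q.dim (f ` K) (f ` S) = place_degree R K (nonunits S)"
  proof -
    have "place_ring R K P = RS" using place_ring_nonunits[OF vr] by (simp add: P_def RS_def)
    then show ?thesis unfolding place_degree_def Let_def P_def[symmetric] by (simp add: Qc f_def)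
  qed
  ultimately have cd: "card (f ` S) = card K ^ place_degree R K (nonunits S)" by simp
  note r = reps[OF order_refl]
  have "finite (rep ` f ` S)" using \<open>finite (f ` S)\<close> by simp
  moreover have "card (rep ` f ` S) = card K ^ place_degree R K (nonunits S)" using r cd by (simp add: card_image)
  moreover have "\<exists>a\<in>rep ` f ` S. z \<ominus> a \<in> P" if "z \<in> S" for z
    using feq[OF that, of "rep (f z)"] rep[of "f z"] that by force
  ultimately show ?thesis using r unfolding P_def by (intro exI[of _ "rep ` f ` S"]) simp
qed

text \<open>If \<open>z\<close> lay outside, 1/z would lie inside, and with it z = (1/z)^(n-1)
  z^n.\<close>

lemma valuation_ring_root_closed:
  assumes vr: "valuation_ring R K S" and z: "z \<in> carrier R" "z [^] (n::nat) \<in> S" "n \<ge> 1"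
  shows "z \<in> S"
proof (rule ccontr)
  assume zS: "z \<notin> S"
  note D = valuation_ringD[OF vr]
  note E = subringE[OF D(1)]
  have z0: "z \<noteq> \<zero>" using zS E(2) by auto
  then have iz: "inv z \<in> S" using D(5)[OF z(1)] zS by auto
  have pw: "inv z [^] k \<in> S" for k :: nat by (induction k) (use E(3) E(6)[OF _ iz] in auto)
  obtain k where k: "n = Suc k" using z(3) by (cases n) auto
  have zk: "z [^] k \<in> carrier R" "z [^] k \<noteq> \<zero>" using z z0 nz_pow by auto
  have "inv z [^] k \<otimes> z [^] n = (inv (z [^] k) \<otimes> z [^] k) \<otimes> z"
    unfolding k inv_pow'[OF z(1) z0] using z nz_inv(1)[OF z(1) z0] by (simp add: m_assoc)
  then have "inv z [^] k \<otimes> z [^] n = z" using nz_inv(4)[OF zk] z by simp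
  then show False using E(6)[OF pw[of k] z(2)] zS by simp
qed

lemma subring_pow: "subring S R \<Longrightarrow> z \<in> S \<Longrightarrow> z [^] (n::nat) \<in> S"
  by (induction n) (auto simp: subringE(3,6))

end

section \<open>Places of the Kummer extension and their valuations\<close>

context kummer_extension
begin

lemma kappa_VT_mem:
  assumes "subring S R" "K \<subseteq> S" "V \<in> S"
  shows "T \<in> S" "\<kappa> \<otimes> (V \<otimes> T [^] b) \<in> S"
proof -
  show "T \<in> S" using subringE(3,7)[OF assms(1)] assms(3) by simp
  then show "\<kappa> \<otimes> (V \<otimes> T [^] b) \<in> S"
    using subringE(6)[OF assms(1)] subring_pow[OF assms(1)] assms(2,3) kappa(1) by (simp add: subset_iff)
qed

lemma finite_place_closed:
  assumes vr: "valuation_ring R K S" and V: "V \<in> S"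
  shows "KV \<subseteq> S" "U \<in> S" "E B \<subseteq> S"
proof -
  note D = valuation_ringD[OF vr]
  show KV: "KV \<subseteq> S" by (rule adjoin_least[OF D(1,2) V])
  have "U [^] s \<in> S" unfolding U_power using kappa_VT_mem(2)[OF D(1,2) V] .
  then show U: "U \<in> S" using valuation_ring_root_closed[OF vr U_closed] s_pos by blast
  show "E B \<subseteq> S" unfolding E_def
    by (rule polys_least[OF D(1) _ U]) (use KV in \<open>auto simp: adjoin_def\<close>)
qed

text \<open>The elements carried into \<open>S\<close> by some power of 1/V form a ring, and this
  ring contains \<open>K\<close>, \<open>V\<close> and \<open>U\<close>.\<close>

lemma infinite_place_closed:
  assumes vr: "valuation_ring R K S" and V: "V \<notin> S" and z: "z \<in> E B"
  shows "\<exists>n::nat. inv V [^] n \<otimes> z \<in> S"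
proof -
  note D = valuation_ringD[OF vr]
  note SE = subringE[OF D(1)]
  define W where "W = inv V"
  have W: "W \<in> carrier R" "W \<noteq> \<zero>" "V \<otimes> W = \<one>" "W \<otimes> V = \<one>" "W \<in> S"
    using nz_inv[OF V_closed V_nz] D(5)[OF V_closed V_nz] V by (auto simp: W_def)
  note Wp = subring_pow[OF D(1) W(5)]
  define Q where "Q = {z \<in> carrier R. \<exists>n::nat. W [^] n \<otimes> z \<in> S}"
  have up: "W [^] m \<otimes> z \<in> S" if "W [^] n \<otimes> z \<in> S" "z \<in> carrier R" "n \<le> m" for n m :: nat and z
  proof -
    have "W [^] m = W [^] (m - n) \<otimes> W [^] n" using W that(3) nat_pow_mult[OF W(1)] by simp
    then have "W [^] m \<otimes> z = W [^] (m - n) \<otimes> (W [^] n \<otimes> z)" using W that by (simp add: m_assoc)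
    then show ?thesis using SE(6)[OF Wp that(1)] by simp
  qed
  have Q: "subring Q R"
  proof (rule subringI)
    show "Q \<subseteq> carrier R" by (auto simp: Q_def)
    have "W [^] (0::nat) \<otimes> \<one> \<in> S" using SE(3) by simp
    then show "\<one> \<in> Q" unfolding Q_def by blast
  next
    fix z assume z: "z \<in> Q"
    then obtain n :: nat where n: "W [^] n \<otimes> z \<in> S" "z \<in> carrier R" by (auto simp: Q_def)
    then have "W [^] n \<otimes> (\<ominus> z) \<in> S" using SE(5)[OF n(1)] W by (simp add: r_minus)
    then show "\<ominus> z \<in> Q" using n(2) unfolding Q_def by auto
  next
    fix y z assume "y \<in> Q" "z \<in> Q"
    then obtain n m :: nat where n: "W [^] n \<otimes> y \<in> S" "y \<in> carrier R" and m: "W [^] m \<otimes> z \<in> S" "z \<in> carrier R"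
      by (auto simp: Q_def)
    have "W [^] (n + m) \<otimes> (y \<otimes> z) = (W [^] n \<otimes> y) \<otimes> (W [^] m \<otimes> z)"
      using n m W by (simp add: nat_pow_mult[symmetric] m_ac)
    then show "y \<otimes> z \<in> Q" using SE(6)[OF n(1) m(1)] n(2) m(2) unfolding Q_def by (metis (mono_tags, lifting) m_closed mem_Collect_eq)
    have "W [^] (n + m) \<otimes> (y \<oplus> z) = W [^] (n + m) \<otimes> y \<oplus> W [^] (n + m) \<otimes> z"
      using n m W by (simp add: r_distr)
    moreover have "W [^] (n + m) \<otimes> y \<in> S" "W [^] (n + m) \<otimes> z \<in> S" using up n m by auto
    ultimately show "y \<oplus> z \<in> Q" using SE(7) n(2) m(2) unfolding Q_def by (metis (mono_tags, lifting) a_closed mem_Collect_eq)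
  qed
  have SQ: "S \<subseteq> Q"
  proof
    fix z assume z: "z \<in> S"
    then have "W [^] (0::nat) \<otimes> z \<in> S" using D(3) by auto
    then show "z \<in> Q" using z D(3) unfolding Q_def by blast
  qed
  have "W [^] (1::nat) \<otimes> V \<in> S" using W SE(3) by simp
  then have VQ: "V \<in> Q" unfolding Q_def using V_closed by blast
  \<comment> \<open>It suffices to treat the s-th power, \<kappa> times W^((b+1)s) V T^b. One factor
    W^(b+1) takes care of V T^b, since W^(b+1) V T^b = (1 + W)^b; the remaining ones lie in
    \<open>S\<close> anyway.\<close>
  have "W [^] (b + 1) \<otimes> U \<in> S"
  proof (rule valuation_ring_root_closed[OF vr _ _ s_pos])
    show "W [^] (b + 1) \<otimes> U \<in> carrier R" using W U_closed by simp
    obtain s' where s': "s = Suc s'" using s_pos by (cases s) auto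
    define w where "w = W [^] (b + 1)"
    define z where "z = V \<otimes> T [^] b"
    have wc: "w \<in> carrier R" "z \<in> carrier R" "w \<in> S" unfolding w_def z_def using W V_closed Wp[of "b + 1"] by auto
    have WT: "W \<otimes> T = \<one> \<oplus> W" using W V_closed by (simp add: r_distr)
    have "w \<otimes> z = (V \<otimes> W) \<otimes> (W [^] b \<otimes> T [^] b)"
      unfolding w_def z_def using W(1) V_closed by (simp add: m_ac)
    also have "\<dots> = (W \<otimes> T) [^] b" using W V_closed by (simp add: nat_pow_distrib)
    also have "\<dots> \<in> S" unfolding WT using subring_pow[OF D(1)] SE(3) SE(7) W(5) by simp
    finally have wz: "w \<otimes> z \<in> S" .
    have "(w \<otimes> U) [^] s = w [^] s \<otimes> (\<kappa> \<otimes> z)"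
      using wc U_closed U_power by (simp add: nat_pow_distrib z_def)
    also have "\<dots> = (w [^] s' \<otimes> \<kappa>) \<otimes> (w \<otimes> z)"
      unfolding s' using wc kappa_closed by (simp add: m_ac)
    also have "\<dots> \<in> S" using SE(6)[OF SE(6)[OF subring_pow[OF D(1) wc(3)]] wz] kappa D(2) by auto
    finally show "(W [^] (b + 1) \<otimes> U) [^] s \<in> S" by (simp add: w_def)
  qed
  then have UQ: "U \<in> Q" unfolding Q_def using U_closed by blast
  have KQ: "K \<subseteq> Q" using SQ D(2) by simp
  have "polys K V B \<subseteq> Q" by (rule polys_least[OF Q KQ VQ])
  then have "E B \<subseteq> Q" unfolding E_def by (rule polys_least[OF Q _ UQ])
  then show ?thesis using z unfolding Q_def W_def by blast
qed

text \<open>A denominator from K[V] reduces to the boxes \<open>E B\<close>, which lie in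
  \<open>S\<close> if \<open>V\<close> does and otherwise are brought there by a power of 1/V. The
  last clause is what later yields polynomials vanishing at a given finite place.\<close>

lemma KV_ratio:
  assumes vr: "valuation_ring R K S" and w: "w \<in> carrier R"
  shows "\<exists>g1\<in>KV. \<exists>g2\<in>KV. g1 \<noteq> \<zero> \<and> g2 \<noteq> \<zero> \<and> g1 \<otimes> inv g2 \<otimes> w \<in> S \<and> (V \<in> S \<longrightarrow> g2 = \<one>)"
proof -
  note D = valuation_ringD[OF vr]
  obtain h B where h: "h \<in> KV" "h \<noteq> \<zero>" "h \<otimes> w \<in> E B" using spanning_E[OF w] by blast
  have hc: "h \<in> carrier R" using h KV_closed by auto
  have o: "\<one> \<in> KV" using subringE[OF KV_subring] by auto
  show ?thesis
  proof (cases "V \<in> S")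
    case True
    have "h \<otimes> inv \<one> \<otimes> w \<in> S" using finite_place_closed(3)[OF vr True] h(3) hc by auto
    then show ?thesis using h o by (intro bexI[of _ h] bexI[of _ \<one>]) auto
  next
    case False
    obtain n :: nat where n: "inv V [^] n \<otimes> (h \<otimes> w) \<in> S"
      using infinite_place_closed[OF vr False h(3)] by blast
    have "h \<otimes> inv (V [^] n) \<otimes> w = inv V [^] n \<otimes> (h \<otimes> w)"
      using hc w nz_inv[OF V_closed V_nz] by (simp add: inv_pow'[OF V_closed V_nz] m_ac)
    moreover have "V [^] n \<in> KV" "V [^] n \<noteq> \<zero>"
      using subring_pow[OF KV_subring V_KV] nz_pow[OF V_closed V_nz] by auto
    ultimately show ?thesis using h n False by (intro bexI[of _ h] bexI[of _ "V [^] n"]) auto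
  qed
qed

lemma KV_degree: "f \<in> KV \<Longrightarrow> g \<in> KV \<Longrightarrow> \<exists>N. f \<in> polys K V (Suc N) \<and> g \<in> polys K V (Suc N)"
proof -
  assume "f \<in> KV" "g \<in> KV"
  then obtain i j where "f \<in> polys K V i" "g \<in> polys K V j" by (auto simp: adjoin_def)
  then have "f \<in> polys K V (Suc (i + j))" "g \<in> polys K V (Suc (i + j))"
    using polysK_mono[of i "Suc (i + j)"] polysK_mono[of j "Suc (i + j)"] by auto
  then show ?thesis by blast
qed

text \<open>\<open>KV_ratio\<close> for 1/z provides a multiple \<open>f\<close> of \<open>z\<close>
  in K(V). Incongruence modulo \<open>z\<close> implies incongruence modulo \<open>f\<close>, and
  there \<open>incongruent_card\<close> applies.\<close>

lemma finite_quotients: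
  assumes vr: "valuation_ring R K S" and z: "z \<in> S" "z \<noteq> \<zero>"
  shows "\<exists>D. \<forall>Y. incongruent S z Y \<longrightarrow> card Y \<le> D"
proof -
  note D = valuation_ringD[OF vr]
  have zc: "z \<in> carrier R" using z D by auto
  obtain g1 g2 where g: "g1 \<in> KV" "g2 \<in> KV" "g1 \<noteq> \<zero>" "g2 \<noteq> \<zero>" "g1 \<otimes> inv g2 \<otimes> inv z \<in> S"
    using KV_ratio[OF vr nz_inv(1)[OF zc z(2)]] by blast
  obtain N where N: "g1 \<in> polys K V (Suc N)" "g2 \<in> polys K V (Suc N)" using KV_degree[OF g(1,2)] by blast
  define f where "f = g1 \<otimes> inv g2"
  have gc: "g1 \<in> carrier R" "g2 \<in> carrier R" using g KV_closed by auto
  then have fc: "f \<in> carrier R" unfolding f_def using nz_inv[OF gc(2) g(4)] by simp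
  have "f = z \<otimes> (f \<otimes> inv z)" using cancel_left(1)[OF zc z(2) fc] fc zc nz_inv[OF zc z(2)] by (simp add: m_lcomm m_comm)
  then have fz: "\<exists>c\<in>S. f = z \<otimes> c" using g(5) f_def by blast
  then have fS: "f \<in> S" using subringE(6)[OF D(1) z(1)] by blast
  have "card Y \<le> card K ^ (s * N)" if "incongruent S z Y" for Y
    by (rule incongruent_card[OF N g(3,4) f_def D(1) fS incongruent_mono[OF that fS fz zc D(1)]])
  then show ?thesis by blast
qed

lemma prime_element_exists: "valuation_ring R K S \<Longrightarrow> \<exists>t. prime_element S t"
  by (rule finite_quotients_imp_prime_element) (use finite_quotients in auto)

abbreviation "Pl \<equiv> places R K"
abbreviation "v \<equiv> valuation R K"
abbreviation "pdeg \<equiv> place_degree R K"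

text \<open>The fractional ideal with exponent \<open>n\<close>. Including zero lets sums be
  estimated without asking whether they vanish.\<close>

definition val_ge :: "'a set \<Rightarrow> int \<Rightarrow> 'a set" where
  "val_ge P n = {z \<in> carrier R. z = \<zero> \<or> v P z \<ge> n}"

lemma place_cases:
  assumes "P \<in> Pl"
  obtains S t where "valuation_ring R K S" "P = nonunits S" "prime_element S t"
    "\<And>z. z \<in> carrier R \<Longrightarrow> z \<noteq> \<zero> \<Longrightarrow> \<exists>u\<in>place_units S. z = t [^] (v P z) \<otimes> u"
proof -
  obtain S where S: "valuation_ring R K S" "P = nonunits S" using assms unfolding places_eq by auto
  obtain t where t: "prime_element S t" using prime_element_exists[OF S(1)] by blast
  have "\<exists>u\<in>place_units S. z = t [^] (v P z) \<otimes> u" if z: "z \<in> carrier R" "z \<noteq> \<zero>" for z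
  proof -
    obtain n :: int and u where nu: "u \<in> place_units S" "z = t [^] n \<otimes> u"
      using t z unfolding prime_element_def by blast
    then show ?thesis using valuation_unique[OF S(1) t nu(2,1)] S(2) by auto
  qed
  then show ?thesis using that S t by blast
qed

lemma v_mult:
  assumes P: "P \<in> Pl" and z: "z \<in> carrier R" "z \<noteq> \<zero>" "w \<in> carrier R" "w \<noteq> \<zero>"
  shows "v P (z \<otimes> w) = v P z + v P w"
proof -
  obtain S t where S: "valuation_ring R K S" "P = nonunits S" and t: "prime_element S t"
    and d: "\<And>z. z \<in> carrier R \<Longrightarrow> z \<noteq> \<zero> \<Longrightarrow> \<exists>u\<in>place_units S. z = t [^] (v P z) \<otimes> u"
    using place_cases[OF P] by blast
  have tc: "t \<in> carrier R" "t \<noteq> \<zero>"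
    using t valuation_ringD(3)[OF S(1)] unfolding prime_element_def nonunits_def by auto
  obtain u where u: "u \<in> place_units S" "z = t [^] v P z \<otimes> u" using d[OF z(1,2)] by blast
  obtain u' where u': "u' \<in> place_units S" "w = t [^] v P w \<otimes> u'" using d[OF z(3,4)] by blast
  note uc = place_units_closed[OF S(1) u(1)] place_units_closed[OF S(1) u'(1)]
  have "z \<otimes> w = (t [^] v P z \<otimes> u) \<otimes> (t [^] v P w \<otimes> u')" using u(2) u'(2) by simp
  also have "\<dots> = t [^] (v P z + v P w) \<otimes> (u \<otimes> u')"
    using uc(1,6) ipow(1)[OF tc] by (simp add: ipow(3)[OF tc] m_ac)
  finally show ?thesis
    using valuation_unique[OF S(1) t _ place_units_closed(4)[OF S(1) u(1) u'(1)]] S(2) by blast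
qed

lemma v_ring:
  assumes vr: "valuation_ring R K S" and z: "z \<in> carrier R" "z \<noteq> \<zero>"
  shows "z \<in> S \<longleftrightarrow> v (nonunits S) z \<ge> 0" "z \<in> nonunits S \<longleftrightarrow> v (nonunits S) z \<ge> 1"
proof -
  obtain t where t: "prime_element S t" using prime_element_exists[OF vr] by blast
  obtain n :: int and u where nu: "u \<in> place_units S" "z = t [^] n \<otimes> u"
    using t z unfolding prime_element_def by blast
  have "v (nonunits S) z = n" by (rule valuation_unique[OF vr t nu(2,1)])
  then show "z \<in> S \<longleftrightarrow> v (nonunits S) z \<ge> 0" "z \<in> nonunits S \<longleftrightarrow> v (nonunits S) z \<ge> 1"
    using prime_element_pow[OF vr t nu(2,1)] by auto
qed

lemma v_one: "P \<in> Pl \<Longrightarrow> v P \<one> = 0"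
  using v_mult[of P \<one> \<one>] by simp

lemma v_inv: "P \<in> Pl \<Longrightarrow> z \<in> carrier R \<Longrightarrow> z \<noteq> \<zero> \<Longrightarrow> v P (inv z) = - v P z"
  using v_mult[of P z "inv z"] nz_inv[of z] v_one[of P] by simp

lemma v_pow: "P \<in> Pl \<Longrightarrow> z \<in> carrier R \<Longrightarrow> z \<noteq> \<zero> \<Longrightarrow> v P (z [^] (n::nat)) = int n * v P z"
  by (induction n) (auto simp: v_one v_mult nz_pow algebra_simps)

lemma v_const:
  assumes P: "P \<in> Pl" and c: "c \<in> K" "c \<noteq> \<zero>" shows "v P c = 0"
proof -
  obtain S where S: "valuation_ring R K S" "P = nonunits S" using P unfolding places_eq by auto
  have "c \<in> S" "inv c \<in> S" "c \<in> carrier R" using c K_inv valuation_ringD(2,3)[OF S(1)] by auto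
  then show ?thesis using v_ring(1)[OF S(1)] v_inv[OF P] c nz_inv[of c] S(2) by fastforce
qed

lemma v_uniformizer: "P \<in> Pl \<Longrightarrow> \<exists>t\<in>carrier R. t \<noteq> \<zero> \<and> v P t = 1"
proof -
  assume P: "P \<in> Pl"
  obtain S t where S: "valuation_ring R K S" "P = nonunits S" and t: "prime_element S t"
    using place_cases[OF P] by blast
  have tc: "t \<in> carrier R" "t \<noteq> \<zero>"
    using t valuation_ringD(3)[OF S(1)] unfolding prime_element_def nonunits_def by auto
  have "\<one> \<in> place_units S" using subringE(3)[OF valuation_ringD(1)[OF S(1)]] unfolding place_units_def by simp
  moreover have "t = t [^] (1::int) \<otimes> \<one>" using ipow(6)[OF tc] tc by simp
  ultimately show ?thesis using valuation_unique[OF S(1) t] S(2) tc by blast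
qed

lemma val_ge_0: assumes vr: "valuation_ring R K S" shows "val_ge (nonunits S) 0 = S" "val_ge (nonunits S) 1 = nonunits S"
  unfolding val_ge_def using v_ring[OF vr] valuation_ringD(3)[OF vr] subringE(2)[OF valuation_ringD(1)[OF vr]]
    nonunits_ideal(1,3)[OF vr] by auto

lemma val_ge_closed: "val_ge P n \<subseteq> carrier R" "\<zero> \<in> val_ge P n"
  by (auto simp: val_ge_def)

lemma val_ge_mono: "n \<le> m \<Longrightarrow> val_ge P m \<subseteq> val_ge P n"
  by (auto simp: val_ge_def)

lemma val_ge_mult:
  assumes P: "P \<in> Pl" and "a \<in> val_ge P n" "c \<in> val_ge P m" shows "a \<otimes> c \<in> val_ge P (n + m)"
proof (cases "a = \<zero> \<or> c = \<zero>")
  case True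
  then show ?thesis using assms(2,3) by (auto simp: val_ge_def)
next
  case False
  then show ?thesis using assms(2,3) v_mult[OF P, of a c] by (auto simp: val_ge_def)
qed

lemma val_ge_v: "z \<in> carrier R \<Longrightarrow> z \<noteq> \<zero> \<Longrightarrow> z \<in> val_ge P n \<longleftrightarrow> n \<le> v P z"
  by (auto simp: val_ge_def)

text \<open>Multiplication by t^(-n) moves the set into the valuation ring, where differences are
  available.\<close>

lemma val_ge_additive: assumes P: "P \<in> Pl" shows "additive_subgroup (val_ge P n) R"
proof (rule additive_subgroupI)
  obtain S where S: "valuation_ring R K S" "P = nonunits S" using P unfolding places_eq by auto
  obtain t where t: "t \<in> carrier R" "t \<noteq> \<zero>" "v P t = 1" using v_uniformizer[OF P] by blast
  note tp = ipow[OF t(1,2)]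
  have vt: "v P (t [^] k) = k" for k :: int
  proof (cases k)
    case (nonneg j)
    then show ?thesis using v_pow[OF P t(1,2), of j] t(3) by (simp add: int_pow_int)
  next
    case (neg j)
    have "t [^] k = inv (t [^] Suc j)"
      using tp(4)[of "int (Suc j)"] neg int_pow_int[of R t "Suc j"] by simp
    then show ?thesis using v_inv[OF P nat_pow_closed[OF t(1)] nz_pow[OF t(1,2)], of "Suc j"]
        v_pow[OF P t(1,2), of "Suc j"] t(3) neg by simp
  qed
  have shift: "t [^] (- n) \<otimes> z \<in> S" if "z \<in> val_ge P n" for z
  proof -
    have "t [^] (- n) \<in> val_ge P (- n)" using val_ge_v tp(1,2) vt by simp
    then have "t [^] (- n) \<otimes> z \<in> val_ge P (- n + n)" using val_ge_mult[OF P] that by blast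
    then show ?thesis using val_ge_0(1)[OF S(1)] S(2) by simp
  qed
  show "val_ge P n \<subseteq> carrier R" "\<zero> \<in> val_ge P n" using val_ge_closed by auto
  fix a c assume ac: "a \<in> val_ge P n" "c \<in> val_ge P n"
  have cc: "a \<in> carrier R" "c \<in> carrier R" using ac val_ge_closed by auto
  have "t [^] (- n) \<otimes> a \<ominus> t [^] (- n) \<otimes> c \<in> val_ge P 0"
    using additive_subgroup_minus[OF subring_additive[OF valuation_ringD(1)[OF S(1)]] shift[OF ac(1)] shift[OF ac(2)]]
      val_ge_0(1)[OF S(1)] S(2) by simp
  moreover have "t [^] n \<in> val_ge P n" using val_ge_v tp(1,2) vt by simp
  ultimately have "t [^] n \<otimes> (t [^] (- n) \<otimes> a \<ominus> t [^] (- n) \<otimes> c) \<in> val_ge P (n + 0)" using val_ge_mult[OF P] by blast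
  moreover have "t [^] n \<otimes> (t [^] (- n) \<otimes> a \<ominus> t [^] (- n) \<otimes> c) = (t [^] n \<otimes> t [^] (- n)) \<otimes> (a \<ominus> c)"
    using tp(1)[of n] tp(1)[of "-n"] cc by (simp add: a_minus_def r_distr r_minus m_assoc)
  moreover have "t [^] n \<otimes> t [^] (- n) = \<one>" using tp(3)[of n "- n"] by simp
  ultimately show "a \<ominus> c \<in> val_ge P n" using cc by simp
qed

lemma val_ge_add: "P \<in> Pl \<Longrightarrow> a \<in> val_ge P n \<Longrightarrow> c \<in> val_ge P n \<Longrightarrow> a \<oplus> c \<in> val_ge P n"
  using additive_subgroup.a_closed[OF val_ge_additive] by blast

lemma val_ge_minus: "P \<in> Pl \<Longrightarrow> a \<in> val_ge P n \<Longrightarrow> c \<in> val_ge P n \<Longrightarrow> a \<ominus> c \<in> val_ge P n"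
  using additive_subgroup_minus[OF val_ge_additive] by blast

lemma K_val_ge: "P \<in> Pl \<Longrightarrow> K \<subseteq> val_ge P 0"
  using v_const K_closed by (auto simp: val_ge_def)

lemma residue_system:
  assumes P: "P \<in> Pl"
  shows "\<exists>Y. finite Y \<and> Y \<subseteq> val_ge P 0 \<and> card Y = card K ^ pdeg P \<and>
    (\<forall>a\<in>Y. \<forall>c\<in>Y. a \<noteq> c \<longrightarrow> a \<ominus> c \<notin> val_ge P 1) \<and> (\<forall>z\<in>val_ge P 0. \<exists>a\<in>Y. z \<ominus> a \<in> val_ge P 1)"
proof -
  obtain S t where S: "valuation_ring R K S" "P = nonunits S" and t: "prime_element S t"
    using place_cases[OF P] by blast
  have tm: "t \<in> nonunits S" "t \<noteq> \<zero>" "t \<in> S" using t unfolding prime_element_def nonunits_def by auto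
  obtain D where D: "\<And>Y. incongruent S t Y \<Longrightarrow> card Y \<le> D" using finite_quotients[OF S(1) tm(3,2)] by blast
  have sub: "{t \<otimes> c | c. c \<in> S} \<subseteq> nonunits S"
    using nonunits_ideal(4)[OF S(1) _ tm(1)] m_comm valuation_ringD(3)[OF S(1)] tm(3) by (auto simp: subset_iff)
  show ?thesis unfolding S(2) val_ge_0[OF S(1)]
  proof (rule residue_representatives[OF S(1) subfield_K finite_K])
    fix Y assume Y: "finite Y" "Y \<subseteq> S"
      and d: "\<And>a c. a \<in> Y \<Longrightarrow> c \<in> Y \<Longrightarrow> a \<noteq> c \<Longrightarrow> a \<ominus> c \<notin> nonunits S"
    have "incongruent S t Y" unfolding incongruent_def using Y d sub by blast
    then show "card Y \<le> D" by (rule D)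
  qed
qed

text \<open>In degree zero one representative would be congruent to both 0 and 1.\<close>

lemma deg_pos: assumes P: "P \<in> Pl" shows "pdeg P \<ge> 1"
proof (rule ccontr)
  assume "\<not> ?thesis"
  then obtain Y where Y: "finite Y" "Y \<subseteq> val_ge P 0" "card Y = 1" "\<forall>z\<in>val_ge P 0. \<exists>a\<in>Y. z \<ominus> a \<in> val_ge P 1"
    using residue_system[OF P] by auto
  obtain a where a: "Y = {a}" using Y(3) card_1_singletonE by blast
  have z: "\<zero> \<in> val_ge P 0" "\<one> \<in> val_ge P 0" using val_ge_closed v_one[OF P] by (auto simp: val_ge_def)
  then have "\<zero> \<ominus> a \<in> val_ge P 1" "\<one> \<ominus> a \<in> val_ge P 1" using Y a by auto
  then have "(\<one> \<ominus> a) \<ominus> (\<zero> \<ominus> a) \<in> val_ge P 1" using val_ge_minus[OF P] by blast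
  moreover have "a \<in> carrier R" using Y(2) a val_ge_closed by auto
  then have "(\<one> \<ominus> a) \<ominus> (\<zero> \<ominus> a) = \<one>" by algebra
  ultimately show False using v_one[OF P] by (simp add: val_ge_def)
qed

section \<open>Independence of valuations, weak approximation, number of zeros\<close>

lemma place_ring_eq:
  assumes "P \<in> Pl"
  obtains S where "valuation_ring R K S" "P = nonunits S" "val_ge P 0 = S" "val_ge P 1 = P"
  using assms val_ge_0 unfolding places_eq by auto

lemma val_ge_ring: assumes "P \<in> Pl" shows "subring (val_ge P 0) R" "val_ge P 0 \<noteq> carrier R"
  using place_ring_eq[OF assms] valuation_ringD(1,4) by metis+

text \<open>A prime element \<open>t\<close> of \<open>P\<close> vanishes at \<open>Q\<close>;
  otherwise multiplying by powers of \<open>t\<close> would show that the ring of \<open>Q\<close>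
  is the whole field. If some \<open>z\<close> were regular at \<open>Q\<close> with a pole at
  \<open>P\<close>, then z t^k would be a unit at \<open>P\<close> for suitable \<open>k\<close>, so
  its inverse would be regular at \<open>P\<close> but have a pole at \<open>Q\<close>.\<close>

lemma ring_incl_imp_eq:
  assumes P: "P \<in> Pl" and Q: "Q \<in> Pl" and sub: "val_ge P 0 \<subseteq> val_ge Q 0"
  shows "P = Q"
proof -
  obtain t where t: "t \<in> carrier R" "t \<noteq> \<zero>" "v P t = 1" using v_uniformizer[OF P] by blast
  have vt: "v P' (z \<otimes> t [^] k) = v P' z + int k * v P' t" if "z \<in> carrier R" "z \<noteq> \<zero>" "P' \<in> Pl" for P' z and k :: nat
    using v_mult[OF that(3,1,2)] v_pow[OF that(3) t(1,2)] nz_pow[OF t(1,2)] t by simp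
  have pos: "v Q z \<ge> 0" if "z \<in> carrier R" "z \<noteq> \<zero>" "v P z \<ge> 0" for z
    using sub that by (auto simp: val_ge_def)
  have tQ: "v Q t \<ge> 1"
  proof (rule ccontr)
    assume n: "\<not> ?thesis"
    have "z \<in> val_ge Q 0" if z: "z \<in> carrier R" "z \<noteq> \<zero>" for z
    proof -
      define k where "k = nat (- v P z)"
      have zt: "z \<otimes> t [^] k \<in> carrier R" "z \<otimes> t [^] k \<noteq> \<zero>" using z t nz_pow nz_mult by auto
      have "int k \<ge> - v P z" unfolding k_def by simp
      then have "v P (z \<otimes> t [^] k) \<ge> 0" using vt[OF z P, of k] t(3) by simp
      then have "v Q (z \<otimes> t [^] k) \<ge> 0" using pos zt by blast
      then have "v Q z + int k * v Q t \<ge> 0" using vt[OF z Q, of k] by simp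
      moreover have "int k * v Q t \<le> 0" using n by (simp add: mult_nonneg_nonpos)
      ultimately show ?thesis using z by (auto simp: val_ge_def)
    qed
    then have "val_ge Q 0 = carrier R" using val_ge_closed by (auto, metis val_ge_closed(2))
    then show False using val_ge_ring[OF Q] by simp
  qed
  have "val_ge Q 0 \<subseteq> val_ge P 0"
  proof
    fix z assume z: "z \<in> val_ge Q 0"
    show "z \<in> val_ge P 0"
    proof (rule ccontr)
      assume n: "z \<notin> val_ge P 0"
      then have z0: "z \<in> carrier R" "z \<noteq> \<zero>" "v P z < 0" "v Q z \<ge> 0" using z by (auto simp: val_ge_def)
      define k where "k = nat (- v P z)"
      define u where "u = z \<otimes> t [^] k"
      have u: "u \<in> carrier R" "u \<noteq> \<zero>" unfolding u_def using z0 t nz_pow nz_mult by auto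
      have k: "int k = - v P z" "int k > 0" unfolding k_def using z0(3) by simp_all
      have "v P u = 0" using vt[OF z0(1,2) P, of k] t(3) k(1) unfolding u_def by simp
      then have "v Q (inv u) \<ge> 0" using pos[of "inv u"] nz_inv[OF u] v_inv[OF P u] by simp
      then have "v Q z + int k * v Q t \<le> 0" using v_inv[OF Q u] vt[OF z0(1,2) Q, of k] unfolding u_def by simp
      moreover have "int k * v Q t > 0" using k(2) tQ by simp
      ultimately show False using z0 by linarith
    qed
  qed
  then have "val_ge P 0 = val_ge Q 0" using sub by blast
  then show ?thesis using place_ring_eq[OF P] place_ring_eq[OF Q] by metis
qed

lemma separate2:
  assumes P: "P \<in> Pl" and Q: "Q \<in> Pl" and "P \<noteq> Q"
  shows "\<exists>y\<in>carrier R. y \<noteq> \<zero> \<and> v P y > 0 \<and> v Q y < 0"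
proof -
  have *: "\<exists>z\<in>carrier R. z \<noteq> \<zero> \<and> v P z \<ge> 0 \<and> v Q z < 0"
    if "P \<in> Pl" "Q \<in> Pl" "P \<noteq> Q" for P Q
  proof -
    have "\<not> val_ge P 0 \<subseteq> val_ge Q 0" using ring_incl_imp_eq that by blast
    then show ?thesis by (force simp: val_ge_def)
  qed
  obtain x where x: "x \<in> carrier R" "x \<noteq> \<zero>" "v P x \<ge> 0" "v Q x < 0" using * assms by blast
  obtain z where z: "z \<in> carrier R" "z \<noteq> \<zero>" "v Q z \<ge> 0" "v P z < 0" using *[OF Q P] assms by blast
  note iz = nz_inv[OF z(1,2)]
  have "v P (x \<otimes> inv z) > 0" "v Q (x \<otimes> inv z) < 0"
    using v_mult[OF P x(1,2) iz(1,2)] v_mult[OF Q x(1,2) iz(1,2)] v_inv[OF P z(1,2)] v_inv[OF Q z(1,2)] x z by auto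
  moreover have "x \<otimes> inv z \<in> carrier R" "x \<otimes> inv z \<noteq> \<zero>" using x iz nz_mult by auto
  ultimately show ?thesis by blast
qed

lemma v_add_less:
  assumes P: "P \<in> Pl" and a: "a \<in> carrier R" "a \<noteq> \<zero>" and c: "c \<in> val_ge P (v P a + 1)"
  shows "a \<oplus> c \<noteq> \<zero>" "v P (a \<oplus> c) = v P a"
proof -
  have cc: "c \<in> carrier R" using c val_ge_closed by blast
  have na: "a \<notin> val_ge P (v P a + 1)" using val_ge_v[OF a] by simp
  have n: "a \<oplus> c \<notin> val_ge P (v P a + 1)"
  proof
    assume "a \<oplus> c \<in> val_ge P (v P a + 1)"
    then have "(a \<oplus> c) \<ominus> c \<in> val_ge P (v P a + 1)" using val_ge_minus[OF P] c by blast
    moreover have "(a \<oplus> c) \<ominus> c = a" using a cc by algebra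
    ultimately show False using na by simp
  qed
  then show nz: "a \<oplus> c \<noteq> \<zero>" using val_ge_closed by metis
  have "a \<oplus> c \<in> val_ge P (v P a)"
    using val_ge_add[OF P, of a "v P a" c] val_ge_v[OF a] c val_ge_mono[of "v P a" "v P a + 1"] by auto
  then show "v P (a \<oplus> c) = v P a" using n nz a cc val_ge_v[of "a \<oplus> c"] by force
qed

lemma v_add_neq:
  assumes P: "P \<in> Pl" and a: "a \<in> carrier R" "a \<noteq> \<zero>" and c: "c \<in> carrier R" "c \<noteq> \<zero>"
    and ne: "v P a \<noteq> v P c"
  shows "a \<oplus> c \<noteq> \<zero>" "v P (a \<oplus> c) = min (v P a) (v P c)"
proof -
  have "a \<oplus> c \<noteq> \<zero> \<and> v P (a \<oplus> c) = min (v P a) (v P c)"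
  proof (cases "v P a < v P c")
    case True
    then show ?thesis using v_add_less[OF P a, of c] val_ge_v[OF c] by auto
  next
    case False
    then show ?thesis using v_add_less[OF P c, of a] val_ge_v[OF a] ne a c by (auto simp: a_comm)
  qed
  then show "a \<oplus> c \<noteq> \<zero>" "v P (a \<oplus> c) = min (v P a) (v P c)" by auto
qed

lemma separate:
  assumes "finite S" "S \<subseteq> Pl" "P \<in> Pl" "P \<notin> S"
  shows "\<exists>y\<in>carrier R. y \<noteq> \<zero> \<and> v P y > 0 \<and> (\<forall>Q\<in>S. v Q y < 0)"
  using assms(1,2,4)
proof (induction S)
  case empty
  then show ?case using v_uniformizer[OF assms(3)] by force
next
  case (insert Q S)
  obtain x where x: "x \<in> carrier R" "x \<noteq> \<zero>" "v P x > 0" "\<And>Q. Q \<in> S \<Longrightarrow> v Q x < 0"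
    using insert by auto
  have Q: "Q \<in> Pl" "P \<noteq> Q" using insert.prems by auto
  obtain y where y: "y \<in> carrier R" "y \<noteq> \<zero>" "v P y > 0" "v Q y < 0"
    using separate2[OF assms(3) Q] by blast
  \<comment> \<open>\<open>r\<close> exceeds all the values of \<open>x\<close> in absolute value,
    so \<open>x\<close> and y^r have different values wherever \<open>y\<close> has nonzero value;
    where \<open>y\<close> has value zero, \<open>x\<close> has a pole. Hence no pole cancels in x +
    y^r.\<close>
  define r where "r = nat (\<Sum>Q'\<in>insert Q S. \<bar>v Q' x\<bar>) + 1"
  have "r > 0" unfolding r_def by simp
  then have rpos: "int r > 0" by simp
  have yr: "y [^] r \<in> carrier R" "y [^] r \<noteq> \<zero>" using y nz_pow by auto
  have vy: "v Q' (y [^] r) = int r * v Q' y" if "Q' \<in> Pl" for Q' by (rule v_pow[OF that y(1,2)])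
  have r: "int r > \<bar>v Q' x\<bar>" if "Q' \<in> insert Q S" for Q'
  proof -
    have "\<bar>v Q' x\<bar> \<le> (\<Sum>Q'\<in>insert Q S. \<bar>v Q' x\<bar>)"
      by (rule member_le_sum[OF that]) (use insert.hyps in auto)
    then show ?thesis unfolding r_def by linarith
  qed
  have main: "x \<oplus> y [^] r \<noteq> \<zero> \<and> v Q' (x \<oplus> y [^] r) < 0" if Q': "Q' \<in> insert Q S" for Q'
  proof -
    have Qp: "Q' \<in> Pl" using Q' insert.prems by auto
    have ne: "v Q' x \<noteq> v Q' (y [^] r)"
    proof (cases "v Q' y = 0")
      case True
      then have "Q' \<in> S" using Q' y(4) by auto
      then show ?thesis using x(4) vy[OF Qp] True by force
    next
      case False
      then have "int r * 1 \<le> int r * \<bar>v Q' y\<bar>" by (intro mult_left_mono) auto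
      then have "int r \<le> \<bar>v Q' (y [^] r)\<bar>" using vy[OF Qp] by (simp add: abs_mult)
      then show ?thesis using r[OF Q'] by auto
    qed
    have "v Q' x < 0 \<or> v Q' (y [^] r) < 0"
    proof (cases "Q' = Q")
      case True
      have "int r * v Q y < 0" using y(4) rpos by (simp add: mult_pos_neg)
      then show ?thesis using vy[OF Qp] True by simp
    qed (use x(4) Q' in auto)
    then show ?thesis using v_add_neq[OF Qp x(1,2) yr ne] by auto
  qed
  have nz: "x \<oplus> y [^] r \<noteq> \<zero>" using main by blast
  have "v P (y [^] r) > 0" using vy[OF assms(3)] y(3) rpos by simp
  then have "x \<oplus> y [^] r \<in> val_ge P 1"
    using val_ge_add[OF assms(3), of x 1 "y [^] r"] val_ge_v[OF x(1,2)] val_ge_v[OF yr] x(3) by simp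
  then have "v P (x \<oplus> y [^] r) > 0" using nz by (auto simp: val_ge_def)
  then show ?case using main nz x(1) yr(1) by (intro bexI[of _ "x \<oplus> y [^] r"]) auto
qed

text \<open>The witness is 1 / (1 + y^k), where \<open>y\<close> vanishes at \<open>P\<close> and
  has poles on \<open>S\<close>: it is close to 1 where y^k is small and close to 0 where y^k is
  large.\<close>

lemma approx_one:
  assumes S: "finite S" "S \<subseteq> Pl" "P \<in> Pl" "P \<notin> S"
  shows "\<exists>w\<in>carrier R. \<one> \<ominus> w \<in> val_ge P (int n) \<and> (\<forall>Q\<in>S. w \<in> val_ge Q (int n))"
proof -
  obtain y where y: "y \<in> carrier R" "y \<noteq> \<zero>" "v P y > 0" "\<And>Q. Q \<in> S \<Longrightarrow> v Q y < 0"
    using separate[OF S] by blast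
  define k where "k = Suc n"
  have yk: "y [^] k \<in> carrier R" "y [^] k \<noteq> \<zero>" using y nz_pow by auto
  have vk: "v Q (y [^] k) = int k * v Q y" if "Q \<in> Pl" for Q using v_pow[OF that y(1,2)] by simp
  have vP: "v P (y [^] k) \<ge> int k" using vk[OF S(3)] y(3) mult_left_mono[of 1 "v P y" "int k"] by simp
  have ok: "y [^] k \<in> val_ge P 1" using vP val_ge_v[OF yk] by (simp add: k_def)
  define d where "d = \<one> \<oplus> y [^] k"
  have d: "d \<in> carrier R" "d \<noteq> \<zero>" "v P d = 0"
    using v_add_less[OF S(3), of \<one> "y [^] k"] ok v_one[OF S(3)] yk unfolding d_def by auto
  note id = nz_inv[OF d(1,2)]
  have "\<one> \<ominus> inv d = (d \<ominus> \<one>) \<otimes> inv d" using id d by (simp add: a_minus_def l_distr l_minus)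
  also have "d \<ominus> \<one> = y [^] k" unfolding d_def using yk by algebra
  finally have e: "\<one> \<ominus> inv d = y [^] k \<otimes> inv d" .
  have "inv d \<in> val_ge P 0" using val_ge_v[OF id(1,2)] v_inv[OF S(3) d(1,2)] d(3) by simp
  then have "y [^] k \<otimes> inv d \<in> val_ge P (int k + 0)" using val_ge_mult[OF S(3)] val_ge_v[OF yk] vP by blast
  then have "\<one> \<ominus> inv d \<in> val_ge P (int n)" unfolding e using val_ge_mono[of "int n" "int k"] by (auto simp: k_def)
  moreover have "inv d \<in> val_ge Q (int n)" if Q: "Q \<in> S" for Q
  proof -
    have Qp: "Q \<in> Pl" using Q S by auto
    have l: "v Q (y [^] k) \<le> - int k"
      using vk[OF Qp] y(4)[OF Q] mult_left_mono[of "v Q y" "-1" "int k"] by simp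
    have "v Q d = v Q (y [^] k)" unfolding d_def
      using v_add_neq(2)[OF Qp one_closed one_not_zero yk] l v_one[OF Qp] by (simp add: k_def)
    then show ?thesis using val_ge_v[OF id(1,2)] v_inv[OF Qp d(1,2)] l by (simp add: k_def)
  qed
  ultimately show ?thesis using id(1) by blast
qed

text \<open>One place at a time is corrected by adding \<open>a P\<close> times an element close to
  1 at \<open>P\<close> and to 0 at the others. The induction keeps \<open>z\<close> small at the
  places not yet treated, so the correction there starts from zero.\<close>

theorem weak_approximation:
  assumes S: "finite S" "S \<subseteq> Pl" and a: "\<And>P. P \<in> S \<Longrightarrow> a P \<in> carrier R"
  shows "\<exists>z\<in>carrier R. \<forall>P\<in>S. z \<ominus> a P \<in> val_ge P n"
proof -
  have "\<exists>z\<in>carrier R. (\<forall>P\<in>S'. z \<ominus> a P \<in> val_ge P n) \<and> (\<forall>P\<in>S - S'. z \<in> val_ge P n)"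
    if "finite S'" "S' \<subseteq> S" for S'
    using that
  proof (induction S')
    case empty
    show ?case using val_ge_closed(2) by (intro bexI[of _ \<zero>]) auto
  next
    case (insert P S')
    have P: "P \<in> S" "P \<in> Pl" "P \<notin> S'" using insert S by auto
    have ac: "a P \<in> carrier R" using a P by auto
    obtain z where z: "z \<in> carrier R" "\<And>Q. Q \<in> S' \<Longrightarrow> z \<ominus> a Q \<in> val_ge Q n" "\<And>Q. Q \<in> S - S' \<Longrightarrow> z \<in> val_ge Q n"
      using insert by auto
    \<comment> \<open>Extra precision that compensates the poles of \<open>a P\<close> at the places
      of \<open>S\<close>.\<close>
    define m where "m = nat (\<Sum>Q\<in>S. \<bar>n - v Q (a P)\<bar>)"
    have m: "n - v Q (a P) \<le> int m" if "Q \<in> S" for Q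
    proof -
      have "\<bar>n - v Q (a P)\<bar> \<le> (\<Sum>Q\<in>S. \<bar>n - v Q (a P)\<bar>)"
        by (rule member_le_sum[OF that]) (use S in auto)
      then show ?thesis unfolding m_def by linarith
    qed
    have SP: "finite (S - {P})" "S - {P} \<subseteq> Pl" using S by auto
    obtain w where w: "w \<in> carrier R" "\<one> \<ominus> w \<in> val_ge P (int m)" "\<And>Q. Q \<in> S - {P} \<Longrightarrow> w \<in> val_ge Q (int m)"
      using approx_one[OF SP P(2), of m] by auto
    have am: "c \<otimes> a P \<in> val_ge Q n" if "Q \<in> S" "c \<in> val_ge Q (int m)" for Q c
    proof -
      have Q: "Q \<in> Pl" using that S by auto
      have "a P \<in> val_ge Q (v Q (a P))" using ac by (auto simp: val_ge_def)
      then have "c \<otimes> a P \<in> val_ge Q (int m + v Q (a P))" using val_ge_mult[OF Q that(2)] by blast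
      then show ?thesis using val_ge_mono[of n "int m + v Q (a P)"] m[OF that(1)] by auto
    qed
    define z' where "z' = z \<oplus> w \<otimes> a P"
    have zc: "z' \<in> carrier R" using z w ac by (simp add: z'_def)
    have "z' \<ominus> a Q \<in> val_ge Q n" if Q: "Q \<in> insert P S'" for Q
    proof (cases "Q = P")
      case True
      have "z' \<ominus> a P = z \<ominus> (\<one> \<ominus> w) \<otimes> a P" unfolding z'_def using z w ac by algebra
      then show ?thesis using True val_ge_minus[OF P(2) z(3) am[OF P(1) w(2)]] P by simp
    next
      case False
      then have Q': "Q \<in> S'" "Q \<in> S" "Q \<in> Pl" using Q insert.prems S by auto
      have qc: "a Q \<in> carrier R" using a Q' by auto
      have "z' \<ominus> a Q = (z \<ominus> a Q) \<oplus> w \<otimes> a P" unfolding z'_def using z w ac qc by algebra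
      then show ?thesis using val_ge_add[OF Q'(3) z(2)[OF Q'(1)] am[OF Q'(2) w(3)]] False Q'(2) by simp
    qed
    moreover have "z' \<in> val_ge Q n" if Q: "Q \<in> S - insert P S'" for Q
      unfolding z'_def using val_ge_add[of Q z n "w \<otimes> a P"] z(3) am[OF _ w(3)] Q S by auto
    ultimately show ?case using zc by blast
  qed
  from this[OF S(1) order_refl] show ?thesis by auto
qed

text \<open>Expansions of \<open>e\<close> digits to the base of a prime element, the digits
  representing the residue class field.\<close>

lemma residue_system_power:
  assumes P: "P \<in> Pl"
  shows "\<exists>Y. finite Y \<and> Y \<subseteq> val_ge P 0 \<and> card Y = card K ^ (e * pdeg P) \<and>
    (\<forall>a\<in>Y. \<forall>c\<in>Y. a \<noteq> c \<longrightarrow> a \<ominus> c \<notin> val_ge P (int e))"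
proof -
  obtain Y where Y: "finite Y" "Y \<subseteq> val_ge P 0" "card Y = card K ^ pdeg P"
    "\<And>a c. a \<in> Y \<Longrightarrow> c \<in> Y \<Longrightarrow> a \<noteq> c \<Longrightarrow> a \<ominus> c \<notin> val_ge P 1"
    using residue_system[OF P] by auto
  obtain t where t: "t \<in> carrier R" "t \<noteq> \<zero>" "v P t = 1" using v_uniformizer[OF P] by blast
  have tO: "t \<in> val_ge P 1" "t \<in> val_ge P 0" "inv t \<in> val_ge P (-1)"
    using val_ge_v[OF t(1,2)] t(3) nz_inv[OF t(1,2)] val_ge_v[of "inv t" P "-1"] v_inv[OF P t(1,2)] by auto
  have sub: "polys Y t e \<subseteq> val_ge P 0" for e by (rule polys_least[OF val_ge_ring(1)[OF P] Y(2) tO(2)])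
  have inc: "finite (polys Y t e) \<and> card (polys Y t e) = card Y ^ e \<and>
    (\<forall>a\<in>polys Y t e. \<forall>c\<in>polys Y t e. a \<ominus> c \<in> val_ge P (int e) \<longrightarrow> a = c)" for e
  proof (induction e)
    case (Suc e)
    have eq: "polys Y t (Suc e) = (\<lambda>(a, p). a \<oplus> t \<otimes> p) ` (Y \<times> polys Y t e)"
      by (auto simp: polys.simps(2))
    have key: "a = a' \<and> p = p'" if a: "a \<in> Y" "a' \<in> Y" "p \<in> polys Y t e" "p' \<in> polys Y t e"
      and d: "(a \<oplus> t \<otimes> p) \<ominus> (a' \<oplus> t \<otimes> p') \<in> val_ge P (int (Suc e))" for a a' p p'
    proof -
      have o: "a \<in> val_ge P 0" "a' \<in> val_ge P 0" "p \<in> val_ge P 0" "p' \<in> val_ge P 0" using a Y(2) sub by auto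
      have c: "a \<in> carrier R" "a' \<in> carrier R" "p \<in> carrier R" "p' \<in> carrier R" using o val_ge_closed by auto
      have "t \<otimes> (p \<ominus> p') \<in> val_ge P (1 + 0)" using val_ge_mult[OF P tO(1) val_ge_minus[OF P o(3,4)]] .
      then have tp: "t \<otimes> (p \<ominus> p') \<in> val_ge P 1" by simp
      have "(a \<oplus> t \<otimes> p) \<ominus> (a' \<oplus> t \<otimes> p') \<in> val_ge P 1" using d val_ge_mono[of 1 "int (Suc e)"] by auto
      then have "((a \<oplus> t \<otimes> p) \<ominus> (a' \<oplus> t \<otimes> p')) \<ominus> t \<otimes> (p \<ominus> p') \<in> val_ge P 1" using val_ge_minus[OF P _ tp] by blast
      moreover have "((a \<oplus> t \<otimes> p) \<ominus> (a' \<oplus> t \<otimes> p')) \<ominus> t \<otimes> (p \<ominus> p') = a \<ominus> a'" using c t(1) by algebra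
      ultimately have aa: "a = a'" using Y(4) a by auto
      have "(a \<oplus> t \<otimes> p) \<ominus> (a' \<oplus> t \<otimes> p') = t \<otimes> (p \<ominus> p')" unfolding aa using c t(1) by algebra
      then have "inv t \<otimes> (t \<otimes> (p \<ominus> p')) \<in> val_ge P (-1 + int (Suc e))" using val_ge_mult[OF P tO(3)] d by metis
      moreover have "inv t \<otimes> (t \<otimes> (p \<ominus> p')) = p \<ominus> p'" using cancel_left(2)[OF t(1,2)] c by simp
      ultimately have "p \<ominus> p' \<in> val_ge P (int e)" by simp
      then show ?thesis using aa Suc a by blast
    qed
    have self: "a \<ominus> a \<in> val_ge P n" if "a \<in> carrier R" for a n
      using that val_ge_closed(2) by (metis r_right_minus_eq)
    have "inj_on (\<lambda>(a, p). a \<oplus> t \<otimes> p) (Y \<times> polys Y t e)"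
    proof (rule inj_onI, clarify)
      fix a p a' p' assume a: "a \<in> Y" "p \<in> polys Y t e" "a' \<in> Y" "p' \<in> polys Y t e"
        and eq: "a \<oplus> t \<otimes> p = a' \<oplus> t \<otimes> p'"
      have "a \<in> carrier R" "p \<in> carrier R" using a Y(2) sub val_ge_closed by blast+
      then have "(a \<oplus> t \<otimes> p) \<ominus> (a \<oplus> t \<otimes> p) \<in> val_ge P (int (Suc e))" using self t(1) by simp
      then show "a = a' \<and> p = p'" using key[OF a(1,3,2,4)] eq by simp
    qed
    then have "card (polys Y t (Suc e)) = card Y * card Y ^ e" unfolding eq
      using Suc by (simp add: card_image card_cartesian_product)
    moreover have "a = c" if ac: "a \<in> polys Y t (Suc e)" "c \<in> polys Y t (Suc e)" "a \<ominus> c \<in> val_ge P (int (Suc e))" for a c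
    proof -
      obtain a1 p1 where 1: "a = a1 \<oplus> t \<otimes> p1" "a1 \<in> Y" "p1 \<in> polys Y t e" using ac(1) unfolding polys.simps(2) by blast
      obtain a2 p2 where 2: "c = a2 \<oplus> t \<otimes> p2" "a2 \<in> Y" "p2 \<in> polys Y t e" using ac(2) unfolding polys.simps(2) by blast
      show ?thesis using key[OF 1(2) 2(2) 1(3) 2(3)] ac(3) 1(1) 2(1) by simp
    qed
    moreover have "finite (polys Y t (Suc e))" unfolding eq using Suc Y(1) by simp
    ultimately show ?case by simp
  qed simp
  have "card (polys Y t e) = card K ^ (e * pdeg P)" using inc[of e] Y(3) by (simp add: power_mult[symmetric] mult.commute)
  then show ?thesis using inc[of e] sub[of e] by (intro exI[of _ "polys Y t e"]) blast
qed

text \<open>A count in the style of the Chinese remainder theorem: a choice of residues modulo the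
  v(f)-th power of each place of \<open>S\<close> lifts, by weak approximation, to the ring of
  elements regular on \<open>S\<close>. Different choices are incongruent modulo \<open>f\<close>
  there, so \<open>incongruent_card\<close> bounds their number.\<close>

theorem fundamental_inequality:
  assumes g: "g1 \<in> polys K V (Suc N)" "g2 \<in> polys K V (Suc N)" "g1 \<noteq> \<zero>" "g2 \<noteq> \<zero>"
    and f: "f = g1 \<otimes> inv g2" and S: "finite S" "S \<subseteq> Pl" "\<And>P. P \<in> S \<Longrightarrow> v P f \<ge> 0"
  shows "(\<Sum>P\<in>S. v P f * int (pdeg P)) \<le> int (s * N)"
proof -
  have gc: "g1 \<in> carrier R" "g2 \<in> carrier R" using g polysK_closed by auto
  have fc: "f \<in> carrier R" unfolding f using gc nz_inv[OF gc(2) g(4)] by simp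
  define e where "e P = nat (v P f)" for P
  define good where "good P Y \<longleftrightarrow> finite Y \<and> Y \<subseteq> val_ge P 0 \<and> card Y = card K ^ (e P * pdeg P) \<and>
    (\<forall>a\<in>Y. \<forall>c\<in>Y. a \<noteq> c \<longrightarrow> a \<ominus> c \<notin> val_ge P (int (e P)))" for P Y
  have "\<forall>P\<in>S. \<exists>Y. good P Y"
    unfolding good_def using residue_system_power S(2) by blast
  from bchoice[OF this] obtain Y where "\<forall>P\<in>S. good P (Y P)" by blast
  then have Y: "\<And>P. P \<in> S \<Longrightarrow> finite (Y P)" "\<And>P. P \<in> S \<Longrightarrow> Y P \<subseteq> val_ge P 0"
    "\<And>P. P \<in> S \<Longrightarrow> card (Y P) = card K ^ (e P * pdeg P)"
    "\<And>P a c. P \<in> S \<Longrightarrow> a \<in> Y P \<Longrightarrow> c \<in> Y P \<Longrightarrow> a \<ominus> c \<in> val_ge P (int (e P)) \<Longrightarrow> a = c"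
    unfolding good_def by auto
  \<comment> \<open>One precision for all places, at least as large as each exponent
    \<open>e P\<close>.\<close>
  define n where "n = int (\<Sum>P\<in>S. e P)"
  have en: "int (e P) \<le> n" if "P \<in> S" for P
    unfolding n_def of_nat_le_iff by (rule member_le_sum[OF that]) (use S(1) in auto)
  define Z where "Z = PiE S Y"
  have "\<forall>h\<in>Z. \<exists>z\<in>carrier R. \<forall>P\<in>S. z \<ominus> h P \<in> val_ge P n"
  proof
    fix h assume "h \<in> Z"
    then have "h P \<in> carrier R" if "P \<in> S" for P using Y(2)[OF that] val_ge_closed that unfolding Z_def by blast
    then show "\<exists>z\<in>carrier R. \<forall>P\<in>S. z \<ominus> h P \<in> val_ge P n" using weak_approximation[OF S(1,2)] by blast
  qed
  then obtain z where z: "\<And>h. h \<in> Z \<Longrightarrow> z h \<in> carrier R" "\<And>h P. h \<in> Z \<Longrightarrow> P \<in> S \<Longrightarrow> z h \<ominus> h P \<in> val_ge P n"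
    by metis
  define M where "M = {z \<in> carrier R. \<forall>P\<in>S. z \<in> val_ge P 0}"
  have sr: "subring (val_ge P 0) R" if "P \<in> S" for P using val_ge_ring(1) S(2) that by blast
  have M: "subring M R"
  proof (rule subringI)
    show "M \<subseteq> carrier R" by (auto simp: M_def)
    show "\<one> \<in> M" using subringE(3)[OF sr] by (auto simp: M_def)
    show "\<ominus> h \<in> M" if "h \<in> M" for h using subringE(5)[OF sr] that by (auto simp: M_def)
    show "h1 \<otimes> h2 \<in> M" if "h1 \<in> M" "h2 \<in> M" for h1 h2 using subringE(6)[OF sr] that by (auto simp: M_def)
    show "h1 \<oplus> h2 \<in> M" if "h1 \<in> M" "h2 \<in> M" for h1 h2 using subringE(7)[OF sr] that by (auto simp: M_def)
  qed
  have fM: "f \<in> M" unfolding M_def using fc S(3) by (auto simp: val_ge_def)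
  have fo: "f \<in> val_ge P (int (e P))" if "P \<in> S" for P using fc S(3)[OF that] by (auto simp: val_ge_def e_def)
  have hc: "h P \<in> val_ge P 0" "h P \<in> carrier R" "h P \<in> Y P" if "h \<in> Z" "P \<in> S" for h P
    using that Y(2)[OF that(2)] val_ge_closed unfolding Z_def by blast+
  have n0: "n \<ge> 0" unfolding n_def by (rule of_nat_0_le_iff)
  have zM: "z h \<in> M" if h: "h \<in> Z" for h
    unfolding M_def
  proof (intro CollectI conjI ballI)
    show "z h \<in> carrier R" using z h by simp
    fix P assume P: "P \<in> S"
    have "(z h \<ominus> h P) \<oplus> h P \<in> val_ge P 0"
      using val_ge_add[of P "z h \<ominus> h P" 0 "h P"] z(2)[OF h P] hc[OF h P] val_ge_mono[OF n0] S(2) P by auto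
    moreover have "(z h \<ominus> h P) \<oplus> h P = z h" using z(1)[OF h] hc[OF h P] by algebra
    ultimately show "z h \<in> val_ge P 0" by simp
  qed
  have key: "h = h'" if h: "h \<in> Z" "h' \<in> Z" "z h \<ominus> z h' \<in> {f \<otimes> c | c. c \<in> M}" for h h'
  proof -
    obtain c where c: "c \<in> M" "z h \<ominus> z h' = f \<otimes> c" using h(3) by blast
    have "h P = h' P" if P: "P \<in> S" for P
    proof -
      have Pp: "P \<in> Pl" using P S by auto
      have "f \<otimes> c \<in> val_ge P (int (e P) + 0)" using val_ge_mult[OF Pp fo[OF P]] c(1) P unfolding M_def by blast
      then have 1: "z h \<ominus> z h' \<in> val_ge P (int (e P))" using c(2) by simp
      have 2: "z h \<ominus> h P \<in> val_ge P (int (e P))" "z h' \<ominus> h' P \<in> val_ge P (int (e P))"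
        using z(2)[OF h(1) P] z(2)[OF h(2) P] val_ge_mono[OF en[OF P]] by auto
      have "(z h \<ominus> z h') \<ominus> ((z h \<ominus> h P) \<ominus> (z h' \<ominus> h' P)) \<in> val_ge P (int (e P))"
        using val_ge_minus[OF Pp 1 val_ge_minus[OF Pp 2]] .
      moreover have "(z h \<ominus> z h') \<ominus> ((z h \<ominus> h P) \<ominus> (z h' \<ominus> h' P)) = h P \<ominus> h' P"
        using z(1)[OF h(1)] z(1)[OF h(2)] hc(2)[OF h(1) P] hc(2)[OF h(2) P] by algebra
      ultimately show ?thesis using Y(4)[OF P hc(3)[OF h(1) P] hc(3)[OF h(2) P]] by simp
    qed
    then show ?thesis using h(1,2) unfolding Z_def by (rule PiE_ext[rotated 2])
  qed
  have finZ: "finite Z" unfolding Z_def using S(1) Y(1) by (intro finite_PiE)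
  have inj: "inj_on z Z"
  proof (rule inj_onI)
    fix h h' assume h: "h \<in> Z" "h' \<in> Z" "z h = z h'"
    have "z h \<ominus> z h' = \<zero>" unfolding h(3) using z(1)[OF h(2)] by (simp add: a_minus_def r_neg)
    also have "\<zero> = f \<otimes> \<zero>" using fc by simp
    finally have "z h \<ominus> z h' \<in> {f \<otimes> c | c. c \<in> M}" using subringE(2)[OF M] by blast
    then show "h = h'" by (rule key[OF h(1,2)])
  qed
  have "incongruent M f (z ` Z)" unfolding incongruent_def
  proof (intro conjI ballI impI)
    show "finite (z ` Z)" using finZ by simp
    show "z ` Z \<subseteq> M" using zM by auto
    fix a c assume a: "a \<in> z ` Z" and c: "c \<in> z ` Z" and ne: "a \<noteq> c"
    obtain h where h: "h \<in> Z" "a = z h" using a by auto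
    obtain h' where h': "h' \<in> Z" "c = z h'" using c by auto
    show "a \<ominus> c \<notin> {f \<otimes> c | c. c \<in> M}" using key[OF h(1) h'(1)] h h' ne by auto
  qed
  from incongruent_card[OF g f M fM this]
  have "card Z \<le> card K ^ (s * N)" using card_image[OF inj] by simp
  moreover have "card Z = (\<Prod>P\<in>S. card K ^ (e P * pdeg P))"
    unfolding Z_def using Y(3) S(1) by (simp add: card_PiE)
  ultimately have "card K ^ (\<Sum>P\<in>S. e P * pdeg P) \<le> card K ^ (s * N)" by (simp add: power_sum)
  then have "(\<Sum>P\<in>S. e P * pdeg P) \<le> s * N" using card_K power_le_imp_le_exp by (metis Suc_1 Suc_le_lessD)
  moreover have "(\<Sum>P\<in>S. v P f * int (pdeg P)) = int (\<Sum>P\<in>S. e P * pdeg P)"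
    using S(3) by (simp add: e_def)
  ultimately show ?thesis by (simp only: of_nat_le_iff)
qed

section \<open>The place at infinity\<close>

lemma V_not_adjoin_inv: "V \<notin> adjoin K (inv V)"
  using adjoin_inv_imp_torsion[OF subfield_K finite_K V_closed V_nz] V_trans by blast

lemma const_polys: "c \<in> K \<Longrightarrow> c \<in> polys K V (Suc n)"
  using polys_const[OF K_closed _ V_closed] subringE(2)[OF subring_K] by blast

lemma V_polys: "V \<in> polys K V (Suc (Suc 0))"
proof -
  have "V \<otimes> \<one> \<in> polys K V (Suc (Suc 0))"
    by (rule polys_shift[OF K_closed _ V_closed const_polys]) (use subringE(2,3)[OF subring_K] in auto)
  then show ?thesis using V_closed by simp
qed

lemma infinite_place_exists: "\<exists>P\<in>Pl. v P V < 0"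
proof -
  note iV = nz_inv[OF V_closed V_nz]
  obtain S where S: "valuation_ring R K S" "V \<notin> S"
    using Chevalley[OF subfield_K iV(1,2)] V_not_adjoin_inv iV(5) by auto
  have "nonunits S \<in> Pl" using S(1) unfolding places_eq by blast
  moreover have "v (nonunits S) V < 0" using v_ring(1)[OF S(1) V_closed V_nz] S(2) by simp
  ultimately show ?thesis by blast
qed

text \<open>The poles of \<open>V\<close> are the zeros of 1/V, a quotient of polynomials of degree
  at most 1, so the inequality is used with N = 1.\<close>

lemma infinite_places_bound:
  assumes S: "finite S" "S \<subseteq> Pl" "\<And>P. P \<in> S \<Longrightarrow> v P V < 0"
  shows "(\<Sum>P\<in>S. - v P V * int (pdeg P)) \<le> int s"
proof -
  have "(\<Sum>P\<in>S. v P (\<one> \<otimes> inv V) * int (pdeg P)) \<le> int (s * 1)"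
    by (rule fundamental_inequality[OF _ _ one_not_zero V_nz refl S(1,2)])
       (use const_polys[OF subringE(3)[OF subring_K]] V_polys S v_inv[OF _ V_closed V_nz] nz_inv[OF V_closed V_nz]
        in \<open>auto simp: less_imp_le subset_iff\<close>)
  moreover have "v P (\<one> \<otimes> inv V) = - v P V" if "P \<in> S" for P
    using v_inv[OF _ V_closed V_nz] nz_inv[OF V_closed V_nz] that S(2) by auto
  ultimately show ?thesis by simp
qed

lemma v_U: assumes P: "P \<in> Pl" shows "int s * v P U = v P V + int b * v P T"
proof -
  have "v P (U [^] s) = v P \<kappa> + (v P V + v P (T [^] b))"
    unfolding U_power using v_mult[OF P] kappa kappa_closed V_closed V_nz T_closed T_nz nz_pow nz_mult by simp
  then show ?thesis
    using v_pow[OF P U_closed U_nz] v_pow[OF P T_closed T_nz] v_const[OF P kappa] by simp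
qed

text \<open>The Kummer equation gives s v(U) = (b + 1) v(V), so \<open>s\<close> divides v(V) by
  coprimality. As pole order times degree is at most \<open>s\<close>, the pole order is
  \<open>s\<close> and the degree is one.\<close>

lemma infinite_place:
  assumes P: "P \<in> Pl" and V: "v P V < 0"
  shows "v P V = - int s" "pdeg P = 1" "v P U = - int (b + 1)" "v P T = - int s"
proof -
  have o: "\<one> \<in> val_ge P (v P V + 1)" using V v_one[OF P] by (simp add: val_ge_def)
  have T: "v P T = v P V" using v_add_less(2)[OF P V_closed V_nz o] .
  have eq: "int s * v P U = int (b + 1) * v P V" using v_U[OF P] T by (simp add: algebra_simps)
  then have "int s dvd int (b + 1) * v P V" by (metis dvd_triv_left)
  moreover have "coprime (int s) (int (b + 1))" using coprime_s by (simp only: coprime_int_iff)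
  ultimately have "int s dvd v P V" using coprime_dvd_mult_right_iff by blast
  then obtain k where k: "v P V = int s * k" by (auto elim: dvdE)
  have kn: "k < 0" using V s_pos k by (simp add: mult_less_0_iff)
  have bd: "- v P V * int (pdeg P) \<le> int s" using infinite_places_bound[of "{P}"] P V by simp
  have d: "int (pdeg P) \<ge> 1" using deg_pos[OF P] by simp
  have "int s * ((- k) * int (pdeg P)) \<le> int s * 1" using bd k by (simp add: algebra_simps)
  moreover have sp: "0 < int s" using s_pos by simp
  ultimately have kd: "(- k) * int (pdeg P) \<le> 1" by (simp only: mult_le_cancel_left_pos[OF sp])
  have "(-k) * 1 \<le> (- k) * int (pdeg P)" using kn d by (intro mult_left_mono) auto
  then have k1: "k = - 1" using kd kn by linarith
  then show "v P V = - int s" "pdeg P = 1" using k kd d by auto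
  then show "v P T = - int s" using T by simp
  have "int s * v P U = int s * (- int (b + 1))" using eq k k1 by (simp add: algebra_simps)
  then show "v P U = - int (b + 1)" using s_pos by simp
qed

definition "Pinf = (SOME P. P \<in> Pl \<and> v P V < 0)"

lemma Pinf: "Pinf \<in> Pl" "v Pinf V = - int s" "pdeg Pinf = 1" "v Pinf U = - int (b + 1)" "v Pinf T = - int s"
proof -
  have "Pinf \<in> Pl \<and> v Pinf V < 0" unfolding Pinf_def by (rule someI_ex) (use infinite_place_exists in blast)
  then show "Pinf \<in> Pl" "v Pinf V = - int s" "pdeg Pinf = 1" "v Pinf U = - int (b + 1)" "v Pinf T = - int s"
    using infinite_place by auto
qed

text \<open>\<open>Pinf\<close> alone exhausts the bound \<open>s\<close> for the poles of
  \<open>V\<close>.\<close>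

lemma finite_place: assumes "Q \<in> Pl" "Q \<noteq> Pinf" shows "v Q V \<ge> 0"
proof (rule ccontr)
  assume "\<not> ?thesis"
  then have n: "v Q V < 0" by simp
  have "(\<Sum>P\<in>{Q, Pinf}. - v P V * int (pdeg P)) \<le> int s"
    by (rule infinite_places_bound) (use assms n Pinf s_pos in auto)
  then show False using assms(2) Pinf infinite_place[OF assms(1) n] s_pos by simp
qed

section \<open>Riemann-Roch spaces: finiteness and growth\<close>

abbreviation "LL \<equiv> riemann_roch_space R K"

lemma LL_iff: "z \<in> LL A \<longleftrightarrow> z \<in> carrier R \<and> (\<forall>P\<in>Pl. z \<in> val_ge P (- A P))"
  unfolding riemann_roch_space_def val_ge_def by auto

lemma LL_additive: "additive_subgroup (LL A) R"
proof (rule additive_subgroupI)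
  show "LL A \<subseteq> carrier R" by (auto simp: LL_iff)
  show "\<zero> \<in> LL A" using val_ge_closed(2) by (auto simp: LL_iff)
  show "a \<ominus> c \<in> LL A" if "a \<in> LL A" "c \<in> LL A" for a c
    using that val_ge_minus by (auto simp: LL_iff)
qed

lemma LL_mult:
  assumes a: "a \<in> LL A" and c: "c \<in> LL C" shows "a \<otimes> c \<in> LL (\<lambda>P. A P + C P)"
proof -
  have "a \<otimes> c \<in> val_ge P (- A P + - C P)" if P: "P \<in> Pl" for P
    by (rule val_ge_mult[OF P]) (use a c P in \<open>auto simp: LL_iff\<close>)
  moreover have "- (A P + C P) = - A P + - C P" for P by simp
  ultimately show ?thesis using a c by (auto simp: LL_iff)
qed

lemma K_LL: "k \<in> K \<Longrightarrow> k \<in> LL (\<lambda>_. 0)"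
  using K_val_ge K_closed by (auto simp: LL_iff)

lemma LL_smult: "k \<in> K \<Longrightarrow> c \<in> LL A \<Longrightarrow> k \<otimes> c \<in> LL A"
  using LL_mult[OF K_LL, of k c A] by simp

lemma LL_mono: "(\<And>P. P \<in> Pl \<Longrightarrow> A P \<le> C P) \<Longrightarrow> LL A \<subseteq> LL C"
  using val_ge_mono by (auto simp: LL_iff) (meson neg_le_iff_le subsetD)

text \<open>An element whose only pole would be at infinity but which vanishes there has no pole, whereas
  by Chevalley's theorem every non-constant element has one.\<close>

lemma no_poles:
  assumes z: "z \<in> carrier R" "z \<noteq> \<zero>" "\<And>P. P \<in> Pl \<Longrightarrow> v P z \<ge> 0" shows "v Pinf z = 0"
proof (rule ccontr)
  assume "v Pinf z \<noteq> 0"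
  then have pos: "v Pinf z \<ge> 1" using z(3)[OF Pinf(1)] by simp
  define w where "w = inv z"
  have w: "w \<in> carrier R" "w \<noteq> \<zero>" "inv w = z" using nz_inv[OF z(1,2)] by (auto simp: w_def)
  have vw: "v Pinf w \<le> - 1" unfolding w_def using v_inv[OF Pinf(1) z(1,2)] pos by simp
  have neg: "p \<noteq> \<zero> \<longrightarrow> v Pinf p \<le> 0" if "p \<in> polys K w n" for p n
    using that
  proof (induction n arbitrary: p)
    case (Suc n)
    obtain a r where p: "p = a \<oplus> w \<otimes> r" "a \<in> K" "r \<in> polys K w n" using Suc.prems unfolding polys.simps(2) by blast
    have c: "a \<in> carrier R" "r \<in> carrier R" using p K_closed polys_carrier[OF K_closed w(1)] by auto
    show ?case
    proof (cases "r = \<zero>")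
      case True
      then have "p = a" using p c w by simp
      then show ?thesis using v_const[OF Pinf(1) p(2)] by simp
    next
      case False
      have wr: "w \<otimes> r \<in> carrier R" "w \<otimes> r \<noteq> \<zero>" using w c False nz_mult by auto
      have "v Pinf (w \<otimes> r) \<le> - 1" using v_mult[OF Pinf(1) w(1,2) c(2) False] Suc.IH[OF p(3)] False vw by simp
      moreover have "a \<in> val_ge Pinf 0" using K_val_ge[OF Pinf(1)] p(2) by auto
      ultimately have "a \<in> val_ge Pinf (v Pinf (w \<otimes> r) + 1)" using val_ge_mono[of "v Pinf (w \<otimes> r) + 1" 0 Pinf] by auto
      then have "v Pinf (w \<otimes> r \<oplus> a) = v Pinf (w \<otimes> r)" using v_add_less(2)[OF Pinf(1) wr] by blast
      then show ?thesis unfolding p(1) using \<open>v Pinf (w \<otimes> r) \<le> - 1\<close> c wr by (simp add: a_comm)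
    qed
  qed simp
  have "inv w \<notin> adjoin K w" using neg pos z(2) w(3) by (fastforce simp: adjoin_def)
  then obtain S where S: "valuation_ring R K S" "z \<notin> S" using Chevalley[OF subfield_K w(1,2)] w(3) by auto
  have "nonunits S \<in> Pl" using S(1) unfolding places_eq by blast
  then have "v (nonunits S) z \<ge> 0" by (rule z(3))
  then show False using v_ring(1)[OF S(1) z(1,2)] S(2) by simp
qed

text \<open>The counting form of kernel plus image: subtracting a chosen element embeds each fibre
  of \<open>f\<close> into \<open>Z0\<close>.\<close>

lemma card_fibres:
  assumes Y: "finite Y" "\<And>z. z \<in> Z \<Longrightarrow> f z \<in> Y" and Z: "Z \<subseteq> carrier R" and Z0: "finite Z0"
    and d: "\<And>z z'. z \<in> Z \<Longrightarrow> z' \<in> Z \<Longrightarrow> f z = f z' \<Longrightarrow> z \<ominus> z' \<in> Z0"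
  shows "finite Z \<and> card Z \<le> card Z0 * card Y"
proof -
  define rep where "rep y = (SOME z. z \<in> Z \<and> f z = y)" for y
  have rep: "rep (f z) \<in> Z" "f (rep (f z)) = f z" if "z \<in> Z" for z
    using someI_ex[of "\<lambda>z'. z' \<in> Z \<and> f z' = f z"] that unfolding rep_def by blast+
  define g where "g z = (z \<ominus> rep (f z), f z)" for z
  have "inj_on g Z"
  proof (rule inj_onI)
    fix z z' assume z: "z \<in> Z" "z' \<in> Z" "g z = g z'"
    then have e: "f z = f z'" "z \<ominus> rep (f z) = z' \<ominus> rep (f z)" by (auto simp: g_def)
    have c: "z \<in> carrier R" "z' \<in> carrier R" "rep (f z) \<in> carrier R" using z rep Z by auto
    have "z = (z \<ominus> rep (f z)) \<oplus> rep (f z)" using c by algebra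
    also have "\<dots> = z'" unfolding e(2) using c by algebra
    finally show "z = z'" .
  qed
  moreover have "g ` Z \<subseteq> Z0 \<times> Y" using d rep Y(2) by (auto simp: g_def)
  ultimately show ?thesis
    using Z0 Y(1) card_inj_on_le[of g Z "Z0 \<times> Y"] inj_on_finite[of g Z "Z0 \<times> Y"] by (simp add: card_cartesian_product)
qed

lemma val_ge_shift:
  assumes P: "P \<in> Pl"
  shows "\<exists>t\<in>carrier R. \<forall>z\<in>carrier R. \<forall>m. t \<otimes> z \<in> val_ge P (m + n) \<longleftrightarrow> z \<in> val_ge P m"
proof -
  obtain t where t: "t \<in> carrier R" "t \<noteq> \<zero>" "v P t = 1" using v_uniformizer[OF P] by blast
  obtain w where w: "w \<in> carrier R" "w \<noteq> \<zero>" "v P w = n"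
  proof (cases n)
    case (nonneg k)
    then show ?thesis using that[of "t [^] k"] v_pow[OF P t(1,2), of k] t nz_pow by simp
  next
    case (neg k)
    have "t [^] Suc k \<in> carrier R" "t [^] Suc k \<noteq> \<zero>" using t nz_pow[OF t(1,2), of "Suc k"] by auto
    then show ?thesis using that[of "inv (t [^] Suc k)"] v_inv[OF P, of "t [^] Suc k"] v_pow[OF P t(1,2), of "Suc k"]
        nz_inv[of "t [^] Suc k"] neg t(3) by simp
  qed
  have "w \<otimes> z \<in> val_ge P (m + n) \<longleftrightarrow> z \<in> val_ge P m" if z: "z \<in> carrier R" for z m
  proof (cases "z = \<zero>")
    case True
    then show ?thesis using val_ge_closed(2) w by simp
  next
    case False
    then show ?thesis using v_mult[OF P w(1,2) z False] val_ge_v z w nz_mult by (simp add: val_ge_def)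
  qed
  then show ?thesis using w by blast
qed

text \<open>For \<open>t\<close> of value A P + 1, reducing t z modulo \<open>P\<close> maps the
  larger space to the residue class field; elements with the same residue differ by an element of
  the smaller space.\<close>

lemma LL_step:
  assumes P: "P \<in> Pl" and fin: "finite (LL A)"
  shows "finite (LL (A(P := A P + 1))) \<and> card (LL (A(P := A P + 1))) \<le> card (LL A) * card K ^ pdeg P"
proof -
  obtain Y where Y: "finite Y" "Y \<subseteq> val_ge P 0" "card Y = card K ^ pdeg P" "\<And>z. z \<in> val_ge P 0 \<Longrightarrow> \<exists>a\<in>Y. z \<ominus> a \<in> val_ge P 1"
    using residue_system[OF P] by auto
  obtain t where t: "t \<in> carrier R" "\<And>z m. z \<in> carrier R \<Longrightarrow> t \<otimes> z \<in> val_ge P (m + (A P + 1)) \<longleftrightarrow> z \<in> val_ge P m"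
    using val_ge_shift[OF P, of "A P + 1"] by blast
  define C where "C = A(P := A P + 1)"
  define f where "f z = (SOME a. a \<in> Y \<and> t \<otimes> z \<ominus> a \<in> val_ge P 1)" for z
  have LC: "z \<in> carrier R" "t \<otimes> z \<in> val_ge P 0" if "z \<in> LL C" for z
  proof -
    show c: "z \<in> carrier R" using that by (simp add: LL_iff)
    have "z \<in> val_ge P (- (A P + 1))" using that P by (auto simp: LL_iff C_def)
    then show "t \<otimes> z \<in> val_ge P 0" using t(2)[OF c, of "- (A P + 1)"] by simp
  qed
  have f: "f z \<in> Y" "t \<otimes> z \<ominus> f z \<in> val_ge P 1" if "z \<in> LL C" for z
    using someI_ex[of "\<lambda>a. a \<in> Y \<and> t \<otimes> z \<ominus> a \<in> val_ge P 1"] Y(4)[OF LC(2)[OF that]] unfolding f_def by blast+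
  have "finite (LL C) \<and> card (LL C) \<le> card (LL A) * card Y"
  proof (rule card_fibres[OF Y(1) f(1) _ fin])
    show "LL C \<subseteq> carrier R" using LC by auto
    fix z z' assume z: "z \<in> LL C" "z' \<in> LL C" "f z = f z'"
    have c: "z \<in> carrier R" "z' \<in> carrier R" "f z \<in> carrier R" "f z' \<in> carrier R"
      using z LC f Y(2) val_ge_closed by blast+
    have "(t \<otimes> z \<ominus> f z) \<ominus> (t \<otimes> z' \<ominus> f z') \<in> val_ge P 1" using val_ge_minus[OF P] f z by blast
    moreover have "(t \<otimes> z \<ominus> f z) \<ominus> (t \<otimes> z' \<ominus> f z') = t \<otimes> (z \<ominus> z')"
      unfolding z(3) using c t(1) by algebra
    ultimately have "t \<otimes> (z \<ominus> z') \<in> val_ge P (- A P + (A P + 1))" by simp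
    then have zP: "z \<ominus> z' \<in> val_ge P (- A P)" using t(2)[of "z \<ominus> z'" "- A P"] c by blast
    have "z \<ominus> z' \<in> LL C" using additive_subgroup_minus[OF LL_additive] z by blast
    then show "z \<ominus> z' \<in> LL A" using zP by (auto simp: LL_iff C_def split: if_splits)
  qed
  then show ?thesis using Y(3) by (simp add: C_def)
qed

lemma LL_incr:
  assumes S: "finite S" "S \<subseteq> Pl" and fin: "finite (LL A)"
    and C: "\<And>P. P \<in> S \<Longrightarrow> C P = A P + int (k P)" "\<And>P. P \<notin> S \<Longrightarrow> C P = A P"
  shows "finite (LL C) \<and> card (LL C) \<le> card (LL A) * card K ^ (\<Sum>P\<in>S. k P * pdeg P)"
  using S C
proof (induction S arbitrary: C)
  case empty
  then have "C = A" by auto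
  then show ?case using fin by simp
next
  case (insert P S)
  have one: "finite (LL (D(P := D P + int n))) \<and>
      card (LL (D(P := D P + int n))) \<le> card (LL D) * card K ^ (n * pdeg P)" if "finite (LL D)" for D n
  proof (induction n)
    case (Suc n)
    define D' where "D' = D(P := D P + int n)"
    have eq: "D(P := D P + int (Suc n)) = D'(P := D' P + 1)" by (auto simp: D'_def)
    have fD': "finite (LL D')" "card (LL D') \<le> card (LL D) * card K ^ (n * pdeg P)"
      using Suc unfolding D'_def by blast+
    have l1: "finite (LL (D'(P := D' P + 1)))"
      "card (LL (D'(P := D' P + 1))) \<le> card (LL D') * card K ^ pdeg P"
      using LL_step[OF _ fD'(1), of P] insert.prems by blast+
    note l1(2)
    also have "card (LL D') * card K ^ pdeg P \<le> card (LL D) * card K ^ (n * pdeg P) * card K ^ pdeg P"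
      by (rule mult_le_mono1[OF fD'(2)])
    also have "\<dots> = card (LL D) * card K ^ (Suc n * pdeg P)" by (simp add: power_add mult_ac)
    finally show ?case unfolding eq using l1(1) by blast
  qed (use that in simp)
  define D where "D = C(P := A P)"
  have D: "finite (LL D) \<and> card (LL D) \<le> card (LL A) * card K ^ (\<Sum>P\<in>S. k P * pdeg P)"
    by (rule insert.IH) (use insert in \<open>auto simp: D_def\<close>)
  have eq: "C = D(P := D P + int (k P))" using insert.prems by (auto simp: D_def)
  have f: "finite (LL C)" and "card (LL C) \<le> card (LL D) * card K ^ (k P * pdeg P)"
    using one[of D "k P"] D unfolding eq[symmetric] by blast+
  note this(2)
  also have "card (LL D) * card K ^ (k P * pdeg P)
      \<le> card (LL A) * card K ^ (\<Sum>P\<in>S. k P * pdeg P) * card K ^ (k P * pdeg P)"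
    by (rule mult_le_mono1[OF conjunct2[OF D]])
  also have "\<dots> = card (LL A) * card K ^ (\<Sum>P\<in>insert P S. k P * pdeg P)"
    using insert.hyps by (simp add: power_add mult_ac)
  finally show ?case using f by blast
qed

lemma LL_minus_Pinf: "LL (\<lambda>P. if P = Pinf then -1 else 0) = {\<zero>}"
proof -
  have "z = \<zero>" if z: "z \<in> LL (\<lambda>P. if P = Pinf then -1 else 0)" for z
  proof (rule ccontr)
    assume nz: "z \<noteq> \<zero>"
    have zc: "z \<in> carrier R" using z by (simp add: LL_iff)
    have "v P z \<ge> - (if P = Pinf then -1 else 0)" if "P \<in> Pl" for P
      using z that nz by (auto simp: LL_iff val_ge_def)
    from this this[OF Pinf(1)] show False using no_poles[OF zc nz] by (smt (verit))
  qed
  then show ?thesis using additive_subgroup.zero_closed[OF LL_additive] by blast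
qed

lemma divisor_superset:
  assumes A: "A \<in> divisors R K"
  shows "finite {P. A P \<noteq> 0}" "{P. A P \<noteq> 0} \<subseteq> Pl"
    "finite S \<Longrightarrow> {P. A P \<noteq> 0} \<subseteq> S \<Longrightarrow> divisor_degree R K A = (\<Sum>P\<in>S. A P * int (pdeg P))"
  using A unfolding divisors_def divisor_degree_def by (auto intro!: sum.mono_neutral_left)

text \<open>The growth estimate starts from the divisor -Pinf, whose space is zero since a nonzero
  function without poles cannot vanish at \<open>Pinf\<close>.\<close>

lemma finite_LL: assumes A: "A \<in> divisors R K" shows "finite (LL A)"
proof -
  define A0 where "A0 P = (if P = Pinf then -1 else 0 :: int)" for P
  define S where "S = insert Pinf {P. A P \<noteq> 0}"
  define k where "k P = nat (A P - A0 P)" for P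
  define C where "C P = A0 P + (if P \<in> S then int (k P) else 0)" for P
  have S: "finite S" "S \<subseteq> Pl" using divisor_superset(1,2)[OF A] Pinf(1) by (auto simp: S_def)
  have "finite (LL A0)" using LL_minus_Pinf unfolding A0_def by simp
  then have "finite (LL C)" using LL_incr[OF S, of A0 C k] by (simp add: C_def)
  moreover have "LL A \<subseteq> LL C" by (rule LL_mono) (auto simp: C_def k_def S_def A0_def)
  ultimately show ?thesis by (rule finite_subset[rotated])
qed

lemma card_LL: "A \<in> divisors R K \<Longrightarrow> card (LL A) = card K ^ dim K (LL A)"
  by (rule finite_subspace_card[OF subfield_K finite_K finite_LL LL_additive LL_smult])

text \<open>In other words, degree minus dimension increases with the divisor, so it suffices to
  know it for arbitrarily large divisors.\<close>

lemma dim_LL_incr: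
  assumes A: "A \<in> divisors R K" and C: "C \<in> divisors R K" and le: "\<And>P. A P \<le> C P"
  shows "int (dim K (LL C)) - int (dim K (LL A)) \<le> divisor_degree R K C - divisor_degree R K A"
proof -
  define S where "S = {P. A P \<noteq> 0} \<union> {P. C P \<noteq> 0}"
  have S: "finite S" "S \<subseteq> Pl" using divisor_superset(1,2)[OF A] divisor_superset(1,2)[OF C] by (auto simp: S_def)
  define k where "k P = nat (C P - A P)" for P
  have "card (LL C) \<le> card (LL A) * card K ^ (\<Sum>P\<in>S. k P * pdeg P)"
  proof (rule conjunct2[OF LL_incr[OF S finite_LL[OF A]]])
    show "C P = A P + int (k P)" for P using le[of P] by (simp add: k_def)
    show "C P = A P" if "P \<notin> S" for P using that by (simp add: S_def)
  qed
  then have "card K ^ dim K (LL C) \<le> card K ^ (dim K (LL A) + (\<Sum>P\<in>S. k P * pdeg P))"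
    unfolding card_LL[OF A] card_LL[OF C] by (simp add: power_add)
  then have "dim K (LL C) \<le> dim K (LL A) + (\<Sum>P\<in>S. k P * pdeg P)"
    using card_K power_le_imp_le_exp by (metis Suc_1 Suc_le_lessD)
  then have "int (dim K (LL C)) \<le> int (dim K (LL A)) + int (\<Sum>P\<in>S. k P * pdeg P)"
    by (metis of_nat_add of_nat_le_iff)
  moreover have "int (\<Sum>P\<in>S. k P * pdeg P) = (\<Sum>P\<in>S. C P * int (pdeg P)) - (\<Sum>P\<in>S. A P * int (pdeg P))"
    unfolding sum_subtractf[symmetric] using le by (simp add: k_def left_diff_distrib)
  moreover have "divisor_degree R K A = (\<Sum>P\<in>S. A P * int (pdeg P))" "divisor_degree R K C = (\<Sum>P\<in>S. C P * int (pdeg P))"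
    by (rule divisor_superset(3)[OF A S(1)], force simp: S_def) (rule divisor_superset(3)[OF C S(1)], force simp: S_def)
  ultimately show ?thesis by linarith
qed

end

section \<open>Separating the terms of a sum by eigenvalue or by valuation\<close>

lemma (in ring) additive_finsum:
  assumes B: "additive_subgroup B R" and f: "\<And>i. i \<in> I \<Longrightarrow> f i \<in> B"
  shows "finsum R f I \<in> B"
proof (cases "finite I")
  case True
  note Bc = additive_subgroup.a_subset[OF B]
  show ?thesis using True f
  proof (induction I)
    case empty
    then show ?case using additive_subgroup.zero_closed[OF B] by simp
  next
    case (insert i I)
    then have "finsum R f (insert i I) = f i \<oplus> finsum R f I" using Bc by (intro finsum_insert) auto
    then show ?case using insert additive_subgroup.a_closed[OF B] by simp
  qed
next
  case False
  then show ?thesis using additive_subgroup.zero_closed[OF B] by (simp add: finsum_infinite)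
qed

text \<open>Applying \<phi> - ev k removes the component \<open>t k\<close> and multiplies every
  other one by the nonzero constant ev i - ev k, so induction recovers these. The stable subspace
  \<open>B\<close> will be the ring of functions without finite poles and, later on, a fixed
  field.\<close>

lemma (in field) eigen_components:
  assumes K: "subfield K R" and B: "additive_subgroup B R" "\<And>c z. c \<in> K \<Longrightarrow> z \<in> B \<Longrightarrow> c \<otimes> z \<in> B"
    and \<phi>: "\<phi> \<in> ring_hom R R" "\<And>c. c \<in> K \<Longrightarrow> \<phi> c = c" "\<And>z. z \<in> B \<Longrightarrow> \<phi> z \<in> B"
    and I: "finite I" and t: "\<And>i. i \<in> I \<Longrightarrow> t i \<in> carrier R" "\<And>i. i \<in> I \<Longrightarrow> \<phi> (t i) = ev i \<otimes> t i"
    and ev: "\<And>i. i \<in> I \<Longrightarrow> ev i \<in> K" "inj_on ev I"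
    and sum: "finsum R t I \<in> B" and i: "i \<in> I"
  shows "t i \<in> B"
proof -
  interpret \<phi>: ring_hom_cring R R \<phi> by unfold_locales (rule \<phi>(1))
  have Kc: "K \<subseteq> carrier R" using subringE(1)[OF subfieldE(1)[OF K]] .
  note Bc = additive_subgroup.a_subset[OF B(1)]
  have "\<forall>i\<in>I. t i \<in> B" using I t ev sum
  proof (induction I arbitrary: t)
    case (insert k I)
    have tc: "t k \<in> carrier R" "t \<in> I \<rightarrow> carrier R" "ev k \<in> carrier R" using insert.prems Kc by auto
    have ec: "ev i \<in> carrier R" "t i \<in> carrier R" if "i \<in> I" for i using insert.prems that Kc by auto
    have S: "finsum R t (insert k I) = t k \<oplus> finsum R t I" using insert.hyps tc by (intro finsum_insert) auto
    define t' where "t' i = (ev i \<ominus> ev k) \<otimes> t i" for i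
    have t'c: "t' \<in> I \<rightarrow> carrier R" unfolding t'_def using ec tc by auto
    have "\<phi> (finsum R t I) = finsum R (\<lambda>i. ev i \<otimes> t i) I"
    proof -
      have "\<phi> (finsum R t I) = finsum R (\<phi> \<circ> t) I" using tc(2) by (rule \<phi>.hom_finsum)
      also have "\<dots> = finsum R (\<lambda>i. ev i \<otimes> t i) I"
        by (rule finsum_cong') (use insert.prems ec in auto)
      finally show ?thesis .
    qed
    moreover have "finsum R (\<lambda>i. ev i \<otimes> t i) I = finsum R (\<lambda>i. t' i \<oplus> ev k \<otimes> t i) I"
    proof (rule finsum_cong')
      fix i assume "i \<in> I"
      then show "ev i \<otimes> t i = t' i \<oplus> ev k \<otimes> t i" unfolding t'_def using ec[of i] tc(3) by algebra
    qed (use t'c tc ec in auto)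
    moreover have "\<dots> = finsum R t' I \<oplus> finsum R (\<lambda>i. ev k \<otimes> t i) I"
      by (rule finsum_addf) (use t'c tc ec in auto)
    moreover have "finsum R (\<lambda>i. ev k \<otimes> t i) I = ev k \<otimes> finsum R t I"
      by (rule finsum_rdistr[symmetric]) (use tc insert.hyps in auto)
    ultimately have phS: "\<phi> (finsum R t I) = finsum R t' I \<oplus> ev k \<otimes> finsum R t I" by simp
    have sc: "finsum R t I \<in> carrier R" "finsum R t' I \<in> carrier R" using tc t'c by auto
    have "\<phi> (finsum R t (insert k I)) = ev k \<otimes> t k \<oplus> (finsum R t' I \<oplus> ev k \<otimes> finsum R t I)"
      unfolding S using phS insert.prems(2)[of k] tc sc by simp
    then have "\<phi> (finsum R t (insert k I)) \<ominus> ev k \<otimes> finsum R t (insert k I)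
        = (ev k \<otimes> t k \<oplus> (finsum R t' I \<oplus> ev k \<otimes> finsum R t I)) \<ominus> ev k \<otimes> (t k \<oplus> finsum R t I)"
      unfolding S by simp
    also have "\<dots> = finsum R t' I" using tc sc by algebra
    finally have "finsum R t' I = \<phi> (finsum R t (insert k I)) \<ominus> ev k \<otimes> finsum R t (insert k I)" ..
    also have "\<dots> \<in> B" by (rule additive_subgroup_minus[OF B(1) \<phi>(3)[OF insert.prems(5)] B(2)[OF _ insert.prems(5)]])
        (use insert.prems(3) in blast)
    finally have t'B: "finsum R t' I \<in> B" .
    have all: "\<forall>i\<in>I. t' i \<in> B"
    proof (rule insert.IH)
      show "t' i \<in> carrier R" if "i \<in> I" for i using t'c that by auto
      show "ev i \<in> K" if "i \<in> I" for i using insert.prems that by auto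
      show "inj_on ev I" using insert.prems by (auto simp: inj_on_def)
      show "\<phi> (t' i) = ev i \<otimes> t' i" if i: "i \<in> I" for i
      proof -
        have d: "ev i \<ominus> ev k \<in> K" using insert.prems i
          by (intro additive_subgroup_minus[OF subring_additive[OF subfieldE(1)[OF K]]]) auto
        have "\<phi> (t' i) = (ev i \<ominus> ev k) \<otimes> (ev i \<otimes> t i)"
          unfolding t'_def using d \<phi>(2)[OF d] ec[OF i] tc insert.prems(2) i by simp
        then show ?thesis unfolding t'_def using ec[OF i] tc by (simp add: m_lcomm)
      qed
    qed (use t'B in auto)
    have tI: "t i \<in> B" if i: "i \<in> I" for i
    proof -
      have d: "ev i \<ominus> ev k \<in> K" using insert.prems i
        by (intro additive_subgroup_minus[OF subring_additive[OF subfieldE(1)[OF K]]]) auto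
      have "ev i \<noteq> ev k" using insert.prems(4) insert.hyps(2) i by (auto simp: inj_on_def)
      then have nz: "ev i \<ominus> ev k \<noteq> \<zero>" using ec[OF i] tc by simp
      then have "inv (ev i \<ominus> ev k) \<in> K" using subfield_m_inv(1)[OF K] d by simp
      then have "inv (ev i \<ominus> ev k) \<otimes> t' i \<in> B" using B(2) all i by blast
      then show ?thesis unfolding t'_def using cancel_left(2)[of "ev i \<ominus> ev k" "t i"] d nz Kc ec[OF i] by auto
    qed
    have "finsum R t I \<in> B" by (rule additive_finsum[OF B(1)]) (rule tI)
    then have "finsum R t (insert k I) \<ominus> finsum R t I \<in> B" using additive_subgroup_minus[OF B(1)] insert.prems by blast
    moreover have "finsum R t (insert k I) \<ominus> finsum R t I = t k" unfolding S using tc sc by algebra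
    ultimately show ?case using tI by auto
  qed simp
  then show ?thesis using i by blast
qed

context kummer_extension
begin

text \<open>The term of least value cannot be cancelled by the others, so it determines the value of
  the sum.\<close>

lemma distinct_valuations:
  assumes P: "P \<in> Pl" and I: "finite I" and t: "\<And>i. i \<in> I \<Longrightarrow> t i \<in> carrier R"
    and d: "\<And>i j. i \<in> I \<Longrightarrow> j \<in> I \<Longrightarrow> t i \<noteq> \<zero> \<Longrightarrow> t j \<noteq> \<zero> \<Longrightarrow> v P (t i) = v P (t j) \<Longrightarrow> i = j"
    and sum: "finsum R t I \<in> val_ge P n" and i: "i \<in> I"
  shows "t i \<in> val_ge P n"
proof (rule ccontr)
  assume "t i \<notin> val_ge P n"
  define J where "J = {i \<in> I. t i \<notin> val_ge P n}"
  have J: "finite J" "J \<noteq> {}" using I i \<open>t i \<notin> val_ge P n\<close> by (auto simp: J_def)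
  obtain k where k: "k \<in> J" "\<And>j. j \<in> J \<Longrightarrow> v P (t k) \<le> v P (t j)"
    using ex_min_if_finite[of "(\<lambda>j. v P (t j)) ` J"] J
    by (metis (no_types, lifting) arg_min_if_finite(1) arg_min_least)
  have kI: "k \<in> I" "t k \<in> carrier R" "t k \<notin> val_ge P n" using k t by (auto simp: J_def)
  then have kn: "t k \<noteq> \<zero>" "v P (t k) < n" by (auto simp: val_ge_def)
  have oth: "t j \<in> val_ge P (v P (t k) + 1)" if j: "j \<in> I - {k}" for j
  proof (cases "t j = \<zero>")
    case False
    have "v P (t k) \<noteq> v P (t j)" using d[of k j] j kI kn False by auto
    moreover have "v P (t k) \<le> v P (t j)"
      using k(2)[of j] j kn False by (cases "j \<in> J") (auto simp: J_def val_ge_def)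
    ultimately show ?thesis using t j False by (auto simp: val_ge_def)
  qed (simp add: val_ge_closed(2))
  have "finsum R t I = finsum R t (insert k (I - {k}))" using kI by (simp add: insert_absorb)
  also have "\<dots> = t k \<oplus> finsum R t (I - {k})" using I t kI by (intro finsum_insert) auto
  finally have S: "finsum R t I = t k \<oplus> finsum R t (I - {k})" .
  have "finsum R t (I - {k}) \<in> val_ge P (v P (t k) + 1)" by (rule additive_finsum[OF val_ge_additive[OF P]]) (rule oth)
  then have "finsum R t I \<noteq> \<zero>" "v P (finsum R t I) = v P (t k)"
    unfolding S using v_add_less[OF P kI(2) kn(1)] by auto
  then show False using sum kn by (auto simp: val_ge_def)
qed

text \<open>The leading term dominates at infinity, where \<open>V\<close> has a pole of order
  \<open>s\<close>; so the value there reveals the degree \<open>j\<close>.\<close>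

lemma v_polys:
  assumes "p \<in> polys K V n" "p \<noteq> \<zero>"
  shows "\<exists>j<n. p \<in> polys K V (Suc j) \<and> v Pinf p = - int (s * j)"
  using assms
proof (induction n arbitrary: p)
  case (Suc n)
  obtain a r where p: "p = a \<oplus> V \<otimes> r" "a \<in> K" "r \<in> polys K V n" using Suc.prems unfolding polys.simps(2) by blast
  have c: "a \<in> carrier R" "r \<in> carrier R" using p K_closed polysK_closed by auto
  show ?case
  proof (cases "r = \<zero>")
    case True
    then have pa: "p = a" using p c V_closed by simp
    then have "p \<in> polys K V (Suc 0)" "v Pinf p = 0" using const_polys p(2) v_const[OF Pinf(1)] Suc.prems by auto
    then show ?thesis by (intro exI[of _ 0]) auto
  next
    case False
    obtain j where j: "j < n" "r \<in> polys K V (Suc j)" "v Pinf r = - int (s * j)" using Suc.IH[OF p(3) False] by blast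
    have Vr: "V \<otimes> r \<in> carrier R" "V \<otimes> r \<noteq> \<zero>" using V_closed V_nz c False nz_mult by auto
    have vVr: "v Pinf (V \<otimes> r) = - int (s * Suc j)"
      using v_mult[OF Pinf(1) V_closed V_nz c(2) False] j(3) Pinf(2) by simp
    have "a \<in> val_ge Pinf 0" using K_val_ge[OF Pinf(1)] p(2) by auto
    moreover have "v Pinf (V \<otimes> r) + 1 \<le> 0"
    proof -
      have "int (s * Suc j) = int s + int s * int j" "0 \<le> int s * int j" by (simp_all add: algebra_simps)
      then show ?thesis using vVr s_pos by linarith
    qed
    ultimately have "a \<in> val_ge Pinf (v Pinf (V \<otimes> r) + 1)" using val_ge_mono by blast
    then have "v Pinf (V \<otimes> r \<oplus> a) = v Pinf (V \<otimes> r)" using v_add_less(2)[OF Pinf(1) Vr] by blast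
    then have "v Pinf p = - int (s * Suc j)" unfolding p(1) using vVr c Vr by (simp only: a_comm)
    moreover have "p \<in> polys K V (Suc (Suc j))" unfolding p(1) using polys_SucI[OF p(2) j(2)] .
    ultimately show ?thesis using j(1) by blast
  qed
qed simp

lemma v_KV: "p \<in> KV \<Longrightarrow> p \<noteq> \<zero> \<Longrightarrow> \<exists>j. p \<in> polys K V (Suc j) \<and> v Pinf p = - int (s * j)"
  using v_polys unfolding adjoin_def by blast

lemma card_polysK: "card (polys K V n) = card K ^ n"
  by (rule card_polys_nontorsion[OF subfield_K finite_K V_closed V_nz V_trans])

text \<open>The \<open>w i\<close> with \<open>i < s\<close> are a \<open>K[V]\<close>-basis of the ring of functions without finite poles. Their
  pole orders \<open>pole_order i\<close> at infinity are pairwise incongruent modulo \<open>s\<close>, so \<open>gaps\<close> is the number of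
  gaps.\<close>

definition T_exp where "T_exp i = i * b div s"
definition pole_order where "pole_order i = i * (b + 1) - s * T_exp i"
definition w where "w i = U [^] i \<otimes> inv (T [^] T_exp i)"
definition gaps where "gaps = (\<Sum>i<s. pole_order i div s)"

lemma s_T_exp: "s * T_exp i \<le> i * b" unfolding T_exp_def by simp

lemma w_closed: "w i \<in> carrier R" "w i \<noteq> \<zero>"
  using nz_inv[OF nat_pow_closed[OF T_closed] nz_pow[OF T_closed T_nz]] U_closed nz_pow[OF U_closed U_nz] nz_mult
  unfolding w_def by auto

lemma v_w: assumes P: "P \<in> Pl" shows "v P (w i) = int i * v P U - int (T_exp i) * v P T"
proof -
  note Tp = nat_pow_closed[OF T_closed, of "T_exp i"] nz_pow[OF T_closed T_nz, of "T_exp i"]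
  have "v P (w i) = v P (U [^] i) + v P (inv (T [^] T_exp i))"
    unfolding w_def using v_mult[OF P] nz_inv[OF Tp] U_closed nz_pow[OF U_closed U_nz] by simp
  then show ?thesis using v_inv[OF P Tp] v_pow[OF P U_closed U_nz] v_pow[OF P T_closed T_nz] by simp
qed

lemma v_w_Pinf: "v Pinf (w i) = - int (pole_order i)"
proof -
  have "s * T_exp i \<le> i * (b + 1)" using s_T_exp[of i] by simp
  then have "int (pole_order i) = int (i * (b + 1)) - int (s * T_exp i)" unfolding pole_order_def by (rule of_nat_diff)
  then show ?thesis using v_w[OF Pinf(1), of i] Pinf(4,5) by (simp add: algebra_simps)
qed

lemma v_T_V:
  assumes P: "P \<in> Pl" and V: "v P V \<ge> 0"
  shows "v P T \<ge> 0" "v P V > 0 \<Longrightarrow> v P T = 0"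
proof -
  have "V \<in> val_ge P 0" "\<one> \<in> val_ge P 0" using V V_closed v_one[OF P] by (auto simp: val_ge_def)
  then have "T \<in> val_ge P 0" using val_ge_add[OF P] by blast
  then show "v P T \<ge> 0" using T_nz by (auto simp: val_ge_def)
  assume "v P V > 0"
  then have "V \<in> val_ge P (v P \<one> + 1)" using V_closed v_one[OF P] by (auto simp: val_ge_def)
  then have "v P (\<one> \<oplus> V) = v P \<one>" using v_add_less(2)[OF P one_closed one_not_zero] by blast
  then show "v P T = 0" using v_one[OF P] V_closed by (simp add: a_comm)
qed

text \<open>One has s v(w i) = i v(V) + (i b mod s) v(T), and at a finite place at most one of v(V),
  v(T) is positive. Thus \<open>T_exp i\<close>, the integer part of i b / s, is the largest
  exponent that keeps \<open>w i\<close> regular at zeros of \<open>T\<close>, and the value that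
  remains is strictly below v(V) or v(T).\<close>

lemma v_w_finite:
  assumes P: "P \<in> Pl" "P \<noteq> Pinf" and i: "i < s"
  shows "v P (w i) \<ge> 0" "v P V = 0 \<Longrightarrow> v P T = 0 \<Longrightarrow> v P (w i) = 0"
    "v P V > 0 \<Longrightarrow> v P (w i) < v P V" "v P T > 0 \<Longrightarrow> v P (w i) < v P T"
proof -
  note V = finite_place[OF P] and T = v_T_V[OF P(1) finite_place[OF P]]
  have eq: "int s * v P (w i) = int i * v P V + int (i * b - s * T_exp i) * v P T"
  proof -
    have e1: "int (i * b - s * T_exp i) = int i * int b - int s * int (T_exp i)" using s_T_exp[of i] by (simp add: of_nat_diff)
    have "int s * v P (w i) = int i * (int s * v P U) - int s * int (T_exp i) * v P T"
      unfolding v_w[OF P(1)] by (simp add: algebra_simps)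
    then have e2: "int s * v P (w i) = int i * (v P V + int b * v P T) - int s * int (T_exp i) * v P T"
      unfolding v_U[OF P(1)] .
    show ?thesis unfolding e1 e2 by (simp add: algebra_simps)
  qed
  have sp: "0 < int s" using s_pos by simp
  have "0 \<le> int s * v P (w i)" unfolding eq using V T by (intro add_nonneg_nonneg mult_nonneg_nonneg) auto
  then show "v P (w i) \<ge> 0" using sp by (simp add: zero_le_mult_iff)
  show "v P (w i) = 0" if "v P V = 0" "v P T = 0" using eq that sp by simp
  show "v P (w i) < v P V" if "v P V > 0"
  proof -
    have "int s * v P (w i) < int s * v P V" unfolding eq T(2)[OF that] using that i by simp
    then show ?thesis using sp by (simp only: mult_less_cancel_left_pos)
  qed
  show "v P (w i) < v P T" if t: "v P T > 0"
  proof -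
    have v0: "v P V = 0" using T(2) t V by (cases "v P V > 0") auto
    have "i * b - s * T_exp i < s" using s_pos unfolding T_exp_def by (simp add: minus_mult_div_eq_mod)
    then have "int (i * b - s * T_exp i) * v P T < int s * v P T" using t by (intro mult_strict_right_mono) auto
    then have "int s * v P (w i) < int s * v P T" unfolding eq v0 by simp
    then show ?thesis using sp by (simp only: mult_less_cancel_left_pos)
  qed
qed

section \<open>Spaces at infinity: lower bound for the dimension\<close>

lemma KV_finite: assumes "P \<in> Pl" "P \<noteq> Pinf" shows "KV \<subseteq> val_ge P 0"
proof -
  obtain S where S: "valuation_ring R K S" "P = nonunits S" "val_ge P 0 = S" using place_ring_eq[OF assms(1)] by metis
  have "V \<in> S" using finite_place[OF assms] V_closed S(3)[symmetric] by (simp add: val_ge_def)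
  then show ?thesis using finite_place_closed(1)[OF S(1)] S(3) by simp
qed

definition Rfin where "Rfin = {z \<in> carrier R. \<forall>P\<in>Pl - {Pinf}. z \<in> val_ge P 0}"

definition Dinf :: "nat \<Rightarrow> 'a set \<Rightarrow> int" where "Dinf k = (\<lambda>P. if P = Pinf then int k else 0)"

lemma LL_Dinf: "z \<in> LL (Dinf k) \<longleftrightarrow> z \<in> Rfin \<and> z \<in> val_ge Pinf (- int k)"
  using Pinf(1) by (auto simp: LL_iff Rfin_def Dinf_def)

lemma Dinf_divisor: "Dinf k \<in> divisors R K"
proof -
  have sub: "{P. Dinf k P \<noteq> 0} \<subseteq> {Pinf}" by (auto simp: Dinf_def)
  show ?thesis unfolding divisors_def using finite_subset[OF sub] sub Pinf(1) by auto
qed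

lemma degree_Dinf: "divisor_degree R K (Dinf k) = int k"
proof -
  have sub: "{P. Dinf k P \<noteq> 0} \<subseteq> {Pinf}" by (auto simp: Dinf_def)
  show ?thesis using divisor_superset(3)[OF Dinf_divisor _ sub] Pinf(3) by (simp add: Dinf_def)
qed

text \<open>The pole order s j + pole_order i of V^j w i is at most s L - 1 exactly for j < L -
  pole_order i div s. Taking one less than a multiple of \<open>s\<close> makes this independent of
  pole_order i mod s; truncated subtraction allows no coefficient when the difference is
  negative.\<close>

definition coeff_len where "coeff_len L i = L - pole_order i div s"

text \<open>Modulo \<open>s\<close> the pole order is i (b + 1), and b + 1 is invertible modulo
  \<open>s\<close>.\<close>

lemma pole_order_mod_distinct:
  assumes "i < s" "j < s" "int s dvd int (pole_order i) - int (pole_order j)" shows "i = j"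
proof -
  have pole_order: "int (pole_order i) = int (i * (b + 1)) - int (s * T_exp i)" for i
    unfolding pole_order_def using s_T_exp[of i] by (simp add: of_nat_diff)
  have "int (pole_order i) - int (pole_order j) = int (b + 1) * (int i - int j) - int s * (int (T_exp i) - int (T_exp j))"
    unfolding pole_order by (simp add: algebra_simps)
  then have "int s dvd int (b + 1) * (int i - int j)"
    using assms(3) by (metis diff_add_cancel dvd_add dvd_triv_left)
  moreover have "coprime (int s) (int (b + 1))" using coprime_s by (simp only: coprime_int_iff)
  ultimately have d: "int s dvd int i - int j" using coprime_dvd_mult_right_iff by blast
  show ?thesis
  proof (rule ccontr)
    assume "i \<noteq> j"
    then have "int s \<le> \<bar>int i - int j\<bar>" using dvd_imp_le_int[OF _ d] by simp
    then show False using assms(1,2) by linarith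
  qed
qed

lemma w_distinct:
  assumes i: "i < s" "j < s" and r: "r \<in> carrier R" "r \<noteq> \<zero>" "int s dvd v Pinf r"
    and r': "r' \<in> carrier R" "r' \<noteq> \<zero>" "int s dvd v Pinf r'"
    and eq: "v Pinf (r \<otimes> w i) = v Pinf (r' \<otimes> w j)"
  shows "i = j"
proof -
  have "v Pinf r - int (pole_order i) = v Pinf r' - int (pole_order j)"
    using eq v_mult[OF Pinf(1) r(1,2) w_closed] v_mult[OF Pinf(1) r'(1,2) w_closed] v_w_Pinf by simp
  then have "int (pole_order i) - int (pole_order j) = v Pinf r - v Pinf r'" by simp
  then show ?thesis using pole_order_mod_distinct[OF i] dvd_diff[OF r(3) r'(3)] by simp
qed

definition w_comb where "w_comb r = (\<Oplus>i\<in>{..<s}. r i \<otimes> w i)"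

lemma w_comb_mem:
  assumes L: "L \<ge> 1" and r: "\<And>i. i < s \<Longrightarrow> r i \<in> polys K V (coeff_len L i)"
  shows "w_comb r \<in> LL (Dinf (s * L - 1))"
  unfolding w_comb_def
proof (rule additive_finsum[OF LL_additive])
  fix i assume "i \<in> {..<s}"
  then have i: "i < s" by simp
  have rc: "r i \<in> carrier R" using r[OF i] polysK_closed by auto
  show "r i \<otimes> w i \<in> LL (Dinf (s * L - 1))"
  proof (cases "r i = \<zero>")
    case True
    then show ?thesis using w_closed additive_subgroup.zero_closed[OF LL_additive] by simp
  next
    case False
    obtain j where j: "j < coeff_len L i" "v Pinf (r i) = - int (s * j)" using v_polys[OF r[OF i] False] by blast
    have "s * j + pole_order i \<le> s * L - 1"
    proof -
      have "j + pole_order i div s + 1 \<le> L" using j(1) unfolding coeff_len_def by linarith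
      then have "s * (j + pole_order i div s + 1) \<le> s * L" by (rule mult_le_mono2)
      moreover have "pole_order i mod s < s" using s_pos by simp
      moreover have "pole_order i = s * (pole_order i div s) + pole_order i mod s" by simp
      moreover have "s * (j + pole_order i div s + 1) = s * j + s * (pole_order i div s) + s" by (simp add: algebra_simps)
      ultimately show ?thesis by linarith
    qed
    then have "int (s * j) + int (pole_order i) \<le> int (s * L - 1)" by linarith
    moreover have "v Pinf (r i \<otimes> w i) = - int (s * j) - int (pole_order i)"
      using v_mult[OF Pinf(1) rc False w_closed] j(2) v_w_Pinf by simp
    ultimately have "r i \<otimes> w i \<in> val_ge Pinf (- int (s * L - 1))" using rc w_closed by (simp add: val_ge_def)
    moreover have "r i \<otimes> w i \<in> val_ge P 0" if P: "P \<in> Pl" "P \<noteq> Pinf" for P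
    proof -
      have "r i \<in> val_ge P 0" using KV_finite[OF P] r[OF i] by (auto simp: adjoin_def)
      moreover have "w i \<in> val_ge P 0" using v_w_finite(1)[OF P i] w_closed by (simp add: val_ge_def)
      ultimately have "r i \<otimes> w i \<in> val_ge P (0 + 0)" using val_ge_mult[OF P(1)] by blast
      then show ?thesis by simp
    qed
    ultimately show ?thesis unfolding LL_Dinf Rfin_def using rc w_closed by auto
  qed
qed

lemma w_comb_inj: "inj_on w_comb (PiE {..<s} (\<lambda>i. polys K V (coeff_len L i)))"
proof (rule inj_onI)
  fix r r' assume r: "r \<in> PiE {..<s} (\<lambda>i. polys K V (coeff_len L i))" "r' \<in> PiE {..<s} (\<lambda>i. polys K V (coeff_len L i))"
    and eq: "w_comb r = w_comb r'"
  have rc: "r i \<in> carrier R" "r' i \<in> carrier R" "r i \<in> polys K V (coeff_len L i)" "r' i \<in> polys K V (coeff_len L i)" if "i < s" for i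
    using r that polysK_closed by (auto dest!: PiE_mem)
  define d where "d i = (r i \<ominus> r' i) \<otimes> w i" for i
  have dP: "r i \<ominus> r' i \<in> polys K V (coeff_len L i)" "r i \<ominus> r' i \<in> carrier R" if "i < s" for i
    using additive_subgroup_minus[OF polysK_additive] rc that by auto
  have dc: "d i \<in> carrier R" if "i < s" for i using dP that w_closed by (simp add: d_def)
  have "w_comb r = finsum R (\<lambda>i. d i \<oplus> r' i \<otimes> w i) {..<s}" unfolding w_comb_def
  proof (rule finsum_cong')
    fix i assume "i \<in> {..<s}"
    then have "r i \<in> carrier R" "r' i \<in> carrier R" "w i \<in> carrier R" using rc w_closed by auto
    then show "r i \<otimes> w i = d i \<oplus> r' i \<otimes> w i" unfolding d_def by algebra
  qed (use dc rc w_closed in auto)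
  also have "\<dots> = finsum R d {..<s} \<oplus> w_comb r'"
    unfolding w_comb_def by (rule finsum_addf) (use dc rc w_closed in auto)
  finally have "finsum R d {..<s} \<oplus> w_comb r' = w_comb r'" using eq by simp
  moreover have "w_comb r' \<in> carrier R" unfolding w_comb_def using rc w_closed by auto
  moreover have "finsum R d {..<s} \<in> carrier R" using dc by auto
  ultimately have z: "finsum R d {..<s} = \<zero>" by (metis add.r_cancel_one')
  have "r i = r' i" if i: "i < s" for i
  proof (rule ccontr)
    assume "r i \<noteq> r' i"
    then have nz: "r i \<ominus> r' i \<noteq> \<zero>" using rc[OF i] by simp
    then have dn: "d i \<noteq> \<zero>" unfolding d_def using nz_mult w_closed dP[OF i] by simp
    \<comment> \<open>The sum is zero and zero lies in every \<open>val_ge\<close>, so the bound one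
      above the value of \<open>d i\<close> would have to hold for \<open>d i\<close> too.\<close>
    have "d i \<in> val_ge Pinf (v Pinf (d i) + 1)"
    proof (rule distinct_valuations[OF Pinf(1), of "{..<s}"])
      fix i j assume ij: "i \<in> {..<s}" "j \<in> {..<s}" "d i \<noteq> \<zero>" "d j \<noteq> \<zero>" "v Pinf (d i) = v Pinf (d j)"
      have n: "r i \<ominus> r' i \<noteq> \<zero>" "r j \<ominus> r' j \<noteq> \<zero>" using ij(3,4) w_closed unfolding d_def by auto
      have dv: "int s dvd v Pinf p" if "p \<in> polys K V n" "p \<noteq> \<zero>" for p n using v_polys[OF that] by auto
      show "i = j" by (rule w_distinct[OF _ _ dP(2) n(1) dv[OF dP(1) n(1)] dP(2) n(2) dv[OF dP(1) n(2)]])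
          (use ij in \<open>auto simp: d_def\<close>)
    qed (use dc i z val_ge_closed(2) in auto)
    then show False using dn by (simp add: val_ge_def)
  qed
  then show "r = r'" using r by (intro PiE_ext) auto
qed

lemma sum_coeff_len:
  assumes "\<And>i. i < s \<Longrightarrow> pole_order i div s \<le> L" shows "(\<Sum>i<s. coeff_len L i) + gaps = s * L"
proof -
  have "(\<Sum>i<s. coeff_len L i) + gaps = (\<Sum>i<s. coeff_len L i + pole_order i div s)" unfolding gaps_def by (simp add: sum.distrib)
  also have "\<dots> = (\<Sum>i<s. L)" by (rule sum.cong) (use assms in \<open>auto simp: coeff_len_def\<close>)
  finally show ?thesis by simp
qed

lemma card_combs: "card (PiE {..<s} (\<lambda>i. polys K V (coeff_len L i))) = card K ^ (\<Sum>i<s. coeff_len L i)"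
  by (simp add: card_PiE card_polysK power_sum)

lemma dim_Dinf_lower:
  assumes L: "L \<ge> 1" "\<And>i. i < s \<Longrightarrow> pole_order i div s \<le> L"
  shows "int (dim K (LL (Dinf (s * L - 1)))) \<ge> int (s * L) - int gaps"
proof -
  have "w_comb ` PiE {..<s} (\<lambda>i. polys K V (coeff_len L i)) \<subseteq> LL (Dinf (s * L - 1))"
  proof (rule image_subsetI)
    fix r assume r: "r \<in> PiE {..<s} (\<lambda>i. polys K V (coeff_len L i))"
    show "w_comb r \<in> LL (Dinf (s * L - 1))"
      by (rule w_comb_mem[OF L(1)]) (use PiE_mem[OF r] in simp)
  qed
  then have "card (w_comb ` PiE {..<s} (\<lambda>i. polys K V (coeff_len L i))) \<le> card (LL (Dinf (s * L - 1)))"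
    by (rule card_mono[OF finite_LL[OF Dinf_divisor]])
  then have "card K ^ (\<Sum>i<s. coeff_len L i) \<le> card K ^ dim K (LL (Dinf (s * L - 1)))"
    unfolding card_image[OF w_comb_inj] card_combs card_LL[OF Dinf_divisor] .
  then have "(\<Sum>i<s. coeff_len L i) \<le> dim K (LL (Dinf (s * L - 1)))"
    using card_K power_le_imp_le_exp by (metis Suc_1 Suc_le_lessD)
  then show ?thesis using sum_coeff_len[OF L(2)] by linarith
qed

section \<open>Spaces at infinity: upper bound for the dimension\<close>

lemma phi_ring_hom: "ring_hom_cring R R \<phi>"
  by unfold_locales (rule phi_hom)

lemma phi_KV: assumes "g \<in> KV" shows "\<phi> g = g"
proof -
  interpret \<phi>: ring_hom_cring R R \<phi> by (rule phi_ring_hom)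
  define F where "F = {z \<in> carrier R. \<phi> z = z}"
  have "subring F R" by (rule subringI) (auto simp: F_def)
  then have "KV \<subseteq> F" by (rule adjoin_least) (use phi_K phi_V K_closed V_closed in \<open>auto simp: F_def\<close>)
  then show ?thesis using assms by (auto simp: F_def)
qed

lemma phi_inv:
  assumes "z \<in> carrier R" "z \<noteq> \<zero>" shows "\<phi> z \<noteq> \<zero>" "\<phi> (inv z) = inv (\<phi> z)" "\<phi> z \<in> carrier R"
proof -
  interpret \<phi>: ring_hom_cring R R \<phi> by (rule phi_ring_hom)
  note i = nz_inv[OF assms]
  show c: "\<phi> z \<in> carrier R" using assms by simp
  have "\<phi> (z \<otimes> inv z) = \<phi> z \<otimes> \<phi> (inv z)" using \<phi>.hom_mult[OF assms(1) i(1)] .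
  then have e: "\<phi> z \<otimes> \<phi> (inv z) = \<one>" using i by simp
  then show "\<phi> z \<noteq> \<zero>" using i by auto
  show "\<phi> (inv z) = inv (\<phi> z)" using comm_inv_char[OF c _ e] i by simp
qed

text \<open>Some polynomial \<open>g\<close> clears the pole of 1/t for a prime element
  \<open>t\<close>, so g = (g/t) t vanishes at \<open>P\<close>.\<close>

lemma finite_place_polynomial:
  assumes P: "P \<in> Pl" "P \<noteq> Pinf" shows "\<exists>f\<in>KV. f \<noteq> \<zero> \<and> v P f \<ge> 1"
proof -
  obtain S where S: "valuation_ring R K S" "P = nonunits S" "val_ge P 0 = S" using place_ring_eq[OF P(1)] by metis
  have VS: "V \<in> S" using finite_place[OF P] V_closed S(3)[symmetric] by (simp add: val_ge_def)
  obtain t where t: "t \<in> carrier R" "t \<noteq> \<zero>" "v P t = 1" using v_uniformizer[OF P(1)] by blast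
  note it = nz_inv[OF t(1,2)]
  obtain g where g: "g \<in> KV" "g \<noteq> \<zero>" "g \<otimes> inv \<one> \<otimes> inv t \<in> S" using KV_ratio[OF S(1) it(1)] VS by blast
  have gc: "g \<in> carrier R" using g KV_closed by auto
  have gt: "g \<otimes> inv t \<in> val_ge P 0" using g(3) gc S(3) by simp
  have "t \<in> val_ge P 1" using t by (simp add: val_ge_def)
  then have "(g \<otimes> inv t) \<otimes> t \<in> val_ge P (0 + 1)" using val_ge_mult[OF P(1) gt] by blast
  moreover have "(g \<otimes> inv t) \<otimes> t = g" using gc it t by (simp add: m_assoc)
  ultimately have "v P g \<ge> 1" using g(2) by (auto simp: val_ge_def)
  then show ?thesis using g by blast
qed

text \<open>The preimage under \<phi> of the ring of a finite place is again the ring of a finite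
  place: it contains \<open>V\<close>, and it is proper because \<phi> fixes a polynomial in
  \<open>V\<close> vanishing at \<open>P\<close>, whose inverse stays outside. Regularity of
  \<open>z\<close> at that place is regularity of \<phi>(z) at \<open>P\<close>.\<close>

lemma phi_Rfin: assumes z: "z \<in> Rfin" shows "\<phi> z \<in> Rfin"
proof -
  interpret \<phi>: ring_hom_cring R R \<phi> by (rule phi_ring_hom)
  have zc: "z \<in> carrier R" using z by (simp add: Rfin_def)
  have "\<phi> z \<in> val_ge P 0" if P: "P \<in> Pl" "P \<noteq> Pinf" for P
  proof -
    obtain S where S: "valuation_ring R K S" "P = nonunits S" "val_ge P 0 = S" using place_ring_eq[OF P(1)] by metis
    note D = valuation_ringD[OF S(1)] and SE = subringE[OF valuation_ringD(1)[OF S(1)]]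
    have VS: "V \<in> S" using finite_place[OF P] V_closed S(3)[symmetric] by (simp add: val_ge_def)
    define S' where "S' = {z \<in> carrier R. \<phi> z \<in> S}"
    have sub: "subring S' R" by (rule subringI) (use SE in \<open>auto simp: S'_def\<close>)
    obtain f where f: "f \<in> KV" "f \<noteq> \<zero>" "v P f \<ge> 1" using finite_place_polynomial[OF P] by blast
    have fc: "f \<in> carrier R" using f KV_closed by auto
    note inf = nz_inv[OF fc f(2)]
    have "inv f \<notin> S" using v_ring(1)[OF S(1) inf(1,2)] v_inv[OF P(1) fc f(2)] f(3) S(2) by simp
    then have ni: "inv f \<notin> S'" using phi_inv(2)[OF fc f(2)] phi_KV[OF f(1)] by (simp add: S'_def)
    have VS': "V \<in> S'" using VS V_closed phi_V by (simp add: S'_def)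
    have KS': "K \<subseteq> S'" using D(2) K_closed phi_K by (auto simp: S'_def)
    have vr: "valuation_ring R K S'" unfolding valuation_ring_def
    proof (intro conjI ballI psubsetI)
      show "subring S' R" "K \<subseteq> S'" by fact+
      show "S' \<subseteq> carrier R" by (auto simp: S'_def)
      show "S' \<noteq> carrier R" using ni inf(1) by auto
      show "K \<noteq> S'"
      proof
        assume "K = S'"
        then have "V \<in> K" using VS' by simp
        then show False using v_const[OF Pinf(1) _ V_nz] Pinf(2) s_pos by simp
      qed
      fix x assume x: "x \<in> carrier R - {\<zero>}"
      then have "\<phi> x \<in> S \<or> inv (\<phi> x) \<in> S" using D(5) phi_inv(1,3) by auto
      then show "x \<in> S' \<or> inv x \<in> S'" using x phi_inv(2)[of x] nz_inv(1)[of x] by (auto simp: S'_def)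
    qed
    have Pl': "nonunits S' \<in> Pl" using vr unfolding places_eq by blast
    have "v (nonunits S') V \<ge> 0" using v_ring(1)[OF vr V_closed V_nz] VS' by simp
    then have "nonunits S' \<noteq> Pinf" using Pinf(2) s_pos by auto
    then have "z \<in> val_ge (nonunits S') 0" using z Pl' by (auto simp: Rfin_def)
    then show ?thesis using val_ge_0(1)[OF vr] S(3) by (simp add: S'_def)
  qed
  then show ?thesis using zc by (auto simp: Rfin_def)
qed

text \<open>As \<open>Pinf\<close> has degree one, there are \<open>card K\<close> residue classes;
  distinct constants are incongruent and hence meet all of them.\<close>

lemma residue_Pinf: assumes z: "z \<in> val_ge Pinf 0" shows "\<exists>c\<in>K. z \<ominus> c \<in> val_ge Pinf 1"
proof -
  obtain Y where Y: "finite Y" "Y \<subseteq> val_ge Pinf 0" "card Y = card K"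
    "\<And>z. z \<in> val_ge Pinf 0 \<Longrightarrow> \<exists>a\<in>Y. z \<ominus> a \<in> val_ge Pinf 1"
    using residue_system[OF Pinf(1)] Pinf(3) by auto
  define f where "f z = (SOME a. a \<in> Y \<and> z \<ominus> a \<in> val_ge Pinf 1)" for z
  have f: "f z \<in> Y" "z \<ominus> f z \<in> val_ge Pinf 1" if "z \<in> val_ge Pinf 0" for z
    using someI_ex[of "\<lambda>a. a \<in> Y \<and> z \<ominus> a \<in> val_ge Pinf 1"] Y(4)[OF that] unfolding f_def by blast+
  have close: "x \<ominus> y \<in> val_ge Pinf 1" if xy: "x \<in> val_ge Pinf 0" "y \<in> val_ge Pinf 0" "f x = f y" for x y
  proof -
    have c: "x \<in> carrier R" "y \<in> carrier R" "f y \<in> carrier R" using xy f(1)[of y] Y(2) val_ge_closed by blast+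
    have "(x \<ominus> f x) \<ominus> (y \<ominus> f y) \<in> val_ge Pinf 1" using val_ge_minus[OF Pinf(1)] f(2) xy by blast
    moreover have "(x \<ominus> f x) \<ominus> (y \<ominus> f y) = x \<ominus> y" unfolding xy(3) using c by algebra
    ultimately show ?thesis by simp
  qed
  note Ko = K_val_ge[OF Pinf(1)]
  have "inj_on f K"
  proof (rule inj_onI, rule ccontr)
    fix c c' assume c: "c \<in> K" "c' \<in> K" "f c = f c'" "c \<noteq> c'"
    have "c \<ominus> c' \<in> val_ge Pinf 1" using close c Ko by blast
    moreover have "c \<ominus> c' \<in> K" using additive_subgroup_minus[OF K_additive] c by blast
    moreover have "c \<ominus> c' \<noteq> \<zero>" using c r_right_minus_eq[of c c'] K_closed by blast
    ultimately show False using v_const[OF Pinf(1)] by (force simp: val_ge_def)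
  qed
  then have "f ` K = Y" using Y f(1) Ko by (intro card_subset_eq) (auto simp: card_image)
  then obtain c where "c \<in> K" "f c = f z" using f(1)[OF z] by (metis imageE)
  then show ?thesis using close[OF z, of c] Ko by auto
qed

lemma v_quotient_Pinf:
  assumes "g \<in> KV" "h \<in> KV" "h \<noteq> \<zero>" "g \<otimes> inv h \<noteq> \<zero>"
  shows "int s dvd v Pinf (g \<otimes> inv h)"
proof -
  have c: "g \<in> carrier R" "h \<in> carrier R" using assms KV_closed by auto
  have g0: "g \<noteq> \<zero>" using assms(4) nz_inv(1)[OF c(2) assms(3)] by auto
  have "int s dvd v Pinf g" "int s dvd v Pinf h" using v_KV assms g0 by fastforce+
  moreover have "v Pinf (g \<otimes> inv h) = v Pinf g - v Pinf h"
    using v_mult[OF Pinf(1) c(1) g0] nz_inv[OF c(2) assms(3)] v_inv[OF Pinf(1) c(2) assms(3)] by simp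
  ultimately show ?thesis by (simp add: dvd_diff)
qed

text \<open>Subtracting c V^m with the right residue \<open>c\<close> at infinity improves the bound
  there, and by a full \<open>s\<close>, because elements of K(V) have values divisible by
  \<open>s\<close>. For m = 0 the function has no poles and vanishes at infinity, so it is zero.
  Only the numerator changes along the way.\<close>

lemma rational_polynomial:
  assumes "g \<in> KV" "h \<in> KV" "h \<noteq> \<zero>" "g \<otimes> inv h \<in> Rfin" "g \<otimes> inv h \<in> val_ge Pinf (int s - int (s * m))"
  shows "g \<otimes> inv h \<in> polys K V m"
  using assms
proof (induction m arbitrary: g)
  case 0
  have "g \<otimes> inv h = \<zero>"
  proof (rule ccontr)
    assume nz: "g \<otimes> inv h \<noteq> \<zero>"
    have c: "g \<otimes> inv h \<in> carrier R" using 0 by (simp add: Rfin_def)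
    have vi: "v Pinf (g \<otimes> inv h) \<ge> int s" using 0 nz by (auto simp: val_ge_def)
    have "v P (g \<otimes> inv h) \<ge> 0" if "P \<in> Pl" for P
      using 0(4) nz that vi by (cases "P = Pinf") (auto simp: Rfin_def val_ge_def)
    then have "v Pinf (g \<otimes> inv h) = 0" using no_poles[OF c nz] by blast
    then show False using vi s_pos by simp
  qed
  then show ?case by simp
next
  case (Suc m)
  define \<rho> where "\<rho> = g \<otimes> inv h"
  have hg: "h \<in> carrier R" "g \<in> carrier R" using Suc.prems KV_closed by auto
  note ih = nz_inv[OF hg(1) Suc.prems(3)]
  have rc: "\<rho> \<in> carrier R" using hg ih by (simp add: \<rho>_def)
  have Vm: "V [^] m \<in> carrier R" "V [^] m \<noteq> \<zero>" "V [^] m \<in> KV"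
    using V_closed nz_pow[OF V_closed V_nz] subring_pow[OF KV_subring V_KV] by auto
  note iV = nz_inv[OF Vm(1,2)]
  have vV: "v Pinf (V [^] m) = - int (s * m)" using v_pow[OF Pinf(1) V_closed V_nz] Pinf(2) by simp
  have ro: "\<rho> \<in> val_ge Pinf (- int (s * m))" using Suc.prems(5) by (simp add: \<rho>_def algebra_simps)
  have iVo: "inv (V [^] m) \<in> val_ge Pinf (int (s * m))" using iV v_inv[OF Pinf(1) Vm(1,2)] vV by (simp add: val_ge_def)
  have "\<rho> \<otimes> inv (V [^] m) \<in> val_ge Pinf (- int (s * m) + int (s * m))" by (rule val_ge_mult[OF Pinf(1) ro iVo])
  then obtain c where c: "c \<in> K" "\<rho> \<otimes> inv (V [^] m) \<ominus> c \<in> val_ge Pinf 1" using residue_Pinf by auto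
  have cc: "c \<in> carrier R" "c \<in> KV" using c K_closed K_sub_KV by auto
  define g' where "g' = g \<ominus> h \<otimes> (c \<otimes> V [^] m)"
  have g': "g' \<in> KV" unfolding g'_def
    using additive_subgroup_minus[OF subring_additive[OF KV_subring] Suc.prems(1)]
      subringE(6)[OF KV_subring Suc.prems(2) subringE(6)[OF KV_subring cc(2) Vm(3)]] by blast
  have "g' \<otimes> inv h = \<rho> \<ominus> (h \<otimes> inv h) \<otimes> (c \<otimes> V [^] m)"
    unfolding g'_def \<rho>_def using hg ih(1) cc(1) Vm(1) by algebra
  then have e: "g' \<otimes> inv h = \<rho> \<ominus> c \<otimes> V [^] m" using ih cc Vm by simp
  have rfin: "g' \<otimes> inv h \<in> Rfin"
  proof -
    have "g' \<otimes> inv h \<in> val_ge P 0" if P: "P \<in> Pl" "P \<noteq> Pinf" for P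
    proof -
      have "c \<otimes> V [^] m \<in> val_ge P 0" using KV_finite[OF P] subringE(6)[OF KV_subring cc(2) Vm(3)] by blast
      moreover have "\<rho> \<in> val_ge P 0" using Suc.prems(4) P by (auto simp: Rfin_def \<rho>_def)
      ultimately show ?thesis unfolding e using val_ge_minus[OF P(1)] by blast
    qed
    then show ?thesis unfolding e using rc cc Vm by (auto simp: Rfin_def)
  qed
  have "g' \<otimes> inv h \<in> val_ge Pinf (1 - int (s * m))"
  proof -
    have "V [^] m \<in> val_ge Pinf (- int (s * m))" using Vm vV by (simp add: val_ge_def)
    then have "(\<rho> \<otimes> inv (V [^] m) \<ominus> c) \<otimes> V [^] m \<in> val_ge Pinf (1 + - int (s * m))" using val_ge_mult[OF Pinf(1) c(2)] by blast
    moreover have "(\<rho> \<otimes> inv (V [^] m) \<ominus> c) \<otimes> V [^] m = \<rho> \<otimes> (inv (V [^] m) \<otimes> V [^] m) \<ominus> c \<otimes> V [^] m"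
      using rc iV(1) Vm(1) cc(1) by algebra
    ultimately show ?thesis unfolding e using iV(4) rc by simp
  qed
  then have "g' \<otimes> inv h \<in> val_ge Pinf (int s - int (s * m))"
  proof (cases "g' \<otimes> inv h = \<zero>")
    case False
    assume "g' \<otimes> inv h \<in> val_ge Pinf (1 - int (s * m))"
    then have l: "v Pinf (g' \<otimes> inv h) + int (s * m) \<ge> 1" using False by (auto simp: val_ge_def)
    have "int s dvd v Pinf (g' \<otimes> inv h) + int (s * m)" using v_quotient_Pinf[OF g' Suc.prems(2,3) False] by simp
    then have "int s \<le> v Pinf (g' \<otimes> inv h) + int (s * m)" using l by (intro zdvd_imp_le) auto
    then show ?thesis using rfin by (auto simp: val_ge_def Rfin_def)
  qed (simp add: val_ge_closed(2))
  then have "g' \<otimes> inv h \<in> polys K V m" using Suc.IH[OF g' Suc.prems(2,3) rfin] by blast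
  moreover have "\<rho> = g' \<otimes> inv h \<oplus> c \<otimes> V [^] m" unfolding e using rc cc Vm by algebra
  ultimately show ?case unfolding \<rho>_def[symmetric]
    using c(1) polys_snoc[OF K_closed subringE(2)[OF subring_K] V_closed] by blast
qed

text \<open>The lowest nonzero coefficient is a unit at \<open>P\<close>, so the value is v(D) times
  the number of factors \<open>D\<close> in front of it.\<close>

lemma v_local:
  assumes P: "P \<in> Pl" and D: "D \<in> carrier R" "D \<noteq> \<zero>" "v P D > 0" and p: "p \<in> adjoin K D" "p \<noteq> \<zero>"
  shows "v P D dvd v P p"
proof -
  obtain n where "p \<in> polys K D n" using p by (auto simp: adjoin_def)
  then show ?thesis using p(2)
  proof (induction n arbitrary: p)
    case (Suc n)
    obtain a r where pa: "p = a \<oplus> D \<otimes> r" "a \<in> K" "r \<in> polys K D n" using Suc.prems unfolding polys.simps(2) by blast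
    have sub: "polys K D n \<subseteq> val_ge P 0" by (rule polys_least[OF val_ge_ring(1)[OF P] K_val_ge[OF P]]) (use D in \<open>simp add: val_ge_def\<close>)
    have c: "a \<in> carrier R" "r \<in> carrier R" "r \<in> val_ge P 0" using pa K_closed sub val_ge_closed by blast+
    show ?case
    proof (cases "a = \<zero>")
      case True
      then have pr: "p = D \<otimes> r" using pa c D by simp
      then have "r \<noteq> \<zero>" using Suc.prems D by auto
      then show ?thesis using Suc.IH[OF pa(3)] pr v_mult[OF P D(1,2) c(2)] by simp
    next
      case False
      have "D \<in> val_ge P 1" using D by (simp add: val_ge_def)
      then have "D \<otimes> r \<in> val_ge P (1 + 0)" using val_ge_mult[OF P _ c(3)] by blast
      then have "v P p = 0" unfolding pa(1) using v_add_less(2)[OF P c(1) False] v_const[OF P pa(2) False] by simp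
      then show ?thesis by simp
    qed
  qed simp
qed

lemma KV_sub_adjoin_T: "KV \<subseteq> adjoin K T"
proof -
  have s: "subring (adjoin K T) R" by (rule adjoin_subring[OF subring_K T_closed])
  have g: "T \<in> adjoin K T" "K \<subseteq> adjoin K T" using adjoin_gen[OF subring_K T_closed] adjoin_base[OF subring_K T_closed] by auto
  have "T \<ominus> \<one> \<in> adjoin K T" by (rule additive_subgroup_minus[OF subring_additive[OF s] g(1) subringE(3)[OF s]])
  moreover have "T \<ominus> \<one> = V" using V_closed by algebra
  ultimately show ?thesis using adjoin_least[OF s g(2)] by simp
qed

lemma quotient_local:
  assumes P: "P \<in> Pl" and D: "D \<in> {V, T}" "v P D > 0" and g: "g \<in> KV" "h \<in> KV" "h \<noteq> \<zero>" "g \<otimes> inv h \<noteq> \<zero>"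
  shows "v P D dvd v P (g \<otimes> inv h)"
proof -
  have c: "g \<in> carrier R" "h \<in> carrier R" using g KV_closed by auto
  have g0: "g \<noteq> \<zero>" using g(4) nz_inv(1)[OF c(2) g(3)] by auto
  have VT: "D = V \<or> D = T" using D(1) by blast
  have Dc: "D \<in> carrier R" "D \<noteq> \<zero>" using VT V_closed V_nz T_closed T_nz by metis+
  have "KV \<subseteq> adjoin K D" using VT KV_sub_adjoin_T by (elim disjE) (simp_all only: order_refl)
  then have "v P D dvd v P g" "v P D dvd v P h" using v_local[OF P Dc D(2)] g g0 by auto
  moreover have "v P (g \<otimes> inv h) = v P g - v P h"
    using v_mult[OF P c(1) g0] nz_inv[OF c(2) g(3)] v_inv[OF P c(2) g(3)] by simp
  ultimately show ?thesis by (simp add: dvd_diff)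
qed

text \<open>At a finite zero of D = V or D = T, v(g/h) is a multiple of v(D) while v(w i) is below
  v(D); a nonnegative sum leaves no room for a negative multiple. At the other finite places
  \<open>w i\<close> has value zero.\<close>

lemma w_quotient_Rfin:
  assumes g: "g \<in> KV" "h \<in> KV" "h \<noteq> \<zero>" and i: "i < s" and R: "(g \<otimes> inv h) \<otimes> w i \<in> Rfin"
  shows "g \<otimes> inv h \<in> Rfin"
proof -
  have c: "g \<in> carrier R" "h \<in> carrier R" using g KV_closed by auto
  have rc: "g \<otimes> inv h \<in> carrier R" using c nz_inv(1)[OF c(2) g(3)] by simp
  have "g \<otimes> inv h \<in> val_ge P 0" if P: "P \<in> Pl" "P \<noteq> Pinf" for P
  proof (cases "g \<otimes> inv h = \<zero>")
    case False
    have "(g \<otimes> inv h) \<otimes> w i \<noteq> \<zero>" using nz_mult[OF rc w_closed(1) False w_closed(2)] .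
    then have sum: "v P (g \<otimes> inv h) + v P (w i) \<ge> 0"
      using R P v_mult[OF P(1) rc False w_closed] by (auto simp: Rfin_def val_ge_def)
    have big: "v P (g \<otimes> inv h) \<ge> 0" if D: "D \<in> {V, T}" "v P D > 0" "v P (w i) < v P D" for D
    proof -
      obtain k where k: "v P (g \<otimes> inv h) = v P D * k" using quotient_local[OF P(1) D(1,2) g False] by (auto elim: dvdE)
      have "v P D * k > - v P D" using sum k D(3) by linarith
      then have "v P D * (k + 1) > 0" by (simp add: algebra_simps)
      then have "k + 1 > 0" using D(2) by (simp add: zero_less_mult_iff)
      then show ?thesis using k D(2) by simp
    qed
    have "v P (g \<otimes> inv h) \<ge> 0"
    proof (cases "v P V > 0")
      case True
      then show ?thesis using big[of V] v_w_finite(3)[OF P i] by simp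
    next
      case False
      then have V0: "v P V = 0" using finite_place[OF P] by simp
      show ?thesis
      proof (cases "v P T > 0")
        case True
        then show ?thesis using big[of T] v_w_finite(4)[OF P i] by simp
      next
        case False
        then have "v P T = 0" using v_T_V(1)[OF P(1) finite_place[OF P]] by simp
        then show ?thesis using v_w_finite(2)[OF P i V0] sum by simp
      qed
    qed
    then show ?thesis using rc by (simp add: val_ge_def)
  qed (simp add: val_ge_closed(2))
  then show ?thesis using rc by (auto simp: Rfin_def)
qed

lemma Rfin_additive: "additive_subgroup Rfin R"
proof (rule additive_subgroupI)
  show "Rfin \<subseteq> carrier R" "\<zero> \<in> Rfin" using val_ge_closed(2) by (auto simp: Rfin_def)
  show "a \<ominus> c \<in> Rfin" if "a \<in> Rfin" "c \<in> Rfin" for a c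
    using that val_ge_minus by (auto simp: Rfin_def)
qed

lemma Rfin_smult: assumes "c \<in> K" "z \<in> Rfin" shows "c \<otimes> z \<in> Rfin"
proof -
  have "c \<otimes> z \<in> val_ge P (0 + 0)" if "P \<in> Pl" "P \<noteq> Pinf" for P
    by (rule val_ge_mult[OF that(1)]) (use assms that K_val_ge[OF that(1)] in \<open>auto simp: Rfin_def\<close>)
  then show ?thesis using assms K_closed by (auto simp: Rfin_def)
qed

text \<open>\<open>z\<close> expands in powers of \<open>U\<close> with coefficients in K(V).
  Separation by eigenvalue makes each term regular at the finite places, separation by value bounds
  each term at infinity, and the coefficients are then polynomials of bounded degree.\<close>

lemma LL_Dinf_w_comb:
  assumes L: "L \<ge> 1" "\<And>i. i < s \<Longrightarrow> pole_order i div s \<le> L" and z: "z \<in> LL (Dinf (s * L - 1))"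
  shows "z \<in> w_comb ` PiE {..<s} (\<lambda>i. polys K V (coeff_len L i))"
proof -
  have zc: "z \<in> carrier R" and zR: "z \<in> Rfin" and zo: "z \<in> val_ge Pinf (- int (s * L - 1))"
    using z LL_Dinf by (auto simp: Rfin_def)
  obtain h where h: "h \<in> KV" "h \<noteq> \<zero>" "h \<otimes> z \<in> polys KV U s" using spanning[OF zc] by blast
  have hc: "h \<in> carrier R" using h KV_closed by auto
  note ih = nz_inv[OF hc h(2)]
  obtain g where g: "g \<in> {..<s} \<rightarrow> KV" "h \<otimes> z = (\<Oplus>i\<in>{..<s}. g i \<otimes> U [^] i)"
    using h(3) unfolding polys_finsum[OF KV_closed subringE(2)[OF KV_subring] U_closed] by blast
  have gc: "g i \<in> carrier R" "g i \<in> KV" if "i < s" for i using g(1) that KV_closed by auto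
  \<comment> \<open>The factor compensates the power of \<open>T\<close> in the denominator of
    \<open>w i\<close>.\<close>
  define g' where "g' i = g i \<otimes> T [^] T_exp i" for i
  define r where "r i = g' i \<otimes> inv h" for i
  have TK: "T [^] T_exp i \<in> KV" "T [^] T_exp i \<in> carrier R" "T [^] T_exp i \<noteq> \<zero>" for i
    using subring_pow[OF KV_subring T_KV] T_closed nz_pow[OF T_closed T_nz] by auto
  have g'K: "g' i \<in> KV" "g' i \<in> carrier R" if "i < s" for i
    unfolding g'_def using subringE(6)[OF KV_subring gc(2)[OF that] TK(1)] gc[OF that] TK by auto
  have rc: "r i \<in> carrier R" if "i < s" for i unfolding r_def using g'K[OF that] ih by simp
  have rw: "r i \<otimes> w i = inv h \<otimes> (g i \<otimes> U [^] i)" if i: "i < s" for i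
  proof -
    have "r i \<otimes> w i = inv h \<otimes> (g i \<otimes> U [^] i) \<otimes> (T [^] T_exp i \<otimes> inv (T [^] T_exp i))"
      unfolding r_def g'_def w_def using gc[OF i] ih TK nz_inv(1)[OF TK(2,3)] U_closed by (simp add: m_ac)
    then show ?thesis using nz_inv(3)[OF TK(2,3)] gc[OF i] ih U_closed by simp
  qed
  have zsum: "z = (\<Oplus>i\<in>{..<s}. r i \<otimes> w i)"
  proof -
    have "z = inv h \<otimes> (h \<otimes> z)" using cancel_left(2)[OF hc h(2) zc] by simp
    also have "\<dots> = (\<Oplus>i\<in>{..<s}. inv h \<otimes> (g i \<otimes> U [^] i))"
      unfolding g(2) by (rule finsum_rdistr) (use gc ih U_closed in auto)
    also have "\<dots> = (\<Oplus>i\<in>{..<s}. r i \<otimes> w i)"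
      by (rule finsum_cong') (use rw rc w_closed in auto)
    finally show ?thesis .
  qed
  have phi_t: "\<phi> (r i \<otimes> w i) = \<eta> [^] i \<otimes> (r i \<otimes> w i)" if i: "i < s" for i
  proof -
    interpret \<phi>: ring_hom_cring R R \<phi> by (rule phi_ring_hom)
    have ec: "\<eta> \<in> carrier R" using eta(1) K_closed by auto
    have pw: "\<phi> (U [^] i) = \<eta> [^] i \<otimes> U [^] i" for i :: nat
      using phi_U U_closed ec by (induction i) (simp_all add: m_ac)
    have "\<phi> (inv h) = inv h" using phi_inv(2)[OF hc h(2)] phi_KV[OF h(1)] by simp
    then have "\<phi> (inv h \<otimes> (g i \<otimes> U [^] i)) = inv h \<otimes> (g i \<otimes> (\<eta> [^] i \<otimes> U [^] i))"
      using pw phi_KV[OF gc(2)[OF i]] gc[OF i] ih U_closed by simp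
    then show ?thesis unfolding rw[OF i] using gc[OF i] ih U_closed ec by (simp add: m_lcomm)
  qed
  have tR: "r i \<otimes> w i \<in> Rfin" if i: "i < s" for i
  proof (rule eigen_components[OF subfield_K Rfin_additive Rfin_smult phi_hom phi_K phi_Rfin, of "{..<s}" "\<lambda>i. r i \<otimes> w i"])
    show "inj_on (\<lambda>i. \<eta> [^] i) {..<s}" using eta(2) by (auto simp: inj_on_def)
    show "\<eta> [^] i \<in> K" for i :: nat by (rule subring_pow[OF subring_K eta(1)])
  qed (use i rc w_closed phi_t zsum zR in auto)
  have to: "r i \<otimes> w i \<in> val_ge Pinf (- int (s * L - 1))" if i: "i < s" for i
  proof (rule distinct_valuations[OF Pinf(1), of "{..<s}" "\<lambda>i. r i \<otimes> w i"])
    fix i j assume ij: "i \<in> {..<s}" "j \<in> {..<s}" "r i \<otimes> w i \<noteq> \<zero>" "r j \<otimes> w j \<noteq> \<zero>"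
      "v Pinf (r i \<otimes> w i) = v Pinf (r j \<otimes> w j)"
    have n: "r i \<noteq> \<zero>" "r j \<noteq> \<zero>" using ij(3,4) w_closed by auto
    have "int s dvd v Pinf (r k)" if "k < s" "r k \<noteq> \<zero>" for k
      using v_quotient_Pinf[OF g'K(1)[OF that(1)] h(1,2)] that(2) by (simp add: r_def)
    then show "i = j" using w_distinct[of i j "r i" "r j"] ij n rc by auto
  qed (use i rc w_closed zsum zo in auto)
  have rP: "r i \<in> polys K V (coeff_len L i)" if i: "i < s" for i
    unfolding r_def
  proof (rule rational_polynomial[OF g'K(1)[OF i] h(1,2)])
    show "g' i \<otimes> inv h \<in> Rfin" using w_quotient_Rfin[OF g'K(1)[OF i] h(1,2) i] tR[OF i] by (simp add: r_def)
    show "g' i \<otimes> inv h \<in> val_ge Pinf (int s - int (s * coeff_len L i))"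
    proof (cases "r i = \<zero>")
      case False
      have "v Pinf (r i) - int (pole_order i) \<ge> - int (s * L - 1)"
        using to[OF i] nz_mult[OF rc[OF i] w_closed(1) False w_closed(2)] v_mult[OF Pinf(1) rc[OF i] False w_closed]
          v_w_Pinf[of i] by (auto simp: val_ge_def)
      moreover have "s * L \<ge> 1" using s_pos L(1) by simp
      ultimately have l: "v Pinf (r i) \<ge> int (pole_order i) - int s * int L + 1" by (simp add: of_nat_diff)
      obtain k where k: "v Pinf (r i) = int s * k"
        using v_quotient_Pinf[OF g'K(1)[OF i] h(1,2)] False by (auto simp: r_def elim: dvdE)
      have nd: "int (pole_order i) \<ge> int s * int (pole_order i div s)"
        by (metis of_nat_mult of_nat_le_iff times_div_less_eq_dividend)
      \<comment> \<open>With \<open>pole_order i\<close> rounded down, both sides are multiples of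
        \<open>s\<close>; dividing by \<open>s\<close> keeps the inequality strict and gives the
        exact coefficient bound.\<close>
      have "int s * k > int s * (int (pole_order i div s) - int L)" using l k nd by (simp add: algebra_simps)
      then have "k > int (pole_order i div s) - int L" using s_pos by (simp add: mult_less_cancel_left)
      moreover have "int (coeff_len L i) = int L - int (pole_order i div s)" using L(2)[OF i] by (simp add: coeff_len_def of_nat_diff)
      ultimately have "k \<ge> 1 - int (coeff_len L i)" by linarith
      then have "int s * k \<ge> int s * (1 - int (coeff_len L i))" by (intro mult_left_mono) auto
      then have "v Pinf (r i) \<ge> int s - int (s * coeff_len L i)" using k by (simp add: algebra_simps)
      then show ?thesis using rc[OF i] by (simp add: val_ge_def r_def)
    qed (simp add: r_def val_ge_closed(2))
  qed
  define r' where "r' = restrict r {..<s}"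
  have "w_comb r' = z" unfolding w_comb_def zsum
    by (rule finsum_cong') (use rc w_closed in \<open>auto simp: r'_def\<close>)
  moreover have "r' \<in> PiE {..<s} (\<lambda>i. polys K V (coeff_len L i))" using rP by (auto simp: r'_def)
  ultimately show ?thesis by blast
qed

lemma dim_Dinf:
  assumes L: "L \<ge> 1" "\<And>i. i < s \<Longrightarrow> pole_order i div s \<le> L"
  shows "int (dim K (LL (Dinf (s * L - 1)))) = int (s * L) - int gaps"
proof -
  have "LL (Dinf (s * L - 1)) \<subseteq> w_comb ` PiE {..<s} (\<lambda>i. polys K V (coeff_len L i))" using LL_Dinf_w_comb[OF L] by blast
  moreover have "finite (polys K V n)" for n using polys_card[OF finite_K] by blast
  then have "finite (PiE {..<s} (\<lambda>i. polys K V (coeff_len L i)))" by (intro finite_PiE) auto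
  ultimately have "card (LL (Dinf (s * L - 1))) \<le> card (PiE {..<s} (\<lambda>i. polys K V (coeff_len L i)))"
    by (meson card_image_le card_mono finite_imageI le_trans)
  then have "card K ^ dim K (LL (Dinf (s * L - 1))) \<le> card K ^ (\<Sum>i<s. coeff_len L i)"
    unfolding card_combs card_LL[OF Dinf_divisor] .
  then have "dim K (LL (Dinf (s * L - 1))) \<le> (\<Sum>i<s. coeff_len L i)"
    using card_K power_le_imp_le_exp by (metis Suc_1 Suc_le_lessD)
  then show ?thesis using sum_coeff_len[OF L(2)] dim_Dinf_lower[OF L] by linarith
qed

end

section \<open>Sums of integer parts\<close>

lemma card_multiples:
  fixes s a :: nat
  assumes "s \<ge> 1" shows "card {i. i < s \<and> s dvd i * a} = gcd a s"
proof -
  define g where "g = gcd a s"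
  have g: "g \<ge> 1" "g dvd s" "g dvd a" using assms by (auto simp: g_def Suc_le_eq)
  obtain s' where s': "s = g * s'" using g(2) by (elim dvdE)
  obtain a' where a': "a = g * a'" using g(3) by (elim dvdE)
  have sp: "s' \<ge> 1" using s' assms by (cases s') auto
  have "g * gcd a' s' = g * 1" using g_def a' s' by (simp add: gcd_mult_distrib_nat)
  then have cop: "coprime s' a'" using g(1) by (simp add: coprime_iff_gcd_eq_1 gcd.commute)
  have iff: "s dvd i * a \<longleftrightarrow> s' dvd i" for i
  proof -
    have "s dvd i * a \<longleftrightarrow> g * s' dvd g * (i * a')" unfolding s' a' by (simp add: mult_ac)
    also have "\<dots> \<longleftrightarrow> s' dvd i * a'" using g(1) by simp
    also have "\<dots> \<longleftrightarrow> s' dvd i" using cop by (simp add: coprime_dvd_mult_left_iff)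
    finally show ?thesis .
  qed
  have "{i. i < s \<and> s dvd i * a} = (\<lambda>k. s' * k) ` {..<g}"
  proof (intro equalityI subsetI)
    fix i assume "i \<in> {i. i < s \<and> s dvd i * a}"
    then have i: "i < s" "s' dvd i" using iff by auto
    then obtain k where k: "i = s' * k" by (auto elim: dvdE)
    then have "k < g" using i(1) s' sp by (simp add: mult.commute)
    then show "i \<in> (\<lambda>k. s' * k) ` {..<g}" using k by auto
  next
    fix i assume "i \<in> (\<lambda>k. s' * k) ` {..<g}"
    then obtain k where "k < g" "i = s' * k" by auto
    then show "i \<in> {i. i < s \<and> s dvd i * a}" using iff s' sp by (simp add: mult.commute)
  qed
  moreover have "inj_on (\<lambda>k. s' * k) {..<g}" using sp by (auto simp: inj_on_def)
  ultimately show ?thesis by (simp add: card_image g_def)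
qed

text \<open>Pairing i with s - i: the two integer parts add up to \<open>a\<close> if
  \<open>s\<close> divides i a, and to a - 1 otherwise. With i = 0 included, the number of indices
  of the first kind is the gcd.\<close>

lemma sum_mult_div:
  fixes s a :: nat
  assumes s: "s \<ge> 1" and a: "a \<ge> 1"
  shows "2 * (\<Sum>i<s. i * a div s) + s + a = s * a + gcd a s"
proof -
  define f where "f i = i * a div s" for i
  have pair: "f i + f (s - i) + 1 = a + (if s dvd i * a then 1 else 0)" if i: "i \<in> {1..<s}" for i
  proof -
    have tot: "i * a + (s - i) * a = s * a" using i by (simp flip: add_mult_distrib)
    have e1: "i * a = s * f i + i * a mod s" "(s - i) * a = s * f (s - i) + (s - i) * a mod s"
      unfolding f_def by simp_all
    show ?thesis
    proof (cases "s dvd i * a")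
      case True
      then have "s dvd (s - i) * a" using tot by (metis dvd_add_right_iff dvd_triv_left)
      then have "s * (f i + f (s - i)) = s * a" using tot e1 True by (simp add: distrib_left)
      then show ?thesis using True s by simp
    next
      case False
      have "\<not> s dvd (s - i) * a" using tot False by (metis dvd_add_left_iff dvd_triv_left)
      then have m: "i * a mod s > 0" "(s - i) * a mod s > 0" "i * a mod s < s" "(s - i) * a mod s < s"
        using False s by (auto simp: dvd_eq_mod_eq_0)
      have "s * (f i + f (s - i)) < s * a" "s * a < s * (f i + f (s - i) + 2)"
        using tot e1 m unfolding distrib_left mult_2_right by linarith+
      then have "f i + f (s - i) < a" "a < f i + f (s - i) + 2" by (simp_all only: mult_less_cancel1)
      then show ?thesis using False by simp
    qed
  qed
  have re: "(\<Sum>i\<in>{1..<s}. f (s - i)) = (\<Sum>i\<in>{1..<s}. f i)"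
    by (rule sum.reindex_bij_witness[of _ "\<lambda>i. s - i" "\<lambda>i. s - i"]) auto
  have spl: "(\<Sum>i<s. g i) = g 0 + (\<Sum>i\<in>{1..<s}. g i)" for g :: "nat \<Rightarrow> nat"
  proof -
    have "{..<s} = insert 0 {1..<s}" using s by auto
    then show ?thesis by simp
  qed
  have "(\<Sum>i\<in>{1..<s}. f i + f (s - i) + 1) = (\<Sum>i\<in>{1..<s}. a + (if s dvd i * a then 1 else 0))"
    by (rule sum.cong[OF refl pair])
  then have "2 * (\<Sum>i\<in>{1..<s}. f i) + (s - 1) = (s - 1) * a + (\<Sum>i\<in>{1..<s}. if s dvd i * a then 1 else 0)"
    unfolding sum.distrib re by simp
  moreover have "1 + (\<Sum>i\<in>{1..<s}. if s dvd i * a then 1 else (0::nat)) = gcd a s"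
  proof -
    have "(\<Sum>i<s. if s dvd i * a then 1 else (0::nat)) = card {i. i < s \<and> s dvd i * a}"
      by (simp add: sum.If_cases lessThan_def Collect_conj_eq)
    then show ?thesis using spl[of "\<lambda>i. if s dvd i * a then 1 else 0"] card_multiples[OF s] by simp
  qed
  moreover have "(\<Sum>i<s. f i) = (\<Sum>i\<in>{1..<s}. f i)" using spl[of f] by (simp add: f_def)
  moreover have "(s - 1) * a + a = s * a" using s by (cases s) auto
  ultimately show ?thesis using s unfolding f_def by linarith
qed

section \<open>Number of gaps, Riemann's inequality and the genus\<close>

context kummer_extension
begin

text \<open>\<open>pole_order i div s\<close> is the integer part of i (b + 1) / s minus that of i b
  / s, so two instances of \<open>sum_mult_div\<close> are subtracted; the gcd in the first is
  1.\<close>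

lemma gaps_formula: "2 * gaps + gcd b s = s"
proof -
  have pole_order: "pole_order i div s + T_exp i = i * (b + 1) div s" for i
  proof -
    have "s * T_exp i \<le> i * (b + 1)" using s_T_exp[of i] by simp
    then have "i * (b + 1) = pole_order i + s * T_exp i" unfolding pole_order_def by simp
    then show ?thesis using s_pos by simp
  qed
  have "gaps + (\<Sum>i<s. T_exp i) = (\<Sum>i<s. i * (b + 1) div s)"
    unfolding gaps_def sum.distrib[symmetric] pole_order ..
  moreover have "2 * (\<Sum>i<s. i * (b + 1) div s) + s + (b + 1) = s * (b + 1) + gcd (b + 1) s"
    by (rule sum_mult_div[OF s_pos]) simp
  moreover have "2 * (\<Sum>i<s. T_exp i) + s + b = s * b + gcd b s"
    unfolding T_exp_def by (rule sum_mult_div[OF s_pos b_pos])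
  moreover have "gcd (b + 1) s = 1" using coprime_s by (simp add: coprime_iff_gcd_eq_1 gcd.commute)
  ultimately show ?thesis by (simp add: algebra_simps)
qed

lemma v_KV_nonneg:
  assumes "P \<in> Pl" "P \<noteq> Pinf" "f \<in> KV" "f \<noteq> \<zero>" shows "v P f \<ge> 0"
  using KV_finite[OF assms(1,2)] assms(3,4) by (auto simp: val_ge_def)

text \<open>A product of powers of polynomials vanishing at the single places; no factor has a pole
  at the other finite places.\<close>

lemma dominating_polynomial:
  assumes "finite S" "S \<subseteq> Pl - {Pinf}"
  shows "\<exists>f\<in>KV. f \<noteq> \<zero> \<and> (\<forall>P\<in>S. v P f \<ge> a P)"
  using assms
proof (induction S)
  case empty
  then show ?case using subringE(3)[OF KV_subring] by (intro bexI[of _ \<one>]) auto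
next
  case (insert P S)
  obtain f where f: "f \<in> KV" "f \<noteq> \<zero>" "\<And>Q. Q \<in> S \<Longrightarrow> v Q f \<ge> a Q" using insert by auto
  have P: "P \<in> Pl" "P \<noteq> Pinf" using insert.prems by auto
  obtain g where g: "g \<in> KV" "g \<noteq> \<zero>" "v P g \<ge> 1" using finite_place_polynomial[OF P] by blast
  define n where "n = nat (a P)"
  have c: "f \<in> carrier R" "g \<in> carrier R" using f g KV_closed by auto
  have gn: "g [^] n \<in> KV" "g [^] n \<noteq> \<zero>" "g [^] n \<in> carrier R"
    using subring_pow[OF KV_subring g(1)] nz_pow[OF c(2) g(2)] c by auto
  have vm: "v Q (f \<otimes> g [^] n) = v Q f + int n * v Q g" if "Q \<in> Pl" for Q
    using v_mult[OF that c(1) f(2) gn(3,2)] v_pow[OF that c(2) g(2)] by simp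
  have "v Q (f \<otimes> g [^] n) \<ge> a Q" if Q: "Q \<in> insert P S" for Q
  proof -
    have Qp: "Q \<in> Pl" "Q \<noteq> Pinf" using Q insert.prems by auto
    note pole_order = v_KV_nonneg[OF Qp f(1,2)] v_KV_nonneg[OF Qp g(1,2)]
    show ?thesis
    proof (cases "Q = P")
      case True
      have "int n * 1 \<le> int n * v P g" using g(3) by (intro mult_left_mono) auto
      moreover have "a P \<le> int n" unfolding n_def by simp
      ultimately show ?thesis using vm[OF Qp(1)] pole_order unfolding True by linarith
    next
      case False
      then have "v Q f \<ge> a Q" using f(3) Q by auto
      moreover have "int n * v Q g \<ge> 0" using pole_order by simp
      ultimately show ?thesis using vm[OF Qp(1)] by linarith
    qed
  qed
  moreover have "f \<otimes> g [^] n \<in> KV" "f \<otimes> g [^] n \<noteq> \<zero>"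
    using subringE(6)[OF KV_subring f(1) gn(1)] nz_mult c f(2) gn by auto
  ultimately show ?case by blast
qed

text \<open>Infinitely many zeros would include s N + 1 of them, each contributing at least 1 to a
  sum bounded by s N.\<close>

lemma finite_zeros:
  assumes f: "f \<in> polys K V (Suc N)" "f \<noteq> \<zero>"
  shows "finite {P \<in> Pl. P \<noteq> Pinf \<and> v P f \<noteq> 0}"
    "(\<Sum>P | P \<in> Pl \<and> P \<noteq> Pinf \<and> v P f \<noteq> 0. v P f * int (pdeg P)) \<le> int (s * N)"
proof -
  define Z where "Z = {P \<in> Pl. P \<noteq> Pinf \<and> v P f \<noteq> 0}"
  have fK: "f \<in> KV" using f(1) by (auto simp: adjoin_def)
  have fc: "f \<in> carrier R" using fK KV_closed by auto
  have bound: "(\<Sum>P\<in>S. v P f * int (pdeg P)) \<le> int (s * N)" if S: "finite S" "S \<subseteq> Z" for S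
  proof (rule fundamental_inequality[OF f(1) const_polys[OF subringE(3)[OF subring_K]] f(2) one_not_zero _ S(1)])
    show "f = f \<otimes> inv \<one>" using fc by simp
    show "S \<subseteq> Pl" using S(2) by (auto simp: Z_def)
    show "v P f \<ge> 0" if "P \<in> S" for P using v_KV_nonneg[OF _ _ fK f(2)] that S(2) by (auto simp: Z_def)
  qed
  have "finite Z"
  proof (rule ccontr)
    assume "infinite Z"
    then obtain S where S: "finite S" "card S = Suc (s * N)" "S \<subseteq> Z" using infinite_arbitrarily_large by blast
    have "1 \<le> v P f * int (pdeg P)" if "P \<in> S" for P
    proof -
      have P: "P \<in> Pl" "P \<noteq> Pinf" "v P f \<noteq> 0" using that S(3) by (auto simp: Z_def)
      have "v P f \<ge> 1" "int (pdeg P) \<ge> 1" using v_KV_nonneg[OF P(1,2) fK f(2)] P(3) deg_pos[OF P(1)] by auto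
      then have "1 * 1 \<le> v P f * int (pdeg P)" by (intro mult_mono) auto
      then show ?thesis by simp
    qed
    then have "(\<Sum>P\<in>S. 1) \<le> (\<Sum>P\<in>S. v P f * int (pdeg P))" by (rule sum_mono)
    then have "int (card S) \<le> int (s * N)" using bound[OF S(1,3)] by simp
    then show False unfolding S(2) by simp
  qed
  then show "finite {P \<in> Pl. P \<noteq> Pinf \<and> v P f \<noteq> 0}"
    "(\<Sum>P | P \<in> Pl \<and> P \<noteq> Pinf \<and> v P f \<noteq> 0. v P f * int (pdeg P)) \<le> int (s * N)"
    using bound[of Z] unfolding Z_def by auto
qed

lemma LL_shift_card:
  assumes A: "A \<in> divisors R K" and f: "f \<in> carrier R" "f \<noteq> \<zero>"
    and C: "\<And>P. P \<in> Pl \<Longrightarrow> C P = A P - v P f"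
  shows "card (LL C) \<le> card (LL A)"
proof (rule card_inj_on_le[of "\<lambda>z. inv f \<otimes> z"])
  note i = nz_inv[OF f]
  show "inj_on (\<lambda>z. inv f \<otimes> z) (LL C)"
  proof (rule inj_onI)
    fix z z' assume z: "z \<in> LL C" "z' \<in> LL C" "inv f \<otimes> z = inv f \<otimes> z'"
    then show "z = z'" using m_lcancel[OF i(2,1), of z z'] by (simp add: LL_iff)
  qed
  show "(\<lambda>z. inv f \<otimes> z) ` LL C \<subseteq> LL A"
  proof (rule image_subsetI)
    fix z assume z: "z \<in> LL C"
    then have zc: "z \<in> carrier R" by (simp add: LL_iff)
    have "inv f \<otimes> z \<in> val_ge P (- A P)" if P: "P \<in> Pl" for P
    proof -
      have "inv f \<in> val_ge P (- v P f)" using i v_inv[OF P f] by (simp add: val_ge_def)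
      moreover have "z \<in> val_ge P (- (A P - v P f))" using z P C[OF P] by (auto simp: LL_iff)
      ultimately have "inv f \<otimes> z \<in> val_ge P (- v P f + - (A P - v P f))" using val_ge_mult[OF P] by blast
      then show ?thesis by simp
    qed
    then show "inv f \<otimes> z \<in> LL A" using zc i by (simp add: LL_iff)
  qed
  show "finite (LL A)" by (rule finite_LL[OF A])
qed

text \<open>After multiplication by a polynomial in \<open>V\<close>, every divisor is bounded by a large multiple of
  the infinite place.\<close>

theorem riemann_inequality:
  assumes A: "A \<in> divisors R K"
  shows "divisor_degree R K A - int (dim K (LL A)) + 1 \<le> int gaps"
proof -
  have sA: "finite {P. A P \<noteq> 0}" "{P. A P \<noteq> 0} \<subseteq> Pl" using divisor_superset[OF A] by auto
  obtain f where f: "f \<in> KV" "f \<noteq> \<zero>" "\<And>P. P \<in> {P. A P \<noteq> 0} - {Pinf} \<Longrightarrow> v P f \<ge> A P"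
  proof -
    have "finite ({P. A P \<noteq> 0} - {Pinf})" "{P. A P \<noteq> 0} - {Pinf} \<subseteq> Pl - {Pinf}" using sA by auto
    from dominating_polynomial[OF this, of A] show ?thesis using that by auto
  qed
  have fc: "f \<in> carrier R" using f KV_closed by auto
  obtain N where N: "f \<in> polys K V (Suc N)" "v Pinf f = - int (s * N)" using v_KV[OF f(1,2)] by blast
  define Z where "Z = {P \<in> Pl. P \<noteq> Pinf \<and> v P f \<noteq> 0}"
  have Z: "finite Z" "(\<Sum>P\<in>Z. v P f * int (pdeg P)) \<le> int (s * N)"
    using finite_zeros[OF N(1) f(2)] by (auto simp: Z_def)
  \<comment> \<open>\<open>A\<close> minus the divisor of \<open>f\<close>, set to zero off the
    places to be a divisor in the sense of \<open>divisors\<close>.\<close>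
  define C where "C P = (if P \<in> Pl then A P - v P f else 0)" for P
  define S where "S = insert Pinf ({P. A P \<noteq> 0} \<union> Z)"
  have "finite S" "{P. A P \<noteq> 0} \<subseteq> S" using sA(1) Z(1) by (auto simp: S_def)
  moreover have "S \<subseteq> Pl" using sA(2) Pinf(1) unfolding S_def Z_def by blast
  moreover have "{P. C P \<noteq> 0} \<subseteq> S"
  proof
    fix P assume "P \<in> {P. C P \<noteq> 0}"
    then have "P \<in> Pl" "A P \<noteq> v P f" by (auto simp: C_def split: if_splits)
    then show "P \<in> S" unfolding S_def Z_def by (cases "A P = 0") auto
  qed
  ultimately have S: "finite S" "S \<subseteq> Pl" "{P. A P \<noteq> 0} \<subseteq> S" "{P. C P \<noteq> 0} \<subseteq> S" by blast+
  have C: "C \<in> divisors R K" unfolding divisors_def using S(2,4) finite_subset[OF S(4,1)] by auto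
  \<comment> \<open>The divisor of \<open>f\<close> has degree at most zero: the finite zeros
    contribute at most s N and the pole at infinity exactly -s N. Hence the degree of
    \<open>C\<close> is at least that of \<open>A\<close>.\<close>
  have "(\<Sum>P\<in>S. v P f * int (pdeg P)) \<le> 0"
  proof -
    have "(\<Sum>P\<in>S. v P f * int (pdeg P)) = v Pinf f * int (pdeg Pinf) + (\<Sum>P\<in>S - {Pinf}. v P f * int (pdeg P))"
      by (rule sum.remove) (use S(1) in \<open>auto simp: S_def\<close>)
    also have "(\<Sum>P\<in>S - {Pinf}. v P f * int (pdeg P)) = (\<Sum>P\<in>Z. v P f * int (pdeg P))"
      by (rule sum.mono_neutral_right) (use S(1,2) in \<open>auto simp: S_def Z_def\<close>)
    finally show ?thesis using Z(2) N(2) Pinf(3) by simp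
  qed
  moreover have "divisor_degree R K C = (\<Sum>P\<in>S. A P * int (pdeg P)) - (\<Sum>P\<in>S. v P f * int (pdeg P))"
    unfolding divisor_superset(3)[OF C S(1,4)] sum_subtractf[symmetric]
    by (rule sum.cong) (use S(2) in \<open>auto simp: C_def left_diff_distrib\<close>)
  ultimately have degC: "divisor_degree R K C \<ge> divisor_degree R K A"
    using divisor_superset(3)[OF A S(1,3)] by simp
  have "card K ^ dim K (LL C) \<le> card K ^ dim K (LL A)"
    using LL_shift_card[OF A fc f(2), of C] unfolding card_LL[OF A] card_LL[OF C] by (simp add: C_def)
  then have dimC: "dim K (LL C) \<le> dim K (LL A)"
    using card_K power_le_imp_le_exp by (metis Suc_1 Suc_le_lessD)
  \<comment> \<open>Large enough for s L - 1 to dominate \<open>C\<close> at infinity and for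
    \<open>dim_Dinf\<close> to apply.\<close>
  define L where "L = 1 + nat (C Pinf) + (\<Sum>i<s. pole_order i div s)"
  have L: "L \<ge> 1" "\<And>i. i < s \<Longrightarrow> pole_order i div s \<le> L"
  proof -
    fix i assume "i < s"
    then have "pole_order i div s \<le> (\<Sum>i<s. pole_order i div s)" by (intro member_le_sum) auto
    then show "pole_order i div s \<le> L" unfolding L_def by simp
  qed (simp add: L_def)
  have sL: "s * L \<ge> L" "s * L \<ge> 1" using s_pos L(1) by simp_all
  have "C P \<le> Dinf (s * L - 1) P" for P
  proof (cases "P = Pinf")
    case True
    have "nat (C Pinf) \<le> L - 1" unfolding L_def by simp
    then have "C Pinf \<le> int (L - 1)" by linarith
    also have "\<dots> \<le> int (s * L - 1)" unfolding of_nat_le_iff using sL(1) by (rule diff_le_mono)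
    finally show ?thesis using True by (simp add: Dinf_def)
  next
    case False
    have "A P \<le> v P f" if "P \<in> Pl"
      using f(3)[of P] v_KV_nonneg[OF that False f(1,2)] False by (cases "A P = 0") auto
    then show ?thesis using False by (simp add: Dinf_def C_def)
  qed
  from dim_LL_incr[OF C Dinf_divisor this]
  have "int (s * L) - int gaps - int (dim K (LL C)) \<le> int (s * L - 1) - divisor_degree R K C"
    using dim_Dinf[OF L] unfolding degree_Dinf by simp
  then show ?thesis using degC dimC sL(2) by (simp add: of_nat_diff)
qed

text \<open>The maximum is attained at the multiples s L - 1 of \<open>Pinf\<close>, where the
  dimension is exact.\<close>

theorem genus_eq: "genus R K = int gaps"
  unfolding genus_def
proof (rule Greatest_equality)
  define L where "L = 1 + (\<Sum>i<s. pole_order i div s)"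
  have L: "L \<ge> 1" "\<And>i. i < s \<Longrightarrow> pole_order i div s \<le> L"
  proof -
    fix i assume "i < s"
    then have "pole_order i div s \<le> (\<Sum>i<s. pole_order i div s)" by (intro member_le_sum) auto
    then show "pole_order i div s \<le> L" unfolding L_def by simp
  qed (simp add: L_def)
  have "s * L \<ge> 1" using s_pos L(1) by simp
  then have "int gaps = divisor_degree R K (Dinf (s * L - 1)) - int (dim K (LL (Dinf (s * L - 1)))) + 1"
    using dim_Dinf[OF L] degree_Dinf[of "s * L - 1"] by (simp only: of_nat_diff)
  then show "\<exists>A\<in>divisors R K. int gaps = divisor_degree R K A - int (dim K (LL A)) + 1"
    using Dinf_divisor by blast
  fix g assume "\<exists>A\<in>divisors R K. g = divisor_degree R K A - int (dim K (LL A)) + 1"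
  then show "g \<le> int gaps" using riemann_inequality by blast
qed

end

section \<open>Radical extensions: fractions with denominators in K[z]\<close>

locale radical_extension = field R for R (structure) +
  fixes K :: "'a set" and z w :: 'a and N :: nat
  assumes K: "subfield K R" "finite K"
    and z: "z \<in> carrier R" "z \<noteq> \<zero>" "\<And>i::nat. i > 0 \<Longrightarrow> z [^] i \<noteq> \<one>"
    and w: "w \<in> carrier R" "w [^] N \<in> adjoin K z" and N: "N \<ge> 1"
begin

abbreviation "B \<equiv> adjoin K z"
text \<open>Boxes of bounded degree exhausting B[w], with at most \<open>card K ^ (n * N)\<close>
  elements.\<close>

definition Er where "Er n = polys (polys K z n) w N"

lemma sK: "subring K R" using subfieldE(1)[OF K(1)] .
lemma Kc: "K \<subseteq> carrier R" and K0: "\<zero> \<in> K" and K1: "\<one> \<in> K" using subringE[OF sK] by auto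
lemma K_add: "additive_subgroup K R" by (rule subring_additive[OF sK])
lemma polysz: "additive_subgroup (polys K z n) R" by (rule polys_subgroup[OF K_add z(1)])
lemma polyszc: "polys K z n \<subseteq> carrier R" by (rule polys_carrier[OF Kc z(1)])
lemma polysz0: "\<zero> \<in> polys K z n" by (rule polys_zero[OF K0 z(1)])
lemma polysz_mono: "n \<le> m \<Longrightarrow> polys K z n \<subseteq> polys K z m" by (rule polys_mono[OF Kc K0 z(1)])
lemma Er_add: "additive_subgroup (Er n) R" unfolding Er_def by (rule polys_subgroup[OF polysz w(1)])
lemma Er_closed: "Er n \<subseteq> carrier R" unfolding Er_def by (rule polys_carrier[OF polyszc w(1)])
lemma Er_mono: "n \<le> m \<Longrightarrow> Er n \<subseteq> Er m" unfolding Er_def by (rule polys_mono_coeff[OF polysz_mono])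

lemma polysz_mult: "p \<in> polys K z (Suc n) \<Longrightarrow> r \<in> polys K z m \<Longrightarrow> p \<otimes> r \<in> polys K z (n + m)"
  by (rule polys_mult[OF K_add subringE(6)[OF sK] z(1)])

lemma Er_scale: "p \<in> polys K z (Suc n) \<Longrightarrow> e \<in> Er m \<Longrightarrow> p \<otimes> e \<in> Er (n + m)"
  unfolding Er_def
  by (rule polys_scale[OF polyszc w(1), where B' = "polys K z (n + m)"]) (use polyszc polysz_mult in auto)

lemma polysz_Er: "polys K z n \<subseteq> Er n"
  using polys_const[OF polyszc polysz0 w(1)] N unfolding Er_def by (cases N) auto

text \<open>Multiplication by \<open>w\<close> only creates the new power w^N, a fixed polynomial in
  \<open>z\<close>; its length bounds the growth uniformly in \<open>n\<close>.\<close>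

lemma Er_shift: "\<exists>D. \<forall>n. \<forall>e\<in>Er n. w \<otimes> e \<in> Er (n + D)"
proof -
  obtain D where D: "w [^] N \<in> polys K z D" using w(2) by (auto simp: adjoin_def)
  have "w \<otimes> e \<in> Er (n + D)" if e: "e \<in> Er n" for e n
  proof (cases n)
    case 0
    have "polys {\<zero>} w k = {\<zero>}" for k using w by (induction k) (auto simp: polys.simps(2))
    then have "e = \<zero>" using e 0 by (simp add: Er_def)
    then show ?thesis using w additive_subgroup.zero_closed[OF Er_add] by simp
  next
    case (Suc n')
    have "w \<otimes> e \<in> polys (polys K z n) w (Suc N)" using e unfolding Er_def by (rule polys_shift[OF polyszc polysz0 w(1)])
    then obtain p a where pa: "w \<otimes> e = p \<oplus> a \<otimes> w [^] N" "a \<in> polys K z n" "p \<in> Er n"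
      unfolding polys_snoc[OF polyszc polysz0 w(1)] Er_def by blast
    have "a \<otimes> w [^] N \<in> polys K z (n' + D)" using polysz_mult[OF _ D] pa(2) Suc by simp
    then have "a \<otimes> w [^] N \<in> Er (n + D)" using polysz_Er Er_mono[of "n' + D" "n + D"] Suc by auto
    moreover have "p \<in> Er (n + D)" using pa(3) Er_mono[of n "n + D"] by auto
    ultimately show ?thesis unfolding pa(1) using additive_subgroup.a_closed[OF Er_add] by blast
  qed
  then show ?thesis by blast
qed

lemma Er_mult: assumes u: "u \<in> Er m" shows "\<exists>D. \<forall>n. \<forall>e\<in>Er n. u \<otimes> e \<in> Er (n + D)"
proof -
  obtain D where D: "\<And>n e. e \<in> Er n \<Longrightarrow> w \<otimes> e \<in> Er (n + D)" using Er_shift by blast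
  have "u \<otimes> e \<in> Er (n + (m + k * D))" if "u \<in> polys (polys K z m) w k" "e \<in> Er n" for k n e u
    using that
  proof (induction k arbitrary: u)
    case 0
    then have "e \<in> carrier R" using Er_closed by blast
    then show ?case using 0 additive_subgroup.zero_closed[OF Er_add] by simp
  next
    case (Suc k)
    obtain g r where g: "u = g \<oplus> w \<otimes> r" "g \<in> polys K z m" "r \<in> polys (polys K z m) w k"
      using Suc.prems(1) unfolding polys.simps(2) by blast
    have c: "g \<in> carrier R" "r \<in> carrier R" "e \<in> carrier R"
      using g polyszc polys_carrier[OF polyszc w(1)] Suc.prems(2) Er_closed by blast+
    have "u \<otimes> e = g \<otimes> e \<oplus> w \<otimes> (r \<otimes> e)" unfolding g(1) using c w by (simp add: l_distr m_assoc)
    moreover have "g \<otimes> e \<in> Er (n + (m + Suc k * D))"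
    proof -
      have "g \<in> polys K z (Suc m)" using g(2) polysz_mono[of m "Suc m"] by auto
      then have "g \<otimes> e \<in> Er (m + n)" using Er_scale Suc.prems(2) by blast
      then show ?thesis using Er_mono[of "m + n" "n + (m + Suc k * D)"] by auto
    qed
    moreover have "w \<otimes> (r \<otimes> e) \<in> Er (n + (m + Suc k * D))"
      using D[OF Suc.IH[OF g(3) Suc.prems(2)]] by (simp add: add_ac)
    ultimately show ?case using additive_subgroup.a_closed[OF Er_add] by simp
  qed
  then show ?thesis using u unfolding Er_def by blast
qed

lemma polys_B_Er: "u \<in> polys B w N \<longleftrightarrow> (\<exists>n. u \<in> Er n)"
proof
  assume "u \<in> polys B w N"
  then show "\<exists>n. u \<in> Er n" unfolding Er_def adjoin_def
    by (intro polys_UN[OF polysz polysz_mono w(1)])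
next
  assume "\<exists>n. u \<in> Er n"
  then show "u \<in> polys B w N" unfolding Er_def using polys_mono_coeff[of _ B w N] by (auto simp: adjoin_def)
qed

lemma polys_B_subring: "subring (polys B w N) R"
proof (rule subringI)
  show "polys B w N \<subseteq> carrier R" using polys_B_Er Er_closed by blast
  have "\<one> \<in> polys K z (Suc 0)" by (rule polys_const[OF Kc K0 z(1) K1])
  then show "\<one> \<in> polys B w N" using polys_B_Er polysz_Er by blast
  show "\<ominus> u \<in> polys B w N" if "u \<in> polys B w N" for u
    using that polys_B_Er additive_subgroup.a_inv_closed[OF Er_add] by blast
  show "u \<otimes> u' \<in> polys B w N" if "u \<in> polys B w N" "u' \<in> polys B w N" for u u'
    using that polys_B_Er Er_mult by meson
  show "u \<oplus> u' \<in> polys B w N" if u: "u \<in> polys B w N" "u' \<in> polys B w N" for u u'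
  proof -
    obtain i j where "u \<in> Er i" "u' \<in> Er j" using u polys_B_Er by blast
    then have "u \<in> Er (i + j)" "u' \<in> Er (i + j)" using Er_mono[of i "i + j"] Er_mono[of j "i + j"] by auto
    then show ?thesis using additive_subgroup.a_closed[OF Er_add] polys_B_Er by blast
  qed
qed

lemma B_sub: "B \<subseteq> polys B w N"
proof
  fix u assume "u \<in> B"
  then show "u \<in> polys B w N" using polys_B_Er polysz_Er unfolding adjoin_def by blast
qed

lemma w_mem: "w \<in> polys B w N"
proof -
  have "\<one> \<in> polys B w N" using subringE(3)[OF polys_B_subring] .
  then obtain n where "\<one> \<in> Er n" using polys_B_Er by blast
  then have "\<exists>D. w \<otimes> \<one> \<in> Er (n + D)" using Er_shift by blast
  then show ?thesis using polys_B_Er w by auto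
qed

text \<open>The pairs \<open>(p, e)\<close> with \<open>p \<in> K[z]\<close>, \<open>e \<in> B[w]\<close> of bounded degree outnumber the possible
  values of \<open>p + u e\<close>.\<close>

lemma multiple_in_B:
  assumes u: "u \<in> polys B w N" "u \<noteq> \<zero>"
  shows "\<exists>h\<in>B. \<exists>e\<in>polys B w N. h \<noteq> \<zero> \<and> h = u \<otimes> e"
proof (rule ccontr)
  assume no: "\<not> ?thesis"
  obtain m where m: "u \<in> Er m" using u polys_B_Er by blast
  have uc: "u \<in> carrier R" using m Er_closed by auto
  obtain D where D: "\<And>n e. e \<in> Er n \<Longrightarrow> u \<otimes> e \<in> Er (n + D)" using Er_mult[OF m] by blast
  have "{\<zero>, \<one>} \<subseteq> K" using K0 K1 by simp
  then have "card {\<zero>, \<one>} \<le> card K" by (rule card_mono[OF K(2)])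
  then have K2: "card K \<ge> 2" by simp
  \<comment> \<open>Increasing the length by \<open>D\<close> raises the size bound of the box by
    the factor \<open>card K ^ (D * N)\<close>, whereas the injection forces a factor
    \<open>card K ^ M\<close>: a surplus of one in the exponent at each step.\<close>
  define M where "M = D * N + 1"
  have finE: "finite (Er n)" "card (Er n) \<le> card K ^ (n * N)" for n
  proof -
    have 1: "finite (polys K z n)" "card (polys K z n) \<le> card K ^ n" using polys_card[OF K(2)] by auto
    show "finite (Er n)" unfolding Er_def using polys_card[OF 1(1)] by blast
    have "card (Er n) \<le> card (polys K z n) ^ N" unfolding Er_def using polys_card[OF 1(1)] by blast
    also have "\<dots> \<le> (card K ^ n) ^ N" by (rule power_mono[OF 1(2)]) simp
    finally show "card (Er n) \<le> card K ^ (n * N)" by (simp add: power_mult)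
  qed
  have step: "card K ^ M * card (Er n) \<le> card (Er (n + D))" if n: "n \<ge> M" for n
  proof -
    have "inj_on (\<lambda>(p, e). p \<oplus> u \<otimes> e) (polys K z M \<times> Er n)"
    proof (rule inj_onI, clarify)
      fix p e p' e' assume a: "p \<in> polys K z M" "e \<in> Er n" "p' \<in> polys K z M" "e' \<in> Er n"
        and eq: "p \<oplus> u \<otimes> e = p' \<oplus> u \<otimes> e'"
      have c: "p \<in> carrier R" "p' \<in> carrier R" "e \<in> carrier R" "e' \<in> carrier R"
        using a polyszc Er_closed by blast+
      have "p \<ominus> p' = (p \<oplus> u \<otimes> e) \<ominus> (p' \<oplus> u \<otimes> e)" using c uc by algebra
      also have "\<dots> = u \<otimes> (e' \<ominus> e)" unfolding eq using c uc by algebra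
      finally have pp: "p \<ominus> p' = u \<otimes> (e' \<ominus> e)" .
      have "p \<ominus> p' \<in> B" using additive_subgroup_minus[OF polysz a(1,3)] by (auto simp: adjoin_def)
      moreover have "e' \<ominus> e \<in> polys B w N" using additive_subgroup_minus[OF Er_add a(4,2)] polys_B_Er by blast
      ultimately have "p \<ominus> p' = \<zero>" using no pp by blast
      then have p: "p = p'" using c by simp
      then have "u \<otimes> e = u \<otimes> e'" using eq c uc by simp
      then have "e = e'" using m_lcancel[OF u(2) uc c(3,4)] by simp
      then show "p = p' \<and> e = e'" using p by simp
    qed
    moreover have "(\<lambda>(p, e). p \<oplus> u \<otimes> e) ` (polys K z M \<times> Er n) \<subseteq> Er (n + D)"
    proof (clarify)
      fix p e assume "p \<in> polys K z M" "e \<in> Er n"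
      then have "p \<in> Er (n + D)" "u \<otimes> e \<in> Er (n + D)"
        using polysz_Er[of M] Er_mono[of M "n + D"] n D by auto
      then show "p \<oplus> u \<otimes> e \<in> Er (n + D)" using additive_subgroup.a_closed[OF Er_add] by blast
    qed
    ultimately have "card (polys K z M \<times> Er n) \<le> card (Er (n + D))" using finE(1) by (rule card_inj_on_le)
    then show ?thesis by (simp add: card_cartesian_product card_polys_nontorsion[OF K z])
  qed
  have grow: "card K ^ (M * k) \<le> card (Er (M + k * D))" for k
  proof (induction k)
    case 0
    have "\<zero> \<in> Er M" using additive_subgroup.zero_closed[OF Er_add] .
    then have "card (Er M) > 0" using finE(1) card_gt_0_iff by blast
    then show ?case by simp
  next
    case (Suc k)
    have "card K ^ (M * Suc k) = card K ^ M * card K ^ (M * k)" by (simp add: power_add)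
    also have "\<dots> \<le> card K ^ M * card (Er (M + k * D))" by (rule mult_le_mono2[OF Suc])
    also have "\<dots> \<le> card (Er (M + k * D + D))" by (rule step) simp
    finally show ?case by (simp add: add_ac)
  qed
  \<comment> \<open>After this many steps the accumulated surplus exceeds M N, the exponent in the
    bound for the initial box.\<close>
  define k where "k = M * N + 1"
  have "card K ^ (M * k) \<le> card K ^ ((M + k * D) * N)" using grow[of k] finE(2)[of "M + k * D"] by linarith
  then have "M * k \<le> (M + k * D) * N" using K2 power_le_imp_le_exp by (metis Suc_1 Suc_le_lessD)
  then have "k * (D * N) + k \<le> M * N + k * (D * N)" by (simp add: M_def algebra_simps)
  then show False by (simp add: k_def)
qed

text \<open>The elements for which a \<open>spanning\<close> property as in
  \<open>kummer_extension\<close> holds. They are shown to form a field, so generators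
  suffice.\<close>

definition fractions where "fractions = {u \<in> carrier R. \<exists>h\<in>B. h \<noteq> \<zero> \<and> h \<otimes> u \<in> polys B w N}"

lemma B_subring: "subring B R" by (rule adjoin_subring[OF sK z(1)])

lemma polys_B_fractions: "polys B w N \<subseteq> fractions"
proof
  fix u assume u: "u \<in> polys B w N"
  then have "u \<in> carrier R" using subringE(1)[OF polys_B_subring] by blast
  then show "u \<in> fractions" unfolding fractions_def using u subringE(3)[OF B_subring]
    by (intro CollectI conjI bexI[of _ \<one>]) auto
qed

text \<open>For inverses, \<open>multiple_in_B\<close> plays the part of a norm: g = (h u) e in
  \<open>B\<close> gives g / u = h e.\<close>

lemma fractions_closed:
  assumes "u \<in> fractions" "u' \<in> fractions"
  shows "u \<oplus> u' \<in> fractions" "u \<otimes> u' \<in> fractions" "\<ominus> u \<in> fractions" "u \<noteq> \<zero> \<Longrightarrow> inv u \<in> fractions"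
proof -
  note S = subringE[OF polys_B_subring]
  have Bc: "B \<subseteq> carrier R" using subringE(1)[OF B_subring] .
  obtain h where h: "h \<in> B" "h \<noteq> \<zero>" "h \<otimes> u \<in> polys B w N" and uc: "u \<in> carrier R"
    using assms(1) by (auto simp: fractions_def)
  obtain h' where h': "h' \<in> B" "h' \<noteq> \<zero>" "h' \<otimes> u' \<in> polys B w N" and uc': "u' \<in> carrier R"
    using assms(2) by (auto simp: fractions_def)
  have hc: "h \<in> carrier R" "h' \<in> carrier R" using h h' Bc by auto
  have hS: "h \<in> polys B w N" "h' \<in> polys B w N" using h h' B_sub by auto
  have hh: "h \<otimes> h' \<in> B" "h \<otimes> h' \<noteq> \<zero>" using subringE(6)[OF B_subring h(1) h'(1)] nz_mult hc h h' by auto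
  have "(h \<otimes> h') \<otimes> (u \<oplus> u') = h' \<otimes> (h \<otimes> u) \<oplus> h \<otimes> (h' \<otimes> u')" using hc uc uc' by (simp add: r_distr m_ac)
  also have "\<dots> \<in> polys B w N" using S(7)[OF S(6)[OF hS(2) h(3)] S(6)[OF hS(1) h'(3)]] .
  finally show "u \<oplus> u' \<in> fractions" unfolding fractions_def using hh uc uc' by auto
  have "(h \<otimes> h') \<otimes> (u \<otimes> u') = (h \<otimes> u) \<otimes> (h' \<otimes> u')" using hc uc uc' by (simp add: m_ac)
  also have "\<dots> \<in> polys B w N" using S(6)[OF h(3) h'(3)] .
  finally show "u \<otimes> u' \<in> fractions" unfolding fractions_def using hh uc uc' by auto
  have "h \<otimes> (\<ominus> u) = \<ominus> (h \<otimes> u)" using hc uc by (simp add: r_minus)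
  also have "\<dots> \<in> polys B w N" using S(5)[OF h(3)] .
  finally show "\<ominus> u \<in> fractions" unfolding fractions_def using h uc by auto
  assume un: "u \<noteq> \<zero>"
  then have hu: "h \<otimes> u \<noteq> \<zero>" using nz_mult[OF hc(1) uc h(2)] by simp
  obtain g e where g: "g \<in> B" "e \<in> polys B w N" "g \<noteq> \<zero>" "g = (h \<otimes> u) \<otimes> e" using multiple_in_B[OF h(3) hu] by blast
  have ec: "e \<in> carrier R" using g(2) S(1) by blast
  note iu = nz_inv[OF uc un]
  have "g \<otimes> inv u = (h \<otimes> e) \<otimes> (u \<otimes> inv u)" unfolding g(4) using hc uc ec iu(1) by (simp add: m_ac)
  also have "\<dots> = h \<otimes> e" using iu hc ec by simp
  also have "\<dots> \<in> polys B w N" using S(6)[OF hS(1) g(2)] .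
  finally show "inv u \<in> fractions" unfolding fractions_def using g iu(1) by auto
qed

lemma fractions_eq_carrier:
  assumes gen: "carrier R = generate_field R X'" and X': "X' \<subseteq> fractions"
  shows "fractions = carrier R"
proof
  show "fractions \<subseteq> carrier R" by (auto simp: fractions_def)
  have "u \<in> fractions" if "u \<in> generate_field R X'" for u
    using that
  proof (induction rule: generate_field.induct)
    case one
    show ?case using polys_B_fractions subringE(3)[OF polys_B_subring] by blast
  qed (use X' fractions_closed in auto)
  then show "carrier R \<subseteq> fractions" using gen by auto
qed

end

section \<open>Characteristic two; transcendental elements are not roots of unity\<close>

context field
begin

lemma char2_frobenius:
  assumes two: "\<one> \<oplus> \<one> = \<zero>" and u: "u \<in> carrier R" "w \<in> carrier R"
  shows "(u \<oplus> w) [^] ((2::nat) ^ n) = u [^] ((2::nat) ^ n) \<oplus> w [^] ((2::nat) ^ n)"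
proof (induction n)
  case 0
  show ?case using u by simp
next
  case (Suc n)
  define p where "p = u [^] ((2::nat) ^ n)"
  define r where "r = w [^] ((2::nat) ^ n)"
  have c: "p \<in> carrier R" "r \<in> carrier R" using u by (auto simp: p_def r_def)
  have dbl: "c [^] ((2::nat) ^ Suc n) = c [^] ((2::nat) ^ n) \<otimes> c [^] ((2::nat) ^ n)" if "c \<in> carrier R" for c
    using nat_pow_mult[OF that, of "2 ^ n" "2 ^ n"] by (simp add: mult_2)
  have "(u \<oplus> w) [^] ((2::nat) ^ Suc n) = (p \<oplus> r) \<otimes> (p \<oplus> r)"
    using dbl[of "u \<oplus> w"] u Suc by (simp add: p_def r_def)
  also have "\<dots> = (p \<otimes> p \<oplus> r \<otimes> r) \<oplus> (\<one> \<oplus> \<one>) \<otimes> (p \<otimes> r)" using c by algebra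
  also have "\<dots> = p \<otimes> p \<oplus> r \<otimes> r" using two c by simp
  finally show ?case using dbl u by (simp add: p_def r_def)
qed

text \<open>The order of the additive group of \<open>K\<close> annihilates 1, and 2^k times 1 is (1
  + 1)^k, so 1 + 1 is nilpotent in a field.\<close>

lemma char2_of_card:
  assumes K: "subfield K R" "finite K" "card K = 2 ^ k" shows "\<one> \<oplus> \<one> = \<zero>"
proof -
  have sK: "subring K R" using subfieldE(1)[OF K(1)] .
  interpret KR: ring "R\<lparr>carrier := K\<rparr>" by (rule subring_is_ring[OF sK])
  have "\<one> \<in> carrier (add_monoid (R\<lparr>carrier := K\<rparr>))" using subringE(3)[OF sK] by simp
  then have "\<one> [^]\<^bsub>add_monoid (R\<lparr>carrier := K\<rparr>)\<^esub> order (add_monoid (R\<lparr>carrier := K\<rparr>))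
      = \<one>\<^bsub>add_monoid (R\<lparr>carrier := K\<rparr>)\<^esub>"
    by (rule group.pow_order_eq_1[OF KR.a_group])
  moreover have "order (add_monoid (R\<lparr>carrier := K\<rparr>)) = 2 ^ k" using K(3) by (simp add: order_def)
  moreover have "\<one> [^]\<^bsub>add_monoid (R\<lparr>carrier := K\<rparr>)\<^esub> (j::nat) = [j] \<cdot> \<one>" for j
    by (induction j) (simp_all add: nat_pow_def add_pow_def)
  ultimately have z: "[(2 ^ k :: nat)] \<cdot> \<one> = \<zero>" by simp
  have "[(2 ^ j :: nat)] \<cdot> \<one> = (\<one> \<oplus> \<one>) [^] j" for j
  proof (induction j)
    case (Suc j)
    have "[(2 ^ Suc j :: nat)] \<cdot> \<one> = [(2 ^ j :: nat)] \<cdot> \<one> \<oplus> [(2 ^ j :: nat)] \<cdot> \<one>"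
      using add.nat_pow_mult[of \<one> "2 ^ j" "2 ^ j"] by (simp add: mult_2)
    also have "\<dots> = (\<one> \<oplus> \<one>) [^] j \<otimes> (\<one> \<oplus> \<one>)" unfolding Suc by (simp add: r_distr)
    finally show ?case by simp
  qed simp
  then have "(\<one> \<oplus> \<one>) [^] k = \<zero>" using z by metis
  then show ?thesis using nz_pow[of "\<one> \<oplus> \<one>" k] by auto
qed

text \<open>Evaluation at \<open>x\<close> is injective on polynomials, and X^i and 1 are different
  coefficient lists.\<close>

lemma transcendental_imp_nontorsion:
  assumes K: "subfield K R" and x: "x \<in> carrier R" "transcendental K x" and i: "(i::nat) > 0"
  shows "x [^] i \<noteq> \<one>"
proof
  assume xi: "x [^] i = \<one>"
  have K01: "\<zero> \<in> K" "\<one> \<in> K" using subringE[OF subfieldE(1)[OF K]] by auto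
  have e: "eval (\<one> # replicate k \<zero>) x = x [^] k" for k :: nat
  proof -
    have "eval (replicate k \<zero>) x = \<zero>" by (induction k) (use x in auto)
    then show ?thesis using x by simp
  qed
  have p: "(\<one> # replicate k \<zero>) \<in> carrier (K[X])" for k
    unfolding univ_poly_carrier[symmetric] polynomial_def using K01 by auto
  have "eval (\<one> # replicate i \<zero>) x = eval (\<one> # replicate 0 \<zero>) x" unfolding e using xi by simp
  then have "\<one> # replicate i \<zero> = \<one> # replicate 0 \<zero>"
    using x(2) p unfolding transcendental_def ring_hom_def inj_on_def by blast
  then show False using i by simp
qed

end

section \<open>Diagonalising the automorphism\<close>

text \<open>In the coordinates \<open>X\<close>, \<open>Y\<close> the automorphism is diagonal and the equation of the curve keeps its
  shape, up to a constant. This needs \<open>\<delta> \<noteq> 1\<close>, that is, \<open>q > 2\<close>.\<close>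

locale hermitian_automorphism = field R for R (structure) +
  fixes K :: "'a set" and x y a \<delta> :: 'a and \<sigma> :: "'a \<Rightarrow> 'a" and n q :: nat
  assumes subfield_K: "subfield K R" and card_K: "card K = q\<^sup>2" and n: "n \<ge> 2" "q = 2 ^ n"
    and x: "x \<in> carrier R" "x \<noteq> \<zero>" "\<And>i::nat. i > 0 \<Longrightarrow> x [^] i \<noteq> \<one>" and y: "y \<in> carrier R"
    and curve: "y [^] q \<oplus> y = x [^] (q + 1)"
    and generated: "carrier R = generate_field R (K \<union> {x, y})"
    and a: "a \<in> K" "a \<noteq> \<zero>" "\<And>i j. i < q\<^sup>2 - 1 \<Longrightarrow> j < q\<^sup>2 - 1 \<Longrightarrow> a [^] (i::nat) = a [^] j \<Longrightarrow> i = j"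
      "a [^] (q\<^sup>2 - 1) = \<one>"
    and \<delta>: "\<delta> = a [^] (q + 1)"
    and \<sigma>: "\<sigma> \<in> ring_hom R R" "\<And>c. c \<in> K \<Longrightarrow> \<sigma> c = c"
      "\<sigma> x = (a \<otimes> x) \<otimes> inv (\<delta> \<otimes> y \<oplus> (\<delta> \<oplus> \<one>))" "\<sigma> y = inv (\<delta> \<otimes> y \<oplus> (\<delta> \<oplus> \<one>))"
begin

lemma q_bounds: "q \<ge> 4" "q > 0" "q\<^sup>2 - 1 = (q - 1) * (q + 1)" "q\<^sup>2 - 1 \<ge> 1"
proof -
  have "2 ^ 2 \<le> (2::nat) ^ n" using n(1) by (intro power_increasing) auto
  then show q4: "q \<ge> 4" using n(2) by simp
  then show "q > 0" by simp
  show "q\<^sup>2 - 1 = (q - 1) * (q + 1)" by (simp add: power2_eq_square algebra_simps)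
  then show "q\<^sup>2 - 1 \<ge> 1" using q4 by simp
qed

lemma finite_K: "finite K"
  using card_K q_bounds(2) by (metis card.infinite power_not_zero less_numeral_extra(3))

lemma subring_K: "subring K R" using subfieldE(1)[OF subfield_K] .
lemma Kc: "K \<subseteq> carrier R" and K0: "\<zero> \<in> K" and K1: "\<one> \<in> K" using subringE[OF subring_K] by auto
lemma ac: "a \<in> carrier R" using a Kc by auto

lemma two: "\<one> \<oplus> \<one> = \<zero>"
  by (rule char2_of_card[OF subfield_K finite_K, of "2 * n"]) (simp add: card_K n(2) power_mult mult.commute)

lemma dbl: "z \<in> carrier R \<Longrightarrow> z \<oplus> z = \<zero>"
proof -
  assume "z \<in> carrier R"
  then have "z \<oplus> z = (\<one> \<oplus> \<one>) \<otimes> z" by algebra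
  then show ?thesis using two \<open>z \<in> carrier R\<close> by simp
qed

lemma frob: "u \<in> carrier R \<Longrightarrow> w \<in> carrier R \<Longrightarrow> (u \<oplus> w) [^] q = u [^] q \<oplus> w [^] q"
  unfolding n(2) by (rule char2_frobenius[OF two])

lemma \<delta>K: "\<delta> \<in> K" "\<delta> \<in> carrier R" "\<delta> \<noteq> \<zero>"
  using subring_pow[OF subring_K a(1), of "q + 1"] nz_pow[OF ac a(2), of "q + 1"] ac unfolding \<delta> by auto

text \<open>For q \<ge> 4 the exponent q + 1 is below the order q^2 - 1 of \<open>a\<close>. Hence y
  = 1 and y = 1/\<delta>, the fixed points of the action on \<open>y\<close>, are distinct.\<close>

lemma \<delta>_ne_1: "\<delta> \<noteq> \<one>"
proof
  assume "\<delta> = \<one>"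
  then have eq: "a [^] (q + 1) = a [^] (0::nat)" using \<delta> by simp
  have lt: "q + 1 < q\<^sup>2 - 1"
  proof -
    have "2 * (q + 1) \<le> (q - 1) * (q + 1)" using q_bounds(1) by (intro mult_le_mono1) simp
    moreover have "q + 1 < 2 * (q + 1)" by simp
    ultimately show ?thesis unfolding q_bounds(3) by (rule less_le_trans[rotated])
  qed
  have "0 < q\<^sup>2 - 1" using q_bounds(4) by linarith
  from a(3)[OF lt this eq] show False by simp
qed

lemma \<delta>_q: "\<delta> [^] (q - 1) = \<one>" "\<delta> [^] q = \<delta>"
proof -
  show 1: "\<delta> [^] (q - 1) = \<one>" unfolding \<delta> using nat_pow_pow[OF ac, of "q + 1" "q - 1"] a(4) q_bounds(3) by (simp add: mult.commute)
  have "q = Suc (q - 1)" using q_bounds by simp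
  then have "\<delta> [^] q = \<delta> [^] (q - 1) \<otimes> \<delta>" by (metis nat_pow_Suc)
  then show "\<delta> [^] q = \<delta>" using 1 \<delta>K by simp
qed

definition "\<epsilon> = \<delta> \<oplus> \<one>"

lemma \<epsilon>: "\<epsilon> \<in> K" "\<epsilon> \<in> carrier R" "\<epsilon> \<noteq> \<zero>"
proof -
  show "\<epsilon> \<in> K" unfolding \<epsilon>_def using subringE(7)[OF subring_K \<delta>K(1) K1] .
  then show "\<epsilon> \<in> carrier R" using Kc by auto
  show "\<epsilon> \<noteq> \<zero>"
  proof
    assume "\<epsilon> = \<zero>"
    then have "(\<delta> \<oplus> \<one>) \<oplus> \<one> = \<one>" by (simp add: \<epsilon>_def)
    moreover have "(\<delta> \<oplus> \<one>) \<oplus> \<one> = \<delta> \<oplus> (\<one> \<oplus> \<one>)" using \<delta>K by (simp add: a_assoc)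
    ultimately show False using two \<delta>K \<delta>_ne_1 by simp
  qed
qed

text \<open>In characteristic 2 such an \<open>e\<close> satisfies e^q + e = 0, so y = e would give
  x^(q+1) = 0. This keeps the denominators linear in \<open>y\<close> from vanishing.\<close>

lemma frobenius_fixed_ne_y: assumes e: "e \<in> carrier R" "e [^] q = e" shows "y \<noteq> e"
proof
  assume "y = e"
  then have "x [^] (q + 1) = \<zero>" using curve e dbl by simp
  then show False using nz_pow[OF x(1,2)] by blast
qed

text \<open>On \<open>y\<close> the automorphism acts as y \<mapsto> 1 / (\<delta> y + \<delta> +
  1). In characteristic 2 its fixed points are the roots of (\<delta> y + 1)(y + 1), and num / den
  moves them to infinity and 0, so in this coordinate the map is multiplication by a
  constant.\<close>

definition "den = \<delta> \<otimes> y \<oplus> \<one>"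
definition "num = y \<oplus> \<one>"

lemma sum_zero_imp_eq: "u \<in> carrier R \<Longrightarrow> w \<in> carrier R \<Longrightarrow> u \<oplus> w = \<zero> \<Longrightarrow> u = w"
proof -
  assume u: "u \<in> carrier R" "w \<in> carrier R" "u \<oplus> w = \<zero>"
  have "u = (u \<oplus> w) \<oplus> w" using u(1,2) dbl[OF u(2)] by (simp add: a_assoc)
  then show ?thesis using u by simp
qed

lemma num: "num \<in> carrier R" "num \<noteq> \<zero>"
proof -
  show "num \<in> carrier R" unfolding num_def using y by simp
  show "num \<noteq> \<zero>" using sum_zero_imp_eq[OF y one_closed] frobenius_fixed_ne_y[of \<one>] unfolding num_def by auto
qed

lemma den: "den \<in> carrier R" "den \<noteq> \<zero>"
proof -
  show "den \<in> carrier R" unfolding den_def using y \<delta>K by simp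
  note i = nz_inv[OF \<delta>K(2,3)]
  show "den \<noteq> \<zero>"
  proof
    assume "den = \<zero>"
    then have "\<delta> \<otimes> y = \<one>" using sum_zero_imp_eq[of "\<delta> \<otimes> y" \<one>] y \<delta>K unfolding den_def by simp
    then have "y = inv \<delta>" using comm_inv_char[OF \<delta>K(2) y] by simp
    moreover have "inv \<delta> [^] q = inv \<delta>" using inv_pow'[OF \<delta>K(2,3), of q] \<delta>_q(2) by simp
    ultimately show False using frobenius_fixed_ne_y[OF i(1)] by simp
  qed
qed

definition "X' = x \<otimes> inv den"
definition "Y' = num \<otimes> inv den"

lemma X': "X' \<in> carrier R" "X' \<noteq> \<zero>" and Y': "Y' \<in> carrier R" "Y' \<noteq> \<zero>"
  using nz_inv[OF den] x num nz_mult unfolding X'_def Y'_def by auto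

text \<open>Over the common denominator and with \<delta>^q = \<delta>, the terms \<delta> y^(q+1)
  and the constants occur twice and cancel; (\<delta> + 1)(y^q + y) remains.\<close>

lemma curve': "Y' [^] q \<oplus> Y' = \<epsilon> \<otimes> X' [^] (q + 1)"
proof -
  note i = nz_inv[OF den]
  have uq: "num [^] q = y [^] q \<oplus> \<one>" unfolding num_def using frob[OF y one_closed] by simp
  have wq: "den [^] q = \<delta> \<otimes> y [^] q \<oplus> \<one>" unfolding den_def
    using frob[of "\<delta> \<otimes> y" \<one>] y \<delta>K \<delta>_q(2) by (simp add: nat_pow_distrib)
  define yq where "yq = y [^] q"
  have yc: "yq \<in> carrier R" using y by (simp add: yq_def)
  have "num [^] q \<otimes> den \<oplus> num \<otimes> den [^] q
      = (yq \<oplus> \<one>) \<otimes> (\<delta> \<otimes> y \<oplus> \<one>) \<oplus> (y \<oplus> \<one>) \<otimes> (\<delta> \<otimes> yq \<oplus> \<one>)"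
    unfolding uq wq unfolding num_def den_def yq_def ..
  also have "\<dots> = (\<delta> \<oplus> \<one>) \<otimes> (yq \<oplus> y) \<oplus> ((\<one> \<oplus> \<one>) \<oplus> (\<one> \<oplus> \<one>) \<otimes> (\<delta> \<otimes> yq \<otimes> y))"
    using yc y \<delta>K by algebra
  also have "\<dots> = \<epsilon> \<otimes> x [^] (q + 1)"
    using two yc y \<delta>K curve x(1) by (simp add: \<epsilon>_def yq_def)
  finally have main: "num [^] q \<otimes> den \<oplus> num \<otimes> den [^] q = \<epsilon> \<otimes> x [^] (q + 1)" .
  have w1: "inv den [^] (q + 1) = inv den [^] q \<otimes> inv den" by simp
  have iq: "inv den [^] q \<in> carrier R" "den [^] q \<in> carrier R" "num [^] q \<in> carrier R" using i den num by auto
  have wq1: "den [^] q \<otimes> inv den [^] q = \<one>" using nat_pow_distrib[OF den(1) i(1), of q] i(3) by simp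
  have "(num [^] q \<otimes> den \<oplus> num \<otimes> den [^] q) \<otimes> (inv den [^] q \<otimes> inv den)
      = (num [^] q \<otimes> inv den [^] q) \<otimes> (den \<otimes> inv den) \<oplus> (num \<otimes> inv den) \<otimes> (den [^] q \<otimes> inv den [^] q)"
    using iq i(1) den(1) num(1) by algebra
  also have "\<dots> = Y' [^] q \<oplus> Y'" unfolding Y'_def wq1 i(3) using iq i(1) num(1) by (simp add: nat_pow_distrib)
  finally have l: "Y' [^] q \<oplus> Y' = (num [^] q \<otimes> den \<oplus> num \<otimes> den [^] q) \<otimes> inv den [^] (q + 1)" by (simp only: w1)
  show ?thesis unfolding l main X'_def
    using \<epsilon>(2) x(1) i(1) nat_pow_distrib[OF x(1) i(1), of "q + 1"] by (simp add: m_assoc)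
qed

text \<open>Invariant under \<sigma>, as Y' is multiplied by \<delta> and \<delta>^(q-1) = 1. It
  also factors the left side of the curve: Y'^q + Y' = (V + 1) Y'.\<close>

definition "Vd = Y' [^] (q - 1)"
abbreviation "Td \<equiv> Vd \<oplus> \<one>"

lemma Vd: "Vd \<in> carrier R" "Vd \<noteq> \<zero>" unfolding Vd_def using Y' nz_pow by auto

lemma YT: "Td \<otimes> Y' = \<epsilon> \<otimes> X' [^] (q + 1)"
proof -
  have "q = Suc (q - 1)" using q_bounds by simp
  then have "Y' [^] q = Vd \<otimes> Y'" unfolding Vd_def by (metis nat_pow_Suc)
  then have "Td \<otimes> Y' = Y' [^] q \<oplus> Y'" using Vd Y' by (simp add: l_distr)
  then show ?thesis using curve' by simp
qed

definition "\<kappa>' = inv \<epsilon> [^] (q - 1)"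

lemma \<kappa>': "\<kappa>' \<in> K" "\<kappa>' \<noteq> \<zero>"
proof -
  have "inv \<epsilon> \<in> K" using subfield_m_inv(1)[OF subfield_K] \<epsilon> by simp
  then show "\<kappa>' \<in> K" unfolding \<kappa>'_def by (rule subring_pow[OF subring_K])
  show "\<kappa>' \<noteq> \<zero>" unfolding \<kappa>'_def using nz_pow nz_inv \<epsilon> by simp
qed

text \<open>The curve reads \<epsilon> X'^(q+1) = (V + 1) Y', and the power q - 1 turns Y' into
  \<open>V\<close>.\<close>

lemma X_power: "X' [^] (q\<^sup>2 - 1) = \<kappa>' \<otimes> (Vd \<otimes> Td [^] (q - 1))"
proof -
  note i = nz_inv[OF \<epsilon>(2,3)]
  have "X' [^] (q + 1) = inv \<epsilon> \<otimes> (Td \<otimes> Y')" unfolding YT using cancel_left(2)[OF \<epsilon>(2,3)] X' by simp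
  then have "X' [^] ((q + 1) * (q - 1)) = (inv \<epsilon> \<otimes> (Td \<otimes> Y')) [^] (q - 1)"
    using nat_pow_pow[OF X'(1), of "q + 1" "q - 1"] by metis
  also have "\<dots> = \<kappa>' \<otimes> (Td [^] (q - 1) \<otimes> Vd)"
    unfolding \<kappa>'_def Vd_def using i(1) Y' Vd by (simp add: nat_pow_distrib)
  also have "\<dots> = \<kappa>' \<otimes> (Vd \<otimes> Td [^] (q - 1))" using Vd by (simp add: m_comm)
  finally show ?thesis unfolding q_bounds(3) by (simp add: mult.commute)
qed

section \<open>Action of the automorphism in the new coordinates\<close>

lemma sigma_ring_hom: "ring_hom_cring R R \<sigma>"
  by unfold_locales (rule \<sigma>(1))

lemma sigma_inv:
  assumes "z \<in> carrier R" "z \<noteq> \<zero>" shows "\<sigma> z \<noteq> \<zero>" "\<sigma> (inv z) = inv (\<sigma> z)" "\<sigma> z \<in> carrier R"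
proof -
  interpret s: ring_hom_cring R R \<sigma> by (rule sigma_ring_hom)
  note i = nz_inv[OF assms]
  show c: "\<sigma> z \<in> carrier R" using assms by simp
  have "\<sigma> (z \<otimes> inv z) = \<sigma> z \<otimes> \<sigma> (inv z)" using s.hom_mult[OF assms(1) i(1)] .
  then have e: "\<sigma> z \<otimes> \<sigma> (inv z) = \<one>" using i by simp
  then show "\<sigma> z \<noteq> \<zero>" using i by auto
  show "\<sigma> (inv z) = inv (\<sigma> z)" using comm_inv_char[OF c _ e] i by simp
qed

lemma sigma_pow: "z \<in> carrier R \<Longrightarrow> \<sigma> (z [^] (k::nat)) = \<sigma> z [^] k"
proof -
  interpret s: ring_hom_cring R R \<sigma> by (rule sigma_ring_hom)
  show "z \<in> carrier R \<Longrightarrow> \<sigma> (z [^] (k::nat)) = \<sigma> z [^] k" by (induction k) simp_all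
qed

text \<open>\<sigma> multiplies \<open>x\<close>, \<open>num\<close> and \<open>den\<close> by a/p,
  \<delta>/p and 1/p with the same p = \<delta> y + \<delta> + 1, which cancels in the
  quotients.\<close>

lemma sigma_X: "\<sigma> X' = a \<otimes> X'" and sigma_Y: "\<sigma> Y' = \<delta> \<otimes> Y'"
proof -
  interpret s: ring_hom_cring R R \<sigma> by (rule sigma_ring_hom)
  define p where "p = \<delta> \<otimes> y \<oplus> (\<delta> \<oplus> \<one>)"
  have pc: "p \<in> carrier R" using y \<delta>K by (simp add: p_def)
  have p0: "p \<noteq> \<zero>"
  proof
    assume "p = \<zero>"
    then have "\<sigma> y = inv \<zero>" using \<sigma>(4) by (simp add: p_def)
    have "\<delta> \<otimes> y = \<epsilon>" using sum_zero_imp_eq[of "\<delta> \<otimes> y" \<epsilon>] \<open>p = \<zero>\<close> y \<delta>K \<epsilon> by (simp add: p_def \<epsilon>_def)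
    then have "y = inv \<delta> \<otimes> \<epsilon>" using cancel_left(2)[OF \<delta>K(2,3) y] by simp
    moreover have "(inv \<delta> \<otimes> \<epsilon>) [^] q = inv \<delta> \<otimes> \<epsilon>"
    proof -
      have "\<epsilon> [^] q = \<epsilon>" unfolding \<epsilon>_def using frob[OF \<delta>K(2) one_closed] \<delta>_q(2) by simp
      then show ?thesis using nat_pow_distrib[of "inv \<delta>" \<epsilon> q] nz_inv(1)[OF \<delta>K(2,3)] \<epsilon> inv_pow'[OF \<delta>K(2,3), of q] \<delta>_q(2) by simp
    qed
    ultimately show False using frobenius_fixed_ne_y nz_inv(1)[OF \<delta>K(2,3)] \<epsilon> by simp
  qed
  note ip = nz_inv[OF pc p0] and iw = nz_inv[OF den]
  have "\<sigma> den = \<delta> \<otimes> inv p \<oplus> \<one>" unfolding den_def using y \<delta>K \<sigma>(2)[OF \<delta>K(1)] \<sigma>(4) by (simp add: p_def)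
  also have "\<dots> = (\<delta> \<oplus> p) \<otimes> inv p" using ip \<delta>K pc by (simp add: l_distr)
  also have "\<delta> \<oplus> p = den"
  proof -
    have "\<delta> \<oplus> p = (\<delta> \<oplus> \<delta>) \<oplus> den" unfolding p_def den_def using y \<delta>K by algebra
    then show ?thesis using dbl[OF \<delta>K(2)] den by simp
  qed
  finally have sw: "\<sigma> den = den \<otimes> inv p" .
  have "\<sigma> num = inv p \<oplus> \<one>" unfolding num_def using y \<sigma>(4) by (simp add: p_def)
  also have "\<dots> = (\<one> \<oplus> p) \<otimes> inv p" using ip pc by (simp add: l_distr)
  also have "\<one> \<oplus> p = \<delta> \<otimes> num"
  proof -
    have "\<one> \<oplus> p = (\<one> \<oplus> \<one>) \<oplus> \<delta> \<otimes> num" unfolding p_def num_def using y \<delta>K by algebra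
    then show ?thesis using two \<delta>K num by simp
  qed
  finally have su: "\<sigma> num = \<delta> \<otimes> num \<otimes> inv p" .
  have "inv (\<sigma> den) = inv den \<otimes> p" unfolding sw using inv_mult'[OF den ip(1,2)] ip(5) by simp
  then have siw: "\<sigma> (inv den) = inv den \<otimes> p" using sigma_inv(2)[OF den] by simp
  have "\<sigma> X' = (a \<otimes> x \<otimes> inv p) \<otimes> (inv den \<otimes> p)" unfolding X'_def using x iw \<sigma>(3) siw by (simp add: p_def)
  also have "\<dots> = (a \<otimes> (x \<otimes> inv den)) \<otimes> (inv p \<otimes> p)" using x(1) iw(1) ip(1) pc ac by algebra
  finally show "\<sigma> X' = a \<otimes> X'" unfolding X'_def using ip(4) x iw ac by simp
  have "\<sigma> Y' = (\<delta> \<otimes> num \<otimes> inv p) \<otimes> (inv den \<otimes> p)" unfolding Y'_def using num iw su siw by simp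
  also have "\<dots> = (\<delta> \<otimes> (num \<otimes> inv den)) \<otimes> (inv p \<otimes> p)" using num(1) iw(1) ip(1) pc \<delta>K(2) by algebra
  finally show "\<sigma> Y' = \<delta> \<otimes> Y'" unfolding Y'_def using ip(4) num iw \<delta>K by simp
qed

lemma sigma_V: "\<sigma> Vd = Vd"
  unfolding Vd_def using sigma_pow[OF Y'(1)] sigma_Y \<delta>_q(1) \<delta>K Y' by (simp add: nat_pow_distrib)

text \<open>In characteristic 2 the matrix with rows (1, 1) and (\<delta>, 1) squares to the scalar
  \<delta> + 1, so the change of coordinate is its own inverse.\<close>

lemma y_eq: "\<delta> \<otimes> Y' \<oplus> \<one> \<noteq> \<zero>" "y = (Y' \<oplus> \<one>) \<otimes> inv (\<delta> \<otimes> Y' \<oplus> \<one>)"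
proof -
  note iw = nz_inv[OF den]
  have Yw: "Y' \<otimes> den = num" unfolding Y'_def using iw den num by (simp add: m_assoc)
  have "(\<delta> \<otimes> Y' \<oplus> \<one>) \<otimes> den = \<delta> \<otimes> (Y' \<otimes> den) \<oplus> den" using \<delta>K(2) Y'(1) den(1) by algebra
  also have "\<dots> = (\<delta> \<otimes> y \<oplus> \<delta> \<otimes> y) \<oplus> \<epsilon>"
    unfolding Yw unfolding num_def den_def \<epsilon>_def using y \<delta>K(2) by algebra
  also have "\<dots> = \<epsilon>" using dbl[of "\<delta> \<otimes> y"] y \<delta>K \<epsilon> by simp
  finally have e: "(\<delta> \<otimes> Y' \<oplus> \<one>) \<otimes> den = \<epsilon>" .
  then show nz: "\<delta> \<otimes> Y' \<oplus> \<one> \<noteq> \<zero>" using \<epsilon>(3) den by auto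
  have "(Y' \<oplus> \<one>) \<otimes> den = Y' \<otimes> den \<oplus> den" using Y' den by (simp add: l_distr)
  also have "\<dots> = (\<one> \<oplus> \<one>) \<oplus> (\<delta> \<oplus> \<one>) \<otimes> y" unfolding Yw unfolding num_def den_def using y \<delta>K(2) by algebra
  also have "\<dots> = \<epsilon> \<otimes> y" using two y \<delta>K by (simp add: \<epsilon>_def)
  finally have "(Y' \<oplus> \<one>) \<otimes> den = ((\<delta> \<otimes> Y' \<oplus> \<one>) \<otimes> den) \<otimes> y" unfolding e .
  also have "\<dots> = (y \<otimes> (\<delta> \<otimes> Y' \<oplus> \<one>)) \<otimes> den" using y \<delta>K(2) Y'(1) den(1) by algebra
  finally have "Y' \<oplus> \<one> = y \<otimes> (\<delta> \<otimes> Y' \<oplus> \<one>)" using m_rcancel[OF den(2,1)] y \<delta>K Y' by simp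
  then show "y = (Y' \<oplus> \<one>) \<otimes> inv (\<delta> \<otimes> Y' \<oplus> \<one>)"
    using div_eq_iff[of "Y' \<oplus> \<one>" "\<delta> \<otimes> Y' \<oplus> \<one>" y] nz y \<delta>K Y' by simp
qed

text \<open>If \<open>V\<close>, and with it Y', were a root of unity, K[Y'] would be finite.
  Nonzero elements of a finite subring are roots of unity, so their inverses stay inside; hence
  \<open>y\<close> and x^(q+1) would lie in it and \<open>x\<close> would be a root of
  unity.\<close>

lemma V_nontorsion: assumes i: "(i::nat) > 0" shows "Vd [^] i \<noteq> \<one>"
proof
  assume Vi: "Vd [^] i = \<one>"
  define k where "k = (q - 1) * i"
  have k: "k > 0" using i q_bounds(1) by (simp add: k_def)
  have Yk: "Y' [^] k = \<one>" using nat_pow_pow[OF Y'(1), of "q - 1" i] Vi by (simp add: k_def Vd_def)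
  have all: "finite L \<Longrightarrow> subring L R \<Longrightarrow> z \<in> L \<Longrightarrow> z \<noteq> \<zero> \<Longrightarrow> \<exists>j::nat. j > 0 \<and> z [^] j = \<one>" for L z
  proof -
    assume L: "finite L" "subring L R" "z \<in> L" "z \<noteq> \<zero>"
    have zc: "z \<in> carrier R" using subringE(1)[OF L(2)] L(3) by auto
    have "range (\<lambda>j::nat. z [^] j) \<subseteq> L" using subring_pow[OF L(2,3)] by auto
    then have "finite (range (\<lambda>j::nat. z [^] j))" using L(1) finite_subset by blast
    then have "\<not> inj (\<lambda>j::nat. z [^] j)" using finite_imageD by blast
    then obtain i j :: nat where ij: "i < j" "z [^] i = z [^] j"
      unfolding inj_def by (metis linorder_neqE_nat)
    have "z [^] j = z [^] i \<otimes> z [^] (j - i)" using nat_pow_mult[OF zc, of i "j - i"] ij(1) by simp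
    then have "z [^] i \<otimes> \<one> = z [^] i \<otimes> z [^] (j - i)" using ij(2) zc by simp
    then have "z [^] (j - i) = \<one>"
      using m_lcancel[OF nz_pow[OF zc L(4)] nat_pow_closed[OF zc] one_closed] zc by simp
    then show "\<exists>j::nat. j > 0 \<and> z [^] j = \<one>" using ij(1) by (intro exI[of _ "j - i"]) simp
  qed
  define L where "L = adjoin K Y'"
  have sL: "subring L R" unfolding L_def by (rule adjoin_subring[OF subring_K Y'(1)])
  have KL: "K \<subseteq> L" "Y' \<in> L" unfolding L_def using adjoin_base[OF subring_K Y'(1)] adjoin_gen[OF subring_K Y'(1)] by auto
  have "L = polys K Y' k"
  proof -
    \<comment> \<open>Exponents of Y' can be reduced modulo \<open>k\<close>, so \<open>k\<close>
      coefficients suffice.\<close>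
    have "polys K Y' (k + j) \<subseteq> polys K Y' k" for j
    proof (induction j)
      case (Suc j)
      have "polys K Y' (Suc (k + j)) \<subseteq> polys K Y' k"
      proof
        fix z assume "z \<in> polys K Y' (Suc (k + j))"
        then obtain p c where pc: "z = p \<oplus> c \<otimes> Y' [^] (k + j)" "c \<in> K" "p \<in> polys K Y' (k + j)"
          unfolding polys_snoc[OF Kc K0 Y'(1)] by blast
        define r where "r = (k + j) mod k"
        have "Y' [^] (k + j) = Y' [^] r"
        proof -
          have "k + j = k * ((k + j) div k) + r" unfolding r_def by (rule mult_div_mod_eq[symmetric])
          then have "Y' [^] (k + j) = (Y' [^] k) [^] ((k + j) div k) \<otimes> Y' [^] r"
            using nat_pow_mult[OF Y'(1)] nat_pow_pow[OF Y'(1)] by metis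
          then show ?thesis using Yk Y' by simp
        qed
        moreover have "r < k" unfolding r_def using k by simp
        moreover have "c \<otimes> Y' [^] r \<in> polys K Y' (Suc r)"
        proof -
          have "c \<otimes> Y' [^] r = \<zero> \<oplus> c \<otimes> Y' [^] r" using pc(2) Kc Y' by auto
          then show ?thesis unfolding polys_snoc[OF Kc K0 Y'(1)] using pc(2) polys_zero[OF K0 Y'(1)] by blast
        qed
        ultimately have "c \<otimes> Y' [^] (k + j) \<in> polys K Y' k" using polys_mono[OF Kc K0 Y'(1), of "Suc r" k] by auto
        moreover have "p \<in> polys K Y' k" using pc(3) Suc by auto
        ultimately show "z \<in> polys K Y' k" unfolding pc(1)
          using additive_subgroup.a_closed[OF polys_subgroup[OF subring_additive[OF subring_K] Y'(1)]] by blast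
      qed
      then show ?case by simp
    qed simp
    moreover have "polys K Y' j \<subseteq> polys K Y' (k + j)" for j by (rule polys_mono[OF Kc K0 Y'(1)]) simp
    ultimately show ?thesis unfolding L_def adjoin_def by blast
  qed
  then have fL: "finite L" using polys_card[OF finite_K] by simp
  have L1: "\<delta> \<otimes> Y' \<oplus> \<one> \<in> L" "Y' \<oplus> \<one> \<in> L"
    using subringE(3,7)[OF sL] subringE(6)[OF sL] KL \<delta>K by auto
  define d where "d = \<delta> \<otimes> Y' \<oplus> \<one>"
  have d: "d \<in> L" "d \<noteq> \<zero>" "d \<in> carrier R" using L1 y_eq(1) subringE(1)[OF sL] by (auto simp: d_def)
  obtain j :: nat where j: "j > 0" "d [^] j = \<one>" using all[OF fL sL d(1,2)] by blast
  obtain j' where j': "j = Suc j'" using j(1) by (cases j) auto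
  have "inv d = d [^] j'" using comm_inv_char[OF d(3) nat_pow_closed[OF d(3)], of j'] j(2) j' d(3) by (simp add: m_comm)
  then have "inv d \<in> L" using subring_pow[OF sL d(1)] by simp
  then have "(Y' \<oplus> \<one>) \<otimes> inv (\<delta> \<otimes> Y' \<oplus> \<one>) \<in> L" using subringE(6)[OF sL L1(2)] by (simp add: d_def)
  then have yL: "y \<in> L" by (subst y_eq(2))
  have "x [^] (q + 1) \<in> L" unfolding curve[symmetric] using subringE(7)[OF sL subring_pow[OF sL yL] yL] .
  then obtain i :: nat where i: "i > 0" "(x [^] (q + 1)) [^] i = \<one>" using all[OF fL sL _ nz_pow[OF x(1,2)]] by blast
  then have "x [^] ((q + 1) * i) = \<one>" using nat_pow_pow[OF x(1), of "q + 1" i] by simp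
  then show False using x(3)[of "(q + 1) * i"] i(1) by simp
qed

lemma radical: "radical_extension R K Vd X' (q\<^sup>2 - 1)"
proof -
  have s: "subring (adjoin K Vd) R" by (rule adjoin_subring[OF subring_K Vd(1)])
  have V: "Vd \<in> adjoin K Vd" "K \<subseteq> adjoin K Vd" using adjoin_gen[OF subring_K Vd(1)] adjoin_base[OF subring_K Vd(1)] by auto
  have "Td \<in> adjoin K Vd" using subringE(7)[OF s V(1) subringE(3)[OF s]] .
  then have "Vd \<otimes> Td [^] (q - 1) \<in> adjoin K Vd" using subringE(6)[OF s V(1) subring_pow[OF s]] by blast
  then have "X' [^] (q\<^sup>2 - 1) \<in> adjoin K Vd" unfolding X_power using subringE(6)[OF s] \<kappa>'(1) V(2) by blast
  then show ?thesis
    by (intro radical_extension.intro field_axioms radical_extension_axioms.intro subfield_K finite_K Vd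
        V_nontorsion X'(1) q_bounds(4))
qed

text \<open>All generators are fractions: Y' = \<epsilon> X'^(q+1) / (V + 1), then \<open>y\<close>
  by the inverse change of coordinate, then \<open>den\<close>, and finally x = X' den.\<close>

lemma hermitian_spanning:
  assumes z: "z \<in> carrier R"
  shows "\<exists>h\<in>adjoin K Vd. h \<noteq> \<zero> \<and> h \<otimes> z \<in> polys (adjoin K Vd) X' (q\<^sup>2 - 1)"
proof -
  interpret E: radical_extension R K Vd X' "q\<^sup>2 - 1" by (rule radical)
  note F = E.fractions_closed
  have XF: "X' \<in> E.fractions" using E.polys_B_fractions E.w_mem by blast
  have KF: "K \<subseteq> E.fractions"
    using E.polys_B_fractions E.B_sub adjoin_base[OF subring_K Vd(1)] by blast
  have VB: "Vd \<in> adjoin K Vd" by (rule adjoin_gen[OF subring_K Vd(1)])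
  have TB: "Td \<in> adjoin K Vd" using subringE(7)[OF E.B_subring VB subringE(3)[OF E.B_subring]] .
  have Tn: "Td \<noteq> \<zero>" using YT nz_mult[OF \<epsilon>(2) nat_pow_closed[OF X'(1)] \<epsilon>(3) nz_pow[OF X'], of "q + 1"] Y' by auto
  have "\<epsilon> \<otimes> X' [^] (q + 1) \<in> polys (adjoin K Vd) X' (q\<^sup>2 - 1)"
    using subringE(6)[OF E.polys_B_subring _ subring_pow[OF E.polys_B_subring E.w_mem]] E.B_sub
      adjoin_base[OF subring_K Vd(1)] \<epsilon>(1) by blast
  then have YF: "Y' \<in> E.fractions" unfolding E.fractions_def using TB Tn YT Y' by auto
  have 1: "\<one> \<in> E.fractions" "\<delta> \<in> E.fractions" using KF K1 \<delta>K by auto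
  have "\<delta> \<otimes> Y' \<oplus> \<one> \<in> E.fractions" using F(1)[OF F(2)[OF 1(2) YF] 1(1)] .
  then have "inv (\<delta> \<otimes> Y' \<oplus> \<one>) \<in> E.fractions" using F(4) y_eq(1) by blast
  then have yF: "y \<in> E.fractions" by (subst y_eq(2)) (rule F(2)[OF F(1)[OF YF 1(1)]])
  have wF: "den \<in> E.fractions" unfolding den_def using F(1)[OF F(2)[OF 1(2) yF] 1(1)] .
  have "x = X' \<otimes> den" unfolding X'_def using x den nz_inv[OF den] by (simp add: m_assoc)
  then have xF: "x \<in> E.fractions" using F(2)[OF XF wF] by simp
  have "E.fractions = carrier R" by (rule E.fractions_eq_carrier[OF generated]) (use KF xF yF in auto)
  then show ?thesis using z unfolding E.fractions_def by blast
qed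

end

text \<open>Expressions keep their meaning in the fixed field, whose record differs from that of the
  big field only in the carrier.\<close>

lemma (in ring) polys_consistent:
  assumes F: "subring F R" shows "ring.polys (R\<lparr>carrier := F\<rparr>) B w n = polys B w n"
proof -
  interpret F: ring "R\<lparr>carrier := F\<rparr>" by (rule subring_is_ring[OF F])
  show ?thesis by (induction n) (simp_all add: F.polys.simps polys.simps)
qed

lemma (in ring) adjoin_consistent:
  assumes F: "subring F R" shows "ring.adjoin (R\<lparr>carrier := F\<rparr>) B w = adjoin B w"
  unfolding ring.adjoin_def[OF subring_is_ring[OF F]] adjoin_def polys_consistent[OF F] ..

lemma (in cring) polys_monomial:
  assumes B: "B \<subseteq> carrier R" "\<zero> \<in> B" and w: "w \<in> carrier R" and g: "g \<in> B" "i < n"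
  shows "g \<otimes> w [^] i \<in> polys B w n"
proof -
  have "g \<otimes> w [^] i = \<zero> \<oplus> g \<otimes> w [^] i" using B g w by auto
  then have "g \<otimes> w [^] i \<in> polys B w (Suc i)" unfolding polys_snoc[OF B w] using g(1) polys_zero[OF B(2) w] by blast
  then show ?thesis using polys_mono[OF B w, of "Suc i" n] g(2) by auto
qed

section \<open>The fixed field as a Kummer extension of K(V)\<close>

context hermitian_automorphism
begin

lemma sigma_funpow:
  shows "(\<sigma> ^^ k) \<in> ring_hom R R" "c \<in> K \<Longrightarrow> (\<sigma> ^^ k) c = c" "(\<sigma> ^^ k) X' = a [^] k \<otimes> X'" "(\<sigma> ^^ k) Vd = Vd"
proof -
  show "(\<sigma> ^^ k) \<in> ring_hom R R"
  proof (induction k)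
    case 0
    show ?case by (simp add: ring_hom_def)
  next
    case (Suc k)
    then show ?case using ring_hom_trans[OF Suc \<sigma>(1)] by (simp only: funpow.simps)
  qed
  show "c \<in> K \<Longrightarrow> (\<sigma> ^^ k) c = c" by (induction k) (simp_all add: \<sigma>(2))
  show "(\<sigma> ^^ k) Vd = Vd" by (induction k) (simp_all add: sigma_V)
  interpret s: ring_hom_cring R R \<sigma> by (rule sigma_ring_hom)
  show "(\<sigma> ^^ k) X' = a [^] k \<otimes> X'"
  proof (induction k)
    case (Suc k)
    have "\<sigma> (a [^] k \<otimes> X') = a [^] k \<otimes> (a \<otimes> X')"
      using sigma_X sigma_pow[OF ac] \<sigma>(2)[OF a(1)] ac X' by simp
    then show ?case using Suc ac X' by (simp add: m_assoc)
  qed (use X' in simp)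
qed

lemma a_pow_eq_1: assumes "a [^] (k::nat) = \<one>" shows "q\<^sup>2 - 1 dvd k"
proof -
  define N where "N = q\<^sup>2 - 1"
  have N: "N > 0" using q_bounds(4) by (simp add: N_def)
  have "a [^] k = a [^] (N * (k div N)) \<otimes> a [^] (k mod N)"
    using nat_pow_mult[OF ac, of "N * (k div N)" "k mod N"] by simp
  also have "a [^] (N * (k div N)) = \<one>" using nat_pow_pow[OF ac, of N "k div N"] a(4) by (simp add: N_def)
  finally have e: "a [^] (k mod N) = a [^] (0::nat)" using assms ac by simp
  have "k mod N = 0" by (rule a(3)[OF _ _ e]) (use N in \<open>simp_all add: N_def\<close>)
  then show ?thesis by (simp add: N_def dvd_eq_mod_eq_0)
qed

definition Fx where "Fx k = {z \<in> carrier R. (\<sigma> ^^ k) z = z}"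

lemma Fx_subfield: "subfield (Fx k) R"
proof (rule subfieldI')
  interpret t: ring_hom_cring R R "\<sigma> ^^ k" by unfold_locales (rule sigma_funpow(1))
  show "subring (Fx k) R" by (rule subringI) (auto simp: Fx_def)
  fix z assume z: "z \<in> Fx k - {\<zero>}"
  then have zc: "z \<in> carrier R" "z \<noteq> \<zero>" "(\<sigma> ^^ k) z = z" by (auto simp: Fx_def)
  note i = nz_inv[OF zc(1,2)]
  have "z \<otimes> (\<sigma> ^^ k) (inv z) = (\<sigma> ^^ k) (z \<otimes> inv z)" using t.hom_mult[OF zc(1) i(1)] zc(3) by simp
  then have "z \<otimes> (\<sigma> ^^ k) (inv z) = \<one>" using i(3) by simp
  then have "inv z = (\<sigma> ^^ k) (inv z)" using comm_inv_char[OF zc(1)] i(1) by simp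
  then show "inv z \<in> Fx k" using i(1) by (simp add: Fx_def)
qed

text \<open>In an expansion in powers of X' the terms are eigenvectors of \<sigma> with distinct
  eigenvalues a^i. The fixed field of \<sigma>^s is stable under \<sigma>, so every term belongs to
  it; for a nonzero term this means a^(s i) = 1, hence \<open>m\<close> divides i, and a power of
  X'^m is left.\<close>

lemma fixed_spanning:
  assumes sm: "s * m = q\<^sup>2 - 1" and z: "z \<in> Fx s"
  shows "\<exists>h\<in>adjoin K Vd. h \<noteq> \<zero> \<and> h \<otimes> z \<in> polys (adjoin K Vd) (X' [^] m) s"
proof -
  interpret t: ring_hom_cring R R "\<sigma> ^^ s" by unfold_locales (rule sigma_funpow(1))
  interpret s: ring_hom_cring R R \<sigma> by (rule sigma_ring_hom)
  define N where "N = q\<^sup>2 - 1"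
  define B where "B = adjoin K Vd"
  have sB: "subring B R" unfolding B_def by (rule adjoin_subring[OF subring_K Vd(1)])
  have Bc: "B \<subseteq> carrier R" "\<zero> \<in> B" using subringE[OF sB] by auto
  have fixB: "\<sigma> g = g" if "g \<in> B" for g
  proof -
    have "subring {z \<in> carrier R. \<sigma> z = z} R" by (rule subringI) auto
    then have "B \<subseteq> {z \<in> carrier R. \<sigma> z = z}" unfolding B_def
      by (rule adjoin_least) (use \<sigma>(2) Kc Vd sigma_V in auto)
    then show ?thesis using that by auto
  qed
  then have fixBk: "(\<sigma> ^^ k) g = g" if "g \<in> B" for g k using that by (induction k) simp_all
  have zc: "z \<in> carrier R" using z by (simp add: Fx_def)
  note sF = subfieldE(1)[OF Fx_subfield[of s]]
  obtain h where h: "h \<in> B" "h \<noteq> \<zero>" "h \<otimes> z \<in> polys B X' N"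
    using hermitian_spanning[OF zc] unfolding B_def N_def by blast
  have "h \<in> Fx s" using h(1) Bc fixBk by (auto simp: Fx_def)
  then have hzF: "h \<otimes> z \<in> Fx s" using subringE(6)[OF sF _ z] by blast
  obtain g where g: "g \<in> {..<N} \<rightarrow> B" "h \<otimes> z = (\<Oplus>i\<in>{..<N}. g i \<otimes> X' [^] i)"
    using h(3) unfolding polys_finsum[OF Bc X'(1)] by blast
  have gc: "g i \<in> B" "g i \<in> carrier R" if "i < N" for i using g(1) that Bc by auto
  have spow: "(\<sigma> ^^ k) (X' [^] i) = (a [^] k) [^] i \<otimes> X' [^] i" for k i :: nat
  proof -
    interpret tk: ring_hom_cring R R "\<sigma> ^^ k" by unfold_locales (rule sigma_funpow(1))
    have "(\<sigma> ^^ k) (X' [^] i) = ((\<sigma> ^^ k) X') [^] i" using X' by (induction i) simp_all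
    then show ?thesis unfolding sigma_funpow(3) using nat_pow_distrib[of "a [^] k" X' i] ac X' by simp
  qed
  have comp: "g i \<otimes> X' [^] i \<in> Fx s" if i: "i < N" for i
  proof (rule eigen_components[OF subfield_K subring_additive[OF sF] _ \<sigma>(1,2) _ finite_lessThan[of N]])
    show "c \<otimes> z \<in> Fx s" if "c \<in> K" "z \<in> Fx s" for c z
      using subringE(6)[OF sF _ that(2)] sigma_funpow(2)[OF that(1), of s] that(1) Kc by (auto simp: Fx_def)
    show "\<sigma> z \<in> Fx s" if "z \<in> Fx s" for z
      using that funpow_swap1[of \<sigma> s z] by (auto simp: Fx_def)
    show "\<sigma> (g i \<otimes> X' [^] i) = a [^] i \<otimes> (g i \<otimes> X' [^] i)" if "i \<in> {..<N}" for i
      using spow[of 1 i] gc[of i] fixB[of "g i"] that ac X' by (simp add: m_lcomm)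
    show "inj_on (\<lambda>i. a [^] i) {..<N}" using a(3) by (auto simp: inj_on_def N_def)
    show "a [^] i \<in> K" for i :: nat by (rule subring_pow[OF subring_K a(1)])
  qed (use i gc X' g(2) hzF in auto)
  have mono: "g i \<otimes> X' [^] i \<in> polys B (X' [^] m) s" if i: "i < N" for i
  proof (cases "g i = \<zero>")
    case True
    then show ?thesis using X' polys_zero[OF Bc(2)] by simp
  next
    case False
    have c: "g i \<otimes> X' [^] i \<in> carrier R" "g i \<otimes> X' [^] i \<noteq> \<zero>"
      using gc[OF i] X' nz_pow[OF X'] nz_mult False by auto
    have "(\<sigma> ^^ s) (g i \<otimes> X' [^] i) = g i \<otimes> ((a [^] s) [^] i \<otimes> X' [^] i)"
      using t.hom_mult[OF gc(2)[OF i] nat_pow_closed[OF X'(1)], of i] fixBk[OF gc(1)[OF i]] spow by simp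
    also have "\<dots> = (a [^] (s * i)) \<otimes> (g i \<otimes> X' [^] i)"
      using nat_pow_pow[OF ac] gc[OF i] X' ac by (simp add: m_lcomm)
    finally have "(a [^] (s * i)) \<otimes> (g i \<otimes> X' [^] i) = \<one> \<otimes> (g i \<otimes> X' [^] i)"
      using comp[OF i] c by (simp add: Fx_def)
    then have "a [^] (s * i) = \<one>" using m_rcancel[OF c(2,1)] ac by simp
    then have "s * m dvd s * i" using a_pow_eq_1 sm by simp
    moreover have sp: "s > 0" using sm q_bounds(4) by (cases s) auto
    ultimately have "m dvd i" by simp
    then obtain j where j: "i = m * j" by (elim dvdE)
    have "m * j < m * s" using i j sm by (simp add: N_def mult.commute)
    then have js: "j < s" by simp
    have "X' [^] i = (X' [^] m) [^] j" unfolding j using nat_pow_pow[OF X'(1)] by simp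
    then show ?thesis using polys_monomial[OF Bc _ gc(1)[OF i] js, of "X' [^] m"] X' by simp
  qed
  have "h \<otimes> z \<in> polys B (X' [^] m) s" unfolding g(2)
    by (rule additive_finsum[OF polys_subgroup[OF subring_additive[OF sB]]]) (use X' mono in auto)
  then show ?thesis using h unfolding B_def by blast
qed

text \<open>Here b = q - 1, so that b + 1 = q is prime to every divisor of q^2 - 1. The generator
  X'^m is fixed by \<sigma>^s because a^(s m) = 1.\<close>

lemma kummer_fixed_field:
  assumes sm: "s * m = q\<^sup>2 - 1"
  shows "kummer_extension (R\<lparr>carrier := Fx s\<rparr>) K Vd (X' [^] m) \<kappa>' s (q - 1) \<sigma> (a [^] m)"
proof -
  define F where "F = R\<lparr>carrier := Fx s\<rparr>"
  note sF = subfieldE(1)[OF Fx_subfield[of s]]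
  interpret t: ring_hom_cring R R "\<sigma> ^^ s" by unfold_locales (rule sigma_funpow(1))
  interpret s: ring_hom_cring R R \<sigma> by (rule sigma_ring_hom)
  interpret F: field F unfolding F_def by (rule subfield_iff(2)[OF Fx_subfield])
  have s1: "s \<ge> 1" using sm q_bounds(4) by (cases s) auto
  have pw: "z [^]\<^bsub>F\<^esub> (k::nat) = z [^] k" for z k by (simp add: F_def nat_pow_def)
  have [simp]: "carrier F = Fx s" "\<zero>\<^bsub>F\<^esub> = \<zero>" "\<one>\<^bsub>F\<^esub> = \<one>" "z \<otimes>\<^bsub>F\<^esub> z' = z \<otimes> z'" "z \<oplus>\<^bsub>F\<^esub> z' = z \<oplus> z'" for z z'
    by (simp_all add: F_def)
  have PSF: "F.polys B w n = polys B w n" "F.adjoin B w = adjoin B w" for B w n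
    unfolding F_def using polys_consistent[OF sF] adjoin_consistent[OF sF] by auto
  have KF: "K \<subseteq> Fx s" using Kc sigma_funpow(2) by (auto simp: Fx_def)
  have "kummer_extension F K Vd (X' [^] m) \<kappa>' s (q - 1) \<sigma> (a [^] m)"
  proof (intro kummer_extension.intro kummer_extension_axioms.intro)
    show "field F" by (rule F.field_axioms)
    show "subfield K F"
    proof (rule F.subfield_iff(1))
      show "field (F\<lparr>carrier := K\<rparr>)" using subfield_iff(2)[OF subfield_K] by (simp add: F_def)
      show "K \<subseteq> carrier F" using KF by simp
    qed
    show "finite K" by (rule finite_K)
    show "Vd \<in> carrier F" using Vd sigma_funpow(4) by (simp add: Fx_def)
    show "Vd \<noteq> \<zero>\<^bsub>F\<^esub>" using Vd by simp
    show "Vd [^]\<^bsub>F\<^esub> i \<noteq> \<one>\<^bsub>F\<^esub>" if "0 < i" for i :: nat using V_nontorsion[OF that] by (simp add: pw)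
    have "(\<sigma> ^^ s) (X' [^] m) = ((\<sigma> ^^ s) X') [^] m" using X' by (induction m) simp_all
    also have "\<dots> = a [^] (s * m) \<otimes> X' [^] m"
      unfolding sigma_funpow(3) using nat_pow_distrib[of "a [^] s" X' m] nat_pow_pow[OF ac] ac X' by simp
    also have "\<dots> = X' [^] m" using a(4) sm X' by simp
    finally show "X' [^] m \<in> carrier F" using X' by (simp add: Fx_def)
    show "\<kappa>' \<in> K" "\<kappa>' \<noteq> \<zero>\<^bsub>F\<^esub>" using \<kappa>' by auto
    have "(X' [^] m) [^] s = X' [^] (q\<^sup>2 - 1)" using nat_pow_pow[OF X'(1), of m s] sm by (simp add: mult.commute)
    then show "(X' [^] m) [^]\<^bsub>F\<^esub> s = \<kappa>' \<otimes>\<^bsub>F\<^esub> (Vd \<otimes>\<^bsub>F\<^esub> (Vd \<oplus>\<^bsub>F\<^esub> \<one>\<^bsub>F\<^esub>) [^]\<^bsub>F\<^esub> (q - 1))"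
      using X_power by (simp add: pw)
    show "1 \<le> s" by (rule s1)
    show "1 \<le> q - 1" using q_bounds(1) by simp
    show "coprime s (q - 1 + 1)"
    proof (rule coprimeI)
      fix c assume c: "c dvd s" "c dvd q - 1 + 1"
      have "c dvd q" using c(2) q_bounds(1) by simp
      then have "c dvd q\<^sup>2" by (simp add: power2_eq_square)
      moreover have "c dvd q\<^sup>2 - 1" using c(1) sm by (metis dvd_mult2)
      moreover have "q\<^sup>2 = (q\<^sup>2 - 1) + 1" using q_bounds(2) by simp
      ultimately show "is_unit c" by (metis dvd_add_right_iff)
    qed
    show "\<exists>h\<in>F.adjoin K Vd. h \<noteq> \<zero>\<^bsub>F\<^esub> \<and> h \<otimes>\<^bsub>F\<^esub> z \<in> F.polys (F.adjoin K Vd) (X' [^] m) s" if "z \<in> carrier F" for z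
      using fixed_spanning[OF sm, of z] that by (simp add: PSF)
    show "\<sigma> \<in> ring_hom F F"
    proof (rule ring_hom_memI)
      show "\<sigma> z \<in> carrier F" if "z \<in> carrier F" for z
        using that funpow_swap1[of \<sigma> s z] by (auto simp: Fx_def)
    qed (auto simp: Fx_def)
    show "\<sigma> c = c" if "c \<in> K" for c by (rule \<sigma>(2)[OF that])
    show "\<sigma> Vd = Vd" by (rule sigma_V)
    show "\<sigma> (X' [^] m) = a [^] m \<otimes>\<^bsub>F\<^esub> X' [^] m"
      using sigma_pow[OF X'(1)] sigma_X nat_pow_distrib[OF ac X'(1)] by simp
    show "a [^] m \<in> K" by (rule subring_pow[OF subring_K a(1)])
    show "i = j" if ij: "i < s" "j < s" "(a [^] m) [^]\<^bsub>F\<^esub> i = (a [^] m) [^]\<^bsub>F\<^esub> j" for i j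
    proof -
      have m: "m > 0" using sm q_bounds(4) by (cases m) auto
      have "m * k < q\<^sup>2 - 1" if "k < s" for k using that m sm by (metis mult.commute mult_less_mono1)
      moreover have "a [^] (m * i) = a [^] (m * j)" using ij(3) nat_pow_pow[OF ac] by (simp add: pw)
      ultimately have "m * i = m * j" using a(3) ij(1,2) by blast
      then show ?thesis using m by simp
    qed
  qed
  then show ?thesis by (simp add: F_def)
qed

text \<open>\<open>gaps_formula\<close> is multiplied by \<open>m\<close>, and m gcd(q - 1, s) =
  gcd((q - 1) m, (q - 1)(q + 1)) = (q - 1) gcd(m, q + 1).\<close>

lemma genus_fixed_field:
  assumes sm: "s * m = q\<^sup>2 - 1"
  shows "2 * int m * genus (R\<lparr>carrier := Fx s\<rparr>) K = (int q - 1) * (int q + 1 - int (gcd m (q + 1)))"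
proof -
  interpret k: kummer_extension "R\<lparr>carrier := Fx s\<rparr>" K Vd "X' [^] m" \<kappa>' s "q - 1" \<sigma> "a [^] m"
    by (rule kummer_fixed_field[OF sm])
  have "m * gcd (q - 1) s = gcd ((q - 1) * m) ((q - 1) * (q + 1))"
    using sm q_bounds(3) by (simp add: gcd_mult_distrib_nat mult.commute)
  also have "\<dots> = (q - 1) * gcd m (q + 1)" by (rule gcd_mult_distrib_nat[symmetric])
  finally have g: "m * gcd (q - 1) s = (q - 1) * gcd m (q + 1)" .
  have "m * (2 * k.gaps + gcd (q - 1) s) = m * s" using k.gaps_formula by simp
  then have "2 * m * k.gaps + (q - 1) * gcd m (q + 1) = (q - 1) * (q + 1)"
    using g sm q_bounds(3) by (simp add: distrib_left mult_ac)
  then have "int (2 * m * k.gaps + (q - 1) * gcd m (q + 1)) = int ((q - 1) * (q + 1))" by (simp only:)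
  moreover have "int (q - 1) = int q - 1" using q_bounds(1) by simp
  ultimately have "2 * int m * int k.gaps + (int q - 1) * int (gcd m (q + 1)) = (int q - 1) * (int q + 1)"
    by (simp only: of_nat_add of_nat_mult of_nat_numeral of_nat_1)
  then show ?thesis unfolding k.genus_eq by (simp add: algebra_simps)
qed

end

section \<open>The automorphism group\<close>

text \<open>\<open>field_aut_group\<close> is \<open>BijGroup\<close> with a smaller carrier, so
  this supplies its group structure.\<close>

lemma (in field) field_aut_group_subgroup:
  "subgroup {f \<in> ring_iso R R \<inter> extensional (carrier R). \<forall>k\<in>K. f k = k} (BijGroup (carrier R))"
  if K: "K \<subseteq> carrier R"
proof -
  define C where "C = {f \<in> ring_iso R R \<inter> extensional (carrier R). \<forall>k\<in>K. f k = k}"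
  have bij: "f \<in> Bij (carrier R)" if "f \<in> C" for f
    using that unfolding C_def Bij_def ring_iso_def by auto
  have "subgroup C (BijGroup (carrier R))"
  proof (rule group.subgroupI[OF group_BijGroup])
    show "C \<subseteq> carrier (BijGroup (carrier R))" using bij by (auto simp: BijGroup_def)
    have "(\<lambda>z\<in>carrier R. z) \<in> C"
    proof -
      have "(\<lambda>z\<in>carrier R. z) \<in> ring_iso R R"
        by (rule ring_iso_restrict[of id]) (auto simp: ring_iso_def ring_hom_def)
      then show ?thesis using K by (auto simp: C_def)
    qed
    then show "C \<noteq> {}" by auto
  next
    fix f assume f: "f \<in> C"
    have fi: "f \<in> ring_iso R R" "bij_betw f (carrier R) (carrier R)" "\<And>k. k \<in> K \<Longrightarrow> f k = k"
      using f by (auto simp: C_def ring_iso_def)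
    have "inv\<^bsub>BijGroup (carrier R)\<^esub> f = (\<lambda>z\<in>carrier R. inv_into (carrier R) f z)"
      by (rule inv_BijGroup[OF bij[OF f]])
    moreover have "(\<lambda>z\<in>carrier R. inv_into (carrier R) f z) \<in> ring_iso R R"
      by (rule ring_iso_restrict[OF ring_iso_set_sym[OF ring_axioms fi(1)]]) simp
    moreover have "inv_into (carrier R) f k = k" if "k \<in> K" for k
      using bij_betw_inv_into_left[OF fi(2), of k] fi(3)[OF that] that K by auto
    ultimately show "inv\<^bsub>BijGroup (carrier R)\<^esub> f \<in> C" using K by (auto simp: C_def)
  next
    fix f g assume fg: "f \<in> C" "g \<in> C"
    have "compose (carrier R) f g \<in> ring_iso R R"
    proof (rule ring_iso_restrict)
      show "f \<circ> g \<in> ring_iso R R" using ring_iso_set_trans[of g R R f R] fg by (auto simp: C_def)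
    qed (simp add: compose_def)
    then show "f \<otimes>\<^bsub>BijGroup (carrier R)\<^esub> g \<in> C"
      using fg bij K by (auto simp: BijGroup_def C_def compose_def)
  qed
  then show ?thesis by (simp add: C_def)
qed

lemma (in field) field_aut_group:
  assumes K: "K \<subseteq> carrier R"
  shows "Group.group (field_aut_group R K)"
    "f \<in> carrier (field_aut_group R K) \<Longrightarrow> f \<in> ring_hom R R"
    "f \<in> carrier (field_aut_group R K) \<Longrightarrow> k \<in> K \<Longrightarrow> f k = k"
    "f \<in> carrier (field_aut_group R K) \<Longrightarrow> g \<in> carrier (field_aut_group R K) \<Longrightarrow> z \<in> carrier R \<Longrightarrow>
      (f \<otimes>\<^bsub>field_aut_group R K\<^esub> g) z = f (g z)"
    "z \<in> carrier R \<Longrightarrow> \<one>\<^bsub>field_aut_group R K\<^esub> z = z"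
proof -
  show "Group.group (field_aut_group R K)"
    unfolding field_aut_group_def
    by (rule subgroup.subgroup_is_group[OF field_aut_group_subgroup[OF K] group_BijGroup])
  have C: "f \<in> ring_iso R R" "f \<in> Bij (carrier R)" "\<And>k. k \<in> K \<Longrightarrow> f k = k"
    if "f \<in> carrier (field_aut_group R K)" for f
    using that unfolding field_aut_group_def Bij_def ring_iso_def by auto
  show "f \<in> ring_hom R R" if "f \<in> carrier (field_aut_group R K)" for f
    using C(1)[OF that] by (simp add: ring_iso_def)
  show "f k = k" if "f \<in> carrier (field_aut_group R K)" "k \<in> K" for f k using C(3)[OF that] .
  show "(f \<otimes>\<^bsub>field_aut_group R K\<^esub> g) z = f (g z)"
    if "f \<in> carrier (field_aut_group R K)" "g \<in> carrier (field_aut_group R K)" "z \<in> carrier R" for f g z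
    using C(2)[OF that(1)] C(2)[OF that(2)] that(3) by (simp add: field_aut_group_def BijGroup_def compose_def)
  show "\<one>\<^bsub>field_aut_group R K\<^esub> z = z" if "z \<in> carrier R" for z
    using that by (simp add: field_aut_group_def BijGroup_def)
qed

lemma (in field) aut_pow:
  assumes K: "K \<subseteq> carrier R" and f: "f \<in> carrier (field_aut_group R K)" and z: "z \<in> carrier R"
  shows "(f [^]\<^bsub>field_aut_group R K\<^esub> (k::nat)) z = (f ^^ k) z"
proof -
  note A = field_aut_group[OF K]
  interpret A: Group.group "field_aut_group R K" by (rule A(1))
  show ?thesis using z
  proof (induction k arbitrary: z)
    case 0
    then show ?case using A(5) by simp
  next
    case (Suc k)
    have fz: "f z \<in> carrier R" using A(2)[OF f] Suc.prems by (rule ring_hom_closed)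
    have "(f [^]\<^bsub>field_aut_group R K\<^esub> Suc k) z = (f [^]\<^bsub>field_aut_group R K\<^esub> k) (f z)"
      using A(4)[OF A.nat_pow_closed[OF f] f Suc.prems] by simp
    then show ?case using Suc.IH[OF fz] by (simp add: funpow_swap1)
  qed
qed

text \<open>Reduces the fixed field of a cyclic group to that of a generator.\<close>

lemma (in field) fixed_by_generated:
  assumes K: "K \<subseteq> carrier R" and t: "t \<in> carrier (field_aut_group R K)" and z: "z \<in> carrier R"
  shows "(\<forall>g \<in> generate (field_aut_group R K) {t}. g z = z) \<longleftrightarrow> t z = z"
proof
  assume "\<forall>g \<in> generate (field_aut_group R K) {t}. g z = z"
  then show "t z = z" using generate.incl[of t "{t}"] by auto
next
  note A = field_aut_group[OF K]
  interpret A: Group.group "field_aut_group R K" by (rule A(1))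
  assume tz: "t z = z"
  have "g \<in> carrier (field_aut_group R K) \<and> g z = z" if "g \<in> generate (field_aut_group R K) {t}" for g
    using that
  proof (induction rule: generate.induct)
    case one
    then show ?case using A(5)[OF z] by simp
  next
    case (incl h)
    then show ?case using t tz by simp
  next
    case (inv h)
    then have h: "h = t" by simp
    have "(inv\<^bsub>field_aut_group R K\<^esub> t \<otimes>\<^bsub>field_aut_group R K\<^esub> t) z = z" using A.l_inv[OF t] A(5)[OF z] by simp
    then show ?case using A(4)[OF A.inv_closed[OF t] t z] tz t h by simp
  next
    case (eng h1 h2)
    then show ?case using A(4)[OF _ _ z] by simp
  qed
  then show "\<forall>g \<in> generate (field_aut_group R K) {t}. g z = z" by blast
qed

lemma (in field) transcendental_nonzero:
  assumes K: "subfield K R" and x: "x \<in> carrier R" "transcendental K x" shows "x \<noteq> \<zero>"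
proof
  assume "x = \<zero>"
  then have "eval [\<one>, \<zero>] x = eval [] x" using x by simp
  moreover have "[\<one>, \<zero>] \<in> carrier (K[X])" "[] \<in> carrier (K[X])"
    unfolding univ_poly_carrier[symmetric] polynomial_def using subringE(2,3)[OF subfieldE(1)[OF K]] by auto
  ultimately show False
    using x(2) unfolding transcendental_def ring_hom_def inj_on_def by blast
qed

text \<open>For \<open>q = 2\<close> the given automorphism has order 6 instead of 3, so the case
  is vacuous.\<close>

lemma (in field) hermitian_aut_q_2:
  assumes K: "subfield K R" "finite K" "card K = 2 ^ k" and x: "x \<in> carrier R" "x \<noteq> \<zero>" and y: "y \<in> carrier R"
    and curve: "y [^] (2::nat) \<oplus> y = x [^] (3::nat)"
    and a: "a \<in> K" "a [^] (3::nat) = \<one>"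
    and f: "f \<in> ring_hom R R" "\<And>k. k \<in> K \<Longrightarrow> f k = k" "f x = (a \<otimes> x) \<otimes> inv y" "f y = inv y"
  shows "f (f (f x)) \<noteq> x"
proof
  assume three: "f (f (f x)) = x"
  interpret s: ring_hom_cring R R f by unfold_locales (rule f(1))
  have ac: "a \<in> carrier R" using subfieldE(3)[OF K(1)] a by auto
  have x3: "x [^] (3::nat) \<noteq> \<zero>" using nz_pow[OF x] by blast
  have y0: "y \<noteq> \<zero>"
  proof
    assume "y = \<zero>"
    then show False using curve x3 by (simp add: numeral_2_eq_2)
  qed
  note i = nz_inv[OF y y0]
  have "y \<otimes> f (inv y) = y \<otimes> y"
  proof -
    have "inv y \<otimes> f (inv y) = f (y \<otimes> inv y)" using s.hom_mult[OF y i(1)] f(4) by simp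
    then have "inv y \<otimes> f (inv y) = \<one>" using i by simp
    then have "inv (inv y) = f (inv y)" using comm_inv_char[OF i(1)] i(1) by simp
    then show ?thesis using i by simp
  qed
  then have siy: "f (inv y) = y" using m_lcancel[OF y0 y] i(1) y by simp
  \<comment> \<open>Since f(1/y) = y, the second iterate sends \<open>x\<close> to a^2 x and the
    third to a^3 x / y = x / y. The assumption thus gives y = 1, and the curve gives x^3 = 1 + 1 =
    0.\<close>
  have "f (f x) = (a \<otimes> (a \<otimes> x \<otimes> inv y)) \<otimes> y"
    unfolding f(3) using ac x y i(1) f(2)[OF a(1)] f(3) siy by simp
  also have "\<dots> = (a \<otimes> a \<otimes> x) \<otimes> (inv y \<otimes> y)" using ac x(1) y i(1) by algebra
  finally have "f (f x) = a \<otimes> a \<otimes> x" using i ac x by simp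
  then have "x = a \<otimes> a \<otimes> (a \<otimes> x \<otimes> inv y)" using three ac x f(2)[OF a(1)] f(3) by simp
  also have "\<dots> = a [^] (3::nat) \<otimes> (x \<otimes> inv y)" using ac x y i(1) by (simp add: numeral_3_eq_3 m_ac)
  finally have "x \<otimes> \<one> = x \<otimes> inv y" using a(2) x i(1) by simp
  then have "inv y = \<one>" using m_lcancel[OF x(2,1) one_closed i(1)] by simp
  then have "y = \<one>" using i(5) by simp
  then have "x [^] (3::nat) = \<one> \<oplus> \<one>" using curve by simp
  then show False using x3 char2_of_card[OF K] by simp
qed

theorem theorem5p1:
  fixes H :: "('a, 'b) ring_scheme" (structure) and K :: "'a set" and x y a \<delta> c :: 'a
    and \<sigma> :: "'a \<Rightarrow> 'a" and n q m d :: nat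
    and A :: "('a \<Rightarrow> 'a) monoid" and G :: "('a \<Rightarrow> 'a) set"
  assumes q: "n \<ge> 1" "q = 2 ^ n"
    and H: "hermitian_function_field q H K x y"
    and a: "a \<in> K - {\<zero>}" "group.ord (units_of H) a = q\<^sup>2 - 1"
    and \<delta>: "\<delta> = a [^] (q + 1)"
    and c: "c = \<delta> \<oplus> a [^] (q + 1) \<otimes> inv \<delta>"
    and A: "A = field_aut_group H K"
    and \<sigma>: "\<sigma> \<in> carrier A"
      "\<sigma> x = (a \<otimes> x) \<otimes> inv (a [^] (q + 1) \<otimes> y \<oplus> c)"
      "\<sigma> y = inv (a [^] (q + 1) \<otimes> y \<oplus> c)"
      "group.ord A \<sigma> = q\<^sup>2 - 1"
    and m: "m > 0" "m dvd q\<^sup>2 - 1"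
    and G: "G = generate A {\<sigma> [^]\<^bsub>A\<^esub> ((q\<^sup>2 - 1) div m)}"
    and d: "d = gcd m (q + 1)"
  shows "real_of_int (genus (fixed_field H G) K)
           = (real q - 1) * (real q + 1 - real d) / (2 * real m)"
proof -
  interpret H: field H using H by (simp add: hermitian_function_field_def)
  have K: "subfield K H" and cK: "card K = q\<^sup>2" and xc: "x \<in> carrier H" and yc: "y \<in> carrier H"
    and tr: "H.transcendental K x" and curve: "y [^] q \<oplus> y = x [^] (q + 1)"
    and gen: "carrier H = generate_field H (K \<union> {x, y})"
    using H unfolding hermitian_function_field_def hermitian_function_field_axioms_def by auto
  have Kc: "K \<subseteq> carrier H" using subfieldE(3)[OF K] .
  have cK2: "card K = 2 ^ (2 * n)" by (simp add: cK q(2) power_mult mult.commute)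
  then have fK: "finite K" using card.infinite by fastforce
  have x0: "x \<noteq> \<zero>" by (rule H.transcendental_nonzero[OF K xc tr])
  have xt: "x [^] i \<noteq> \<one>" if "i > 0" for i :: nat
    by (rule H.transcendental_imp_nontorsion[OF K xc tr that])
  define N where "N = q\<^sup>2 - 1"
  have a': "a \<in> K" "a \<noteq> \<zero>" "a \<in> carrier H" "a \<in> Units H" using a(1) Kc H.field_Units by auto
  \<comment> \<open>The order is given in the group of units; this carries it over to powers in
    \<open>H\<close>.\<close>
  have aN: "a [^] k = \<one> \<longleftrightarrow> N dvd k" for k :: nat
  proof -
    have "a \<in> carrier (units_of H)" using a'(4) by (simp add: units_of_carrier)
    from group.pow_eq_id[OF H.units_group this, of k] show ?thesis
      using a(2) H.units_of_pow[OF a'(4), of k] by (simp add: units_of_one N_def)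
  qed
  have inj: "i = j" if ij: "i < N" "j < N" "a [^] i = a [^] j" for i j :: nat
  proof -
    have le: "i = j" if "i \<le> j" "j < N" "a [^] i = a [^] j" for i j :: nat
    proof -
      have "a [^] i \<otimes> \<one> = a [^] i \<otimes> a [^] (j - i)"
        using H.nat_pow_mult[OF a'(3), of i "j - i"] that(1,3) a'(3) by simp
      then have "a [^] (j - i) = \<one>"
        using H.m_lcancel[OF H.nz_pow[OF a'(3,2)] H.nat_pow_closed[OF a'(3)] H.one_closed] a'(3) by simp
      then have "N dvd j - i" using aN by simp
      then have "j - i = 0" using that(2) by (meson dvd_imp_le less_imp_diff_less not_le neq0_conv)
      then show ?thesis using that(1) by simp
    qed
    show ?thesis using le[of i j] le[of j i] ij by (cases "i \<le> j") auto
  qed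
  have dc: "\<delta> \<in> carrier H" "\<delta> \<noteq> \<zero>" unfolding \<delta> using a'(3) H.nz_pow[OF a'(3,2), of "q + 1"] by auto
  have c1: "c = \<delta> \<oplus> \<one>" unfolding c \<delta>[symmetric] using H.nz_inv(3)[OF dc] by simp
  note AG = H.field_aut_group[OF Kc, folded A]
  have hom: "\<sigma> \<in> ring_hom H H" and fixK: "\<And>k. k \<in> K \<Longrightarrow> \<sigma> k = k" using AG(2,3) \<sigma>(1) by auto
  have sx: "\<sigma> x = (a \<otimes> x) \<otimes> inv (\<delta> \<otimes> y \<oplus> (\<delta> \<oplus> \<one>))" "\<sigma> y = inv (\<delta> \<otimes> y \<oplus> (\<delta> \<oplus> \<one>))"
    using \<sigma>(2,3) unfolding \<delta>[symmetric] c1 by auto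
  \<comment> \<open>For q = 2 one has \<delta> = a^3 = 1 and c = 0, so \<sigma>(x) = a x / y and
    \<sigma>(y) = 1 / y, whereas the assumed order q^2 - 1 is 3.\<close>
  have "n \<noteq> 1"
  proof
    assume "n = 1"
    then have q2: "q = 2" using q(2) by simp
    have N3: "N = 3" by (simp add: N_def q2)
    have d1: "\<delta> = \<one>" unfolding \<delta> q2 using aN[of 3] N3 by simp
    have two: "\<one> \<oplus> \<one> = \<zero>" by (rule H.char2_of_card[OF K fK cK2])
    have s2: "\<sigma> x = (a \<otimes> x) \<otimes> inv y" "\<sigma> y = inv y" using sx yc unfolding d1 two by auto
    have "\<sigma> [^]\<^bsub>A\<^esub> (3::nat) = \<one>\<^bsub>A\<^esub>" using group.pow_ord_eq_1[OF AG(1) \<sigma>(1)] \<sigma>(4) N3 by (simp add: N_def)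
    then have "(\<sigma> ^^ 3) x = x" using H.aut_pow[OF Kc, folded A, OF \<sigma>(1) xc, of 3] AG(5)[OF xc] by simp
    then have "\<sigma> (\<sigma> (\<sigma> x)) = x" by (simp add: numeral_3_eq_3)
    moreover have "a [^] (3::nat) = \<one>" using aN N3 by simp
    moreover have "y [^] (2::nat) \<oplus> y = x [^] (3::nat)" using curve q2 by simp
    ultimately show False
      using H.hermitian_aut_q_2[OF K fK cK2 xc x0 yc _ a'(1) _ hom fixK s2] by blast
  qed
  then have n2: "n \<ge> 2" using q(1) by simp
  interpret h: hermitian_automorphism H K x y a \<delta> \<sigma> n q
    by (intro hermitian_automorphism.intro hermitian_automorphism_axioms.intro H.field_axioms K cK n2 q(2) xc x0 xt yc
        curve gen a'(1,2) inj[unfolded N_def] \<delta> hom fixK sx) (use aN[of N] in \<open>simp_all add: N_def\<close>)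
  define s where "s = (q\<^sup>2 - 1) div m"
  have sm: "s * m = q\<^sup>2 - 1" using m(2) by (simp add: s_def)
  interpret AG: Group.group A by (rule AG(1))
  have "fixed_field H G = H\<lparr>carrier := h.Fx s\<rparr>"
  proof -
    have "(\<forall>\<tau>\<in>G. \<tau> z = z) \<longleftrightarrow> (\<sigma> ^^ s) z = z" if z: "z \<in> carrier H" for z
      using H.fixed_by_generated[OF Kc, folded A, OF AG.nat_pow_closed[OF \<sigma>(1)] z, of s]
        H.aut_pow[OF Kc, folded A, OF \<sigma>(1) z, of s] unfolding G s_def by simp
    then have "{z \<in> carrier H. \<forall>\<tau>\<in>G. \<tau> z = z} = h.Fx s" unfolding h.Fx_def by blast
    then show ?thesis unfolding fixed_field_def by simp
  qed
  then have "2 * int m * genus (fixed_field H G) K = (int q - 1) * (int q + 1 - int d)"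
    using h.genus_fixed_field[OF sm] d by simp
  then have "real_of_int (2 * int m * genus (fixed_field H G) K) = real_of_int ((int q - 1) * (int q + 1 - int d))"
    by (simp only:)
  then have "2 * real m * real_of_int (genus (fixed_field H G) K) = (real q - 1) * (real q + 1 - real d)" by simp
  then show ?thesis using m(1) by (simp add: field_simps)
qed

end
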